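(* Let $v\in C^2(\mathbb{R}^2)$ satisfy $-\Delta v=e^{v}$ in $\mathbb{R}^2$ and $e^{v}\in L^1(\mathbb{R}^2)$. Then $v$ is a nonlinearly unstable solution of both $a(t)\partial_{tt}u+b(t)\partial_tu-\Delta u=e^u$ and $b(t)\partial_tu-\Delta u=e^u$ on $\mathbb{R}^2$, in the following sense. There exist $\sigma>0$ and a nonnegative eigenfunction $\phi_1\in L^2(\mathbb{R}^2)$ with $-\Delta\phi_1-e^{v}\phi_1=-\sigma^2\phi_1$ such that, for every $T\in(0,\infty]$, the following two statements hold. (I) Second-order equation. Let $b\in L^1_{loc}(0,\infty)$, let $a\in C^1(0,T)$, and suppose there is $a_0>0$ with $a(t)\ge a_0$ for all $t\in[0,\infty)$. Let $(u_0,u_1)\in H^1(\mathbb{R}^2)\times L^2(\mathbb{R}^2)$ satisfy $\int\phi_1u_1\,dx>0$ and $\int\phi_1u_0\,dx>0$, and let $u$ be a solution of $$a(t)\partial_{tt}u+b(t)\partial_tu-\Delta u=e^u,\quad u(0,x)=v(x)+u_0(x),\quad \partial_tu(0,x)=u_1(x),\quad x\in\mathbb{R}^2,$$ on $[0,T)$ with $u-v\in C^1([0,T);L^2(\mathbb{R}^2))$. Then: (a) there is $C_0>0$ such that $\|u(t)-v\|_2>C_0\int\phi_1u_0\,dx>0$ for all $t\in(0,T)$; (b) if $b\in L^\infty(0,T)$, $a'(t)>0$, $B:=\|b\|_\infty/a_0$ and $\int\phi_1u_1\,dx\ge\big(-B+\sqrt{\sigma^2/a(0)+B^2}\big)\int\phi_1u_0\,dx$,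 then there is $C_1>0$ such that $\|u(t)-v\|_2\ge C_1e^{\mu(t)}$ for all $t\in(0,T)$, where $\mu(t)=\int_0^t\big(-B+\sqrt{\sigma^2/a(s)+B^2}\big)ds$ is increasing, positive for $t>0$, and satisfies $\mu(t)>C\int_0^t\frac{1}{a(s)}ds$ for $t>0$, for some $C>0$; (d) if $b\in L^1(0,\infty)$ and $a\in L^\infty(0,\infty)$, then there exist $T_0,C_2,\mu>0$ such that $\|u(t)-v\|_2\ge C_2e^{\mu t}$ for all $t\in(T_0,T)$. (II) First-order equation. Let $b\in L^1_{loc}(0,\infty)$ with $b(t)>0$ for all $t\in[0,\infty)$, let $u_0\in L^\infty(\mathbb{R}^2)$ satisfy $\int\phi_1u_0\,dx>0$, and let $u$ be a solution of $$b(t)\partial_tu-\Delta u=e^u,\quad u(0,x)=v(x)+u_0(x),\quad x\in\mathbb{R}^2,$$ on $[0,T)$ such that $u-v$ is $C^1$ and bounded for each $t$. Then: (a) there is $C_0>0$ such that $\|u(t)-v\|_\infty>C_0\int\phi_1u_0\,dx>0$ for all $t\in(0,T)$; (b) if $b\in L^\infty(0,T)$, then there exist $T_0,C_1,\mu>0$ such that $\|u(t)-v\|_\infty\ge C_1e^{\mu t}$ for all $t\in(T_0,T)$.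
   Context: All spatial integrals are over $\mathbb{R}^2$. For functions of $x$, $\|\cdot\|_2$ and $\|\cdot\|_\infty$ are the norms of $L^2(\mathbb{R}^2)$ and $L^\infty(\mathbb{R}^2)$; $\|b\|_\infty$ is the norm of $L^\infty(0,T)$. In (I) the equation for $u-v$ is understood in the sense of distributions. *)

theory Defs
  imports "HOL-Analysis.Analysis" "HOL-Probability.Essential_Supremum"
begin

section \<open>Classical differentiability and test functions\<close>

definition partial :: "'a::euclidean_space \<Rightarrow> ('a \<Rightarrow> real) \<Rightarrow> 'a \<Rightarrow> real" where
  "partial e f x = frechet_derivative f (at x) e"

primrec Ck :: "nat \<Rightarrow> ('a::euclidean_space \<Rightarrow> real) \<Rightarrow> bool" where
  "Ck 0 f \<longleftrightarrow> continuous_on UNIV f"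
| "Ck (Suc k) f \<longleftrightarrow> f differentiable_on UNIV \<and> (\<forall>e\<in>Basis. Ck k (partial e f))"

definition laplacian :: "('a::euclidean_space \<Rightarrow> real) \<Rightarrow> 'a \<Rightarrow> real" where
  "laplacian f x = (\<Sum>e\<in>Basis. partial e (partial e f) x)"

text \<open>The space of smooth functions with compact support contained in the open set \<open>\<Omega>\<close>;
  the functions are extended by zero to the whole space.\<close>

definition test_functions :: "'a::euclidean_space set \<Rightarrow> ('a \<Rightarrow> real) set" where
  "test_functions \<Omega> =
     {\<psi>. (\<forall>k. Ck k \<psi>) \<and> (\<exists>K. compact K \<and> K \<subseteq> \<Omega> \<and> (\<forall>x. x \<notin> K \<longrightarrow> \<psi> x = 0))}"

section \<open>Function spaces\<close>

text \<open>Elements of the Lebesgue spaces are represented by functions, so equality in these spaces is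
  equality almost everywhere. The real-valued norms below carry information only on
  members of the corresponding space.\<close>

definition L2 :: "'a measure \<Rightarrow> ('a \<Rightarrow> real) set" where
  "L2 M = {f. f \<in> borel_measurable M \<and> integrable M (\<lambda>x. (f x)\<^sup>2)}"

definition L2_norm :: "'a measure \<Rightarrow> ('a \<Rightarrow> real) \<Rightarrow> real" where
  "L2_norm M f = sqrt (LINT x|M. (f x)\<^sup>2)"

definition Linf :: "'a measure \<Rightarrow> ('a \<Rightarrow> real) set" where
  "Linf M = {f. f \<in> borel_measurable M \<and> esssup M (\<lambda>x. ereal \<bar>f x\<bar>) < \<infinity>}"

definition Linf_norm :: "'a measure \<Rightarrow> ('a \<Rightarrow> real) \<Rightarrow> real" where
  "Linf_norm M f = real_of_ereal (esssup M (\<lambda>x. ereal \<bar>f x\<bar>))"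

definition L1_loc :: "'a::euclidean_space set \<Rightarrow> ('a \<Rightarrow> real) set" where
  "L1_loc S = {f. \<forall>K. compact K \<and> K \<subseteq> S \<longrightarrow> f absolutely_integrable_on K}"

definition H1 :: "('a::euclidean_space \<Rightarrow> real) set" where
  "H1 = {f \<in> L2 lebesgue. \<forall>e\<in>Basis. \<exists>g\<in>L2 lebesgue. \<forall>\<xi>\<in>test_functions UNIV.
           (LINT x|lebesgue. f x * partial e \<xi> x) = - (LINT x|lebesgue. g x * \<xi> x)}"

section \<open>The eigenvalue problem\<close>

text \<open>A nonzero element \<open>\<phi>\<close> of \<open>L\<^sup>2\<close> that satisfies \<open>-\<Delta>\<phi> - V\<phi> = \<kappa>\<phi>\<close> in the
  sense of distributions.\<close>

definition L2_eigenfunction ::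
    "('a::euclidean_space \<Rightarrow> real) \<Rightarrow> real \<Rightarrow> ('a \<Rightarrow> real) \<Rightarrow> bool" where
  "L2_eigenfunction V \<kappa> \<phi> \<longleftrightarrow>
     \<phi> \<in> L2 lebesgue \<and> \<not> (AE x in lebesgue. \<phi> x = 0) \<and>
     (\<forall>\<xi>\<in>test_functions UNIV.
        (LINT x|lebesgue. \<phi> x * (- laplacian \<xi> x - V x * \<xi> x)) =
        \<kappa> * (LINT x|lebesgue. \<phi> x * \<xi> x))"

section \<open>The evolution equations\<close>

definition Ico0 :: "ereal \<Rightarrow> real set" where
  "Ico0 T = {t. 0 \<le> t \<and> ereal t < T}"

definition Ioo0 :: "ereal \<Rightarrow> real set" where
  "Ioo0 T = {t. 0 < t \<and> ereal t < T}"

text \<open>The curve \<open>w\<close> is continuously differentiable on the interval \<open>I\<close>, with derivative \<open>w'\<close>, as a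
  curve in the function space \<open>X\<close> whose topology is given by the family \<open>P\<close> of
  seminorms. At an end point of \<open>I\<close> belonging to \<open>I\<close> the derivative is one-sided.\<close>

definition C1_curve :: "('a \<Rightarrow> real) set \<Rightarrow> (('a \<Rightarrow> real) \<Rightarrow> real) set \<Rightarrow> real set \<Rightarrow>
    (real \<Rightarrow> 'a \<Rightarrow> real) \<Rightarrow> (real \<Rightarrow> 'a \<Rightarrow> real) \<Rightarrow> bool" where
  "C1_curve X P I w w' \<longleftrightarrow>
     (\<forall>t\<in>I. w t \<in> X \<and> w' t \<in> X) \<and>
     (\<forall>p\<in>P. \<forall>s\<in>I.
        ((\<lambda>t. p (\<lambda>x. (w t x - w s x) / (t - s) - w' s x)) \<longlongrightarrow> 0) (at s within I) \<and>
        ((\<lambda>t. p (\<lambda>x. w' t x - w' s x)) \<longlongrightarrow> 0) (at s within I))"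

definition L1_loc_seminorms :: "(('a::euclidean_space \<Rightarrow> real) \<Rightarrow> real) set" where
  "L1_loc_seminorms = {(\<lambda>f. LINT x:K|lebesgue. \<bar>f x\<bar>) | K. compact K}"

text \<open>With \<open>w = u - v\<close>, where \<open>-\<Delta>v = e\<^sup>v\<close>, and \<open>wt\<close> the time derivative of \<open>w\<close>: the equation
  \<open>a \<partial>\<^sub>t\<^sub>t w + b \<partial>\<^sub>t w - \<Delta>w = e\<^sup>u - e\<^sup>v\<close> in the sense of distributions on \<open>(0,T) \<times> \<real>\<^sup>2\<close>. The
  coefficient \<open>a\<close> is only continuously differentiable, so \<open>a \<partial>\<^sub>t\<^sub>t w\<close> is the distribution
  \<open>\<psi> \<mapsto> - \<integral>\<integral> wt \<partial>\<^sub>t(a \<psi>)\<close>. The right-hand side is a distribution because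
  \<open>e\<^sup>u\<close> is locally integrable. Iterated integrals do not depend on the representatives of
  \<open>w t\<close> and \<open>wt t\<close> that are chosen at the individual times.\<close>

definition perturbation_eq :: "ereal \<Rightarrow> (real \<Rightarrow> real) \<Rightarrow> (real \<Rightarrow> real) \<Rightarrow> (real^2 \<Rightarrow> real) \<Rightarrow>
    (real \<Rightarrow> real^2 \<Rightarrow> real) \<Rightarrow> (real \<Rightarrow> real^2 \<Rightarrow> real) \<Rightarrow> bool" where
  "perturbation_eq T a b v u wt \<longleftrightarrow>
     (\<lambda>(t, x). exp (u t x)) \<in> L1_loc (Ioo0 T \<times> UNIV) \<and>
     (\<forall>\<psi>\<in>test_functions (Ioo0 T \<times> UNIV).
        (LINT t:Ioo0 T|lebesgue. LINT x|lebesgue.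
            - wt t x * (deriv a t * \<psi> (t, x) + a t * deriv (\<lambda>s. \<psi> (s, x)) t)
            + b t * wt t x * \<psi> (t, x)
            - (u t x - v x) * laplacian (\<lambda>y. \<psi> (t, y)) x) =
        (LINT t:Ioo0 T|lebesgue. LINT x|lebesgue. (exp (u t x) - exp (v x)) * \<psi> (t, x)))"

definition second_order_solution :: "ereal \<Rightarrow> (real \<Rightarrow> real) \<Rightarrow> (real \<Rightarrow> real) \<Rightarrow>
    (real^2 \<Rightarrow> real) \<Rightarrow> (real^2 \<Rightarrow> real) \<Rightarrow> (real^2 \<Rightarrow> real) \<Rightarrow> (real \<Rightarrow> real^2 \<Rightarrow> real) \<Rightarrow> bool" where
  "second_order_solution T a b v u0 u1 u \<longleftrightarrow>
     (\<exists>wt. C1_curve (L2 lebesgue) {L2_norm lebesgue} (Ico0 T) (\<lambda>t x. u t x - v x) wt \<and>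
           perturbation_eq T a b v u wt \<and>
           (AE x in lebesgue. u 0 x = v x + u0 x) \<and>
           (AE x in lebesgue. wt 0 x = u1 x))"

text \<open>In the first-order problem the perturbation is bounded at each time, uniformly on compact
  time intervals. Its continuous differentiability in time, and its
  continuity at time zero, are required only in the topology of \<open>L\<^sup>1\<^sub>l\<^sub>o\<^sub>c\<close>. This is
  implied by continuous differentiability on \<open>[0,T)\<close> in the norm of \<open>L\<^sup>\<infinity>\<close>, and also by joint continuous
  differentiability in \<open>(t,x)\<close>. It does not force initial data in
  \<open>L\<^sup>\<infinity>\<close> to be continuous. The equation is the case \<open>a = 0\<close> of the one above.\<close>

definition first_order_solution :: "ereal \<Rightarrow> (real \<Rightarrow> real) \<Rightarrow>
    (real^2 \<Rightarrow> real) \<Rightarrow> (real^2 \<Rightarrow> real) \<Rightarrow> (real \<Rightarrow> real^2 \<Rightarrow> real) \<Rightarrow> bool" where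
  "first_order_solution T b v u0 u \<longleftrightarrow>
     (\<forall>t\<in>Ico0 T. (\<lambda>x. u t x - v x) \<in> Linf lebesgue) \<and>
     (\<forall>\<tau>\<in>Ico0 T. \<exists>M. \<forall>t\<in>{0..\<tau>}. Linf_norm lebesgue (\<lambda>x. u t x - v x) \<le> M) \<and>
     (\<forall>p\<in>L1_loc_seminorms. ((\<lambda>t. p (\<lambda>x. u t x - u 0 x)) \<longlongrightarrow> 0) (at_right 0)) \<and>
     (\<exists>wt. C1_curve (L1_loc UNIV) L1_loc_seminorms (Ioo0 T) (\<lambda>t x. u t x - v x) wt \<and>
           perturbation_eq T (\<lambda>_. 0) b v u wt) \<and>
     (AE x in lebesgue. u 0 x = v x + u0 x)"

end

theory Submission
  imports Defs "HOL-Computational_Algebra.Polynomial" "HOL-Probability.Distributions" "HOL-Real_Asymp.Real_Asymp" "HOL-Complex_Analysis.Great_Picard"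
begin

text \<open>
  The perturbation \<open>w = u - v\<close> satisfies \<open>a w\<^sub>t\<^sub>t + b w\<^sub>t - \<Delta>w = e\<^sup>u - e\<^sup>v \<ge> e\<^sup>v w\<close> by convexity of the exponential. If
  the linearised operator \<open>- \<Delta> - e\<^sup>v\<close> has a nonnegative eigenfunction \<open>\<phi>\<close> with a negative eigenvalue \<open>- \<sigma>\<^sup>2\<close>, then
  testing with \<open>\<phi>\<close> preserves the inequality, and the projection \<open>y(t) = \<integral> \<phi> w(t)\<close> satisfies
  \<open>a y'' + b y' \<ge> \<sigma>\<^sup>2 y\<close>, or \<open>b y' \<ge> \<sigma>\<^sup>2 y\<close> for the first-order equation. Growth of \<open>y\<close> is then a question
  about ordinary differential inequalities, and it passes to the norms of \<open>w\<close> by the Cauchy-Schwarz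
  and Hoelder inequalities.

  The eigenfunction. A point-picking argument shows that \<open>e\<^sup>v\<close> is bounded (\<open>liouville_exp_bounded\<close>). For
  a bounded, positive, integrable potential in the plane, the Birman-Schwinger operator with the Green function of
  \<open>\<sigma>\<^sup>2 - \<Delta>\<close> as kernel is compact, its norm depends continuously on \<open>\<sigma>\<close>, tends to zero for
  large \<open>\<sigma>\<close> and, because the planar Green function grows like \<open>ln (1/\<sigma>)\<close>, to infinity for
  small \<open>\<sigma>\<close>. At norm 1 it has a nonnegative fixed point (\<open>fixed_point\<close>, \<open>ground_state_exists\<close>), which is the eigenfunction
  (\<open>resolvent_identity\<close>). The Green function enters as a mixture of Gaussians, which makes all its
  properties elementary.

  Testing with the eigenfunction. It is not compactly supported, and is approximated by nonnegative test functions
  whose Laplacians converge as well (\<open>test_function_approximation\<close>). The resulting distributional inequalities in time are converted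
  to integrated ones (\<open>weak_to_integral\<close>).

  Growth. For the second-order equation, \<open>y'\<close> stays positive, and the exponential rates come from
  comparison with the Riccati equation or, for integrable damping, from an iteration over unit time
  steps (\<open>riccati_growth\<close>, \<open>exponential_growth\<close>). For the first-order equation, bounds on the derivatives of the approximate
  projections survive the limit (\<open>approximate_growth\<close>).
\<close>

abbreviation nn_integral_lborel :: "('a::euclidean_space => ennreal) => ennreal" (binder "LNN " 10) where
 "nn_integral_lborel f == nn_integral lborel f"

lemmas integrable_le = Bochner_Integration.integrable_bound
 and integral_ge_0 = Bochner_Integration.integral_nonneg
 and integral_eqI = Bochner_Integration.integral_cong
 and integral_plus = Bochner_Integration.integral_add
 and integral_minus = Bochner_Integration.integral_diff

section \<open>Functions of class \<open>C\<^sup>k\<close>\<close>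

lemma partial_eqI: "(f has_derivative f') (at x) ==> partial e f x = f' e"
 unfolding partial_def using frechet_derivative_at by metis

lemma partial_real: "partial 1 f x = deriv f x" if "f differentiable (at x)" for f :: "real => real"
 using that by (metis DERIV_deriv_iff_real_differentiable has_field_derivative_def mult.right_neutral partial_eqI)

lemma Ck_continuous: "Ck k f ==> continuous_on UNIV f"
 by (cases k) (auto intro: differentiable_imp_continuous_on)

lemma sum_inner_Basis_select:
 "e \<in> Basis ==> (\<Sum>i\<in>Basis. (e \<bullet> i) * c i) = (c e :: real)" for e :: "'a::euclidean_space"
 by (subst sum.cong[OF refl, where h="%i. if i = e then c i else 0"]) (auto simp: inner_Basis)

lemma Ck_Suc_D: "Ck (Suc k) f ==> Ck k f"
proof (induction k arbitrary: f)
 case 0 then show ?case by (auto intro: differentiable_imp_continuous_on)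
next
 case (Suc k)
 then have "f differentiable_on UNIV" "!!e. e \<in> Basis ==> Ck (Suc k) (partial e f)"
  unfolding Ck.simps(2)[of "Suc k"] by auto
 then show ?case using Suc.IH by auto
qed

lemma Ck_differentiable: "Ck (Suc k) f ==> f differentiable (at x)"
 by (auto simp: differentiable_on_def)

text \<open>Continuous differentiability makes the derivative the combination of the partial derivatives; this is what lets the class \<open>Ck\<close>, defined through partial derivatives only, be closed under the usual operations.\<close>
lemma Ck_has_derivative:
 assumes "Ck (Suc k) f"
 shows "(f has_derivative (%h. \<Sum>e\<in>Basis. (h \<bullet> e) * partial e f x)) (at x)"
proof -
 have D: "(f has_derivative frechet_derivative f (at x)) (at x)"
  using Ck_differentiable[OF assms] frechet_derivative_works by blast
 then have lin: "linear (frechet_derivative f (at x))" by (simp add: has_derivative_linear)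
 have "frechet_derivative f (at x) h = (\<Sum>e\<in>Basis. (h \<bullet> e) * partial e f x)" for h
 proof -
  have "frechet_derivative f (at x) h = frechet_derivative f (at x) (\<Sum>e\<in>Basis. (h \<bullet> e) *\<^sub>R e)"
   by (simp add: euclidean_representation)
  then show ?thesis by (simp add: linear_sum[OF lin] linear_scale[OF lin] partial_def)
 qed
 then have "frechet_derivative f (at x) = (%h. \<Sum>e\<in>Basis. (h \<bullet> e) * partial e f x)" by auto
 with D show ?thesis by simp
qed

lemma Ck_SucI:
 assumes "!!x. (f has_derivative f' x) (at x)" "!!e. e \<in> Basis ==> Ck k (%x. f' x e)"
 shows "Ck (Suc k) f"
proof -
 have "partial e f = (%x. f' x e)" for e using partial_eqI[OF assms(1)] by auto
 moreover have "f differentiable_on UNIV"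
  using assms(1) by (auto simp: differentiable_on_def differentiable_def)
 ultimately show ?thesis using assms(2) by simp
qed

lemma Ck_const: "Ck k (%x. c)"
proof (induction k arbitrary: c)
 case (Suc k) then show ?case by (intro Ck_SucI[where f'="%x h. 0"]) auto
qed simp

lemma Ck_add: "Ck k f ==> Ck k g ==> Ck k (%x. f x + g x)"
proof (induction k arbitrary: f g)
 case 0 then show ?case by (auto intro: continuous_on_add)
next
 case (Suc k)
 show ?case
  apply (rule Ck_SucI, rule has_derivative_add[OF Ck_has_derivative[OF Suc.prems(1)] Ck_has_derivative[OF Suc.prems(2)]])
  using Suc by (simp add: sum_inner_Basis_select)
qed

lemma Ck_mult: "Ck k f ==> Ck k g ==> Ck k (%x. f x * g x)"
proof (induction k arbitrary: f g)
 case 0 then show ?case by (auto intro: continuous_on_mult)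
next
 case (Suc k)
 show ?case
  apply (rule Ck_SucI, rule has_derivative_mult[OF Ck_has_derivative[OF Suc.prems(1)] Ck_has_derivative[OF Suc.prems(2)]])
  using Suc Suc.prems[THEN Ck_Suc_D]
  by (simp add: Ck_add sum_inner_Basis_select)
qed

lemma Ck_cmult: "Ck k f ==> Ck k (%x. c * f x)"
 using Ck_mult Ck_const by blast

lemma Ck_sum: "(!!i. i \<in> I ==> Ck k (f i)) ==> Ck k (%x. \<Sum>i\<in>I. f i x)"
 by (induction I rule: infinite_finite_induct) (auto intro: Ck_const Ck_add)

lemma Ck_prod: "(!!i. i \<in> I ==> Ck k (f i)) ==> Ck k (%x. \<Prod>i\<in>I. f i x)"
 by (induction I rule: infinite_finite_induct) (auto intro: Ck_const Ck_mult)

lemma Ck_compose_affine: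
 assumes L: "bounded_linear L"
 shows "Ck k f ==> Ck k (%x. f (L x + c))"
proof (induction k arbitrary: f)
 case 0 then show ?case
  using continuous_on_compose2[OF _ continuous_on_add[OF linear_continuous_on[OF L] continuous_on_const]]
  by (metis Ck.simps(1) subset_UNIV)
next
 case (Suc k)
 have D: "((%x. f (L x + c)) has_derivative (%h. \<Sum>e\<in>Basis. (L h \<bullet> e) * partial e f (L x + c))) (at x)" for x
 proof -
  have "((%x. L x + c) has_derivative L) (at x)"
   by (auto intro!: derivative_eq_intros bounded_linear_imp_has_derivative L)
  from has_derivative_compose[OF this Ck_has_derivative[OF Suc.prems]] show ?thesis .
 qed
 show ?case
  apply (rule Ck_SucI, rule D)
  using Suc by (auto intro!: Ck_sum Ck_cmult)
qed

lemma partial_cmult: "Ck (Suc k) f ==> partial e (%x. c * f x) y = c * partial e f y"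
proof -
 assume "Ck (Suc k) f"
 then have "(f has_derivative (frechet_derivative f (at y))) (at y)"
  using Ck_differentiable frechet_derivative_works by blast
 from partial_eqI[OF has_derivative_mult_right[OF this, of c], of e]
 show ?thesis by (simp add: partial_def)
qed

lemma laplacian_cmult:
 assumes "Ck 2 f" shows "laplacian (%x. c * f x) y = c * laplacian f y"
proof -
 have 1: "Ck (Suc 1) f" using assms by (simp add: numeral_2_eq_2)
 have "partial e (partial e (%x. c * f x)) y = c * partial e (partial e f) y" if "e \<in> Basis" for e
 proof -
  have "partial e (%x. c * f x) = (%x. c * partial e f x)" using partial_cmult[OF 1] by auto
  moreover have "Ck (Suc 0) (partial e f)" using 1 that by simp
  ultimately show ?thesis using partial_cmult by metis
 qed
 then show ?thesis by (simp add: laplacian_def sum_distrib_left)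
qed

text \<open>On the line it suffices to exhibit a class of functions that is closed under derivatives.\<close>

lemma Ck_real_family:
 assumes "!!f. f \<in> \<F> ==> EX f':\<F>. ALL x. (f has_field_derivative f' x) (at x)"
 shows "f \<in> \<F> ==> Ck k (f :: real => real)"
proof (induction k arbitrary: f)
 case 0 then show ?case using assms by (metis Ck.simps(1) DERIV_continuous_on has_field_derivative_at_within)
next
 case (Suc k)
 then obtain f' where f': "f' \<in> \<F>" "!!x. (f has_field_derivative f' x) (at x)" using assms by blast
 show ?case by (rule Ck_SucI, rule f'(2)[unfolded has_field_derivative_def]) (simp add: Suc.IH f'(1))
qed

section \<open>Bump functions\<close>

text \<open>The functions \<open>p(1/x) exp(-1/x)\<close>, extended by zero to \<open>x \<le> 0\<close>: a family closed under differentiation that contains \<open>exp(-1/x)\<close>, so all its members are smooth at the origin.\<close>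
definition flat :: "real poly => real => real" where
 "flat p x = (if x > 0 then poly p (1 / x) * exp (- (1 / x)) else 0)"

lemma poly_over_exp_tendsto_0: "((%u. poly p u * exp (- u)) \<longlongrightarrow> 0) at_top" for p :: "real poly"
proof -
 have "((%u. \<Sum>i\<le>degree p. coeff p i * (u ^ i / exp u)) \<longlongrightarrow> (\<Sum>i\<le>degree p. coeff p i * 0)) at_top"
  by (intro tendsto_intros tendsto_power_div_exp_0)
 then show ?thesis
  by (simp add: poly_altdef exp_minus field_simps sum_divide_distrib)
qed

lemma flat_right_0: "((%x. flat p x) \<longlongrightarrow> 0) (at_right 0)"
proof -
 have "((%x. poly p (1 / x) * exp (- (1 / x))) \<longlongrightarrow> 0) (at_right 0)"
  using filterlim_compose[OF poly_over_exp_tendsto_0 filterlim_inverse_at_top_right]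
  by (simp add: inverse_eq_divide)
 then show ?thesis
  by (rule Lim_transform_eventually)
    (rule eventually_mono[OF eventually_at_right_less], simp add: flat_def)
qed

lemma flat_derivative:
 "(flat p has_field_derivative flat ([:0, 0, 1:] * (p - pderiv p)) x) (at x)"
proof -
 consider "x > 0" | "x < 0" | "x = 0" by linarith
 then show ?thesis
 proof cases
  case 1
  have D: "((%x. poly p (1 / x) * exp (- (1 / x))) has_field_derivative
    poly p (1 / x) * (exp (- (1 / x)) * (1 / x^2)) + (poly (pderiv p) (1 / x) * (- 1 / x^2)) * exp (- (1 / x))) (at x)"
   using 1 by (auto intro!: derivative_eq_intros DERIV_chain'[OF _ poly_DERIV] simp: power2_eq_square field_simps)
  have "((%x. poly p (1 / x) * exp (- (1 / x))) has_field_derivative flat ([:0, 0, 1:] * (p - pderiv p)) x) (at x)"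
   by (rule DERIV_cong[OF D]) (use 1 in \<open>simp add: flat_def power2_eq_square algebra_simps\<close>)
  then show ?thesis
   by (rule has_field_derivative_transform_within_open[of _ _ _ "{0<..}"]) (use 1 in \<open>auto simp: flat_def\<close>)
 next
  case 2
  have "((%x. 0) has_field_derivative 0) (at x)" by simp
  then have "(flat p has_field_derivative 0) (at x)"
   by (rule has_field_derivative_transform_within_open[of _ _ _ "{..<0}"]) (use 2 in \<open>auto simp: flat_def\<close>)
  then show ?thesis using 2 by (simp add: flat_def)
 next
  case 3
  have "((%h. flat p h / h) \<longlongrightarrow> 0) (at 0)"
  proof (rule filterlim_split_at)
   show "((%h. flat p h / h) \<longlongrightarrow> 0) (at_left 0)"
    by (rule Lim_transform_eventually[OF tendsto_const])
      (simp add: eventually_at_filter flat_def)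
   show "((%h. flat p h / h) \<longlongrightarrow> 0) (at_right 0)"
    by (rule Lim_transform_eventually[OF flat_right_0[of "[:0, 1:] * p"]])
      (rule eventually_mono[OF eventually_at_right_less], simp add: flat_def)
  qed
  then show ?thesis using 3 by (simp add: DERIV_def flat_def)
 qed
qed

lemma Ck_flat: "Ck k (flat p)"
 by (rule Ck_real_family[of "range flat"]) (use flat_derivative in blast)+

definition bump :: "real => real" where
 "bump x = flat 1 (x + 1) * flat 1 (- x + 1)"

lemma bump_nonneg: "bump x >= 0" and bump_pos: "\<bar>x\<bar> < 1 ==> bump x > 0" and bump_0: "\<bar>x\<bar> >= 1 ==> bump x = 0"
 by (auto simp: bump_def flat_def abs_if split: if_splits)

lemma Ck_bump: "Ck k bump"
proof -
 have "Ck k (%x. flat 1 (x + 1))" "Ck k (%x. flat 1 (- x + 1))"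
  by (intro Ck_compose_affine[OF _ Ck_flat] bounded_linear_minus bounded_linear_ident)+
 from Ck_mult[OF this] show ?thesis by (simp add: bump_def[abs_def])
qed

definition bump_nd :: "'a::euclidean_space => real" where
 "bump_nd x = (\<Prod>i\<in>Basis. bump (x \<bullet> i))"

lemma Ck_bump_nd: "Ck k bump_nd"
proof -
 have "Ck k (%x::'a. bump (x \<bullet> i))" for i
  using Ck_compose_affine[OF bounded_linear_inner_left Ck_bump, where c=0] by simp
 then show ?thesis unfolding bump_nd_def[abs_def] by (rule Ck_prod)
qed

lemma bump_nd_nonneg: "bump_nd x >= 0"
 by (auto simp: bump_nd_def intro!: prod_nonneg bump_nonneg)

lemma bump_nd_0_pos: "bump_nd 0 > 0"
 by (simp add: bump_nd_def bump_pos)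

lemma bump_nd_support:
 assumes "bump_nd x ~= 0" shows "x \<in> cbox (- One) One"
proof -
 have "\<bar>x \<bullet> i\<bar> < 1" if "i \<in> Basis" for i
  using assms that bump_0[of "x \<bullet> i"] unfolding bump_nd_def by (metis finite_Basis not_le prod_zero_iff)
 then show ?thesis by (force simp: mem_box abs_less_iff)
qed

section \<open>Affine changes of variables\<close>

lemma nn_integral_affine:
 fixes f :: "'a::euclidean_space => ennreal"
 assumes [measurable]: "f \<in> borel_measurable borel" and r: "r ~= 0"
 shows "(LNN x. f x) = ennreal (\<bar>r\<bar> ^ DIM('a)) * (LNN x. f (c + r *\<^sub>R x))"
 by (subst lborel_affine[OF r, of c])
   (simp add: nn_integral_density nn_integral_distr nn_integral_cmult)

lemma integrable_affine:
 fixes f :: "'a::euclidean_space => real"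
 assumes f: "integrable lborel f" and r: "r ~= 0"
 shows "integrable lborel (%x. f (c + r *\<^sub>R x))"
proof -
 have [measurable]: "f \<in> borel_measurable borel" using f by auto
 show ?thesis using f r
  by (subst (asm) lborel_affine[OF r, of c])
    (simp add: integrable_density integrable_distr_eq)
qed

lemma integral_affine:
 fixes f :: "'a::euclidean_space => real"
 assumes [measurable]: "f \<in> borel_measurable borel" and r: "r ~= 0"
 shows "(LBINT x. f x) = \<bar>r\<bar> ^ DIM('a) * (LBINT x. f (c + r *\<^sub>R x))"
 by (subst lborel_affine[OF r, of c])
   (simp add: integral_density integral_distr)

lemma abs_integral_le_integral:
 fixes f g :: "'a => real"
 assumes "integrable M f" "integrable M g" "!!x. \<bar>f x\<bar> <= g x"
 shows "\<bar>LINT x|M. f x\<bar> <= (LINT x|M. g x)"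
proof -
 have "\<bar>LINT x|M. f x\<bar> <= (LINT x|M. \<bar>f x\<bar>)" by (rule integral_abs_bound)
 also have "... <= (LINT x|M. g x)" using assms by (intro integral_mono) auto
 finally show ?thesis .
qed

definition supp_ball :: "real => ('a::euclidean_space => real) => bool" where
 "supp_ball R f \<longleftrightarrow> (ALL x. norm x > R --> f x = 0)"

lemma supp_ballD: "supp_ball R f ==> norm x > R ==> f x = 0"
 by (simp add: supp_ball_def)

lemma continuous_csupp_integrable:
 fixes f :: "'a::euclidean_space => real"
 assumes f: "continuous_on UNIV f" "supp_ball R f"
 shows "integrable lborel f"
proof -
 have "integrable lborel (%x. indicator (cball 0 R) x *\<^sub>R f x)"
  by (rule borel_integrable_compact) (auto intro: continuous_on_subset[OF f(1)])
 moreover have "(%x. indicator (cball 0 R) x *\<^sub>R f x) = f"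
  using f(2) by (auto simp: supp_ball_def indicator_def dist_norm fun_eq_iff not_le)
 ultimately show ?thesis by simp
qed

lemma continuous_csupp_bounded:
 fixes f :: "'a::euclidean_space => real"
 assumes f: "continuous_on UNIV f" "supp_ball R f"
 obtains C where "C > 0" "!!x. \<bar>f x\<bar> <= C"
proof -
 have "compact (f ` cball 0 R)"
  by (intro compact_continuous_image continuous_on_subset[OF f(1)]) auto
 then obtain C where C: "C > 0" "!!y. y \<in> f ` cball 0 R ==> norm y <= C"
  using compact_imp_bounded bounded_pos by metis
 show ?thesis
 proof
  show "\<bar>f x\<bar> <= C" for x
   using C supp_ballD[OF f(2), of x] by (cases "norm x <= R") auto
 qed fact
qed

section \<open>Integration by parts\<close>

lemma supp_ball_partial:
 assumes "supp_ball R f"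
 shows "supp_ball R (partial e f)"
 unfolding supp_ball_def
proof (intro allI impI)
 fix x :: 'a assume x: "norm x > R"
 have "((%x. 0) has_derivative (%h. 0)) (at x)" by simp
 moreover have "open {x::'a. norm x > R}" by (intro open_Collect_less continuous_intros)
 ultimately have "(f has_derivative (%h. 0)) (at x)"
  using has_derivative_transform_within_open[of "%x. 0" "%h. 0" x UNIV "{x. norm x > R}" f] assms x
  by (auto simp: supp_ball_def)
 then show "partial e f x = 0" by (rule partial_eqI)
qed

lemma supp_ball_laplacian:
 assumes "supp_ball R f" shows "supp_ball R (laplacian f)"
proof -
 have "supp_ball R (partial e (partial e f))" for e
  using assms by (intro supp_ball_partial)
 then show ?thesis by (simp add: supp_ball_def laplacian_def)
qed

lemma has_real_derivative_along_line:
 assumes f: "Ck (Suc k) f"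
 shows "((%t. f (x + t *\<^sub>R h)) has_real_derivative (\<Sum>e\<in>Basis. (h \<bullet> e) * partial e f (x + t *\<^sub>R h))) (at t)"
proof -
 have "((%t. x + t *\<^sub>R h) has_derivative (%s. s *\<^sub>R h)) (at t)"
  by (auto intro!: derivative_eq_intros)
 from has_derivative_compose[OF this Ck_has_derivative[OF f]]
 show ?thesis unfolding has_field_derivative_def
  by (rule has_derivative_eq_rhs)
    (auto simp: fun_eq_iff sum_distrib_left mult.assoc sum_distrib_right mult.left_commute intro!: sum.cong)
qed

lemma Ck_mean_value:
 assumes f: "Ck (Suc k) f"
 obtains t where "0 < t" "t < 1" "f (x + h) - f x = (\<Sum>e\<in>Basis. (h \<bullet> e) * partial e f (x + t *\<^sub>R h))"
 using MVT2[of 0 1 "%t. f (x + t *\<^sub>R h)", OF _ has_real_derivative_along_line[OF f]] by auto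

lemma integral_partial_eq_0:
 assumes f: "Ck 1 f" and R: "supp_ball R f" and e: "e \<in> Basis"
 shows "(LBINT x. partial e f x) = 0"
proof -
 have f1: "Ck (Suc 0) f" using f by simp
 have cf: "continuous_on UNIV f" and cd: "continuous_on UNIV (partial e f)"
  using Ck_continuous[OF f] f1 e by auto
 note [measurable] = borel_measurable_continuous_onI[OF cf] borel_measurable_continuous_onI[OF cd]
 have int: "integrable lborel f" by (rule continuous_csupp_integrable[OF cf R])
 obtain C where C: "C > 0" "!!x. \<bar>partial e f x\<bar> <= C"
  by (rule continuous_csupp_bounded[OF cd supp_ball_partial[OF R]]) (rule that)
 define h :: "nat => real" where "h n = 1 / real (Suc n)" for n
 have h: "0 < h n" "h n <= 1" for n by (auto simp: h_def)
 have h0: "h \<longlonglongrightarrow> 0" unfolding h_def by (rule LIMSEQ_Suc[OF lim_1_over_n])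
 let ?q = "%n x. (f (x + h n *\<^sub>R e) - f x) / h n"
 have "(%n. LBINT x. ?q n x) \<longlonglongrightarrow> (LBINT x. partial e f x)"
 proof (rule integral_dominated_convergence[where w="%x. C * indicator (cball 0 (\<bar>R\<bar> + 1)) x"])
  show "integrable lborel (%x::'a. C * indicator (cball 0 (\<bar>R\<bar> + 1)) x :: real)"
   using emeasure_lborel_cball_finite[of "0::'a" "\<bar>R\<bar> + 1"] by (intro integrable_mult_right integrable_real_indicator) simp_all
  show "AE x in lborel. (%n. ?q n x) \<longlonglongrightarrow> partial e f x"
  proof (rule AE_I2)
   fix x
   have "((%t. f (x + t *\<^sub>R e)) has_real_derivative partial e f x) (at 0)"
    using has_real_derivative_along_line[OF f1, of x e 0] e
    by (simp add: sum_inner_Basis_select)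
   then have "((%t. (f (x + t *\<^sub>R e) - f x) / t) \<longlongrightarrow> partial e f x) (at 0)"
    by (simp add: DERIV_def)
   moreover have "filterlim h (at 0) sequentially"
    using h0 h(1) by (intro filterlim_atI) (auto simp: less_imp_neq[symmetric] eventually_sequentially)
   ultimately show "(%n. ?q n x) \<longlonglongrightarrow> partial e f x" by (rule filterlim_compose)
  qed
  show "AE x in lborel. norm (?q n x) <= C * indicator (cball 0 (\<bar>R\<bar> + 1)) x" for n
  proof (rule AE_I2)
   fix x
   obtain t where t: "f (x + h n *\<^sub>R e) - f x = (\<Sum>i\<in>Basis. ((h n *\<^sub>R e) \<bullet> i) * partial i f (x + t *\<^sub>R (h n *\<^sub>R e)))"
    using Ck_mean_value[OF f1] by metis
   have "f (x + h n *\<^sub>R e) - f x = h n * partial e f (x + t *\<^sub>R (h n *\<^sub>R e))"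
    unfolding t using e by (simp add: sum_inner_Basis_select mult.assoc flip: sum_distrib_left)
   then have 1: "norm (?q n x) <= C" using h(1)[of n] C by simp
   show "norm (?q n x) <= C * indicator (cball 0 (\<bar>R\<bar> + 1)) x"
   proof (cases "norm x <= \<bar>R\<bar> + 1")
    case False
    have "norm (x + h n *\<^sub>R e) >= norm x - norm (h n *\<^sub>R e)" by (metis norm_diff_ineq)
    moreover have "norm (h n *\<^sub>R e) <= 1" using h[of n] e by simp
    ultimately have "f (x + h n *\<^sub>R e) = 0" "f x = 0" using False supp_ballD[OF R] by auto
    then show ?thesis using C by simp
   qed (use 1 in auto)
  qed
 qed auto
 moreover have "(LBINT x. ?q n x) = 0" for n
 proof -
  have "integrable lborel (%x. f (x + h n *\<^sub>R e))"
   using integrable_affine[OF int, of 1 "h n *\<^sub>R e"] by (simp add: add.commute)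
  moreover have "(LBINT x. f (x + h n *\<^sub>R e)) = (LBINT x. f x)"
   using integral_affine[of f 1 "h n *\<^sub>R e"] by (simp add: add.commute)
  ultimately show ?thesis using int by simp
 qed
 then have "(%n. LBINT x. ?q n x) = (%n. 0)" by blast
 ultimately show ?thesis using LIMSEQ_unique tendsto_const by metis
qed

lemma laplacian_continuous: "Ck 2 f ==> continuous_on UNIV (laplacian f)"
 unfolding laplacian_def[abs_def] numeral_2_eq_2 by (auto intro!: continuous_on_sum)

text \<open>Integrating the Laplacian by parts against a potential \<open>H\<close> with gradient \<open>- y \<rho>(y)\<close> yields the radial derivative of \<open>f\<close>, averaged with weight \<open>\<rho>\<close>: the derivative of a weighted mean of \<open>f\<close> in the dilation parameter \<open>r\<close>. For caps this is the mean value property, for Gaussians the heat equation.\<close>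
lemma dilation_identity:
 fixes f H \<rho> :: "'a::euclidean_space => real"
 assumes f: "Ck 2 f" and H: "Ck 1 H" and cont: "continuous_on UNIV \<rho>"
  and grad: "!!e y. e \<in> Basis ==> partial e H y = - (y \<bullet> e) * \<rho> y"
  and r: "r > 0"
  and supp: "supp_ball R f \<or> supp_ball R H & supp_ball R \<rho>"
 shows "(LBINT y. (\<Sum>e\<in>Basis. (y \<bullet> e) * partial e f (r *\<^sub>R y)) * \<rho> y) = r * (LBINT y. laplacian f (r *\<^sub>R y) * H y)"
proof -
 define S where "S = max R (R / r)"
 have f2: "Ck (Suc (Suc 0)) f" using f by (simp add: numeral_2_eq_2)
 have H1: "Ck (Suc 0) H" using H by simp
 have bl: "bounded_linear (%y::'a. r *\<^sub>R y)" by (rule bounded_linear_scaleR_right)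
 have pf: "Ck (Suc 0) (partial e f)" if "e \<in> Basis" for e using f2 that by simp
 have out: "partial e (partial e f) (r *\<^sub>R y) * H y = 0 & partial e f (r *\<^sub>R y) * \<rho> y = 0 & partial e f (r *\<^sub>R y) * H y = 0"
  if "norm y > S" for y e
 proof -
  have "norm y > R" "norm (r *\<^sub>R y) > R" using that r by (auto simp: S_def field_simps)
  then show ?thesis using supp supp_ball_partial[of R f] supp_ball_partial[of R "partial e f"] by (auto simp: supp_ball_def)
 qed
 have cH: "continuous_on UNIV H" by (rule Ck_continuous[OF H])
 have c1: "continuous_on UNIV (%y. partial e f (r *\<^sub>R y))" if "e \<in> Basis" for e
  by (rule continuous_on_compose2[OF Ck_continuous[OF pf[OF that]]]) (auto intro!: continuous_intros)
 have c2: "continuous_on UNIV (%y. partial e (partial e f) (r *\<^sub>R y))" if "e \<in> Basis" for e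
  by (rule continuous_on_compose2[of UNIV]) (use f2 that in \<open>auto intro!: continuous_intros\<close>)
 have i1: "integrable lborel (%y. (y \<bullet> e) * partial e f (r *\<^sub>R y) * \<rho> y)" if "e \<in> Basis" for e
  by (rule continuous_csupp_integrable[of _ S]) (use out c1[OF that] cont in \<open>auto simp: supp_ball_def intro!: continuous_intros\<close>)
 have i2: "integrable lborel (%y. partial e (partial e f) (r *\<^sub>R y) * H y)" if "e \<in> Basis" for e
  by (rule continuous_csupp_integrable[of _ S]) (use out c2[OF that] cH in \<open>auto simp: supp_ball_def intro!: continuous_intros\<close>)
 have "(LBINT y. (y \<bullet> e) * partial e f (r *\<^sub>R y) * \<rho> y) = r * (LBINT y. partial e (partial e f) (r *\<^sub>R y) * H y)"
  if e: "e \<in> Basis" for e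
 proof -
  let ?g = "%y. partial e f (r *\<^sub>R y) * H y"
  have C: "Ck 1 (%y. partial e f (r *\<^sub>R y))" using Ck_compose_affine[OF bl pf[OF e], of 0] by simp
  have D: "((%y. partial e f (r *\<^sub>R y)) has_derivative (%h. \<Sum>i\<in>Basis. ((r *\<^sub>R h) \<bullet> i) * partial i (partial e f) (r *\<^sub>R y))) (at y)" for y
   by (rule has_derivative_compose[OF bounded_linear_imp_has_derivative[OF bl] Ck_has_derivative[OF pf[OF e]]])
  have "partial e ?g y = r * (partial e (partial e f) (r *\<^sub>R y) * H y) - (y \<bullet> e) * partial e f (r *\<^sub>R y) * \<rho> y" for y
   using partial_eqI[OF has_derivative_mult[OF D[of y] Ck_has_derivative[OF H1, of y]], of e] e grad[OF e, of y]
   by (simp add: sum_inner_Basis_select algebra_simps flip: sum_distrib_left)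
  moreover have "(LBINT y. partial e ?g y) = 0"
   by (rule integral_partial_eq_0[OF Ck_mult[OF C H] _ e, of S]) (use out in \<open>auto simp: supp_ball_def\<close>)
  ultimately show ?thesis using i1[OF e] i2[OF e] by simp
 qed
 then show ?thesis
  by (simp add: sum_distrib_right sum_distrib_left laplacian_def i1 i2)
qed

lemma partial_affine:
 assumes f: "Ck (Suc k) f"
 shows "partial e (%x. f (c + s *\<^sub>R x)) x = s * partial e f (c + s *\<^sub>R x)"
proof -
 have "((%x. c + s *\<^sub>R x) has_derivative (%h. s *\<^sub>R h)) (at x)" by (auto intro!: derivative_eq_intros)
 from partial_eqI[OF has_derivative_compose[OF this Ck_has_derivative[OF f]]]
 have "partial e (%x. f (c + s *\<^sub>R x)) x = s * (\<Sum>i\<in>Basis. (e \<bullet> i) * partial i f (c + s *\<^sub>R x))"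
  by (simp add: sum_distrib_left mult.assoc)
 also have "(\<Sum>i\<in>Basis. (e \<bullet> i) * partial i f (c + s *\<^sub>R x)) = partial e f (c + s *\<^sub>R x)"
  using partial_eqI[OF Ck_has_derivative[OF f, of "c + s *\<^sub>R x"], of e] by (rule sym)
 finally show ?thesis .
qed

lemma Ck_affine: "Ck k f ==> Ck k (%x. f (c + s *\<^sub>R x))"
 using Ck_compose_affine[OF bounded_linear_scaleR_right, of k f s c] by (simp add: add.commute)

lemma laplacian_affine:
 assumes f: "Ck 2 f"
 shows "laplacian (%x. f (c + s *\<^sub>R x)) x = s^2 * laplacian f (c + s *\<^sub>R x)"
proof -
 have f2: "Ck (Suc (Suc 0)) f" using f by (simp add: numeral_2_eq_2)
 have "partial e (partial e (%x. f (c + s *\<^sub>R x))) x = s^2 * partial e (partial e f) (c + s *\<^sub>R x)"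
  if e: "e \<in> Basis" for e
 proof -
  have p: "Ck (Suc 0) (partial e f)" using f2 e by simp
  have "partial e (%x. f (c + s *\<^sub>R x)) = (%x. s * partial e f (c + s *\<^sub>R x))"
   using partial_affine[OF f2] by auto
  then show ?thesis
   by (simp add: partial_cmult[OF Ck_affine[OF p]] partial_affine[OF p] power2_eq_square)
 qed
 then show ?thesis by (simp add: laplacian_def sum_distrib_left)
qed

section \<open>Mollification\<close>

definition convolve :: "('a::euclidean_space => real) => ('a => real) => 'a => real" where
 "convolve \<rho> f x = (LBINT y. \<rho> (x - y) * f y)"

lemma convolve_integrable:
 fixes \<rho> f :: "'a::euclidean_space => real"
 assumes c: "continuous_on UNIV \<rho>" and R: "supp_ball R \<rho>" and f: "integrable lborel f"
 shows "integrable lborel (%y. \<rho> (x - y) * f y)"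
proof -
 obtain C where C: "C > 0" "!!x. \<bar>\<rho> x\<bar> <= C" by (rule continuous_csupp_bounded[OF c R]) (rule that)
 have [measurable]: "\<rho> \<in> borel_measurable borel" by (rule borel_measurable_continuous_onI[OF c])
 show ?thesis
  by (rule integrable_le[OF integrable_mult_right[OF f, of C]])
    (use C f in \<open>auto simp: abs_mult intro!: mult_right_mono\<close>)
qed

lemma continuous_csupp_uniform:
 fixes \<rho> :: "'a::euclidean_space => real"
 assumes c: "continuous_on UNIV \<rho>" and R: "supp_ball R \<rho>" and e: "eps > 0"
 obtains d where "d > 0" "!!x y. norm (x - y) < d ==> \<bar>\<rho> x - \<rho> y\<bar> < eps"
proof -
 have "uniformly_continuous_on (cball 0 (\<bar>R\<bar> + 1)) \<rho>"
  by (rule compact_uniformly_continuous[OF continuous_on_subset[OF c]]) auto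
 then obtain d where d: "d > 0" "!!x y. x \<in> cball 0 (\<bar>R\<bar> + 1) ==> y \<in> cball 0 (\<bar>R\<bar> + 1) ==> dist y x < d ==> dist (\<rho> y) (\<rho> x) < eps"
  using e unfolding uniformly_continuous_on_def by metis
 show ?thesis
 proof
  show "min d 1 > 0" using d by simp
  fix x y :: 'a assume xy: "norm (x - y) < min d 1"
  show "\<bar>\<rho> x - \<rho> y\<bar> < eps"
  proof (cases "norm x <= \<bar>R\<bar> + 1 & norm y <= \<bar>R\<bar> + 1")
   case True
   then show ?thesis using d(2)[of y x] xy by (simp add: dist_norm)
  next
   case False
   then have "norm x > \<bar>R\<bar>" "norm y > \<bar>R\<bar>" using xy norm_triangle_sub[of x y] norm_triangle_sub[of y x]
    by (auto simp: norm_minus_commute)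
   then show ?thesis using supp_ballD[OF R] e by auto
  qed
 qed
qed

lemma continuous_convolve:
 assumes c: "continuous_on UNIV \<rho>" and R: "supp_ball R \<rho>" and f: "integrable lborel f"
 shows "continuous_on UNIV (convolve \<rho> f)"
proof -
 note int = convolve_integrable[OF c R f]
 define I where "I = (LBINT y. \<bar>f y\<bar>) + 1"
 have I: "I > 0" unfolding I_def by (intro add_nonneg_pos integral_ge_0) auto
 have "EX d>0. ALL x'. dist x' x < d --> dist (convolve \<rho> f x') (convolve \<rho> f x) < eps" if "eps > 0" for eps x
 proof -
  obtain d where d: "d > 0" "!!x y. norm (x - y) < d ==> \<bar>\<rho> x - \<rho> y\<bar> < eps / I"
   using continuous_csupp_uniform[OF c R] \<open>eps > 0\<close> I by (metis divide_pos_pos)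
  have "\<bar>convolve \<rho> f x' - convolve \<rho> f x\<bar> < eps" if "norm (x' - x) < d" for x'
  proof -
   have "\<bar>convolve \<rho> f x' - convolve \<rho> f x\<bar> = \<bar>LBINT y. (\<rho> (x' - y) - \<rho> (x - y)) * f y\<bar>"
    unfolding convolve_def using int by (simp add: left_diff_distrib)
   also have "... <= (LBINT y. (eps / I) * \<bar>f y\<bar>)"
   proof -
    have i: "integrable lborel (%y. (\<rho> (x' - y) - \<rho> (x - y)) * f y)"
     using int[of x'] int[of x] by (simp add: left_diff_distrib)
    have "\<bar>\<rho> (x' - y) - \<rho> (x - y)\<bar> * \<bar>f y\<bar> <= (eps / I) * \<bar>f y\<bar>" for y
     using d(2)[of "x' - y" "x - y"] that by (intro mult_right_mono) auto
    then show ?thesis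
     by (intro abs_integral_le_integral i) (use f in \<open>auto simp: abs_mult\<close>)
   qed
   also have "... = (eps / I) * (I - 1)" by (simp add: I_def)
   also have "... < eps" using \<open>eps > 0\<close> I by (simp add: field_simps)
   finally show ?thesis .
  qed
  then show ?thesis using d(1) by (auto simp: dist_norm)
 qed
 then show ?thesis by (auto simp: continuous_on_iff)
qed

text \<open>The derivative falls on the smooth compactly supported factor, so the other factor need only be integrable.\<close>
lemma has_derivative_convolve:
 fixes \<rho> :: "'a::euclidean_space => real"
 assumes \<rho>: "Ck 1 \<rho>" and R: "supp_ball R \<rho>" and f: "integrable lborel f"
 shows "(convolve \<rho> f has_derivative (%h. \<Sum>e\<in>Basis. (h \<bullet> e) * convolve (partial e \<rho>) f x)) (at x)"
proof -
 have \<rho>1: "Ck (Suc 0) \<rho>" using \<rho> by simp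
 have c: "continuous_on UNIV \<rho>" and cp: "!!e. e \<in> Basis ==> continuous_on UNIV (partial e \<rho>)"
  using Ck_continuous[OF \<rho>] \<rho>1 by auto
 note int = convolve_integrable[OF c R f]
 note intp = convolve_integrable[OF cp supp_ball_partial[OF R] f]
 define I where "I = (LBINT y. \<bar>f y\<bar>) + 1"
 have I: "I > 0" unfolding I_def by (intro add_nonneg_pos integral_ge_0) auto
 let ?D = "%x h. \<Sum>e\<in>Basis. (h \<bullet> e) * partial e \<rho> x"
 have main: "EX d>0. ALL h. norm h < d --> norm (convolve \<rho> f (x + h) - convolve \<rho> f x - (\<Sum>e\<in>Basis. (h \<bullet> e) * convolve (partial e \<rho>) f x)) <= eps * norm h"
  if "eps > 0" for eps
 proof -
  have "EX d>0. ALL x y. norm (x - y) < d --> \<bar>partial e \<rho> x - partial e \<rho> y\<bar> < eps / (I * DIM('a))" if "e \<in> Basis" for e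
  proof -
   have "eps / (I * DIM('a)) > 0" using \<open>eps > 0\<close> I by (simp add: DIM_positive)
   from continuous_csupp_uniform[OF cp[OF that] supp_ball_partial[OF R] this] show ?thesis by metis
  qed
  then obtain d where d: "!!e. e \<in> Basis ==> d e > 0"
   "!!e x y. e \<in> Basis ==> norm (x - y) < d e ==> \<bar>partial e \<rho> x - partial e \<rho> y\<bar> < eps / (I * DIM('a))"
   by metis
  define \<delta> where "\<delta> = Min (d ` Basis)"
  have \<delta>: "\<delta> > 0" "!!e. e \<in> Basis ==> \<delta> <= d e" using d by (auto simp: \<delta>_def)
  have key: "\<bar>\<rho> (z + h) - \<rho> z - ?D z h\<bar> <= eps / I * norm h" if h: "norm h < \<delta>" for z h
  proof -
   obtain t where t: "0 < t" "t < 1" "\<rho> (z + h) - \<rho> z = ?D (z + t *\<^sub>R h) h" using Ck_mean_value[OF \<rho>1] by metis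
   have "\<bar>\<rho> (z + h) - \<rho> z - ?D z h\<bar> = \<bar>\<Sum>e\<in>Basis. (h \<bullet> e) * (partial e \<rho> (z + t *\<^sub>R h) - partial e \<rho> z)\<bar>"
    unfolding t(3) by (simp add: right_diff_distrib sum_subtractf)
   also have "... <= (\<Sum>e\<in>Basis. \<bar>(h \<bullet> e) * (partial e \<rho> (z + t *\<^sub>R h) - partial e \<rho> z)\<bar>)" by (rule sum_abs)
   also have "... <= (\<Sum>e\<in>(Basis::'a set). norm h * (eps / (I * DIM('a))))"
   proof (rule sum_mono)
    fix e :: 'a assume e: "e \<in> Basis"
    have "norm (t *\<^sub>R h) <= norm h" using t by (simp add: mult_left_le_one_le)
    then have "norm (z + t *\<^sub>R h - z) < d e" using h \<delta>(2)[OF e] by simp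
    then show "\<bar>(h \<bullet> e) * (partial e \<rho> (z + t *\<^sub>R h) - partial e \<rho> z)\<bar> <= norm h * (eps / (I * DIM('a)))"
     using d(2)[OF e, of "z + t *\<^sub>R h" z] Basis_le_norm[OF e, of h] unfolding abs_mult
     by (intro mult_mono) auto
   qed
   also have "... = eps / I * norm h" by simp
   finally show ?thesis .
  qed
  have "norm (convolve \<rho> f (x + h) - convolve \<rho> f x - (\<Sum>e\<in>Basis. (h \<bullet> e) * convolve (partial e \<rho>) f x)) <= eps * norm h"
   if h: "norm h < \<delta>" for h
  proof -
   let ?J = "%y. \<rho> (x + h - y) * f y - \<rho> (x - y) * f y - (\<Sum>e\<in>Basis. (h \<bullet> e) * (partial e \<rho> (x - y) * f y))"
   have iJ: "integrable lborel ?J" using int intp by auto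
   have "convolve \<rho> f (x + h) - convolve \<rho> f x - (\<Sum>e\<in>Basis. (h \<bullet> e) * convolve (partial e \<rho>) f x) = (LBINT y. ?J y)"
    unfolding convolve_def using int intp by simp
   moreover have "\<bar>LBINT y. ?J y\<bar> <= (LBINT y. (eps / I * norm h) * \<bar>f y\<bar>)"
   proof (rule abs_integral_le_integral)
    show "integrable lborel ?J" by fact
    show "integrable lborel (%y. (eps / I * norm h) * \<bar>f y\<bar>)" using f by auto
    fix y
    have "?J y = (\<rho> ((x - y) + h) - \<rho> (x - y) - ?D (x - y) h) * f y"
     by (simp add: algebra_simps sum_distrib_left)
    then show "\<bar>?J y\<bar> <= eps / I * norm h * \<bar>f y\<bar>"
     using mult_right_mono[OF key[OF h, of "x - y"], of "\<bar>f y\<bar>"] by (simp add: abs_mult)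
   qed
   moreover have "(LBINT y. (eps / I * norm h) * \<bar>f y\<bar>) = eps * norm h * ((I - 1) / I)"
    by (simp add: I_def)
   moreover have "eps * norm h * ((I - 1) / I) <= eps * norm h * 1"
    using \<open>eps > 0\<close> I by (intro mult_left_mono) auto
   ultimately show ?thesis unfolding real_norm_def by linarith
  qed
  then show ?thesis using \<delta>(1) by blast
 qed
 have bl: "bounded_linear (%h::'a. \<Sum>e\<in>Basis. (h \<bullet> e) * convolve (partial e \<rho>) f x)"
  by (intro bounded_linear_sum bounded_linear_mult_const bounded_linear_inner_left)
 show ?thesis unfolding has_derivative_at_alt
 proof (intro conjI bl allI impI)
  fix eps :: real assume "0 < eps"
  from main[OF this] obtain d where d: "d > 0" "!!h. norm h < d ==> norm (convolve \<rho> f (x + h) - convolve \<rho> f x - (\<Sum>e\<in>Basis. (h \<bullet> e) * convolve (partial e \<rho>) f x)) <= eps * norm h"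
   by blast
  show "EX d>0. ALL y. norm (y - x) < d --> norm (convolve \<rho> f y - convolve \<rho> f x - (\<Sum>e\<in>Basis. ((y - x) \<bullet> e) * convolve (partial e \<rho>) f x)) <= eps * norm (y - x)"
   using d(1) d(2)[of "_ - x"] by (intro exI[of _ d]) auto
 qed
qed

lemma partial_convolve:
 assumes "Ck 1 \<rho>" "supp_ball R \<rho>" "integrable lborel f" "e \<in> Basis"
 shows "partial e (convolve \<rho> f) = convolve (partial e \<rho>) f"
proof
 show "partial e (convolve \<rho> f) x = convolve (partial e \<rho>) f x" for x
  using partial_eqI[OF has_derivative_convolve[OF assms(1-3)], of e x] assms(4)
  by (simp add: sum_inner_Basis_select)
qed

lemma Ck_convolve:
 assumes "Ck k \<rho>" "supp_ball R \<rho>" and f: "integrable lborel f"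
 shows "Ck k (convolve \<rho> f)"
 using assms(1,2)
proof (induction k arbitrary: \<rho>)
 case 0 then show ?case using continuous_convolve f by auto
next
 case (Suc k)
 have "Ck (Suc m) \<rho> ==> Ck (Suc 0) \<rho>" for m
  by (induction m) (metis, metis Ck_Suc_D)
 then have 1: "Ck 1 \<rho>" using Suc.prems One_nat_def by metis
 show ?case
 proof (rule Ck_SucI, rule has_derivative_convolve[OF 1 Suc.prems(2) f])
  fix e :: 'a assume e: "e \<in> Basis"
  have "Ck k (convolve (partial e \<rho>) f)"
   using Suc.IH[of "partial e \<rho>"] Suc.prems e supp_ball_partial[of R \<rho>] by auto
  then show "Ck k (%x. \<Sum>i\<in>Basis. (e \<bullet> i) * convolve (partial i \<rho>) f x)"
   using e by (simp add: sum_inner_Basis_select)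
 qed
qed

lemma laplacian_convolve:
 assumes \<rho>: "Ck 2 \<rho>" and R: "supp_ball R \<rho>" and f: "integrable lborel f"
 shows "laplacian (convolve \<rho> f) x = convolve (laplacian \<rho>) f x"
proof -
 have 2: "Ck (Suc (Suc 0)) \<rho>" using \<rho> by (simp add: numeral_2_eq_2)
 have 1: "Ck 1 \<rho>" using Ck_Suc_D[OF 2] by simp
 have p: "Ck 1 (partial e \<rho>)" if "e \<in> Basis" for e using 2 that by simp
 have "partial e (partial e (convolve \<rho> f)) x = convolve (partial e (partial e \<rho>)) f x" if "e \<in> Basis" for e
  using partial_convolve[OF 1 R f that] partial_convolve[OF p[OF that] supp_ball_partial[OF R] f that] by simp
 moreover have "integrable lborel (%y. partial e (partial e \<rho>) (x - y) * f y)" if "e \<in> Basis" for e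
  by (rule convolve_integrable[OF _ supp_ball_partial[OF supp_ball_partial[OF R]] f])
    (use 2 that in auto)
 ultimately show ?thesis by (simp add: laplacian_def convolve_def sum_distrib_right)
qed

section \<open>Boundedness of the exponential\<close>

text \<open>A radial bump together with the weight for which \<open>grad cap = - y cap_weight\<close>. Such a pair turns means of a function into means of its Laplacian.\<close>
definition cap :: "'a::euclidean_space => real" where
 "cap y = flat 1 (1 - (norm y)\<^sup>2)"

definition cap_weight :: "'a::euclidean_space => real" where
 "cap_weight y = 2 * flat [:0, 0, 1:] (1 - (norm y)\<^sup>2)"

lemma flat_continuous: "continuous_on UNIV (flat p)"
 using Ck_continuous[OF Ck_flat[of 0]] .

lemma cap_weight_continuous: "continuous_on UNIV cap_weight"
 unfolding cap_weight_def[abs_def]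
 by (intro continuous_on_mult continuous_on_const continuous_on_compose2[OF flat_continuous] continuous_intros) auto

lemma cap_has_derivative: "(cap has_derivative (%h. - (y \<bullet> h) * cap_weight y)) (at y)"
proof -
 have "((%y. 1 - (norm y)\<^sup>2) has_derivative (%h. - 2 * (y \<bullet> h))) (at y)"
  unfolding power2_norm_eq_inner by (auto intro!: derivative_eq_intros simp: inner_commute)
 from has_derivative_compose[OF this flat_derivative[of 1, unfolded has_field_derivative_def]]
 show ?thesis
  by (simp add: cap_def[abs_def] cap_weight_def algebra_simps pderiv_1)
qed

lemma Ck_cap: "Ck 1 (cap :: 'a::euclidean_space => real)"
proof -
 have "Ck (Suc 0) (cap :: 'a => real)"
  by (rule Ck_SucI, rule cap_has_derivative) (auto intro!: continuous_intros cap_weight_continuous)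
 then show ?thesis by simp
qed

lemma partial_cap: "partial e cap y = - (y \<bullet> e) * cap_weight y"
 by (rule partial_eqI[OF cap_has_derivative])

lemma supp_ball_cap:
 "supp_ball 1 (cap :: 'a::euclidean_space => real)" "supp_ball 1 (cap_weight :: 'a => real)"
proof -
 have "norm x > 1 ==> (norm x)\<^sup>2 > 1" for x :: 'a
  using power_strict_mono[of 1 "norm x" 2] by simp
 then have "norm x > 1 ==> \<not> 1 - (norm x)\<^sup>2 > 0" for x :: 'a by fastforce
 then show "supp_ball 1 (cap :: 'a => real)" "supp_ball 1 (cap_weight :: 'a => real)"
  by (auto simp: supp_ball_def cap_def cap_weight_def flat_def)
qed

lemma cap_nonneg: "cap y >= 0" "cap_weight y >= 0"
 by (auto simp: cap_def cap_weight_def flat_def)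

lemma integral_pos_of_pos_at_0:
 fixes f :: "'a::euclidean_space => real"
 assumes c: "continuous_on UNIV f" and R: "supp_ball R f" and nn: "!!x. f x >= 0" and 0: "f 0 > 0"
 shows "(LBINT x. f x) > 0"
proof -
 have "isCont f 0" using c by (simp add: continuous_on_eq_continuous_at)
 then obtain d where d: "d > 0" "!!x. dist x 0 < d ==> dist (f x) (f 0) < f 0 / 2"
  using 0 unfolding continuous_at by (metis half_gt_zero continuous_at_eps_delta \<open>isCont f 0\<close>)
 have big: "f x >= f 0 / 2" if "x \<in> ball 0 d" for x
  using d(2)[of x] that by (auto simp: dist_commute) (smt (verit) dist_real_def field_sum_of_halves)
 have fin: "emeasure lborel (ball (0::'a) d) < \<infinity>" by (rule emeasure_lborel_ball_finite)
 have "0 < measure lborel (ball (0::'a) d) * (f 0 / 2)"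
  using d 0 content_ball_pos[of d "0::'a"] by simp
 also have "... = (LBINT x. f 0 / 2 * indicator (ball (0::'a) d) x)" by (simp add: measure_completion)
 also have "... <= (LBINT x. f x)"
 proof (rule integral_mono)
  show "integrable lborel (%x::'a. f 0 / 2 * indicator (ball 0 d) x)"
   using fin by (intro integrable_mult_right integrable_real_indicator) auto
  show "integrable lborel f" by (rule continuous_csupp_integrable[OF c R])
  show "f 0 / 2 * indicator (ball 0 d) x <= f x" for x
   using big[of x] nn[of x] by (auto simp: indicator_def)
 qed
 finally show ?thesis .
qed

lemma cap_integral_pos: "(LBINT y. cap (y::'a::euclidean_space)) > 0" "(LBINT y. cap_weight (y::'a::euclidean_space)) > 0"
 by (rule integral_pos_of_pos_at_0[OF Ck_continuous[OF Ck_cap] supp_ball_cap(1)],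
   auto simp: cap_nonneg, simp add: cap_def flat_def)
   (rule integral_pos_of_pos_at_0[OF cap_weight_continuous supp_ball_cap(2)],
   auto simp: cap_nonneg, simp add: cap_weight_def flat_def)

text \<open>Integrates the dilation identity from radius 0 to radius \<open>l\<close>: a lower bound on the Laplacian bounds the mean of \<open>f\<close> from below.\<close>
lemma mean_value_lower_bound:
 fixes f :: "'a::euclidean_space => real"
 assumes f: "Ck 2 f" and l: "l > 0" and K: "!!x. dist c x <= l ==> laplacian f x >= - K"
 shows "(LBINT y. (f (c + l *\<^sub>R y) - f c) * cap_weight y) >= - (K * l^2 / 2 * (LBINT y. cap (y::'a)))"
proof -
 define g where "g x = f (c + x)" for x
 have g: "Ck 2 g" unfolding g_def[abs_def] using Ck_affine[OF f, of c 1] by simp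
 then have g2: "Ck (Suc (Suc 0)) g" by (simp add: numeral_2_eq_2)
 have lap: "laplacian g x = laplacian f (c + x)" for x
  unfolding g_def[abs_def] using laplacian_affine[OF f, of c 1] by simp
 let ?dir = "%r y. \<Sum>e\<in>Basis. (y \<bullet> e) * partial e g (r *\<^sub>R y)"
 let ?A = "%r. indicator {0..l} r :: real"
 have cpg: "continuous_on UNIV (partial e g)" if "e \<in> Basis" for e
  using g2 that Ck_continuous[of "Suc 0" "partial e g"] by auto
 have cdir: "continuous_on UNIV (%(r, y). ?dir r y)"
  unfolding case_prod_unfold
  by (intro continuous_intros continuous_on_compose2[OF cpg]) auto
 have "compact ({0..l} \<times> cball (0::'a) 1)" by (intro compact_Times) auto
 from borel_integrable_compact[OF this, of "%(r, y). ?dir r y * cap_weight y"]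
 have "integrable lborel (%p. indicator ({0..l} \<times> cball (0::'a) 1) p *\<^sub>R (case p of (r, y) => ?dir r y * cap_weight y))"
  using continuous_on_mult[OF continuous_on_subset[OF cdir] continuous_on_compose2[OF cap_weight_continuous continuous_on_snd[OF continuous_on_id]], of "{0..l} \<times> cball (0::'a) 1"]
  by (simp add: case_prod_unfold)
 also have "(%p. indicator ({0..l} \<times> cball (0::'a) 1) p *\<^sub>R (case p of (r, y) => ?dir r y * cap_weight y))
   = (%(r, y). ?A r * (?dir r y * cap_weight y))"
  using supp_ballD[OF supp_ball_cap(2)] by (force simp: fun_eq_iff indicator_def not_le)
 finally have int: "integrable (lborel \<Otimes>\<^sub>M lborel) (%(r, y). ?A r * (?dir r y * cap_weight y))"
  by (simp add: lborel_prod)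
 have ftc: "(LBINT r. ?A r * ?dir r y) = f (c + l *\<^sub>R y) - f c" for y
 proof -
  have "(LBINT r. ?dir r y * ?A r) = g (l *\<^sub>R y) - g (0 *\<^sub>R y)"
  proof (rule integral_FTC_Icc_real)
   show "0 <= l" using l by simp
   show "((%r. g (r *\<^sub>R y)) has_real_derivative ?dir r y) (at r)" for r
    using has_real_derivative_along_line[OF g2, of 0 y r] by simp
   show "isCont (%r. ?dir r y) r" for r
   proof -
    have "continuous_on UNIV (%r. ?dir r y)"
     by (intro continuous_intros continuous_on_compose2[OF cpg]) auto
    then show ?thesis by (simp add: continuous_on_eq_continuous_at)
   qed
  qed
  then show ?thesis by (simp add: g_def mult.commute)
 qed
 have lap_int: "- K * (LBINT y. cap (y::'a)) <= (LBINT y. laplacian g (r *\<^sub>R y) * cap y)" if r: "0 <= r" "r <= l" for r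
 proof -
  have "(LBINT y. (- K) * cap (y::'a)) <= (LBINT y. laplacian g (r *\<^sub>R y) * cap y)"
  proof (rule integral_mono)
   show "integrable lborel (%y::'a. - K * cap y)"
    by (intro integrable_mult_right continuous_csupp_integrable[OF Ck_continuous[OF Ck_cap] supp_ball_cap(1)])
   show "integrable lborel (%y. laplacian g (r *\<^sub>R y) * cap y)"
    by (rule continuous_csupp_integrable[of _ 1])
      (use supp_ballD[OF supp_ball_cap(1)] in \<open>auto intro!: continuous_intros continuous_on_compose2[OF laplacian_continuous[OF g]] Ck_continuous[OF Ck_cap] simp: supp_ball_def\<close>)
   fix y :: 'a
   show "- K * cap y <= laplacian g (r *\<^sub>R y) * cap y"
   proof (cases "norm y <= 1")
    case True
    then have "r * norm y <= l * 1" using r by (intro mult_mono) auto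
    then show ?thesis using r K[of "c + r *\<^sub>R y"] by (intro mult_right_mono cap_nonneg) (simp add: lap dist_norm)
   qed (simp add: supp_ballD[OF supp_ball_cap(1)])
  qed
  then show ?thesis by simp
 qed
 have half: "(LBINT r. r * ?A r) = l^2 / 2"
 proof -
  have "((%r. r\<^sup>2 / 2) has_real_derivative r) (at r)" for r :: real by (auto intro!: derivative_eq_intros)
  from integral_FTC_Icc_real[OF _ this, of 0 l] show ?thesis using l by simp
 qed
 have "- (K * l^2 / 2 * (LBINT y. cap (y::'a))) = (LBINT r. (- K * (LBINT y. cap (y::'a))) * (r * ?A r))"
  using half by simp
 also have "... <= (LBINT r. (LBINT y. ?A r * (?dir r y * cap_weight y)))"
 proof (rule integral_mono_AE)
  have "integrable lborel (%r. indicator {0..l} r *\<^sub>R r)"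
   by (rule borel_integrable_compact) (auto intro: continuous_intros)
  then show "integrable lborel (%r. (- K * (LBINT y. cap (y::'a))) * (r * ?A r))"
   by (intro integrable_mult_right) (simp add: mult.commute)
  show "integrable lborel (%r. (LBINT y. ?A r * (?dir r y * cap_weight y)))"
   using lborel_pair.integrable_fst'[OF int] by simp
  show "AE r in lborel. (- K * (LBINT y. cap (y::'a))) * (r * ?A r) <= (LBINT y. ?A r * (?dir r y * cap_weight y))"
   using AE_lborel_singleton[of "0::real"]
  proof eventually_elim
   fix r :: real assume "r ~= 0"
   show "(- K * (LBINT y. cap (y::'a))) * (r * ?A r) <= (LBINT y. ?A r * (?dir r y * cap_weight y))"
   proof (cases "0 < r & r <= l")
    case True
    have "(LBINT y. ?dir r y * cap_weight y) = r * (LBINT y. laplacian g (r *\<^sub>R y) * cap y)"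
     by (rule dilation_identity[OF g Ck_cap cap_weight_continuous partial_cap])
       (use True supp_ball_cap in auto)
    then show ?thesis using True mult_left_mono[OF lap_int[of r], of r] by (simp add: mult_ac)
   next
    case False
    then have "r < 0 \<or> r > l" using \<open>r ~= 0\<close> by linarith
    then show ?thesis by auto
   qed
  qed
 qed
 also have "... = (LBINT y. (LBINT r. ?A r * (?dir r y * cap_weight y)))"
  using lborel_pair.Fubini_integral[OF int] by simp
 also have "... = (LBINT y. (f (c + l *\<^sub>R y) - f c) * cap_weight y)"
  by (simp add: ftc flip: mult.assoc)
 finally show ?thesis .
qed

text \<open>An \<open>\<epsilon>\<close>-regularity argument. Both the equation and the mass \<open>\<integral> e\<^sup>v\<close> are invariant under the
 natural scaling, in which \<open>e\<^sup>v\<close> has the dimension of an inverse area. If \<open>e\<^sup>v\<close> were large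
 somewhere far out, then at a well chosen nearby point it would be almost maximal on a disc whose area is of order
 \<open>e\<^sup>-\<^sup>v\<close>. There the mean value inequality keeps \<open>v\<close> from dropping on average, and by \<open>e\<^sup>s \<ge> 1 + s\<close>
 the disc carries a fixed amount of mass. But the mass far from the origin is as small as desired.\<close>
lemma liouville_exp_bounded:
 fixes v :: "real^2 => real"
 assumes v: "Ck 2 v" and eq: "!!x. - laplacian v x = exp (v x)" and int: "integrable lborel (%x. exp (v x))"
 obtains C where "C > 0" "!!x. exp (v x) <= C"
proof -
 define h where "h = (LBINT y. cap (y::real^2))"
 define m where "m = (LBINT y. cap_weight (y::real^2))"
 have h: "h > 0" and m: "m > 0" using cap_integral_pos unfolding h_def m_def by auto
 \<comment> \<open>The loss in the mean value inequality is \<open>2 \<kappa> h\<close>; this choice makes it half of \<open>m\<close>.\<close>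
 define \<kappa> where "\<kappa> = m / (4 * h)"
 have \<kappa>: "\<kappa> > 0" "m - 2 * \<kappa> * h = m / 2" using h m by (auto simp: \<kappa>_def)
 obtain D where D: "D > 0" "!!y::real^2. \<bar>cap_weight y\<bar> <= D"
  by (rule continuous_csupp_bounded[OF cap_weight_continuous supp_ball_cap(2)]) (rule that)
 define \<delta> where "\<delta> = m * \<kappa> / (4 * D)"
 have \<delta>: "\<delta> > 0" unfolding \<delta>_def using m \<kappa>(1) D(1) by (intro divide_pos_pos mult_pos_pos) auto
 have vc: "continuous_on UNIV v" by (rule Ck_continuous[OF v])
 then have ec: "continuous_on UNIV (%x. exp (v x))" by (intro continuous_intros)
 note [measurable] = borel_measurable_continuous_onI[OF vc]
 have "(%n. LBINT x. indicator {x. norm x >= real n} x * exp (v x)) \<longlonglongrightarrow> (LBINT (x::real^2). 0)"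
 proof (rule integral_dominated_convergence[OF _ _ int])
  show "AE x in lborel. (%n. indicator {x. norm x >= real n} x * exp (v x)) \<longlonglongrightarrow> 0"
  proof (rule AE_I2)
   fix x :: "real^2"
   obtain N where N: "norm x < real N" using reals_Archimedean2 by blast
   have "\<forall>\<^sub>F n in sequentially. indicator {x. norm x >= real n} x * exp (v x) = 0"
    using eventually_ge_at_top[of N] by eventually_elim (use N in auto)
   then show "(%n. indicator {x. norm x >= real n} x * exp (v x)) \<longlonglongrightarrow> 0" by (rule tendsto_eventually)
  qed
 qed (auto simp: indicator_def)
 then have "\<forall>\<^sub>F n in sequentially. (LBINT x. indicator {x. norm x >= real n} x * exp (v x)) < \<delta>"
  using order_tendstoD(2)[of _ 0 sequentially \<delta>] \<delta> by simp
 then obtain N where N: "(LBINT x. indicator {x. norm x >= real N} x * exp (v x)) < \<delta>"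
  by (auto simp: eventually_sequentially)
 have far: "exp (v x0) <= 4 * \<kappa>" if x0: "norm x0 >= real N + 1" for x0
 proof -
  \<comment> \<open>Point picking: maximising \<open>(1 - dist x0 x)\<^sup>2 e\<^sup>v\<close> yields a point around which \<open>e\<^sup>v\<close> grows at most by the factor 4.\<close>
  have cM: "continuous_on (cball x0 1) (%x. (1 - dist x0 x)\<^sup>2 * exp (v x))"
   by (intro continuous_intros continuous_on_subset[OF ec]) auto
  obtain x1 where x1: "x1 \<in> cball x0 1" "!!x. x \<in> cball x0 1 ==> (1 - dist x0 x)\<^sup>2 * exp (v x) <= (1 - dist x0 x1)^2 * exp (v x1)"
   using continuous_attains_sup[OF _ _ cM] by auto
  define s where "s = 1 - dist x0 x1"
  define E where "E = exp (v x1)"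
  have E: "E > 0" by (simp add: E_def)
  have top: "exp (v x0) <= s^2 * E" using x1(2)[of x0] by (simp add: s_def E_def)
  have s: "s > 0" using x1(1) top by (cases "s = 0") (auto simp: s_def)
  have "s^2 * E < 4 * \<kappa>"
  proof (rule ccontr)
   assume "\<not> s\<^sup>2 * E < 4 * \<kappa>"
   then have big: "4 * \<kappa> / E <= s^2" using E by (simp add: field_simps)
   define l where "l = sqrt (\<kappa> / E)"
   have l2: "l^2 = \<kappa> / E" using \<kappa> E by (simp add: l_def)
   have l: "l > 0" using \<kappa> E by (simp add: l_def)
   have "(2 * l)^2 <= s^2" using big l2 by (simp add: power_mult_distrib)
   then have ls: "2 * l <= s" using s by (metis abs_of_pos abs_le_square_iff l mult_pos_pos zero_less_numeral)
   have near: "exp (v x) <= 4 * E" if "dist x1 x <= l" for x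
   proof -
    have d: "1 - dist x0 x >= s / 2" using dist_triangle[of x0 x x1] that ls by (simp add: s_def)
    then have "(s / 2)^2 <= (1 - dist x0 x)^2" using s by (intro power_mono) auto
    then have "(s / 2)^2 * exp (v x) <= (1 - dist x0 x)^2 * exp (v x)" by simp
    also have "... <= s^2 * E" unfolding s_def E_def by (rule x1(2)) (use d s in auto)
    finally show ?thesis using s by (simp add: power_divide field_simps)
   qed
   have lap: "laplacian v x >= - (4 * E)" if "dist x1 x <= l" for x using near[OF that] eq[of x] by linarith
   have MV: "(LBINT y. (v (x1 + l *\<^sub>R y) - v x1) * cap_weight y) >= - (4 * E * l^2 / 2 * h)"
    unfolding h_def by (rule mean_value_lower_bound[OF v l lap])
   let ?w = "%y. v (x1 + l *\<^sub>R y)"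
   have wc: "continuous_on UNIV ?w" by (rule continuous_on_compose2[OF vc]) (auto intro!: continuous_intros)
   have i0: "integrable lborel (cap_weight :: real^2 => real)"
    by (rule continuous_csupp_integrable[OF cap_weight_continuous supp_ball_cap(2)])
   have i1: "integrable lborel (%y. (?w y - v x1) * cap_weight y)"
    and i2: "integrable lborel (%y. exp (?w y) * cap_weight y)"
    by (rule continuous_csupp_integrable[of _ 1],
      use supp_ballD[OF supp_ball_cap(2)] in \<open>auto simp: supp_ball_def intro!: continuous_intros wc cap_weight_continuous\<close>)+
   define g where "g x = indicator {x. norm x >= real N} x * exp (v x)" for x
   have [measurable]: "g \<in> borel_measurable borel" unfolding g_def by measurable
   have ig: "integrable lborel g"
    by (rule integrable_le[OF int]) (auto simp: g_def indicator_def)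
   have "m / 2 = m + - (4 * E * l^2 / 2 * h)" using \<kappa>(2) E by (simp add: l2)
   also have "... <= m + (LBINT y. (?w y - v x1) * cap_weight y)" using MV by simp
   also have "... = (LBINT y. cap_weight y + (?w y - v x1) * cap_weight y)"
    unfolding m_def using i0 i1 by simp
   also have "... <= (LBINT y. (exp (?w y) * cap_weight y) / E)"
   proof (rule integral_mono)
    fix y
    have "1 + (?w y - v x1) <= exp (?w y - v x1)" by (rule exp_ge_add_one_self)
    from mult_right_mono[OF this cap_nonneg(2)[of y]]
    show "cap_weight y + (?w y - v x1) * cap_weight y <= exp (?w y) * cap_weight y / E"
     by (simp add: E_def exp_diff algebra_simps)
   qed (use i0 i1 i2 in auto)
   also have "... <= (LBINT y. D / E * g (x1 + l *\<^sub>R y))"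
   proof (rule integral_mono)
    show "integrable lborel (%y. D / E * g (x1 + l *\<^sub>R y))"
     using l by (intro integrable_mult_right integrable_affine[OF ig]) auto
    fix y :: "real^2"
    show "exp (?w y) * cap_weight y / E <= D / E * g (x1 + l *\<^sub>R y)"
    proof (cases "norm y <= 1")
     case True
     have "dist x0 (x1 + l *\<^sub>R y) <= dist x0 x1 + l * norm y"
      using dist_triangle[of x0 "x1 + l *\<^sub>R y" x1] l by (simp add: dist_norm)
     moreover have "l * norm y <= l" using True l by simp
     ultimately have "dist x0 (x1 + l *\<^sub>R y) <= 1" using ls l unfolding s_def by linarith
     then have "norm (x1 + l *\<^sub>R y) >= real N" using x0 norm_triangle_sub[of x0 "x1 + l *\<^sub>R y"] by (simp add: dist_norm)
     moreover have "cap_weight y <= D" using D(2)[of y] by simp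
     ultimately show ?thesis using E by (simp add: g_def field_simps)
    next
     case False
     then have "cap_weight y = 0" by (intro supp_ballD[OF supp_ball_cap(2)]) simp
     then show ?thesis using D E by (simp add: g_def)
    qed
   qed (use i2 in auto)
   also have "... = D / E * (E / \<kappa> * (LBINT x. g x))"
    using integral_affine[of g l x1] l \<kappa> E by (simp add: l2)
   also have "... < D / E * (E / \<kappa> * \<delta>)" using N E \<kappa> D by (simp add: g_def[abs_def] divide_strict_right_mono)
   also have "... = m / 4" using E \<kappa> D by (simp add: \<delta>_def)
   finally show False using m by simp
  qed
  with top show ?thesis by simp
 qed
 have "compact ((%x. exp (v x)) ` cball 0 (real N + 1))"
  by (intro compact_continuous_image continuous_on_subset[OF ec]) auto
 then obtain C where C: "C > 0" "!!y. y \<in> (%x. exp (v x)) ` cball 0 (real N + 1) ==> norm y <= C"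
  using compact_imp_bounded bounded_pos by metis
 show ?thesis
 proof
  show "max C (4 * \<kappa>) > 0" using C by simp
  fix x
  show "exp (v x) <= max C (4 * \<kappa>)"
   using far[of x] C(2)[of "exp (v x)"] by (cases "norm x <= real N + 1") auto
 qed
qed

section \<open>The resolvent kernel of the Laplacian in the plane\<close>

definition gauss :: "real^2 => real" where
 "gauss x = exp (- (norm x)\<^sup>2 / 2) / (2 * pi)"

lemma gauss_nonneg: "gauss x >= 0" by (simp add: gauss_def)

lemma gauss_minus: "gauss (- x) = gauss x" by (simp add: gauss_def)

lemma gauss_le_1: "gauss x <= 1"
proof -
 have "exp (- (norm x)\<^sup>2 / 2) <= 1" by simp
 moreover have "2 * pi >= 1" using pi_gt3 by simp
 ultimately have "exp (- (norm x)\<^sup>2 / 2) <= 1 * (2 * pi)" by linarith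
 then show ?thesis unfolding gauss_def by (subst pos_divide_le_eq) auto
qed

lemma gauss_continuous: "continuous_on UNIV gauss"
 unfolding gauss_def[abs_def] by (intro continuous_intros) auto

lemma gauss_measurable[measurable]: "gauss \<in> borel_measurable borel"
 by (rule borel_measurable_continuous_onI[OF gauss_continuous])

lemma gauss_has_derivative: "(gauss has_derivative (%h. - (y \<bullet> h) * gauss y)) (at y)"
 unfolding gauss_def[abs_def] power2_norm_eq_inner
 by (auto intro!: derivative_eq_intros simp: inner_commute)

lemma Ck_gauss: "Ck 1 gauss"
proof -
 have "Ck (Suc 0) gauss"
  by (rule Ck_SucI, rule gauss_has_derivative) (auto intro!: continuous_intros gauss_continuous)
 then show ?thesis by simp
qed

lemma partial_gauss: "partial e gauss y = - (y \<bullet> e) * gauss y"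
 by (rule partial_eqI[OF gauss_has_derivative])

lemma nn_integral_gauss: "(LNN x. ennreal (gauss x)) = 1"
proof -
 have eq: "gauss x = (\<Prod>b\<in>Basis. std_normal_density (x \<bullet> b))" for x :: "real^2"
 proof -
  have "(\<Prod>b\<in>(Basis::(real^2) set). std_normal_density (x \<bullet> b)) =
    (\<Prod>b\<in>(Basis::(real^2) set). 1 / sqrt (2 * pi)) * (\<Prod>b\<in>Basis. exp (- (x \<bullet> b)\<^sup>2 / 2))"
   unfolding std_normal_density_def prod.distrib ..
  also have "(\<Prod>b\<in>(Basis::(real^2) set). 1 / sqrt (2 * pi)) = 1 / (2 * pi)"
   by (simp add: power_divide)
  also have "(\<Prod>b\<in>Basis. exp (- (x \<bullet> b)\<^sup>2 / 2)) = exp (- (norm x)\<^sup>2 / 2)"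
   unfolding exp_sum[OF finite_Basis, symmetric] power2_norm_eq_inner euclidean_inner[of x x]
   by (simp add: sum_negf sum_divide_distrib power2_eq_square)
  finally show ?thesis by (simp add: gauss_def)
 qed
 have "(LNN x. ennreal (gauss x)) = (LNN x. (\<Prod>b\<in>(Basis::(real^2) set). ennreal (std_normal_density (x \<bullet> b))))"
  unfolding eq by (simp add: prod_ennreal)
 also have "... = (\<Prod>b\<in>(Basis::(real^2) set). \<integral>\<^sup>+x. ennreal (std_normal_density x) \<partial>lborel)"
  using nn_integral_lborel_prod[where ?'a="real^2" and f="%b x. ennreal (std_normal_density x)"] by simp
 also have "(LNN x. ennreal (std_normal_density x)) = 1"
  by (subst nn_integral_eq_integral) auto
 finally show ?thesis by simp
qed

lemma integrable_gauss: "integrable lborel gauss"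
 by (rule integrableI_nonneg) (auto simp: gauss_nonneg nn_integral_gauss)

lemma integral_gauss: "(LBINT x. gauss x) = 1"
 by (subst integral_eq_nn_integral) (auto simp: gauss_nonneg nn_integral_gauss)

lemma norm_gauss_le: "norm w * gauss w <= exp (- (norm w)\<^sup>2 / 4) / (2 * pi)"
proof -
 let ?t = "(norm w)^2 / 4"
 have "norm w <= 1 + ?t" using zero_le_power2[of "norm w / 2 - 1"] by (simp add: power2_eq_square field_simps)
 also have "... <= exp ?t" by (rule exp_ge_add_one_self)
 finally have "norm w * exp (- (norm w)\<^sup>2 / 2) <= exp ?t * exp (- (norm w)\<^sup>2 / 2)" by (rule mult_right_mono) auto
 also have "... = exp (- (norm w)\<^sup>2 / 4)" by (simp flip: exp_add)
 finally show ?thesis by (simp add: gauss_def divide_right_mono)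
qed

lemma integrable_norm_gauss: "integrable lborel (%y. norm y * gauss y)"
proof (rule integrable_le)
 show "integrable lborel (%y. gauss (0 + (1 / sqrt 2) *\<^sub>R y))"
  by (rule integrable_affine[OF integrable_gauss]) simp
 have "exp (- (norm y)\<^sup>2 / 4) / (2 * pi) = gauss ((1 / sqrt 2) *\<^sub>R y)" for y :: "real^2"
  by (simp add: gauss_def power_divide)
 then show "AE y in lborel. norm (norm y * gauss y) <= norm (gauss (0 + (1 / sqrt 2) *\<^sub>R y))"
  using norm_gauss_le by (auto simp: gauss_nonneg)
qed measurable

lemma nn_integral_gauss_affine:
 assumes "s ~= 0"
 shows "(LNN x. ennreal (gauss (c + s *\<^sub>R x))) = ennreal (1 / s^2)"
proof -
 have "1 = ennreal (s^2) * (LNN x. ennreal (gauss (c + s *\<^sub>R x)))"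
  using nn_integral_affine[of "%x. ennreal (gauss x)" s c] assms by (simp add: nn_integral_gauss)
 then have "ennreal (1 / s^2) * 1 = ennreal (1 / s^2) * (ennreal (s^2) * (LNN x. ennreal (gauss (c + s *\<^sub>R x))))"
  by simp
 then show ?thesis using assms by (simp flip: mult.assoc ennreal_mult')
qed

text \<open>The \<open>L\<^sup>1\<close> modulus of continuity of the Gaussian is linear. Translates of the kernels below inherit it, which gives Lipschitz bounds.\<close>
lemma gauss_translate_L1:
 "(LNN z. ennreal \<bar>gauss (a + z) - gauss z\<bar>) <= ennreal (4 * exp (1/4) * norm a)"
proof (cases "norm a <= 1")
 case True
 have "\<bar>gauss (a + z) - gauss z\<bar> <= norm a * exp (1/4) * gauss ((1/2) *\<^sub>R z)" for z
 proof -
  obtain t where t: "0 < t" "t < 1" "gauss (z + a) - gauss z = (\<Sum>e\<in>Basis. (a \<bullet> e) * partial e gauss (z + t *\<^sub>R a))"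
   by (rule Ck_mean_value[OF Ck_gauss[unfolded One_nat_def], where x = z and h = a]) (rule that)
  define w where "w = z + t *\<^sub>R a"
  have "gauss (z + a) - gauss z = - (a \<bullet> w) * gauss w"
   unfolding t(3) partial_gauss w_def[symmetric] euclidean_inner[of a w] by (simp add: sum_distrib_right sum_negf mult.assoc)
  then have "\<bar>gauss (a + z) - gauss z\<bar> <= norm a * (norm w * gauss w)"
   using Cauchy_Schwarz_ineq2[of a w] gauss_nonneg[of w] by (simp add: abs_mult add.commute mult_right_mono flip: mult.assoc)
  also have "... <= norm a * (exp (- (norm w)\<^sup>2 / 4) / (2 * pi))" by (intro mult_left_mono norm_gauss_le) auto
  also have "... <= norm a * (exp (1 / 4 - (norm ((1/2) *\<^sub>R z))\<^sup>2 / 2) / (2 * pi))"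
  proof (intro mult_left_mono divide_right_mono)
   have "norm (t *\<^sub>R a) <= 1" using t True mult_mono[of t 1 "norm a" 1] by simp
   moreover have "norm z <= norm w + norm (t *\<^sub>R a)" using norm_triangle_ineq4[of w "t *\<^sub>R a"] by (simp add: w_def)
   ultimately have "norm z <= norm w + 1" by linarith
   then have "(norm z)^2 <= (norm w + 1)^2" by (intro power_mono) auto
   also have "... <= 2 * (norm w)^2 + 2" using zero_le_power2[of "norm w - 1"] by (simp add: power2_eq_square algebra_simps)
   finally show "exp (- (norm w)\<^sup>2 / 4) <= exp (1 / 4 - (norm ((1/2) *\<^sub>R z))\<^sup>2 / 2)"
    by (simp add: power_divide)
  qed auto
  also have "... = norm a * exp (1/4) * gauss ((1/2) *\<^sub>R z)"
  proof -
   have "exp (1 / 4 - (norm ((1/2) *\<^sub>R z))\<^sup>2 / 2) = exp (1/4) * exp (- (norm ((1/2) *\<^sub>R z))\<^sup>2 / 2)"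
    by (simp flip: exp_add)
   then show ?thesis by (simp add: gauss_def)
  qed
  finally show ?thesis .
 qed
 then have "(LNN z. ennreal \<bar>gauss (a + z) - gauss z\<bar>) <= (LNN z. ennreal (norm a * exp (1/4)) * ennreal (gauss (0 + (1/2) *\<^sub>R z)))"
  by (intro nn_integral_mono) (auto simp: ennreal_leI simp flip: ennreal_mult')
 also have "... = ennreal (norm a * exp (1/4)) * ennreal 4"
 proof -
  have "(LNN z. ennreal (gauss (0 + (1/2) *\<^sub>R z))) = ennreal 4"
   by (subst nn_integral_gauss_affine) (auto simp: power_divide)
  moreover have "(LNN z. ennreal (norm a * exp (1/4)) * ennreal (gauss (0 + (1/2) *\<^sub>R z)))
   = ennreal (norm a * exp (1/4)) * (LNN z. ennreal (gauss (0 + (1/2) *\<^sub>R z)))"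
   by (rule nn_integral_cmult) measurable
  ultimately show ?thesis by simp
 qed
 also have "... = ennreal (4 * exp (1/4) * norm a)"
  by (subst ennreal_mult[symmetric]) (auto simp: mult_ac)
 finally show ?thesis .
next
 case False
 have "(LNN z. ennreal \<bar>gauss (a + z) - gauss z\<bar>) <= (LNN z. ennreal (gauss (a + 1 *\<^sub>R z)) + ennreal (gauss z))"
  using gauss_nonneg by (intro nn_integral_mono) (auto simp flip: ennreal_plus intro!: ennreal_leI simp: abs_le_iff)
 also have "... = ennreal 1 + ennreal 1"
  by (subst nn_integral_add) (auto simp: nn_integral_gauss nn_integral_gauss_affine simp del: scaleR_one)
 also have "... = ennreal 2" by (simp flip: ennreal_plus)
 also have "... <= ennreal (4 * exp (1/4) * norm a)"
 proof (rule ennreal_leI)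
  have "1 * 1 <= exp (1/4) * norm a" using False by (intro mult_mono) auto
  then have "1 <= exp (1/4) * norm a" by simp
  then show "2 <= 4 * exp (1/4) * norm a" unfolding mult.assoc by linarith
 qed
 finally show ?thesis .
qed

text \<open>A radial kernel written as a superposition of Gaussians of all widths \<open>r\<close>. All estimates reduce to one-dimensional integrals of the weight \<open>\<omega>\<close>, and no special functions are needed.\<close>
definition mixture :: "(real => real) => real^2 => ennreal" where
 "mixture \<omega> x = (LNN r. ennreal (\<omega> r / r^2 * gauss (x /\<^sub>R r)) * indicator {0<..} r)"

lemma mixture_measurable[measurable]:
 assumes [measurable]: "\<omega> \<in> borel_measurable borel"
 shows "mixture \<omega> \<in> borel_measurable borel"
 unfolding mixture_def[abs_def] by measurable

lemma mixture_minus: "mixture \<omega> (- x) = mixture \<omega> x"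
 by (simp add: mixture_def gauss_def)

lemma mixture_convolution:
 assumes [measurable]: "\<omega> \<in> borel_measurable borel" "f \<in> borel_measurable borel" and w: "!!r. r > 0 ==> \<omega> r >= 0"
 shows "(LNN y. mixture \<omega> (x - y) * f y) =
  (LNN r. (LNN z. ennreal (gauss z) * f (x + r *\<^sub>R z)) * ennreal (\<omega> r) * indicator {0<..} r)"
proof -
 have "(LNN y. mixture \<omega> (x - y) * f y) =
  (LNN y. (LNN r. ennreal (\<omega> r / r^2 * gauss ((x - y) /\<^sub>R r)) * indicator {0<..} r * f y))"
  unfolding mixture_def by (intro nn_integral_cong nn_integral_multc[symmetric]) measurable
 also have "... = (LNN r. (LNN y. ennreal (\<omega> r / r^2 * gauss ((x - y) /\<^sub>R r)) * indicator {0<..} r * f y))"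
  by (rule lborel_pair.Fubini') measurable
 also have "... = (LNN r. (LNN z. ennreal (gauss z) * f (x + r *\<^sub>R z)) * ennreal (\<omega> r) * indicator {0<..} r)"
 proof (intro nn_integral_cong)
  fix r :: real
  show "(LNN y. ennreal (\<omega> r / r^2 * gauss ((x - y) /\<^sub>R r)) * indicator {0<..} r * f y) =
   (LNN z. ennreal (gauss z) * f (x + r *\<^sub>R z)) * ennreal (\<omega> r) * indicator {0<..} r"
  proof (cases "r > 0")
   case True
   have "(LNN y. ennreal (\<omega> r / r^2 * gauss ((x - y) /\<^sub>R r)) * indicator {0<..} r * f y) =
    ennreal (r^2) * (LNN z. ennreal (\<omega> r / r^2 * gauss (- z)) * f (x + r *\<^sub>R z))"
    using True by (subst nn_integral_affine[of _ r x]) simp_all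
   also have "... = ennreal (r^2) * (LNN z. ennreal (\<omega> r / r^2) * (ennreal (gauss z) * f (x + r *\<^sub>R z)))"
    unfolding gauss_minus using ennreal_mult[OF _ gauss_nonneg, of "\<omega> r / r^2"] w[OF True] by (simp add: mult.assoc)
   also have "... = ennreal (r^2) * (ennreal (\<omega> r / r^2) * (LNN z. ennreal (gauss z) * f (x + r *\<^sub>R z)))"
    by (subst nn_integral_cmult) measurable
   also have "... = ennreal (\<omega> r) * (LNN z. ennreal (gauss z) * f (x + r *\<^sub>R z))"
    using w[OF True] True by (simp flip: mult.assoc ennreal_mult)
   finally show ?thesis using True by (simp add: mult.commute)
  qed simp
 qed
 finally show ?thesis .
qed

definition half_integral :: "(real => real) => ennreal" where
 "half_integral \<omega> = (LNN r. ennreal (\<omega> r) * indicator {0<..} r)"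

lemma mixture_L1:
 assumes [measurable]: "\<omega> \<in> borel_measurable borel" and w: "!!r. r > 0 ==> \<omega> r >= 0"
 shows "(LNN y. mixture \<omega> (x - y)) = half_integral \<omega>"
 using mixture_convolution[OF assms(1) _ w, of "%_. 1" x] by (simp add: nn_integral_gauss half_integral_def)

lemma mixture_L2:
 assumes [measurable]: "\<omega> \<in> borel_measurable borel" and w: "!!r. r > 0 ==> \<omega> r >= 0"
 shows "(LNN y. (mixture \<omega> (x - y))\<^sup>2) <= (half_integral (%r. \<omega> r / r))^2"
proof -
 let ?W = "half_integral (%r. \<omega> r / r)"
 define D where "D = density lborel (%r. ennreal (\<omega> r / r) * indicator {0<..} r)"
 have [measurable_cong]: "sets D = sets borel" by (simp add: D_def)
 have D: "(\<integral>\<^sup>+r. f r \<partial>D) = (LNN r. ennreal (\<omega> r / r) * indicator {0<..} r * f r)" if [measurable]: "f \<in> borel_measurable borel" for f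
  unfolding D_def by (rule nn_integral_density) measurable
 have "(mixture \<omega> z)^2 <= ?W * (\<integral>\<^sup>+r. ennreal ((gauss (z /\<^sub>R r) / r)^2) \<partial>D)" for z
 proof -
  have "mixture \<omega> z = (\<integral>\<^sup>+r. 1 * ennreal (gauss (z /\<^sub>R r) / r) \<partial>D)"
   unfolding mixture_def by (subst D) (auto intro!: nn_integral_cong simp: indicator_def w gauss_nonneg power2_eq_square mult_ac divide_inverse simp flip: ennreal_mult)
  then have "(mixture \<omega> z)^2 <= (\<integral>\<^sup>+r. 1\<^sup>2 \<partial>D) * (\<integral>\<^sup>+r. (ennreal (gauss (z /\<^sub>R r) / r))\<^sup>2 \<partial>D)"
   by (simp only:) (rule Cauchy_Schwarz_nn_integral, measurable)
  also have "(\<integral>\<^sup>+r. 1\<^sup>2 \<partial>D) = ?W" by (subst D) (auto simp: half_integral_def)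
  also have "(\<integral>\<^sup>+r. (ennreal (gauss (z /\<^sub>R r) / r))\<^sup>2 \<partial>D) = (\<integral>\<^sup>+r. ennreal ((gauss (z /\<^sub>R r) / r)^2) \<partial>D)"
   by (subst (1 2) D) (auto intro!: nn_integral_cong simp: indicator_def ennreal_power gauss_nonneg)
  finally show ?thesis .
 qed
 then have "(LNN y. (mixture \<omega> (x - y))\<^sup>2) <= (LNN y. ?W * (\<integral>\<^sup>+r. ennreal ((gauss ((x - y) /\<^sub>R r) / r)^2) \<partial>D))"
  by (intro nn_integral_mono)
 also have "... = (LNN y. ?W * (LNN r. ennreal (\<omega> r / r) * indicator {0<..} r * ennreal ((gauss ((x - y) /\<^sub>R r) / r)^2)))"
  by (intro nn_integral_cong arg_cong2[where f="(*)"] D) measurable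
 also have "... = ?W * (LNN y. (LNN r. ennreal (\<omega> r / r) * indicator {0<..} r * ennreal ((gauss ((x - y) /\<^sub>R r) / r)^2)))"
  by (rule nn_integral_cmult) measurable
 also have "(LNN y. (LNN r. ennreal (\<omega> r / r) * indicator {0<..} r * ennreal ((gauss ((x - y) /\<^sub>R r) / r)^2)))
  = (LNN r. (LNN y. ennreal (\<omega> r / r) * indicator {0<..} r * ennreal ((gauss ((x - y) /\<^sub>R r) / r)^2)))"
  by (rule lborel_pair.Fubini') measurable
 also have "... <= ?W"
  unfolding half_integral_def
 proof (intro nn_integral_mono)
  fix r :: real
  show "(LNN y. ennreal (\<omega> r / r) * indicator {0<..} r * ennreal ((gauss ((x - y) /\<^sub>R r) / r)^2)) <= ennreal (\<omega> r / r) * indicator {0<..} r"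
  proof (cases "r > 0")
   case True
   have "(LNN y. ennreal ((gauss ((x - y) /\<^sub>R r) / r)^2)) <= (LNN y. ennreal (1 / r^2) * ennreal (gauss ((x /\<^sub>R r) + (- 1 / r) *\<^sub>R y)))"
   proof (intro nn_integral_mono)
    fix y
    have "(gauss ((x - y) /\<^sub>R r) / r)^2 <= (1 / r^2) * gauss ((x - y) /\<^sub>R r)"
     using gauss_le_1 gauss_nonneg by (simp add: power_divide power2_eq_square mult_left_le divide_right_mono)
    moreover have "(x - y) /\<^sub>R r = (x /\<^sub>R r) + (- 1 / r) *\<^sub>R y" by (simp add: scaleR_right_diff_distrib divide_inverse)
    ultimately have "(gauss ((x - y) /\<^sub>R r) / r)^2 <= (1 / r^2) * gauss ((x /\<^sub>R r) + (- 1 / r) *\<^sub>R y)" by (simp only:)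
    then show "ennreal ((gauss ((x - y) /\<^sub>R r) / r)^2) <= ennreal (1 / r^2) * ennreal (gauss ((x /\<^sub>R r) + (- 1 / r) *\<^sub>R y))"
     by (subst ennreal_mult[symmetric]) (auto simp: gauss_nonneg intro: ennreal_leI)
   qed
   also have "... = ennreal (1 / r^2) * ennreal (r^2)"
    using True by (subst nn_integral_cmult, measurable, subst nn_integral_gauss_affine) (auto simp: power_divide)
   also have "... = 1" using True by (simp flip: ennreal_mult')
   finally have le: "(LNN y. ennreal ((gauss ((x - y) /\<^sub>R r) / r)^2)) <= 1" .
   have "(LNN y. ennreal (\<omega> r / r) * indicator {0<..} r * ennreal ((gauss ((x - y) /\<^sub>R r) / r)^2))
    = ennreal (\<omega> r / r) * indicator {0<..} r * (LNN y. ennreal ((gauss ((x - y) /\<^sub>R r) / r)^2))"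
    by (rule nn_integral_cmult) measurable
   also have "... <= ennreal (\<omega> r / r) * indicator {0<..} r * 1" by (intro mult_left_mono le) auto
   finally show ?thesis by simp
  qed simp
 qed
 finally show ?thesis by (simp add: power2_eq_square mult_left_mono)
qed

lemma mixture_convolution_Lipschitz:
 assumes [measurable]: "\<omega> \<in> borel_measurable borel" "f \<in> borel_measurable borel"
  and w: "!!r. r > 0 ==> \<omega> r >= 0" and f: "!!x. f x <= ennreal C"
 shows "(LNN y. mixture \<omega> (x - y) * f y) <= (LNN y. mixture \<omega> (x' - y) * f y)
  + ennreal C * ennreal (4 * exp (1/4) * norm (x - x')) * half_integral (%r. \<omega> r / r)"
proof -
 let ?L = "4 * exp (1/4) * norm (x - x')"
 have "(LNN z. ennreal (gauss z) * f (x + r *\<^sub>R z)) * ennreal (\<omega> r) * indicator {0<..} r \<le>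
  (LNN z. ennreal (gauss z) * f (x' + r *\<^sub>R z)) * ennreal (\<omega> r) * indicator {0<..} r
   + ennreal C * ennreal ?L * (ennreal (\<omega> r / r) * indicator {0<..} r)" for r
 proof (cases "r > 0")
  case True
  define a where "a = (x' - x) /\<^sub>R r"
  have "(LNN z. ennreal (gauss z) * f (x + r *\<^sub>R z)) = (LNN z. ennreal (gauss (a + z)) * f (x' + r *\<^sub>R z))"
  proof -
   have "x + r *\<^sub>R (a + z) = x' + r *\<^sub>R z" for z using True by (simp add: a_def scaleR_right_distrib)
   then show ?thesis using nn_integral_affine[of "%z. ennreal (gauss z) * f (x + r *\<^sub>R z)" 1 a] by simp
  qed
  also have "... <= (LNN z. ennreal (gauss z) * f (x' + r *\<^sub>R z) + ennreal \<bar>gauss (a + z) - gauss z\<bar> * ennreal C)"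
  proof (intro nn_integral_mono)
   fix z
   have "ennreal (gauss (a + z)) <= ennreal (gauss z) + ennreal \<bar>gauss (a + z) - gauss z\<bar>"
    using gauss_nonneg[of z] by (simp flip: ennreal_plus)
   from mult_right_mono[OF this, of "f (x' + r *\<^sub>R z)"]
   have "ennreal (gauss (a + z)) * f (x' + r *\<^sub>R z) <= ennreal (gauss z) * f (x' + r *\<^sub>R z) + ennreal \<bar>gauss (a + z) - gauss z\<bar> * f (x' + r *\<^sub>R z)"
    by (simp add: distrib_right)
   also have "... <= ennreal (gauss z) * f (x' + r *\<^sub>R z) + ennreal \<bar>gauss (a + z) - gauss z\<bar> * ennreal C"
    by (intro add_left_mono mult_left_mono f) auto
   finally show "ennreal (gauss (a + z)) * f (x' + r *\<^sub>R z) <= ennreal (gauss z) * f (x' + r *\<^sub>R z) + ennreal \<bar>gauss (a + z) - gauss z\<bar> * ennreal C" .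
  qed
  also have "... = (LNN z. ennreal (gauss z) * f (x' + r *\<^sub>R z)) + (LNN z. ennreal \<bar>gauss (a + z) - gauss z\<bar>) * ennreal C"
   by (simp add: nn_integral_add nn_integral_multc)
  also have "... <= (LNN z. ennreal (gauss z) * f (x' + r *\<^sub>R z)) + ennreal (4 * exp (1/4) * norm a) * ennreal C"
   by (intro add_left_mono mult_right_mono gauss_translate_L1) auto
  also have "4 * exp (1/4) * norm a = ?L / r"
  proof -
   have "norm a = norm (x - x') / r"
    using True by (simp only: a_def norm_scaleR norm_minus_commute[of x' x]) (simp add: field_simps)
   then show ?thesis by simp
  qed
  finally have "(LNN z. ennreal (gauss z) * f (x + r *\<^sub>R z)) * ennreal (\<omega> r) \<le>
   ((LNN z. ennreal (gauss z) * f (x' + r *\<^sub>R z)) + ennreal (?L / r) * ennreal C) * ennreal (\<omega> r)"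
   by (rule mult_right_mono) simp
  also have "... = (LNN z. ennreal (gauss z) * f (x' + r *\<^sub>R z)) * ennreal (\<omega> r) + ennreal C * (ennreal (?L / r) * ennreal (\<omega> r))"
   by (simp add: distrib_right distrib_left mult_ac)
  also have "ennreal (?L / r) * ennreal (\<omega> r) = ennreal ?L * ennreal (\<omega> r / r)"
   using True w[OF True] by (simp flip: ennreal_mult)
  finally show ?thesis using True by (simp add: mult.assoc)
 qed simp
 then have "(LNN y. mixture \<omega> (x - y) * f y) <= (LNN r. (LNN z. ennreal (gauss z) * f (x' + r *\<^sub>R z)) * ennreal (\<omega> r) * indicator {0<..} r
   + ennreal C * ennreal ?L * (ennreal (\<omega> r / r) * indicator {0<..} r))"
  by (subst mixture_convolution[OF assms(1,2) w]) (auto intro!: nn_integral_mono)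
 also have "... = (LNN y. mixture \<omega> (x' - y) * f y) + ennreal C * ennreal ?L * half_integral (%r. \<omega> r / r)"
 proof -
  let ?g = "%r. (LNN z. ennreal (gauss z) * f (x' + r *\<^sub>R z)) * ennreal (\<omega> r) * indicator {0<..} r"
  let ?h = "%r. ennreal (\<omega> r / r) * indicator {0<..} r"
  have "(LNN r. ?g r + ennreal C * ennreal ?L * ?h r) = (LNN r. ?g r) + (LNN r. ennreal C * ennreal ?L * ?h r)"
   by (rule nn_integral_add) measurable
  also have "(LNN r. ennreal C * ennreal ?L * ?h r) = ennreal C * ennreal ?L * (LNN r. ?h r)"
   by (rule nn_integral_cmult) measurable
  finally show ?thesis using mixture_convolution[OF assms(1,2) w, of x'] by (simp add: half_integral_def)
 qed
 finally show ?thesis .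
qed

text \<open>The Gaussian of width \<open>r\<close> is the heat kernel at time \<open>t = r\<^sup>2/2\<close>, and \<open>r exp(-(\<sigma> r)\<^sup>2/2) dr\<close> is \<open>exp(-\<sigma>\<^sup>2 t) dt\<close>. The mixture is thus the Laplace transform of the heat semigroup, the Green function of \<open>\<sigma>\<^sup>2 - \<Delta>\<close>.\<close>
definition rweight :: "real => real => real" where
 "rweight \<sigma> r = r * exp (- (\<sigma> * r)\<^sup>2 / 2)"

lemma rweight_measurable[measurable]: "rweight \<sigma> \<in> borel_measurable borel"
 unfolding rweight_def[abs_def] by measurable

lemma half_integral_rweight:
 assumes s: "\<sigma> > 0"
 shows "half_integral (rweight \<sigma>) = ennreal (1 / \<sigma>^2)"
proof -
 have "half_integral (rweight \<sigma>) = (LNN r. ennreal (rweight \<sigma> r) * indicator {0..} r)"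
  unfolding half_integral_def
  by (intro nn_integral_cong) (auto simp: indicator_def rweight_def)
 also have "... = ennreal (0 - (- exp (- (\<sigma> * 0)\<^sup>2 / 2) / \<sigma>^2))"
 proof (rule nn_integral_FTC_atLeast)
  fix x :: real assume "0 <= x"
  show "((%r. - exp (- (\<sigma> * r)\<^sup>2 / 2) / \<sigma>^2) has_real_derivative rweight \<sigma> x) (at x)"
   using s by (auto intro!: derivative_eq_intros simp: rweight_def power2_eq_square field_simps)
  show "0 <= rweight \<sigma> x" using \<open>0 <= x\<close> by (simp add: rweight_def)
 next
  have "filterlim (%r. (\<sigma> * r)\<^sup>2 / 2) at_top at_top"
   using s by real_asymp
  then have "((%r. exp (- ((\<sigma> * r)^2 / 2))) \<longlongrightarrow> 0) at_top"
   by (intro filterlim_compose[OF exp_at_bot] filterlim_uminus_at_bot_at_top[THEN filterlim_compose])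
  then have "((%r. - exp (- ((\<sigma> * r)^2 / 2)) / \<sigma>^2) \<longlongrightarrow> - 0 / \<sigma>^2) at_top"
   using s by (intro tendsto_intros) auto
  then show "((%r. - exp (- (\<sigma> * r)\<^sup>2 / 2) / \<sigma>^2) \<longlongrightarrow> 0) at_top" by simp
 qed measurable
 finally show ?thesis by simp
qed

definition resolvent_const :: "real => real" where
 "resolvent_const \<sigma> = enn2real (half_integral (%r. rweight \<sigma> r / r))"

lemma resolvent_const:
 assumes s: "\<sigma> > 0"
 shows "half_integral (%r. rweight \<sigma> r / r) = ennreal (resolvent_const \<sigma>)" "resolvent_const \<sigma> >= 0"
proof -
 have "integrable lborel (%r. (sqrt (2 * pi) / \<sigma>) * normal_density 0 (1 / \<sigma>) r)"
  using s by (intro integrable_mult_right) simp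
 moreover have "(sqrt (2 * pi) / \<sigma>) * normal_density 0 (1 / \<sigma>) r = exp (- (\<sigma> * r)\<^sup>2 / 2)" for r
  using s by (simp add: normal_density_def real_sqrt_divide real_sqrt_mult power_divide power_mult_distrib)
 ultimately have i: "integrable lborel (%r. exp (- (\<sigma> * r)\<^sup>2 / 2))" by simp
 have "half_integral (%r. rweight \<sigma> r / r) <= (LNN r. ennreal (exp (- (\<sigma> * r)\<^sup>2 / 2)))"
  unfolding half_integral_def by (intro nn_integral_mono) (auto simp: rweight_def indicator_def)
 also have "... < \<infinity>" using i by (simp add: integrable_iff_bounded)
 finally show "half_integral (%r. rweight \<sigma> r / r) = ennreal (resolvent_const \<sigma>)"
  by (simp add: resolvent_const_def)
qed (simp add: resolvent_const_def)

definition resolvent_kernel :: "real => real^2 => ennreal" where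
 "resolvent_kernel \<sigma> = mixture (rweight \<sigma>)"

lemma resolvent_kernel_measurable[measurable]: "resolvent_kernel \<sigma> \<in> borel_measurable borel"
 unfolding resolvent_kernel_def by measurable

lemma rweight_nonneg: "r > 0 ==> rweight \<sigma> r >= 0"
 by (simp add: rweight_def)

text \<open>The kernels decrease in \<open>\<sigma>\<close>, and the total mass of a difference is small when the parameters are close. The norm of the weighted operator therefore depends continuously on \<open>\<sigma>\<close>.\<close>
lemma resolvent_kernel_diff:
 assumes "0 < \<sigma>" "\<sigma> <= \<tau>"
 shows "resolvent_kernel \<sigma> x = resolvent_kernel \<tau> x + mixture (%r. rweight \<sigma> r - rweight \<tau> r) x"
  and "half_integral (%r. rweight \<sigma> r - rweight \<tau> r) = ennreal (1 / \<sigma>^2 - 1 / \<tau>^2)"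
  and "!!r. r > 0 ==> rweight \<sigma> r - rweight \<tau> r >= 0"
proof -
 show le: "rweight \<sigma> r - rweight \<tau> r >= 0" if "r > 0" for r
 proof -
  have "(\<sigma> * r)^2 <= (\<tau> * r)^2" using assms that by (intro power_mono mult_right_mono) auto
  then show ?thesis using that by (simp add: rweight_def)
 qed
 have "resolvent_kernel \<tau> x + mixture (%r. rweight \<sigma> r - rweight \<tau> r) x =
  (LNN r. ennreal (rweight \<tau> r / r^2 * gauss (x /\<^sub>R r)) * indicator {0<..} r +
   ennreal ((rweight \<sigma> r - rweight \<tau> r) / r^2 * gauss (x /\<^sub>R r)) * indicator {0<..} r)"
  unfolding resolvent_kernel_def mixture_def by (rule nn_integral_add[symmetric]) measurable
 also have "... = resolvent_kernel \<sigma> x" unfolding resolvent_kernel_def mixture_def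
 proof (intro nn_integral_cong)
  fix r :: real
  show "ennreal (rweight \<tau> r / r^2 * gauss (x /\<^sub>R r)) * indicator {0<..} r +
   ennreal ((rweight \<sigma> r - rweight \<tau> r) / r^2 * gauss (x /\<^sub>R r)) * indicator {0<..} r
   = ennreal (rweight \<sigma> r / r^2 * gauss (x /\<^sub>R r)) * indicator {0<..} r"
  proof (cases "r > 0")
   case True
   have "rweight \<tau> r / r^2 * gauss (x /\<^sub>R r) + (rweight \<sigma> r - rweight \<tau> r) / r^2 * gauss (x /\<^sub>R r)
    = rweight \<sigma> r / r^2 * gauss (x /\<^sub>R r)"
    by (simp add: diff_divide_distrib left_diff_distrib)
   moreover have "0 <= rweight \<tau> r / r^2 * gauss (x /\<^sub>R r)"
     "0 <= (rweight \<sigma> r - rweight \<tau> r) / r^2 * gauss (x /\<^sub>R r)"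
    using le[OF True] rweight_nonneg[OF True] gauss_nonneg by auto
   ultimately show ?thesis using True by (simp only: ennreal_plus[symmetric] indicator_simps greaterThan_iff mult_1_right)
  qed simp
 qed
 finally show "resolvent_kernel \<sigma> x = resolvent_kernel \<tau> x + mixture (%r. rweight \<sigma> r - rweight \<tau> r) x" by simp
 have t: "\<tau> > 0" using assms by simp
 have "half_integral (rweight \<tau>) + half_integral (%r. rweight \<sigma> r - rweight \<tau> r) =
  (LNN r. ennreal (rweight \<tau> r) * indicator {0<..} r + ennreal (rweight \<sigma> r - rweight \<tau> r) * indicator {0<..} r)"
  unfolding half_integral_def by (rule nn_integral_add[symmetric]) measurable
 also have "... = half_integral (rweight \<sigma>)" unfolding half_integral_def
  using le rweight_nonneg by (intro nn_integral_cong) (auto simp: indicator_def simp flip: ennreal_plus)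
 finally have eq: "ennreal (1 / \<tau>^2) + half_integral (%r. rweight \<sigma> r - rweight \<tau> r) = ennreal (1 / \<sigma>^2)"
  using half_integral_rweight assms t by simp
 have le2: "1 / \<tau>^2 <= 1 / \<sigma>^2" using assms by (intro divide_left_mono power_mono) auto
 show "half_integral (%r. rweight \<sigma> r - rweight \<tau> r) = ennreal (1 / \<sigma>^2 - 1 / \<tau>^2)"
 proof -
  have "half_integral (%r. rweight \<sigma> r - rweight \<tau> r) = ennreal (1 / \<sigma>^2) - ennreal (1 / \<tau>^2)"
   unfolding eq[symmetric] by simp
  then show ?thesis by (simp add: ennreal_minus)
 qed
qed

text \<open>In the plane the Green function blows up logarithmically as \<open>\<sigma> \<rightarrow> 0\<close>: this is the recurrence of planar Brownian motion, and the reason why every positive potential, however small, produces a bound state.\<close>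
lemma resolvent_kernel_lower_bound:
 assumes s: "0 < \<sigma>" "\<sigma> < 1" and x: "norm x <= R"
 shows "resolvent_kernel \<sigma> x >= ennreal (exp (- 1 / 2) * exp (- R\<^sup>2 / 2) / (2 * pi) * ln (1 / \<sigma>))"
proof -
 let ?c = "exp (- 1 / 2) * exp (- R\<^sup>2 / 2) / (2 * pi)"
 have "ennreal (?c * ln (1 / \<sigma>)) = ennreal (?c * ln (1 / \<sigma>) - ?c * ln 1)" by simp
 also have "... = (LNN r. ennreal (?c * (1 / r)) * indicator {1..1/\<sigma>} r)"
  using s by (intro nn_integral_FTC_Icc[symmetric]) (auto intro!: derivative_eq_intros)
 also have "... <= resolvent_kernel \<sigma> x"
  unfolding resolvent_kernel_def mixture_def
 proof (intro nn_integral_mono)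
  fix r :: real
  show "ennreal (?c * (1 / r)) * indicator {1..1/\<sigma>} r <= ennreal (rweight \<sigma> r / r^2 * gauss (x /\<^sub>R r)) * indicator {0<..} r"
  proof (cases "1 <= r & r <= 1 / \<sigma>")
   case True
   then have "\<sigma> * r <= 1" using s by (simp add: field_simps)
   then have "(\<sigma> * r)^2 <= 1" using s True by (simp add: power_le_one)
   then have 1: "exp (- 1 / 2) <= exp (- (\<sigma> * r)\<^sup>2 / 2)" by simp
   have "norm (x /\<^sub>R r) <= norm x" using True mult_right_mono[of 1 r "norm x"] by (simp add: field_simps)
   then have "(norm (x /\<^sub>R r))^2 <= R^2" using x by (intro power_mono) auto
   then have 2: "exp (- R\<^sup>2 / 2) / (2 * pi) <= gauss (x /\<^sub>R r)" unfolding gauss_def by (intro divide_right_mono) auto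
   have "?c * (1 / r) = (exp (- 1 / 2) * (exp (- R\<^sup>2 / 2) / (2 * pi))) * (1 / r)" by simp
   also have "... <= (exp (- (\<sigma> * r)\<^sup>2 / 2) * gauss (x /\<^sub>R r)) * (1 / r)"
    using True by (intro mult_right_mono mult_mono 1 2) auto
   also have "... = rweight \<sigma> r / r^2 * gauss (x /\<^sub>R r)"
    using True by (simp add: rweight_def power2_eq_square)
   finally show ?thesis using True by (simp add: ennreal_leI)
  qed simp
 qed
 finally show ?thesis .
qed

lemma integrable_lborel_product:
 fixes f :: "'a::euclidean_space => real" and g :: "'b::euclidean_space => real"
 assumes f: "integrable lborel f" and g: "integrable lborel g"
 shows "integrable (lborel \<Otimes>\<^sub>M lborel) (%(x, y). f x * g y)"
proof -
 have [measurable]: "f \<in> borel_measurable borel" "g \<in> borel_measurable borel" using f g by auto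
 show ?thesis
  by (rule lborel_pair.Fubini_integrable) (use f g in \<open>auto simp: abs_mult\<close>)
qed

lemma rweight_integrable:
 assumes s: "\<sigma> > 0"
 shows "integrable lborel (%r. indicator {0<..} r * rweight \<sigma> r)"
  and "integrable lborel (%r. indicator {0<..} r * exp (- (\<sigma> * r)\<^sup>2 / 2))"
proof -
 have a: "(LNN r. ennreal (indicator {0<..} r * w r)) = half_integral w" for w
  unfolding half_integral_def by (intro nn_integral_cong) (simp add: indicator_def)
 show "integrable lborel (%r. indicator {0<..} r * rweight \<sigma> r)"
 proof (rule integrableI_nonneg)
  show "AE r in lborel. 0 <= indicator {0<..} r * rweight \<sigma> r"
   by (intro AE_I2) (auto simp: indicator_def rweight_nonneg)
  show "(LNN r. ennreal (indicator {0<..} r * rweight \<sigma> r)) < \<infinity>"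
   unfolding a half_integral_rweight[OF s] by simp
 qed measurable
 have "half_integral (%r. exp (- (\<sigma> * r)\<^sup>2 / 2)) = half_integral (%r. rweight \<sigma> r / r)"
  unfolding half_integral_def by (intro nn_integral_cong) (auto simp: indicator_def rweight_def)
 then show "integrable lborel (%r. indicator {0<..} r * exp (- (\<sigma> * r)\<^sup>2 / 2))"
 proof (intro integrableI_nonneg)
  assume eq: "half_integral (%r. exp (- (\<sigma> * r)\<^sup>2 / 2)) = half_integral (%r. rweight \<sigma> r / r)"
  show "(LNN r. ennreal (indicator {0<..} r * exp (- (\<sigma> * r)\<^sup>2 / 2))) < \<infinity>"
   unfolding a eq resolvent_const[OF s] by simp
 qed auto
qed

text \<open>The kernel is a fundamental solution of \<open>\<sigma>\<^sup>2 - \<Delta>\<close>. In the variables \<open>(r, z)\<close> with \<open>w = r z\<close>, the Laplacian is integrated by parts once in \<open>z\<close>; with \<open>partial e gauss z = - (z \<bullet> e) gauss z\<close> the result is an exact derivative in \<open>r\<close>.\<close>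
lemma resolvent_delta:
 fixes \<zeta> :: "real^2 => real"
 assumes s: "\<sigma> > 0" and \<zeta>: "Ck 2 \<zeta>" and R: "supp_ball R \<zeta>"
 shows "(LBINT r. (LBINT z. indicator {0<..} r * rweight \<sigma> r * gauss z * (\<sigma>^2 * \<zeta> (r *\<^sub>R z) - laplacian \<zeta> (r *\<^sub>R z)))) = \<zeta> 0"
proof -
 let ?i = "%r::real. indicator {0<..} r :: real"
 define p where "p r = exp (- (\<sigma> * r)\<^sup>2 / 2)" for r
 have wp: "rweight \<sigma> r = r * p r" for r by (simp add: rweight_def p_def)
 have \<zeta>2: "Ck (Suc (Suc 0)) \<zeta>" using \<zeta> by (simp add: numeral_2_eq_2)
 let ?dir = "%r z. \<Sum>e\<in>Basis. (z \<bullet> e) * partial e \<zeta> (r *\<^sub>R z)"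
 have c0: "continuous_on UNIV \<zeta>" by (rule Ck_continuous[OF \<zeta>])
 have cp: "continuous_on UNIV (partial e \<zeta>)" if "e \<in> Basis" for e
  using \<zeta>2 that Ck_continuous[of "Suc 0" "partial e \<zeta>"] by auto
 have cl: "continuous_on UNIV (laplacian \<zeta>)" by (rule laplacian_continuous[OF \<zeta>])
 note [measurable] = borel_measurable_continuous_onI[OF c0] borel_measurable_continuous_onI[OF cl]
 obtain C where C: "C > 0" "!!x. \<bar>\<zeta> x\<bar> <= C" by (rule continuous_csupp_bounded[OF c0 R]) (rule that)
 have "EX D>0. ALL x. \<bar>partial e \<zeta> x\<bar> <= D" if "e \<in> Basis" for e
  using continuous_csupp_bounded[OF cp[OF that] supp_ball_partial[OF R]] by metis
 then obtain D where D: "!!e x. e \<in> Basis ==> \<bar>partial e \<zeta> x\<bar> <= D e" "!!e. e \<in> Basis ==> D e > 0" by metis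
 have suppl: "supp_ball R (laplacian \<zeta>)" by (rule supp_ball_laplacian[OF R])
 obtain C' where C': "C' > 0" "!!x. \<bar>laplacian \<zeta> x\<bar> <= C'" by (rule continuous_csupp_bounded[OF cl suppl]) (rule that)
 have dirb: "\<bar>?dir r z\<bar> <= norm z * (\<Sum>e\<in>(Basis::(real^2) set). D e)" for r z
 proof -
  have "\<bar>?dir r z\<bar> <= (\<Sum>e\<in>Basis. \<bar>(z \<bullet> e) * partial e \<zeta> (r *\<^sub>R z)\<bar>)" by (rule sum_abs)
  also have "... <= (\<Sum>e\<in>Basis. norm z * D e)"
   by (intro sum_mono) (auto simp: abs_mult intro!: mult_mono Basis_le_norm D)
  finally show ?thesis by (simp add: sum_distrib_left)
 qed
 have cdir: "continuous_on UNIV (%(r, z). ?dir r z)"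
  unfolding case_prod_unfold by (intro continuous_intros continuous_on_compose2[OF cp]) auto
 have [measurable]: "(%(r, z). ?dir r z) \<in> borel_measurable (borel \<Otimes>\<^sub>M borel)"
  using borel_measurable_continuous_onI[OF cdir] by (simp add: borel_prod)
 have [measurable]: "p \<in> borel_measurable borel" unfolding p_def[abs_def] by measurable
 let ?H = "%r z. ?i r * p r * (\<sigma>^2 * r * \<zeta> (r *\<^sub>R z) - ?dir r z) * gauss z"
 have intH: "integrable (lborel \<Otimes>\<^sub>M lborel) (%(r, z). ?H r z)"
 proof (rule integrable_le)
  show "integrable (lborel \<Otimes>\<^sub>M lborel) (%x. \<sigma>\<^sup>2 * C * (case x of (r, z) => (?i r * rweight \<sigma> r) * gauss (z::real^2))
   + (\<Sum>e\<in>(Basis::(real^2) set). D e) * (case x of (r, z) => (?i r * p r) * (norm z * gauss z)))"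
   unfolding p_def
   by (intro Bochner_Integration.integrable_add integrable_mult_right integrable_lborel_product rweight_integrable[OF s] integrable_gauss integrable_norm_gauss)
  show "AE x in lborel \<Otimes>\<^sub>M lborel. norm (case x of (r, z) => ?H r z) <= norm (\<sigma>^2 * C * (case x of (r, z) => (?i r * rweight \<sigma> r) * gauss (z::real^2))
   + (\<Sum>e\<in>(Basis::(real^2) set). D e) * (case x of (r, z) => (?i r * p r) * (norm z * gauss z)))"
  proof (intro AE_I2, clarify)
   fix r and z :: "real^2"
   show "norm (?H r z) <= norm (\<sigma>^2 * C * (?i r * rweight \<sigma> r * gauss z)
    + (\<Sum>e\<in>(Basis::(real^2) set). D e) * (?i r * p r * (norm z * gauss z)))"
   proof (cases "r > 0")
    case True
    have pp: "p r > 0" by (simp add: p_def)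
    have "\<bar>\<sigma>\<^sup>2 * r * \<zeta> (r *\<^sub>R z) - ?dir r z\<bar> <= \<bar>\<sigma>\<^sup>2 * r * \<zeta> (r *\<^sub>R z)\<bar> + \<bar>?dir r z\<bar>" by (rule abs_triangle_ineq4)
    also have "... <= \<sigma>^2 * r * C + norm z * (\<Sum>e\<in>(Basis::(real^2) set). D e)"
     using True C(2) by (intro add_mono dirb) (auto simp: abs_mult intro!: mult_left_mono)
    finally have b: "\<bar>\<sigma>\<^sup>2 * r * \<zeta> (r *\<^sub>R z) - ?dir r z\<bar> <= \<sigma>^2 * r * C + norm z * (\<Sum>e\<in>(Basis::(real^2) set). D e)" .
    have "norm (?H r z) = p r * gauss z * \<bar>\<sigma>\<^sup>2 * r * \<zeta> (r *\<^sub>R z) - ?dir r z\<bar>"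
     using True pp gauss_nonneg[of z] by (simp add: abs_mult)
    also have "... <= p r * gauss z * (\<sigma>^2 * r * C + norm z * (\<Sum>e\<in>(Basis::(real^2) set). D e))"
     using b pp gauss_nonneg[of z] by (intro mult_left_mono) auto
    also have "... = \<sigma>^2 * C * (?i r * rweight \<sigma> r * gauss z)
     + (\<Sum>e\<in>(Basis::(real^2) set). D e) * (?i r * p r * (norm z * gauss z))"
     using True by (simp add: wp algebra_simps)
    finally show ?thesis by (simp only: real_norm_def)
   qed simp
  qed
 qed measurable
 have "(LBINT r. (LBINT z. ?i r * rweight \<sigma> r * gauss z * (\<sigma>^2 * \<zeta> (r *\<^sub>R z) - laplacian \<zeta> (r *\<^sub>R z))))
   = (LBINT r. (LBINT z. ?H r z))"
 proof (rule integral_eqI[OF refl])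
  fix r :: real
  show "(LBINT z. ?i r * rweight \<sigma> r * gauss z * (\<sigma>^2 * \<zeta> (r *\<^sub>R z) - laplacian \<zeta> (r *\<^sub>R z))) = (LBINT z. ?H r z)"
  proof (cases "r > 0")
   case True
   have id: "(LBINT z. ?dir r z * gauss z) = r * (LBINT z. laplacian \<zeta> (r *\<^sub>R z) * gauss z)"
    by (rule dilation_identity[OF \<zeta> Ck_gauss gauss_continuous partial_gauss True disjI1[OF R]])
   have i1: "integrable lborel (%z. \<zeta> (r *\<^sub>R z) * gauss z)"
    by (rule integrable_le[OF integrable_mult_right[OF integrable_gauss, of C]])
      (use C gauss_nonneg in \<open>auto simp: abs_mult intro!: mult_right_mono\<close>)
   have i2: "integrable lborel (%z. laplacian \<zeta> (r *\<^sub>R z) * gauss z)"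
    by (rule integrable_le[OF integrable_mult_right[OF integrable_gauss, of C']])
      (use C' gauss_nonneg in \<open>auto simp: abs_mult intro!: mult_right_mono\<close>)
   have i3: "integrable lborel (%z. ?dir r z * gauss z)"
   proof (rule integrable_le[OF integrable_mult_right[OF integrable_norm_gauss, of "\<Sum>e\<in>(Basis::(real^2) set). D e"]])
    have "continuous_on UNIV (?dir r)" by (intro continuous_intros continuous_on_compose2[OF cp]) auto
    note [measurable] = borel_measurable_continuous_onI[OF this]
    show "(%z. ?dir r z * gauss z) \<in> borel_measurable lborel" by measurable
    show "AE z in lborel. norm (?dir r z * gauss z) <= norm ((\<Sum>e\<in>(Basis::(real^2) set). D e) * (norm z * gauss z))"
    proof (rule AE_I2)
     fix z
     have "\<bar>?dir r z\<bar> * gauss z <= norm z * (\<Sum>e\<in>(Basis::(real^2) set). D e) * gauss z"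
      using dirb gauss_nonneg by (intro mult_right_mono) auto
     also have "... <= \<bar>(\<Sum>e\<in>(Basis::(real^2) set). D e) * (norm z * gauss z)\<bar>" by (simp add: mult_ac)
     finally show "norm (?dir r z * gauss z) <= norm ((\<Sum>e\<in>(Basis::(real^2) set). D e) * (norm z * gauss z))"
      using gauss_nonneg[of z] by (simp add: abs_mult)
    qed
   qed
   have "(LBINT z. ?i r * rweight \<sigma> r * gauss z * (\<sigma>^2 * \<zeta> (r *\<^sub>R z) - laplacian \<zeta> (r *\<^sub>R z)))
    = (LBINT z. (p r * r * \<sigma>^2) * (\<zeta> (r *\<^sub>R z) * gauss z) - (p r * r) * (laplacian \<zeta> (r *\<^sub>R z) * gauss z))"
    using True by (intro integral_eqI) (simp_all add: wp algebra_simps)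
   also have "... = (p r * r * \<sigma>^2) * (LBINT z. \<zeta> (r *\<^sub>R z) * gauss z) - p r * (LBINT z. ?dir r z * gauss z)"
    unfolding id using i1 i2 by simp
   also have "... = (LBINT z. (p r * r * \<sigma>^2) * (\<zeta> (r *\<^sub>R z) * gauss z) - p r * (?dir r z * gauss z))"
    using i1 i3 by simp
   also have "... = (LBINT z. ?H r z)"
    using True by (intro integral_eqI) (simp_all add: algebra_simps)
   finally show ?thesis .
  qed simp
 qed
 also have "... = (LBINT z. (LBINT r. ?H r z))"
  using lborel_pair.Fubini_integral[OF intH] by simp
 also have "... = (LBINT z. \<zeta> 0 * gauss z)"
 proof (rule integral_cong_AE)
  show "(%z. LBINT r. ?H r z) \<in> borel_measurable lborel"
  proof -
   have "(%(z, r). ?H r z) \<in> borel_measurable (lborel \<Otimes>\<^sub>M lborel)"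
    using borel_measurable_integrable[OF lborel_pair.integrable_product_swap[OF intH]]
    by (simp add: case_prod_unfold)
   then show ?thesis by (rule lborel.borel_measurable_lebesgue_integral)
  qed
  show "AE z in lborel. (LBINT r. ?H r z) = \<zeta> 0 * gauss z"
   using AE_lborel_singleton[of "0::real^2"]
  proof eventually_elim
   fix z :: "real^2" assume z: "z ~= 0"
   define n where "n = \<bar>R\<bar> / norm z + 1"
   have n: "n > 0" by (simp add: n_def add_nonneg_pos)
   have far: "norm (r *\<^sub>R z) > R" if "r >= n" for r
   proof -
    have "r * norm z >= n * norm z" using that z by (intro mult_right_mono) auto
    also have "n * norm z = \<bar>R\<bar> + norm z" using z by (simp add: n_def field_simps)
    finally show ?thesis using z that n by simp (smt (verit) zero_less_norm_iff)
   qed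
   let ?F = "%r. - p r * \<zeta> (r *\<^sub>R z)"
   let ?f = "%r. p r * (\<sigma>^2 * r * \<zeta> (r *\<^sub>R z) - ?dir r z)"
   have "(LBINT r. ?f r * indicator {0..n} r) = ?F n - ?F 0"
   proof (rule integral_FTC_Icc_real)
    show "0 <= n" using n by simp
    show "(?F has_real_derivative ?f r) (at r)" for r
    proof -
     have "((%r. - p r) has_real_derivative \<sigma>\<^sup>2 * r * p r) (at r)"
      unfolding p_def by (auto intro!: derivative_eq_intros simp: power2_eq_square)
     from DERIV_mult[OF this has_real_derivative_along_line[OF \<zeta>2, of 0 z r]]
     show ?thesis by (simp add: algebra_simps)
    qed
    show "isCont ?f r" for r
    proof -
     have "continuous_on UNIV ?f" unfolding p_def
      by (intro continuous_intros continuous_on_compose2[OF cp] continuous_on_compose2[OF c0]) auto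
     then show ?thesis by (simp add: continuous_on_eq_continuous_at)
    qed
   qed
   also have "?F n - ?F 0 = \<zeta> 0" using supp_ballD[OF R far[of n]] by (simp add: p_def)
   finally have 1: "(LBINT r. ?f r * indicator {0..n} r) = \<zeta> 0" .
   have "(LBINT r. ?H r z) = (LBINT r. (?f r * indicator {0..n} r) * gauss z)"
   proof (rule integral_cong_AE)
    have "continuous_on UNIV (%r. ?dir r z)" by (intro continuous_intros continuous_on_compose2[OF cp]) auto
    note [measurable] = borel_measurable_continuous_onI[OF this]
    show "(%r. ?H r z) \<in> borel_measurable lborel" "(%r. (?f r * indicator {0..n} r) * gauss z) \<in> borel_measurable lborel"
     by measurable
    show "AE r in lborel. ?H r z = (?f r * indicator {0..n} r) * gauss z"
     using AE_lborel_singleton[of "0::real"]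
    proof eventually_elim
     fix r :: real assume "r ~= 0"
     then consider "r < 0" | "0 < r" "r <= n" | "r > n" by linarith
     then show "?H r z = (?f r * indicator {0..n} r) * gauss z"
     proof cases
      case 3
      then have "\<zeta> (r *\<^sub>R z) = 0" "!!e. partial e \<zeta> (r *\<^sub>R z) = 0"
       using supp_ballD[OF R far[of r]] supp_ballD[OF supp_ball_partial[OF R] far[of r]] by auto
      then show ?thesis by simp
     qed auto
    qed
   qed
   also have "... = \<zeta> 0 * gauss z" using 1 by simp
   finally show "(LBINT r. ?H r z) = \<zeta> 0 * gauss z" .
  qed
 qed measurable
 also have "... = \<zeta> 0" by (simp add: integral_gauss)
 finally show ?thesis .
qed

text \<open>A function of the form \<open>G * h\<close>, with \<open>G\<close> the Green function, solves \<open>\<sigma>\<^sup>2 \<phi> - \<Delta>\<phi> = h\<close> in the sense of distributions: Fubini, then the fundamental solution property at each point.\<close>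
lemma resolvent_identity:
 fixes \<phi> h \<xi> :: "real^2 => real"
 assumes s: "\<sigma> > 0" and \<xi>: "Ck 2 \<xi>" and R: "supp_ball R \<xi>"
  and h: "integrable lborel h" "!!x. h x >= 0" and \<phi>: "integrable lborel \<phi>" "!!x. \<phi> x >= 0"
  and eq: "!!x. ennreal (\<phi> x) = (LNN y. resolvent_kernel \<sigma> (x - y) * ennreal (h y))"
 shows "(LBINT x. \<phi> x * (\<sigma>^2 * \<xi> x - laplacian \<xi> x)) = (LBINT x. h x * \<xi> x)"
proof -
 define P :: "(real \<times> (real^2)) measure" where
  "P = density (lborel \<Otimes>\<^sub>M lborel) (%(r, z). ennreal (indicator {0<..} r * rweight \<sigma> r * gauss z))"
 have [measurable_cong]: "sets P = sets (borel \<Otimes>\<^sub>M borel)" unfolding P_def sets_density by (intro sets_pair_measure_cong sets_lborel)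
 have nnP: "(\<integral>\<^sup>+q. F q \<partial>P) = (LNN r. (LNN z. ennreal (gauss z) * F (r, z)) * ennreal (rweight \<sigma> r) * indicator {0<..} r)"
  if [measurable]: "F \<in> borel_measurable (borel \<Otimes>\<^sub>M borel)" for F :: "real \<times> (real^2) => ennreal"
 proof -
  have "(\<integral>\<^sup>+q. F q \<partial>P) = (\<integral>\<^sup>+q. (case q of (r, z) => ennreal (indicator {0<..} r * rweight \<sigma> r * gauss z)) * F q \<partial>(lborel \<Otimes>\<^sub>M lborel))"
   unfolding P_def by (rule nn_integral_density) measurable
  also have "... = (LNN r. (LNN z. ennreal (indicator {0<..} r * rweight \<sigma> r * gauss z) * F (r, z)))"
   by (subst lborel.nn_integral_fst[symmetric]) simp_all
  also have "... = (LNN r. (LNN z. ennreal (gauss z) * F (r, z)) * ennreal (rweight \<sigma> r) * indicator {0<..} r)"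
  proof (intro nn_integral_cong)
   fix r :: real
   show "(LNN z. ennreal (indicator {0<..} r * rweight \<sigma> r * gauss z) * F (r, z))
    = (LNN z. ennreal (gauss z) * F (r, z)) * ennreal (rweight \<sigma> r) * indicator {0<..} r"
   proof (cases "r > 0")
    case True
    have "(LNN z. ennreal (indicator {0<..} r * rweight \<sigma> r * gauss z) * F (r, z))
     = (LNN z. ennreal (gauss z) * F (r, z) * ennreal (rweight \<sigma> r))"
     using True rweight_nonneg[OF True] by (intro nn_integral_cong) (simp add: ennreal_mult gauss_nonneg mult_ac)
    also have "... = (LNN z. ennreal (gauss z) * F (r, z)) * ennreal (rweight \<sigma> r)"
     by (rule nn_integral_multc) measurable
    finally show ?thesis using True by simp
   qed simp
  qed
  finally show ?thesis .
 qed
 have massP: "emeasure P (space P) = ennreal (1 / \<sigma>^2)"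
  using nnP[of "%_. 1"] half_integral_rweight[OF s] by (simp add: nn_integral_gauss half_integral_def)
 interpret P: finite_measure P by standard (simp add: massP)
 interpret LP: pair_sigma_finite "lborel :: (real^2) measure" P ..
 have [measurable]: "h \<in> borel_measurable borel" "\<phi> \<in> borel_measurable borel" using h \<phi> by auto
 define \<theta> where "\<theta> x = \<sigma>^2 * \<xi> x - laplacian \<xi> x" for x
 have c\<theta>: "continuous_on UNIV \<theta>" unfolding \<theta>_def
  by (intro continuous_intros Ck_continuous[OF \<xi>] laplacian_continuous[OF \<xi>])
 note [measurable] = borel_measurable_continuous_onI[OF c\<theta>]
 have "supp_ball R \<theta>"
  using supp_ball_laplacian[OF R] R by (auto simp: supp_ball_def \<theta>_def)
 then obtain C where C: "C > 0" "!!x. \<bar>\<theta> x\<bar> <= C" by (rule continuous_csupp_bounded[OF c\<theta>]) (rule that)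
 let ?t = "%x q. x + fst q *\<^sub>R snd q :: real^2"
 have nn\<phi>: "(\<integral>\<^sup>+q. ennreal (h (?t x q)) \<partial>P) = ennreal (\<phi> x)" for x
 proof -
  have "(\<integral>\<^sup>+q. ennreal (h (?t x q)) \<partial>P) = (LNN r. (LNN z. ennreal (gauss z) * ennreal (h (x + r *\<^sub>R z))) * ennreal (rweight \<sigma> r) * indicator {0<..} r)"
   by (subst nnP) simp_all
  also have "... = ennreal (\<phi> x)" unfolding eq resolvent_kernel_def
   by (rule mixture_convolution[symmetric]) (auto simp: rweight_nonneg)
  finally show ?thesis .
 qed
 have ih: "integrable P (%q. h (?t x q))" for x
  by (rule integrableI_nonneg) (use h nn\<phi> in auto)
 have int\<phi>: "(LINT q|P. h (?t x q)) = \<phi> x" for x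
  by (subst integral_eq_nn_integral) (use h nn\<phi> \<phi> in auto)
 have F1: "integrable (lborel \<Otimes>\<^sub>M P) (%(x, q). h (?t x q) * \<theta> x)"
 proof (rule LP.Fubini_integrable)
  have "(LINT q|P. norm (case (x, q) of (x, q) => h (?t x q) * \<theta> x)) = \<phi> x * \<bar>\<theta> x\<bar>" for x
   using int\<phi>[of x] h(2) by (simp add: abs_mult)
  moreover have "integrable lborel (%x. \<phi> x * \<bar>\<theta> x\<bar>)"
  proof (rule integrable_le[OF integrable_mult_right[OF \<phi>(1), of C]])
   show "AE x in lborel. norm (\<phi> x * \<bar>\<theta> x\<bar>) <= norm (C * \<phi> x)"
   proof (rule AE_I2)
    fix x
    show "norm (\<phi> x * \<bar>\<theta> x\<bar>) <= norm (C * \<phi> x)"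
     using mult_left_mono[OF C(2)[of x] \<phi>(2)[of x]] C(1) \<phi>(2)[of x] by (simp add: abs_mult mult.commute)
   qed
  qed measurable
  ultimately show "integrable lborel (%x. LINT q|P. norm (case (x, q) of (x, q) => h (?t x q) * \<theta> x))" by simp
 qed (use ih in auto)
 let ?u = "%x q. x - fst q *\<^sub>R snd q :: real^2"
 have bd: "integrable P (%q. \<theta> (?u x q))" for x
  by (rule P.integrable_const_bound[of _ C]) (use C in auto)
 have F2: "integrable (lborel \<Otimes>\<^sub>M P) (%(x, q). h x * \<theta> (?u x q))"
 proof (rule LP.Fubini_integrable)
  have "integrable lborel (%x. h x * (LINT q|P. \<bar>\<theta> (?u x q)\<bar>))"
  proof (rule integrable_le[OF integrable_mult_right[OF h(1), of "C * measure P (space P)"]])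
   have "\<bar>LINT q|P. \<bar>\<theta> (?u x q)\<bar>\<bar> <= C * measure P (space P)" for x
   proof -
    have "(LINT q|P. \<bar>\<theta> (?u x q)\<bar>) <= (LINT q|P. C)" using bd[of x] C by (intro integral_mono) auto
    moreover have "(LINT q|P. \<bar>\<theta> (?u x q)\<bar>) >= 0" by (rule integral_ge_0) simp
    ultimately show ?thesis by (simp add: mult.commute)
   qed
   then show "AE x in lborel. norm (h x * (LINT q|P. \<bar>\<theta> (?u x q)\<bar>)) <= norm (C * measure P (space P) * h x)"
    using h(2) C by (auto simp: abs_mult mult.commute intro!: mult_left_mono)
  qed measurable
  then show "integrable lborel (%x. LINT q|P. norm (case (x, q) of (x, q) => h x * \<theta> (?u x q)))"
   using h(2) by (simp add: abs_mult)
 qed (use bd in auto)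
 have key: "(LINT q|P. \<theta> (?u x q)) = \<xi> x" for x
 proof -
  define \<zeta> :: "real^2 => real" where "\<zeta> w = \<xi> (x + (- 1) *\<^sub>R w)" for w
  have \<zeta>: "Ck 2 \<zeta>" unfolding \<zeta>_def[abs_def] by (rule Ck_affine[OF \<xi>])
  have "supp_ball (\<bar>R\<bar> + norm x) \<zeta>"
   unfolding supp_ball_def
  proof (intro allI impI)
   fix w :: "real^2" assume "norm w > \<bar>R\<bar> + norm x"
   then have "norm (x - w) > R" using norm_triangle_sub[of w x] by (simp add: norm_minus_commute)
   then show "\<zeta> w = 0" using supp_ballD[OF R] by (simp add: \<zeta>_def)
  qed
  note del = resolvent_delta[OF s \<zeta> this]
  have \<theta>\<zeta>: "\<sigma>^2 * \<zeta> w - laplacian \<zeta> w = \<theta> (x - w)" for w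
   unfolding \<theta>_def \<zeta>_def[abs_def] laplacian_affine[OF \<xi>] by simp
  have "(LINT q|P. \<theta> (?u x q)) = (LINT q|(lborel \<Otimes>\<^sub>M lborel). (case q of (r, z) => indicator {0<..} r * rweight \<sigma> r * gauss z) *\<^sub>R \<theta> (?u x q))"
   unfolding P_def case_prod_unfold
   by (rule integral_density)
     (auto intro!: AE_I2 mult_nonneg_nonneg simp: gauss_nonneg indicator_def rweight_nonneg)
  also have "... = (LBINT r. (LBINT z. indicator {0<..} r * rweight \<sigma> r * gauss z * \<theta> (x - r *\<^sub>R z)))"
  proof -
   have "integrable (lborel \<Otimes>\<^sub>M lborel) (%(r, z). indicator {0<..} r * rweight \<sigma> r * gauss z * \<theta> (x - r *\<^sub>R z))"
   proof (rule integrable_le[OF integrable_mult_right[OF integrable_lborel_product[OF rweight_integrable(1)[OF s] integrable_gauss], of C]])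
    show "AE q in lborel \<Otimes>\<^sub>M lborel. norm (case q of (r, z) => indicator {0<..} r * rweight \<sigma> r * gauss z * \<theta> (x - r *\<^sub>R z))
     <= norm (C * (case q of (r, z) => indicator {0<..} r * rweight \<sigma> r * gauss z))"
    proof (intro AE_I2, clarify)
     fix r and z :: "real^2"
     have "\<bar>indicator {0<..} r * rweight \<sigma> r * gauss z\<bar> * \<bar>\<theta> (x - r *\<^sub>R z)\<bar> <= \<bar>indicator {0<..} r * rweight \<sigma> r * gauss z\<bar> * C"
      by (intro mult_left_mono C) auto
     then show "norm (indicator {0<..} r * rweight \<sigma> r * gauss z * \<theta> (x - r *\<^sub>R z))
      <= norm (C * (indicator {0<..} r * rweight \<sigma> r * gauss z))"
      using C(1) by (simp add: abs_mult mult.commute)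
    qed
   qed measurable
   then show ?thesis
    by (subst lborel_pair.integral_fst'[symmetric]) (simp_all add: case_prod_unfold)
  qed
  also have "... = \<zeta> 0" using del unfolding \<theta>\<zeta> .
  finally show ?thesis by (simp add: \<zeta>_def)
 qed
 have "(LBINT x. \<phi> x * \<theta> x) = (LBINT x. (LINT q|P. h (?t x q) * \<theta> x))"
  using int\<phi> ih by simp
 also have "... = (LINT q|P. (LBINT x. h (?t x q) * \<theta> x))"
  using LP.Fubini_integral[OF F1] by simp
 also have "... = (LINT q|P. (LBINT x. h x * \<theta> (?u x q)))"
 proof (rule integral_eqI[OF refl])
  fix q
  show "(LBINT x. h (?t x q) * \<theta> x) = (LBINT x. h x * \<theta> (?u x q))"
   using integral_affine[of "%x. h x * \<theta> (?u x q)" 1 "fst q *\<^sub>R snd q"] by (simp add: add.commute)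
 qed
 also have "... = (LBINT x. (LINT q|P. h x * \<theta> (?u x q)))"
  using LP.Fubini_integral[OF F2] by simp
 also have "... = (LBINT x. h x * \<xi> x)" by (simp add: key)
 finally show ?thesis by (simp add: \<theta>_def)
qed

section \<open>Principal eigenfunctions of symmetric positive kernels\<close>

lemma ennreal_le_of_sq_le:
 assumes "a^2 <= (ennreal c)^2" "c >= 0" shows "a <= ennreal c"
proof (cases a)
 case (real r)
 then have "r^2 <= c^2" using assms by (simp add: ennreal_power)
 then show ?thesis using real assms by (auto intro!: ennreal_leI power2_le_imp_le)
next
 case top
 then show ?thesis using assms ennreal_mult_eq_top_iff[of "ennreal c" "ennreal c"]
  by (simp add: top_unique power2_eq_square)
qed

text \<open>Everything is done with \<open>ennreal\<close>-valued functions, so that no integrability has to be discussed for the images under the kernel operator.\<close>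
locale positive_kernel = sigma_finite_measure M for M :: "'a measure" +
 fixes k :: "'a => 'a => ennreal"
 assumes k_meas[measurable]: "(%(x, y). k x y) \<in> borel_measurable (M \<Otimes>\<^sub>M M)"
  and sym: "!!x y. k x y = k y x"
begin

definition K :: "('a => ennreal) => 'a => ennreal" where
 "K f x = (\<integral>\<^sup>+y. k x y * f y \<partial>M)"

definition N :: "('a => ennreal) => ennreal" where
 "N f = (\<integral>\<^sup>+x. (f x)\<^sup>2 \<partial>M)"

lemma K_meas[measurable]:
 assumes [measurable]: "f \<in> borel_measurable M" shows "K f \<in> borel_measurable M"
 unfolding K_def[abs_def] by measurable

lemma K_mono: "(!!x. f x <= g x) ==> K f x <= K g x"
 unfolding K_def by (intro nn_integral_mono mult_left_mono) auto

lemma k_meas1[measurable]: "x \<in> space M ==> k x \<in> borel_measurable M"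
 by measurable

lemma K_add: "f \<in> borel_measurable M ==> g \<in> borel_measurable M ==> x \<in> space M ==> K (%x. f x + g x) x = K f x + K g x"
 unfolding K_def by (simp add: distrib_left nn_integral_add)

lemma K_cmult: "f \<in> borel_measurable M ==> x \<in> space M ==> K (%x. c * f x) x = c * K f x"
 unfolding K_def by (simp add: nn_integral_cmult mult.left_commute)

lemma K_symmetric:
 assumes [measurable]: "f \<in> borel_measurable M" "g \<in> borel_measurable M"
 shows "(\<integral>\<^sup>+x. K f x * g x \<partial>M) = (\<integral>\<^sup>+x. f x * K g x \<partial>M)"
proof -
 interpret P: pair_sigma_finite M M ..
 have "(\<integral>\<^sup>+x. K f x * g x \<partial>M) = (\<integral>\<^sup>+x. (\<integral>\<^sup>+y. k x y * f y * g x \<partial>M) \<partial>M)"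
  unfolding K_def by (intro nn_integral_cong nn_integral_multc[symmetric]) measurable
 also have "... = (\<integral>\<^sup>+y. (\<integral>\<^sup>+x. k x y * f y * g x \<partial>M) \<partial>M)"
  by (rule P.Fubini') measurable
 also have "... = (\<integral>\<^sup>+y. (\<integral>\<^sup>+x. f y * (k y x * g x) \<partial>M) \<partial>M)"
  by (intro nn_integral_cong) (metis sym mult.assoc mult.commute)
 also have "... = (\<integral>\<^sup>+y. f y * K g y \<partial>M)"
  unfolding K_def by (intro nn_integral_cong nn_integral_cmult) measurable
 finally show ?thesis .
qed

text \<open>Schur test: Cauchy-Schwarz with respect to the measure \<open>k x y dy\<close>, then symmetry of the kernel.\<close>
lemma schur_bound:
 assumes S: "!!x. x \<in> space M ==> (\<integral>\<^sup>+y. k x y \<partial>M) <= S" and [measurable]: "f \<in> borel_measurable M"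
 shows "N (K f) <= S^2 * N f"
proof -
 interpret P: pair_sigma_finite M M ..
 have "(K f x)^2 <= S * (\<integral>\<^sup>+y. k x y * (f y)^2 \<partial>M)" if x: "x \<in> space M" for x
 proof -
  have "(K f x)^2 = (\<integral>\<^sup>+y. 1 * f y \<partial>(density M (k x)))^2"
   unfolding K_def using x by (simp add: nn_integral_density)
  also have "... <= (\<integral>\<^sup>+y. 1\<^sup>2 \<partial>(density M (k x))) * (\<integral>\<^sup>+y. (f y)\<^sup>2 \<partial>(density M (k x)))"
   by (rule Cauchy_Schwarz_nn_integral) auto
  also have "... = (\<integral>\<^sup>+y. k x y \<partial>M) * (\<integral>\<^sup>+y. k x y * (f y)^2 \<partial>M)"
   using x by (simp add: nn_integral_density emeasure_density cong: nn_integral_cong)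
  also have "... <= S * (\<integral>\<^sup>+y. k x y * (f y)^2 \<partial>M)" by (intro mult_right_mono S x) auto
  finally show ?thesis .
 qed
 then have "N (K f) <= (\<integral>\<^sup>+x. S * (\<integral>\<^sup>+y. k x y * (f y)^2 \<partial>M) \<partial>M)"
  unfolding N_def by (intro nn_integral_mono)
 also have "... = S * (\<integral>\<^sup>+x. (\<integral>\<^sup>+y. k x y * (f y)^2 \<partial>M) \<partial>M)"
  by (rule nn_integral_cmult) measurable
 finally have 1: "N (K f) <= S * (\<integral>\<^sup>+x. (\<integral>\<^sup>+y. k x y * (f y)^2 \<partial>M) \<partial>M)" .
 have "(\<integral>\<^sup>+x. (\<integral>\<^sup>+y. k x y * (f y)^2 \<partial>M) \<partial>M) = (\<integral>\<^sup>+x. K (%y. (f y)\<^sup>2) x * 1 \<partial>M)"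
  by (simp add: K_def)
 also have "... = (\<integral>\<^sup>+x. (f x)\<^sup>2 * K (%_. 1) x \<partial>M)" by (rule K_symmetric) measurable
 also have "... <= (\<integral>\<^sup>+x. (f x)\<^sup>2 * S \<partial>M)"
  by (intro nn_integral_mono mult_left_mono) (use S in \<open>auto simp: K_def\<close>)
 also have "... = N f * S" unfolding N_def by (rule nn_integral_multc) measurable
 finally have "(\<integral>\<^sup>+x. (\<integral>\<^sup>+y. k x y * (f y)^2 \<partial>M) \<partial>M) <= N f * S" .
 then have "S * (\<integral>\<^sup>+x. (\<integral>\<^sup>+y. k x y * (f y)^2 \<partial>M) \<partial>M) <= S * (N f * S)" by (rule mult_left_mono) simp
 with 1 show ?thesis by (simp add: power2_eq_square mult_ac)
qed

text \<open>The square of the norm of \<open>K\<close> on \<open>L\<^sup>2\<close>, computed on nonnegative functions; for a positive kernel this loses nothing.\<close>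
definition opnorm2 :: ennreal where
 "opnorm2 = (SUP f\<in>{f \<in> borel_measurable M. N f <= 1}. N (K f))"

lemma N_cmult: "f \<in> borel_measurable M ==> N (%x. c * f x) = c^2 * N f"
 unfolding N_def by (simp add: power_mult_distrib nn_integral_cmult)

lemma N_cong: "(!!x. x \<in> space M ==> f x = g x) ==> N f = N g"
 unfolding N_def by (simp cong: nn_integral_cong)

lemma opnorm2_bound:
 assumes [measurable]: "f \<in> borel_measurable M" and fin: "N f < \<infinity>" "opnorm2 < \<infinity>"
 shows "N (K f) <= opnorm2 * N f"
proof (cases "N f = 0")
 case True
 then have z: "AE x in M. f x = 0" unfolding N_def by (simp add: nn_integral_0_iff_AE)
 have "K f x = 0" if "x \<in> space M" for x
  unfolding K_def using z that by (subst nn_integral_0_iff_AE) auto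
 then have "N (K f) = 0" unfolding N_def by (simp cong: nn_integral_cong)
 then show ?thesis by simp
next
 case False
 define r where "r = enn2real (N f)"
 have r: "N f = ennreal r" "r > 0" using fin False by (auto simp: r_def enn2real_positive_iff less_top zero_less_iff_neq_zero)
 define c where "c = ennreal (1 / sqrt r)"
 have c2: "c^2 = ennreal (1 / r)" using r by (simp add: c_def ennreal_power power_divide)
 have "N (%x. c * f x) = c^2 * N f" by (rule N_cmult) measurable
 also have "... = 1" using r by (simp add: c2 flip: ennreal_mult')
 finally have "N (K (%x. c * f x)) <= opnorm2" unfolding opnorm2_def by (intro SUP_upper) auto
 moreover have "N (K (%x. c * f x)) = c^2 * N (K f)"
  using N_cmult[OF K_meas[OF assms(1)], of c] by (subst N_cong[OF K_cmult]) auto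
 ultimately have "ennreal r * (c^2 * N (K f)) <= ennreal r * opnorm2" by (intro mult_left_mono) auto
 also have "ennreal r * (c^2 * N (K f)) = N (K f)"
  using r by (simp add: c2 flip: mult.assoc ennreal_mult')
 finally show ?thesis using r by (simp add: mult.commute)
qed

lemma K_cong_AE: "AE y in M. f y = g y ==> K f x = K g x"
 unfolding K_def by (rule nn_integral_cong_AE) auto

lemma N_cong_AE: "AE y in M. f y = g y ==> N f = N g"
 unfolding N_def by (rule nn_integral_cong_AE) auto

lemma K_sq_bound:
 assumes [measurable]: "f \<in> borel_measurable M" and "x \<in> space M" and "(\<integral>\<^sup>+y. (k x y)\<^sup>2 \<partial>M) <= Q"
 shows "(K f x)^2 <= Q * N f"
proof -
 have "(K f x)^2 <= (\<integral>\<^sup>+y. (k x y)\<^sup>2 \<partial>M) * (\<integral>\<^sup>+y. (f y)\<^sup>2 \<partial>M)"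
  unfolding K_def using assms by (intro Cauchy_Schwarz_nn_integral) auto
 also have "... <= Q * N f" unfolding N_def by (intro mult_right_mono assms) auto
 finally show ?thesis .
qed

lemma K_sup_bound:
 assumes S: "(\<integral>\<^sup>+y. k x y \<partial>M) <= S" and g: "!!y. g y <= C" and x: "x \<in> space M"
 shows "K g x <= S * C"
proof -
 have "K g x <= (\<integral>\<^sup>+y. k x y * C \<partial>M)" unfolding K_def by (intro nn_integral_mono mult_left_mono g) auto
 also have "... = (\<integral>\<^sup>+y. k x y \<partial>M) * C" using x by (intro nn_integral_multc) auto
 also have "... <= S * C" by (intro mult_right_mono S) auto
 finally show ?thesis .
qed

text \<open>Let \<open>f\<^sub>n\<close> be a maximising sequence of unit vectors. By symmetry
 \<open>\<parallel>K\<^sup>2 f\<^sub>n - f\<^sub>n\<parallel>\<^sup>2 = \<parallel>K\<^sup>2 f\<^sub>n\<parallel>\<^sup>2 + \<parallel>f\<^sub>n\<parallel>\<^sup>2 - 2 \<parallel>K f\<^sub>n\<parallel>\<^sup>2 \<le> 2 - 2 \<parallel>K f\<^sub>n\<parallel>\<^sup>2\<close>, which tends to zero.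
 Compactness gives a limit \<open>h\<close> of \<open>K\<^sup>2 f\<^sub>n\<close> along a subsequence; it is also the limit of \<open>f\<^sub>n\<close>, hence nonzero and
 fixed by \<open>K\<^sup>2\<close>. Then \<open>h + K h\<close> is fixed by \<open>K\<close>, and it cannot vanish because both terms are nonnegative.\<close>
theorem fixed_point:
 fixes S Q :: real
 assumes sp: "space M = UNIV" and finM: "emeasure M UNIV < \<infinity>"
  and S: "!!x. (\<integral>\<^sup>+y. k x y \<partial>M) <= ennreal S" "S >= 0"
  and Q: "!!x. (\<integral>\<^sup>+y. (k x y)\<^sup>2 \<partial>M) <= ennreal Q" "Q >= 0"
  and one: "opnorm2 = 1"
  and compact: "!!g C. (!!n::nat. g n \<in> borel_measurable M) ==> (!!n x. g n x <= ennreal C) ==>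
   EX s. strict_mono s & (ALL x. EX l::real. (%n. enn2real (K (g (s n)) x)) \<longlonglongrightarrow> l)"
 obtains \<phi> :: "'a => real" and B where "\<phi> \<in> borel_measurable M" "!!x. 0 <= \<phi> x" "!!x. \<phi> x <= B"
  "\<not> (AE x in M. \<phi> x = 0)" "!!x. K (%y. ennreal (\<phi> y)) x = ennreal (\<phi> x)"
proof -
 have "EX F:borel_measurable M. N F <= 1 & N (K F) > ennreal (1 - 1 / real (Suc n))" for n
 proof -
  have "ennreal (1 - 1 / real (Suc n)) < ennreal 1" by (intro ennreal_lessI) auto
  then have "ennreal (1 - 1 / real (Suc n)) < opnorm2" by (simp add: one)
  then show ?thesis unfolding opnorm2_def less_SUP_iff by auto
 qed
 then obtain F where F[measurable]: "!!n. F n \<in> borel_measurable M"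
  and F1: "!!n. N (F n) <= 1" and F2: "!!n. N (K (F n)) > ennreal (1 - 1 / real (Suc n))" by metis
 define f where "f n x = enn2real (F n x)" for n x
 have [measurable]: "f n \<in> borel_measurable M" for n unfolding f_def[abs_def] by measurable
 have fF: "AE x in M. ennreal (f n x) = F n x" for n
 proof -
  have "AE x in M. (F n x)\<^sup>2 ~= \<infinity>"
   by (rule nn_integral_PInf_AE) (use F1[of n] in \<open>auto simp: N_def top_unique\<close>)
  then show ?thesis by eventually_elim (auto simp: f_def power2_eq_square ennreal_mult_eq_top_iff less_top)
 qed
 have f0: "f n x >= 0" for n x by (simp add: f_def)
 let ?f = "%n x. ennreal (f n x)"
 have Nf: "N (?f n) <= 1" and NKf: "N (K (?f n)) >= ennreal (1 - 1 / real (Suc n))" for n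
 proof -
  show "N (?f n) <= 1" using N_cong_AE[OF fF[of n]] F1[of n] by simp
  have "K (?f n) = K (F n)" using K_cong_AE[OF fF[of n]] by auto
  then show "N (K (?f n)) >= ennreal (1 - 1 / real (Suc n))" using F2[of n] by simp
 qed
 have b1: "K u x <= ennreal (sqrt (Q * z))" if [measurable]: "u \<in> borel_measurable M" and "N u <= ennreal z" "z >= 0" for u x z
 proof -
  have "(K u x)^2 <= ennreal Q * N u" by (rule K_sq_bound) (auto simp: Q sp)
  also have "... <= ennreal Q * ennreal z" by (intro mult_left_mono that) auto
  also have "... = ennreal (Q * z)" using Q that by (simp add: ennreal_mult)
  also have "... = (ennreal (sqrt (Q * z)))^2" using Q that by (simp add: ennreal_power)
  finally show ?thesis by (rule ennreal_le_of_sq_le) (use Q that in auto)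
 qed
 define q where "q = sqrt Q"
 have q: "q >= 0" using Q by (simp add: q_def)
 have Kf: "K (?f n) x <= ennreal q" for n x
  using b1[of "?f n" 1 x] Nf[of n] by (simp add: q_def)
 have KKf: "K (K (?f n)) x <= ennreal (S * q)" for n x
  using K_sup_bound[OF S(1) Kf] S q by (simp add: sp ennreal_mult)
 have enn_fin: "ennreal (enn2real a) = a" if "a <= ennreal b" for a b
  using that by (metis ennreal_enn2real_if ennreal_neq_top top_unique)
 define p where "p n x = enn2real (K (K (?f n)) x)" for n x
 have p: "ennreal (p n x) = K (K (?f n)) x" "0 <= p n x" "p n x <= S * q" for n x
  using KKf[of n x] S q enn_fin by (auto simp: p_def intro!: enn2real_leI)
 have [measurable]: "p n \<in> borel_measurable M" for n unfolding p_def[abs_def] by measurable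
 obtain s where s: "strict_mono s" and lim: "!!x. EX l. (%n. p (s n) x) \<longlonglongrightarrow> l"
  using compact[of "%n. K (?f n)" q] Kf unfolding p_def by auto
 define h where "h x = lim (%n. p (s n) x)" for x
 have h: "(%n. p (s n) x) \<longlonglongrightarrow> h x" for x using lim unfolding h_def by (metis limI)
 have [measurable]: "h \<in> borel_measurable M" by (rule borel_measurable_LIMSEQ_real[OF h]) auto
 have h0: "h x >= 0" and hb: "h x <= S * q" for x
  by (rule LIMSEQ_le_const[OF h], use p in auto) (rule LIMSEQ_le_const2[OF h], use p in auto)
 have X: "(\<integral>\<^sup>+x. ennreal ((p n x - f n x)^2) \<partial>M) <= ennreal (2 / real (Suc n))" (is "?X <= _") for n
 proof -
  have "?X + 2 * N (K (?f n)) = ?X + 2 * (\<integral>\<^sup>+x. ennreal (p n x) * ennreal (f n x) \<partial>M)"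
   using K_symmetric[of "K (?f n)" "?f n"] by (simp add: p(1) N_def power2_eq_square)
  also have "... = ?X + (\<integral>\<^sup>+x. ennreal (2 * (p n x * f n x)) \<partial>M)"
   using p f0 by (subst nn_integral_cmult[symmetric]) (auto simp: ennreal_mult'')
  also have "... = (\<integral>\<^sup>+x. ennreal ((p n x - f n x)^2) + ennreal (2 * (p n x * f n x)) \<partial>M)"
   by (rule nn_integral_add[symmetric]) measurable
  also have "... = (\<integral>\<^sup>+x. (ennreal (p n x))\<^sup>2 + (ennreal (f n x))^2 \<partial>M)"
  proof (intro nn_integral_cong)
   fix x
   have "(p n x - f n x)^2 + 2 * (p n x * f n x) = (p n x)^2 + (f n x)^2" by (simp add: power2_eq_square algebra_simps)
   then show "ennreal ((p n x - f n x)^2) + ennreal (2 * (p n x * f n x)) = (ennreal (p n x))^2 + (ennreal (f n x))^2"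
    using p(2) f0 by (simp add: ennreal_power flip: ennreal_plus)
  qed
  also have "... = N (K (K (?f n))) + N (?f n)"
   unfolding N_def p(1) by (rule nn_integral_add) measurable
  also have "... <= 1 + 1"
  proof (intro add_mono Nf)
   have fin: "N (?f n) < \<infinity>" using Nf[of n] by (simp add: le_less_trans)
   have a: "N (K (?f n)) <= 1" using opnorm2_bound[of "?f n"] fin Nf[of n] by (simp add: one)
   then have "N (K (?f n)) < \<infinity>" by (simp add: le_less_trans)
   then have "N (K (K (?f n))) <= N (K (?f n))" using opnorm2_bound[of "K (?f n)"] by (simp add: one)
   with a show "N (K (K (?f n))) <= 1" by simp
  qed
  finally have le: "?X + 2 * N (K (?f n)) <= 2" by simp
  have "?X + ennreal (2 - 2 / real (Suc n)) <= ?X + 2 * N (K (?f n))"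
  proof (intro add_left_mono)
   have "ennreal (2 - 2 / real (Suc n)) = 2 * ennreal (1 - 1 / real (Suc n))"
    by (subst ennreal_numeral[symmetric], subst ennreal_mult'[symmetric]) (auto simp: algebra_simps)
   also have "... <= 2 * N (K (?f n))" by (intro mult_left_mono NKf) auto
   finally show "ennreal (2 - 2 / real (Suc n)) <= 2 * N (K (?f n))" .
  qed
  from order.trans[OF this le] have le2: "?X + ennreal (2 - 2 / real (Suc n)) <= ennreal 2" by simp
  then have "?X ~= top" by (auto simp: top_unique)
  then obtain r where r: "?X = ennreal r" "r >= 0" by (cases ?X) auto
  have "0 <= 2 - 2 / real (Suc n)" by (simp add: divide_le_eq)
  with r have "ennreal (r + (2 - 2 / real (Suc n))) = ?X + ennreal (2 - 2 / real (Suc n))"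
   by (simp only: ennreal_plus)
  with le2 have "ennreal (r + (2 - 2 / real (Suc n))) <= ennreal 2" by simp
  then have "r + (2 - 2 / real (Suc n)) <= 2" by (subst (asm) ennreal_le_iff) auto
  then show ?thesis using r by (intro order.trans[OF eq_refl ennreal_leI]) auto
 qed
 have Y: "(%n. \<integral>\<^sup>+x. ennreal ((p (s n) x - h x)^2) \<partial>M) \<longlonglongrightarrow> (\<integral>\<^sup>+x. 0 \<partial>M)"
 proof (rule nn_integral_dominated_convergence[where w="%x. ennreal ((S * q)^2)"])
  show "(\<integral>\<^sup>+x. ennreal ((S * q)^2) \<partial>M) < \<infinity>"
   using finM by (simp add: sp ennreal_mult_less_top)
  show "AE x in M. ennreal ((p (s n) x - h x)^2) <= ennreal ((S * q)^2)" for n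
  proof (intro AE_I2 ennreal_leI)
   fix x
   have "\<bar>p (s n) x - h x\<bar> <= S * q" using p(2,3)[of "s n" x] h0[of x] hb[of x] by linarith
   then show "(p (s n) x - h x)^2 <= (S * q)^2" by (metis abs_le_square_iff abs_of_nonneg S(2) q mult_nonneg_nonneg)
  qed
  show "AE x in M. (%n. ennreal ((p (s n) x - h x)^2)) \<longlonglongrightarrow> 0"
  proof (rule AE_I2)
   fix x
   have "(%n. (p (s n) x - h x)\<^sup>2) \<longlonglongrightarrow> (h x - h x)\<^sup>2" by (intro tendsto_intros h)
   then show "(%n. ennreal ((p (s n) x - h x)^2)) \<longlonglongrightarrow> 0"
    using tendsto_ennrealI by fastforce
  qed
 qed auto
 define Z where "Z n = (\<integral>\<^sup>+x. ennreal ((f (s n) x - h x)^2) \<partial>M)" for n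
 have Zle: "Z n <= 2 * ennreal (2 / real (Suc (s n))) + 2 * (\<integral>\<^sup>+x. ennreal ((p (s n) x - h x)^2) \<partial>M)" for n
 proof -
  have "Z n <= (\<integral>\<^sup>+x. 2 * ennreal ((p (s n) x - f (s n) x)^2) + 2 * ennreal ((p (s n) x - h x)^2) \<partial>M)"
   unfolding Z_def
  proof (intro nn_integral_mono)
   fix x
   have "(f (s n) x - h x)^2 <= 2 * (p (s n) x - f (s n) x)^2 + 2 * (p (s n) x - h x)^2"
    using sum_squares_ge_zero[of "p (s n) x - f (s n) x + (p (s n) x - h x)" 0] by (simp add: power2_eq_square algebra_simps)
   then have "ennreal ((f (s n) x - h x)^2) <= ennreal (2 * (p (s n) x - f (s n) x)^2 + 2 * (p (s n) x - h x)^2)" by (rule ennreal_leI)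
   then show "ennreal ((f (s n) x - h x)^2) <= 2 * ennreal ((p (s n) x - f (s n) x)^2) + 2 * ennreal ((p (s n) x - h x)^2)"
    by (simp add: ennreal_mult')
  qed
  also have "... = 2 * (\<integral>\<^sup>+x. ennreal ((p (s n) x - f (s n) x)^2) \<partial>M) + 2 * (\<integral>\<^sup>+x. ennreal ((p (s n) x - h x)^2) \<partial>M)"
   by (simp add: nn_integral_add nn_integral_cmult)
  also have "... <= 2 * ennreal (2 / real (Suc (s n))) + 2 * (\<integral>\<^sup>+x. ennreal ((p (s n) x - h x)^2) \<partial>M)"
   by (intro add_mono mult_left_mono X) auto
  finally show ?thesis .
 qed
 have "(%n. 2 / real (Suc n)) \<longlonglongrightarrow> 0"
  using tendsto_mult_right_zero[OF LIMSEQ_Suc[OF lim_1_over_n], of 2] by simp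
 then have "(%n. 2 / real (Suc (s n))) \<longlonglongrightarrow> 0"
  using LIMSEQ_subseq_LIMSEQ[OF _ s] by (fastforce simp: o_def)
 then have "(%n. ennreal (2 / real (Suc (s n)))) \<longlonglongrightarrow> 0" using tendsto_ennrealI by fastforce
 then have *: "(%n. 2 * ennreal (2 / real (Suc (s n))) + 2 * (\<integral>\<^sup>+x. ennreal ((p (s n) x - h x)^2) \<partial>M)) \<longlonglongrightarrow> 2 * 0 + 2 * (\<integral>\<^sup>+x. 0 \<partial>M)"
  by (intro tendsto_add ennreal_tendsto_cmult Y) auto
 have lim0: "(%n. 2 * ennreal (2 / real (Suc (s n))) + 2 * (\<integral>\<^sup>+x. ennreal ((p (s n) x - h x)^2) \<partial>M)) \<longlonglongrightarrow> 0"
 proof -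
  have "2 * 0 + 2 * (\<integral>\<^sup>+x. 0 \<partial>M) = (0 :: ennreal)" by simp
  then show ?thesis using * by (simp only:)
 qed
 have Z0: "Z \<longlonglongrightarrow> 0"
  by (rule tendsto_sandwich[OF _ _ tendsto_const lim0]) (intro always_eventually allI Zle zero_le)+
 have h_eq: "K (K (%y. ennreal (h y))) x = ennreal (h x)" for x
 proof -
  define d where "d n y = ennreal \<bar>f (s n) y - h y\<bar>" for n y
  have [measurable]: "d n \<in> borel_measurable M" for n unfolding d_def[abs_def] by measurable
  have Nd: "N (d n) = Z n" for n unfolding N_def Z_def d_def by (simp add: ennreal_power)
  define \<zeta> where "\<zeta> n = S * sqrt (Q * enn2real (Z n))" for n
  have "(%n. enn2real (Z n)) \<longlonglongrightarrow> 0" by (rule tendsto_enn2real) (use Z0 in simp_all)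
  then have "\<zeta> \<longlonglongrightarrow> S * sqrt (Q * 0)" unfolding \<zeta>_def by (intro tendsto_mult tendsto_const tendsto_real_sqrt)
  then have \<zeta>0: "(%n. ennreal (\<zeta> n)) \<longlonglongrightarrow> 0" using tendsto_ennrealI by fastforce
  have ev: "\<forall>\<^sub>F n in sequentially. K (K (d n)) x <= ennreal (\<zeta> n)"
  proof -
   have "\<forall>\<^sub>F n in sequentially. Z n < top" using order_tendstoD(2)[OF Z0, of top] by simp
   then show ?thesis
   proof eventually_elim
   fix n assume fin: "Z n < top"
   have "K (d n) y <= ennreal (sqrt (Q * enn2real (Z n)))" for y
    by (rule b1) (use fin Nd in auto)
   from K_sup_bound[OF S(1) this] show "K (K (d n)) x <= ennreal (\<zeta> n)"
    using S by (simp add: \<zeta>_def sp ennreal_mult')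
   qed
  qed
  have split: "K (K u) x <= K (K w) x + K (K (d n)) x"
   if [measurable]: "u \<in> borel_measurable M" "w \<in> borel_measurable M" and le: "!!y. u y <= w y + d n y" for u w n
  proof -
   have 1: "K u y <= K w y + K (d n) y" for y
   proof -
    have "K u y <= K (%y. w y + d n y) y" by (rule K_mono, rule le)
    then show ?thesis by (simp add: K_add sp)
   qed
   have "K (K u) x <= K (%y. K w y + K (d n) y) x" by (rule K_mono, rule 1)
   then show ?thesis by (simp add: K_add sp)
  qed
  have hf: "ennreal (h y) <= ennreal (f (s n) y) + d n y" "ennreal (f (s n) y) <= ennreal (h y) + d n y" for n y
   unfolding d_def using h0 f0 by (auto simp: simp flip: ennreal_plus intro!: ennreal_leI)
  have ph: "(%n. ennreal (p (s n) x)) \<longlonglongrightarrow> ennreal (h x)" by (intro tendsto_ennrealI h)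
  show ?thesis
  proof (rule antisym)
   have "(%n. ennreal (p (s n) x) + ennreal (\<zeta> n)) \<longlonglongrightarrow> ennreal (h x) + 0" by (intro tendsto_add ph \<zeta>0)
   moreover have "\<forall>\<^sub>F n in sequentially. K (K (%y. ennreal (h y))) x <= ennreal (p (s n) x) + ennreal (\<zeta> n)"
    using ev by eventually_elim (use split[OF _ _ hf(1)] in \<open>auto simp: p(1) intro: order.trans add_left_mono\<close>)
   ultimately show "K (K (%y. ennreal (h y))) x <= ennreal (h x)"
    using tendsto_lowerbound by fastforce
   have "(%n. K (K (%y. ennreal (h y))) x + ennreal (\<zeta> n)) \<longlonglongrightarrow> K (K (%y. ennreal (h y))) x + 0" by (intro tendsto_add tendsto_const \<zeta>0)
   moreover have "\<forall>\<^sub>F n in sequentially. ennreal (p (s n) x) <= K (K (%y. ennreal (h y))) x + ennreal (\<zeta> n)"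
    using ev by eventually_elim (use split[OF _ _ hf(2)] in \<open>auto simp: p(1) intro: order.trans add_left_mono\<close>)
   ultimately show "ennreal (h x) <= K (K (%y. ennreal (h y))) x"
    using tendsto_le[OF _ _ ph] by fastforce
  qed
 qed
 have nz: "\<not> (AE x in M. h x = 0)"
 proof
  assume h0: "AE x in M. h x = 0"
  have ZN: "Z n = N (?f (s n))" for n
   unfolding Z_def N_def using h0 by (intro nn_integral_cong_AE) (auto simp: ennreal_power f0)
  have "\<forall>\<^sub>F n in sequentially. Z n < ennreal (1 / 2)" by (rule order_tendstoD(2)[OF Z0]) (subst ennreal_less_zero_iff, simp)
  from eventually_happens'[OF sequentially_bot eventually_conj[OF this eventually_ge_at_top[of 1]]]
  obtain n where n: "Z n < ennreal (1 / 2)" "n >= 1" by blast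
  have "s n >= 1" using seq_suble[OF s, of n] n by simp
  then have "ennreal (1 / 2) <= ennreal (1 - 1 / real (Suc (s n)))" by (intro ennreal_leI) (simp add: field_simps)
  also have "... <= N (K (?f (s n)))" by (rule NKf)
  also have "... <= Z n"
  proof -
   have "Z n < \<infinity>" using n(1) by (rule less_trans) (simp only: infinity_ennreal_def ennreal_less_top)
   then show ?thesis using opnorm2_bound[of "?f (s n)"] by (simp add: ZN one)
  qed
  finally show False using n by simp
 qed
 have Kh: "K (%y. ennreal (h y)) x <= ennreal (S * (S * q))" for x
  using K_sup_bound[OF S(1) ennreal_leI[OF hb], of x] S q by (simp add: sp ennreal_mult)
 define \<phi> where "\<phi> x = h x + enn2real (K (%y. ennreal (h y)) x)" for x
 have e\<phi>: "ennreal (\<phi> x) = ennreal (h x) + K (%y. ennreal (h y)) x" for x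
  using enn_fin[OF Kh[of x]] h0[of x] by (simp add: \<phi>_def)
 show ?thesis
 proof
  show "\<phi> \<in> borel_measurable M" unfolding \<phi>_def[abs_def] by measurable
  show "0 <= \<phi> x" for x using h0[of x] by (simp add: \<phi>_def)
  show "\<phi> x <= S * q + S * (S * q)" for x
   unfolding \<phi>_def using hb[of x] Kh[of x] S q by (intro add_mono enn2real_leI) auto
  show "\<not> (AE x in M. \<phi> x = 0)"
  proof
   assume "AE x in M. \<phi> x = 0"
   then have "AE x in M. h x = 0"
   proof eventually_elim
    fix x assume "\<phi> x = 0"
    then show "h x = 0" using h0[of x] enn2real_nonneg[of "K (%y. ennreal (h y)) x"] unfolding \<phi>_def by linarith
   qed
   with nz show False by blast
  qed
  fix x
  have "K (%y. ennreal (\<phi> y)) x = K (%y. ennreal (h y)) x + K (K (%y. ennreal (h y))) x"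
   unfolding e\<phi> by (rule K_add) (auto simp: sp)
  then show "K (%y. ennreal (\<phi> y)) x = ennreal (\<phi> x)" unfolding e\<phi> h_eq by (simp add: add.commute)
 qed
qed

end

section \<open>The ground state\<close>

text \<open>Arzela-Ascoli on the whole plane, with pointwise convergence, which suffices together with dominated convergence.\<close>
lemma equi_Lipschitz_subsequence:
 fixes F :: "nat => 'a::euclidean_space => real"
 assumes b: "!!n x. \<bar>F n x\<bar> <= B" and lip: "!!n x y. \<bar>F n x - F n y\<bar> <= L * norm (x - y)"
 shows "EX s. strict_mono s & (ALL x. EX l. (%n. F (s n) x) \<longlonglongrightarrow> l)"
proof -
 obtain D :: "'a set" where D: "countable D" "!!X. open X ==> X ~= {} ==> EX d:D. d \<in> X"
  using countable_dense_exists by metis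
 obtain s :: "nat => nat" where s: "strict_mono s" "!!x. x \<in> D ==> EX l. (%n. F (s n) x) \<longlonglongrightarrow> l"
  by (rule function_convergent_subsequence[OF D(1), of F B]) (use b in auto)
 have L: "L >= 0"
 proof -
  obtain e :: 'a where "e \<in> Basis" using nonempty_Basis by blast
  then show ?thesis using lip[of 0 e 0] by (smt (verit) diff_zero norm_Basis mult_cancel_left2 abs_ge_zero)
 qed
 have "Cauchy (%n. F (s n) x)" for x
  unfolding Cauchy_def
 proof (intro allI impI)
  fix e :: real assume e: "e > 0"
  have "ball x (e / (3 * (L + 1))) ~= {}" using e L by (simp add: not_le divide_pos_pos add_nonneg_pos)
  then obtain d where d: "d \<in> D" "d \<in> ball x (e / (3 * (L + 1)))" using D(2)[OF open_ball] by blast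
  have near: "\<bar>F n x - F n d\<bar> < e / 3" for n
  proof -
   have "\<bar>F n x - F n d\<bar> <= L * norm (x - d)" by (rule lip)
   also have "... <= (L + 1) * norm (x - d)" by (rule mult_right_mono) auto
   also have "... < (L + 1) * (e / (3 * (L + 1)))" using d L by (intro mult_strict_left_mono) (auto simp: dist_norm)
   also have "... = e / 3" using L by (simp add: field_simps)
   finally show ?thesis .
  qed
  have "Cauchy (%n. F (s n) d)" using s(2)[OF d(1)] LIMSEQ_imp_Cauchy by blast
  then obtain M where M: "!!m n. m >= M ==> n >= M ==> dist (F (s m) d) (F (s n) d) < e / 3"
   unfolding Cauchy_def using e by (metis zero_less_divide_iff zero_less_numeral)
  show "EX M. ALL m>=M. ALL n>=M. dist (F (s m) x) (F (s n) x) < e"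
  proof (intro exI allI impI)
   fix m n assume "m >= M" "n >= M"
   then show "dist (F (s m) x) (F (s n) x) < e"
    using M[of m n] near[of "s m"] near[of "s n"] unfolding dist_real_def by linarith
  qed
 qed
 then show ?thesis using s(1) by (meson Cauchy_convergent convergent_def)
qed

lemma nn_integral_sum_sq_le:
 assumes [measurable]: "f \<in> borel_measurable M" "g \<in> borel_measurable M"
  and f: "(\<integral>\<^sup>+x. (f x)\<^sup>2 \<partial>M) <= ennreal (a^2)" and g: "(\<integral>\<^sup>+x. (g x)\<^sup>2 \<partial>M) <= ennreal (b^2)" and ab: "a >= 0" "b >= 0"
 shows "(\<integral>\<^sup>+x. (f x + g x)\<^sup>2 \<partial>M) <= ennreal ((a + b)^2)"
proof -
 have "(\<integral>\<^sup>+x. f x * g x \<partial>M)^2 <= (\<integral>\<^sup>+x. (f x)\<^sup>2 \<partial>M) * (\<integral>\<^sup>+x. (g x)\<^sup>2 \<partial>M)"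
  by (rule Cauchy_Schwarz_nn_integral) measurable
 also have "... <= ennreal (a^2) * ennreal (b^2)" by (intro mult_mono f g) auto
 also have "... = (ennreal (a * b))^2" using ab by (simp add: ennreal_power ennreal_mult power_mult_distrib)
 finally have fg: "(\<integral>\<^sup>+x. f x * g x \<partial>M) <= ennreal (a * b)" by (rule ennreal_le_of_sq_le) (use ab in simp)
 have "(\<integral>\<^sup>+x. (f x + g x)\<^sup>2 \<partial>M) = (\<integral>\<^sup>+x. ((f x)^2 + (g x)^2) + 2 * (f x * g x) \<partial>M)"
  unfolding mult_2 power2_eq_square
  by (intro nn_integral_cong) (simp add: distrib_left distrib_right mult.commute add_ac)
 also have "... = ((\<integral>\<^sup>+x. (f x)\<^sup>2 \<partial>M) + (\<integral>\<^sup>+x. (g x)\<^sup>2 \<partial>M)) + 2 * (\<integral>\<^sup>+x. f x * g x \<partial>M)"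
  by (subst nn_integral_add, measurable, subst nn_integral_add, measurable, subst nn_integral_cmult, measurable)
 also have "... <= (ennreal (a^2) + ennreal (b^2)) + ennreal 2 * ennreal (a * b)"
  using f g fg by (intro add_mono mult_mono) auto
 also have "... = ennreal ((a + b)^2)"
 proof -
  have "(ennreal (a^2) + ennreal (b^2)) + ennreal 2 * ennreal (a * b) = ennreal ((a^2 + b^2) + 2 * (a * b))"
   using ab by (simp only: ennreal_mult[symmetric] ennreal_plus[symmetric] zero_le_power2 add_nonneg_nonneg mult_nonneg_nonneg zero_le_numeral)
  also have "(a^2 + b^2) + 2 * (a * b) = (a + b)^2" by (simp add: power2_eq_square algebra_simps)
  finally show ?thesis .
 qed
 finally show ?thesis .
qed

text \<open>Birman-Schwinger principle. The equation \<open>\<sigma>\<^sup>2 \<phi> - \<Delta>\<phi> = V \<phi>\<close> means that \<open>\<phi>\<close> is fixed by the operator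
 with the Green function as kernel on \<open>L\<^sup>2(V dx)\<close>. Its norm is continuous in \<open>\<sigma>\<close>, at most
 \<open>Vm/\<sigma>\<^sup>2\<close>, and by the logarithmic lower bound it is large for small \<open>\<sigma>\<close>. So it equals 1 for some
 \<open>\<sigma>\<close>, and the norm is attained because bounded functions have equi-Lipschitz images.\<close>
lemma ground_state_exists:
 fixes V :: "real^2 => real"
 assumes V: "continuous_on UNIV V" "!!x. V x > 0" "!!x. V x <= Vm" and Vint: "integrable lborel V"
 obtains \<sigma> \<phi> B L where "\<sigma> > 0" "!!x. 0 <= \<phi> x" "!!x. \<phi> x <= B" "!!x y. \<bar>\<phi> x - \<phi> y\<bar> <= L * norm (x - y)"
  "\<not> (AE x in lborel. \<phi> x = 0)" "integrable lborel \<phi>"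
  "!!x. ennreal (\<phi> x) = (LNN y. resolvent_kernel \<sigma> (x - y) * ennreal (V y * \<phi> y))"
proof -
 note [measurable] = borel_measurable_continuous_onI[OF V(1)]
 have V0: "V x >= 0" for x using V(2)[of x] by simp
 have Vm: "Vm > 0" using V(2,3)[of 0] by simp
 define M where "M = density lborel (%x. ennreal (V x))"
 have [measurable_cong]: "sets M = sets borel" by (simp add: M_def)
 have spM: "space M = UNIV" by (simp add: M_def)
 have nnM: "(\<integral>\<^sup>+x. f x \<partial>M) = (LNN x. f x * ennreal (V x))" if [measurable]: "f \<in> borel_measurable borel" for f
  unfolding M_def by (subst nn_integral_density) (auto simp: mult.commute)
 have nnM_le: "(\<integral>\<^sup>+x. f x \<partial>M) <= (LNN x. f x) * ennreal Vm" if [measurable]: "f \<in> borel_measurable borel" for f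
 proof -
  have "(LNN x. f x * ennreal (V x)) <= (LNN x. f x * ennreal Vm)"
   by (intro nn_integral_mono mult_left_mono ennreal_leI V) auto
  then show ?thesis by (subst nnM) (simp_all add: nn_integral_multc)
 qed
 define m where "m = (LBINT x. V x)"
 have mM: "emeasure M UNIV = ennreal m"
  using nnM[of "%_. 1"] nn_integral_eq_integral[OF Vint] V0 spM by (simp add: m_def)
 interpret FM: finite_measure M by standard (simp add: mM spM)
 have PK: "positive_kernel M (%x y. mixture \<omega> (x - y))" if [measurable]: "\<omega> \<in> borel_measurable borel" for \<omega>
 proof unfold_locales
  show "(%(x, y). mixture \<omega> (x - y)) \<in> borel_measurable (M \<Otimes>\<^sub>M M)" by measurable
  show "mixture \<omega> (x - y) = mixture \<omega> (y - x)" for x y using mixture_minus[of \<omega> "x - y"] by simp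
 qed
 have PKr: "positive_kernel M (%x y. resolvent_kernel \<sigma> (x - y))" for \<sigma>
  using PK[of "rweight \<sigma>"] by (simp add: resolvent_kernel_def)
 define Lam where "Lam \<sigma> = positive_kernel.opnorm2 M (%x y. resolvent_kernel \<sigma> (x - y))" for \<sigma>
 define K where "K \<sigma> = positive_kernel.K M (%x y. resolvent_kernel \<sigma> (x - y))" for \<sigma>
 define N where "N = positive_kernel.N M"
 note NL = N_def and KL = K_def
 have N: "N f = (\<integral>\<^sup>+x. (f x)\<^sup>2 \<partial>M)" for f unfolding N_def using positive_kernel.N_def[OF PKr] by simp
 have K: "K \<sigma> f x = (\<integral>\<^sup>+y. resolvent_kernel \<sigma> (x - y) * f y \<partial>M)" for \<sigma> f x
  unfolding K_def using positive_kernel.K_def[OF PKr] by simp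
 have S: "(\<integral>\<^sup>+y. mixture \<omega> (x - y) \<partial>M) <= ennreal (c * Vm)"
  if [measurable]: "\<omega> \<in> borel_measurable borel" and "!!r. r > 0 ==> \<omega> r >= 0" "half_integral \<omega> = ennreal c" "c >= 0" for \<omega> c x
  using nnM_le[of "%y. mixture \<omega> (x - y)"] mixture_L1[of \<omega> x] that Vm by (simp add: ennreal_mult)
 have Sr: "(\<integral>\<^sup>+y. resolvent_kernel \<sigma> (x - y) \<partial>M) <= ennreal (1 / \<sigma>^2 * Vm)" if "\<sigma> > 0" for \<sigma> x
  unfolding resolvent_kernel_def
  by (rule S) (use that half_integral_rweight[OF that] in \<open>auto simp: rweight_nonneg\<close>)
 have Lam_le: "Lam \<sigma> <= ennreal ((1 / \<sigma>^2 * Vm)^2)" if s: "\<sigma> > 0" for \<sigma>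
 proof -
  interpret positive_kernel M "%x y. resolvent_kernel \<sigma> (x - y)" by (rule PKr)
  show ?thesis unfolding Lam_def opnorm2_def
  proof (rule SUP_least)
   fix f assume f: "f \<in> {f \<in> borel_measurable M. positive_kernel.N M f <= 1}"
   have "positive_kernel.N M (local.K f) <= (ennreal (1 / \<sigma>^2 * Vm))^2 * positive_kernel.N M f"
    by (rule schur_bound) (use f Sr[OF s] in auto)
   also have "... <= (ennreal (1 / \<sigma>^2 * Vm))^2 * 1" using f by (intro mult_left_mono) auto
   finally show "positive_kernel.N M (local.K f) <= ennreal ((1 / \<sigma>^2 * Vm)^2)"
    using Vm by (simp add: ennreal_power)
  qed
 qed
 define l where "l \<sigma> = sqrt (enn2real (Lam \<sigma>))" for \<sigma>
 have Lam_l: "Lam \<sigma> = ennreal ((l \<sigma>)^2)" "l \<sigma> >= 0" if s: "\<sigma> > 0" for \<sigma>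
  using Lam_le[OF s] by (auto simp: l_def ennreal_enn2real_if top_unique)
 have l_le: "l \<sigma> <= 1 / \<sigma>^2 * Vm" if s: "\<sigma> > 0" for \<sigma>
 proof -
  have "(l \<sigma>)^2 <= (1 / \<sigma>^2 * Vm)^2" using Lam_le[OF s] unfolding Lam_l(1)[OF s] by (subst (asm) ennreal_le_iff) auto
  then show ?thesis by (rule power2_le_imp_le) (use Vm in simp)
 qed
 have N_K_le: "N (K \<sigma> f) <= ennreal ((l \<sigma>)^2) * N f" if s: "\<sigma> > 0" and f: "f \<in> borel_measurable M" "N f < \<infinity>" for \<sigma> f
 proof -
  interpret positive_kernel M "%x y. resolvent_kernel \<sigma> (x - y)" by (rule PKr)
  show ?thesis
   using opnorm2_bound[OF f(1)] f(2) Lam_l[OF s] by (simp add: NL KL Lam_def)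
 qed
 have Lam_bound: "l \<sigma> <= c" if s: "\<sigma> > 0" and c: "c >= 0" and le: "!!f. f \<in> borel_measurable M ==> N f <= 1 ==> N (K \<sigma> f) <= ennreal (c^2)" for \<sigma> c
 proof -
  interpret positive_kernel M "%x y. resolvent_kernel \<sigma> (x - y)" by (rule PKr)
  have "Lam \<sigma> <= ennreal (c^2)" unfolding Lam_def opnorm2_def
   by (rule SUP_least) (use le in \<open>auto simp: NL KL\<close>)
  then have "(l \<sigma>)^2 <= c^2" using Lam_l[OF s] by simp
  then show ?thesis using c by (rule power2_le_imp_le)
 qed
 have meas: "K \<sigma> f \<in> borel_measurable M" if "f \<in> borel_measurable M" for \<sigma> f
  unfolding K_def using positive_kernel.K_meas[OF PKr that] .
 have mono: "l \<tau> <= l \<sigma>" and step: "l \<sigma> <= l \<tau> + Vm * (1 / \<sigma>^2 - 1 / \<tau>^2)" if st: "0 < \<sigma>" "\<sigma> <= \<tau>" for \<sigma> \<tau>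
 proof -
  have t: "\<tau> > 0" using st by simp
  define \<delta> where "\<delta> r = rweight \<sigma> r - rweight \<tau> r" for r
  have [measurable]: "\<delta> \<in> borel_measurable borel" unfolding \<delta>_def[abs_def] by measurable
  note dif = resolvent_kernel_diff[OF st, folded \<delta>_def]
  have le2: "1 / \<tau>^2 <= 1 / \<sigma>^2" using st by (intro divide_left_mono power_mono) auto
  show "l \<tau> <= l \<sigma>"
  proof (rule Lam_bound[OF t])
   show "0 <= l \<sigma>" by (rule Lam_l[OF st(1)])
   fix f assume f[measurable]: "f \<in> borel_measurable M" and f1: "N f <= 1"
   have "N (K \<tau> f) <= N (K \<sigma> f)"
    unfolding N K using dif(1) by (intro nn_integral_mono power_mono mult_right_mono) auto
   also have "... <= ennreal ((l \<sigma>)^2) * N f" by (rule N_K_le[OF st(1) f]) (use f1 in \<open>simp add: le_less_trans\<close>)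
   also have "... <= ennreal ((l \<sigma>)^2) * 1" by (intro mult_left_mono f1) auto
   finally show "N (K \<tau> f) <= ennreal ((l \<sigma>)^2)" by simp
  qed
  interpret D: positive_kernel M "%x y. mixture \<delta> (x - y)" by (rule PK) measurable
  show "l \<sigma> <= l \<tau> + Vm * (1 / \<sigma>^2 - 1 / \<tau>^2)"
  proof (rule Lam_bound[OF st(1)])
   let ?d = "(1 / \<sigma>^2 - 1 / \<tau>^2) * Vm"
   have d0: "?d >= 0" using le2 Vm by simp
   show "0 <= l \<tau> + Vm * (1 / \<sigma>^2 - 1 / \<tau>^2)" using d0 Lam_l(2)[OF t] by (simp add: mult.commute)
   fix f assume f[measurable]: "f \<in> borel_measurable M" and f1: "N f <= 1"
   have "N (K \<sigma> f) = (\<integral>\<^sup>+x. (K \<tau> f x + D.K f x)\<^sup>2 \<partial>M)"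
   proof -
    have "K \<sigma> f x = K \<tau> f x + D.K f x" for x
     unfolding K D.K_def dif(1) by (simp add: distrib_right nn_integral_add)
    then show ?thesis by (simp add: N)
   qed
   also have "... <= ennreal ((l \<tau> + ?d)^2)"
   proof (rule nn_integral_sum_sq_le)
    show "K \<tau> f \<in> borel_measurable M" by (rule meas[OF f])
    show "D.K f \<in> borel_measurable M" by measurable
    have "N (K \<tau> f) <= ennreal ((l \<tau>)^2) * N f" by (rule N_K_le[OF t f]) (use f1 in \<open>simp add: le_less_trans\<close>)
    also have "... <= ennreal ((l \<tau>)^2) * 1" by (intro mult_left_mono f1) auto
    finally show "(\<integral>\<^sup>+x. (K \<tau> f x)\<^sup>2 \<partial>M) <= ennreal ((l \<tau>)^2)" by (simp add: N)
    have "D.N (D.K f) <= (ennreal ?d)^2 * D.N f"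
     by (rule D.schur_bound[OF _ f], rule S) (use dif le2 in auto)
    also have "... <= (ennreal ?d)^2 * 1" using f1 by (intro mult_left_mono) (auto simp: N D.N_def)
    finally show "(\<integral>\<^sup>+x. (D.K f x)\<^sup>2 \<partial>M) <= ennreal (?d\<^sup>2)" using d0 by (simp add: D.N_def ennreal_power)
   qed (use d0 Lam_l(2)[OF t] in auto)
   finally show "N (K \<sigma> f) <= ennreal ((l \<tau> + Vm * (1 / \<sigma>^2 - 1 / \<tau>^2))^2)" by (simp add: mult.commute)
  qed
 qed
 have cont: "continuous_on {0<..} l"
  unfolding continuous_on_def
 proof
  fix \<sigma> :: real assume "\<sigma> \<in> {0<..}"
  then have s: "\<sigma> > 0" by simp
  have "((%\<tau>. Vm * \<bar>1 / \<sigma>^2 - 1 / \<tau>^2\<bar>) \<longlongrightarrow> Vm * \<bar>1 / \<sigma>^2 - 1 / \<sigma>^2\<bar>) (at \<sigma> within {0<..})"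
   using s by (intro tendsto_intros) auto
  then have "((%\<tau>. Vm * \<bar>1 / \<sigma>^2 - 1 / \<tau>^2\<bar>) \<longlongrightarrow> 0) (at \<sigma> within {0<..})" by simp
  moreover have "\<forall>\<^sub>F \<tau> in at \<sigma> within {0<..}. norm (l \<tau> - l \<sigma>) <= Vm * \<bar>1 / \<sigma>^2 - 1 / \<tau>^2\<bar>"
   unfolding eventually_at_filter
  proof (intro always_eventually allI impI)
   fix \<tau> :: real assume "\<tau> \<in> {0<..}"
   then have t: "\<tau> > 0" by simp
   consider "\<sigma> <= \<tau>" | "\<tau> <= \<sigma>" by linarith
   then show "norm (l \<tau> - l \<sigma>) <= Vm * \<bar>1 / \<sigma>^2 - 1 / \<tau>^2\<bar>"
   proof cases
    case 1
    then have "1 / \<tau>^2 <= 1 / \<sigma>^2" using s by (intro divide_left_mono power_mono) auto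
    then have eq: "\<bar>1 / \<sigma>^2 - 1 / \<tau>^2\<bar> = 1 / \<sigma>^2 - 1 / \<tau>^2" by linarith
    then show ?thesis using mono[OF s 1] step[OF s 1] unfolding real_norm_def eq by linarith
   next
    case 2
    then have "1 / \<sigma>^2 <= 1 / \<tau>^2" using t by (intro divide_left_mono power_mono) auto
    then have eq: "\<bar>1 / \<sigma>^2 - 1 / \<tau>^2\<bar> = 1 / \<tau>^2 - 1 / \<sigma>^2" by linarith
    then show ?thesis using mono[OF t 2] step[OF t 2] unfolding real_norm_def eq by linarith
   qed
  qed
  ultimately have "((%\<tau>. l \<tau> - l \<sigma>) \<longlongrightarrow> 0) (at \<sigma> within {0<..})"
   by (rule Lim_null_comparison[rotated])
  then show "(l \<longlongrightarrow> l \<sigma>) (at \<sigma> within {0<..})" by (simp add: LIM_zero_iff)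
 qed
 define m0 where "m0 = measure M (ball 0 1)"
 have m0: "m0 > 0"
 proof -
  have "compact (cball (0::real^2) 1)" by simp
  then obtain x0 where x0: "x0 \<in> cball 0 1" "!!x. x \<in> cball 0 1 ==> V x0 <= V x"
   using continuous_attains_inf[OF _ _ continuous_on_subset[OF V(1)], of "cball 0 1"] by auto
  have "0 < ennreal (V x0) * emeasure lborel (ball (0::real^2) 1)"
  proof -
   have "0 < emeasure lborel (ball (0::real^2) 1)"
    using content_ball_pos[of 1 "0::real^2"] emeasure_lborel_ball_finite[of "0::real^2" 1]
    by (auto simp: measure_completion measure_def enn2real_positive_iff)
   then show ?thesis using V(2)[of x0] by (simp add: ennreal_zero_less_mult_iff)
  qed
  also have "... = (LNN x. ennreal (V x0) * indicator (ball (0::real^2) 1) x)"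
   by (subst nn_integral_cmult_indicator) auto
  also have "... <= (LNN x. indicator (ball 0 1) x * ennreal (V x))"
   by (intro nn_integral_mono) (auto simp: indicator_def intro!: ennreal_leI x0)
  also have "... = emeasure M (ball 0 1)"
   using nnM[of "indicator (ball 0 1)", OF borel_measurable_indicator] by simp
  finally show ?thesis by (simp add: m0_def FM.emeasure_eq_measure)
 qed
 have m: "m > 0"
 proof -
  have "m0 <= measure M UNIV" unfolding m0_def using spM by (metis FM.bounded_measure)
  also have "measure M UNIV = m" unfolding measure_def mM using Vint V0 by (simp add: m_def integral_ge_0)
  finally show ?thesis using m0 by simp
 qed
 define c where "c = exp (- 1 / 2) * exp (- 2\<^sup>2 / 2) / (2 * pi)"
 have c: "c > 0" by (simp add: c_def)
 define q where "q = sqrt (m / m0 ^ 3) + 1"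
 have q: "q > 0" "q^2 >= m / m0 ^ 3" using m m0 by (auto simp: q_def power2_eq_square algebra_simps add_nonneg_pos)
 define s1 where "s1 = exp (- (q / c))"
 have s1: "0 < s1" "s1 < 1" using q c by (auto simp: s1_def)
 have "l s1 >= 1"
 proof -
  have low: "resolvent_kernel s1 x >= ennreal q" if "norm x <= 2" for x
   using resolvent_kernel_lower_bound[OF s1 that] c unfolding c_def[symmetric] by (simp add: s1_def ln_div)
  have K1: "K s1 (%_. 1) x >= ennreal (q * m0)" if x: "x \<in> ball 0 1" for x
  proof -
   have "ennreal (q * m0) = (\<integral>\<^sup>+y. ennreal q * indicator (ball 0 1) y \<partial>M)"
    using q by (simp add: nn_integral_cmult_indicator FM.emeasure_eq_measure m0_def ennreal_mult')
   also have "... <= K s1 (%_. 1) x" unfolding K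
   proof (intro nn_integral_mono)
    fix y
    have "norm (x - y) <= 2" if "y \<in> ball 0 1" using x that norm_triangle_ineq4[of x y] by simp
    then show "ennreal q * indicator (ball 0 1) y <= resolvent_kernel s1 (x - y) * 1"
     using low[of "x - y"] by (auto simp: indicator_def)
   qed
   finally show ?thesis .
  qed
  have "ennreal ((q * m0)^2 * m0) = (\<integral>\<^sup>+x. ennreal ((q * m0)^2) * indicator (ball 0 1) x \<partial>M)"
   by (simp add: nn_integral_cmult_indicator FM.emeasure_eq_measure m0_def ennreal_mult')
  also have "... <= N (K s1 (%_. 1))" unfolding N
  proof (intro nn_integral_mono)
   fix x
   show "ennreal ((q * m0)^2) * indicator (ball 0 1) x <= (K s1 (%_. 1) x)^2"
    using power_mono[OF K1[of x], of 2] q m0 by (auto simp: indicator_def ennreal_power)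
  qed
  also have "... <= ennreal ((l s1)^2) * N (%_. 1)"
   by (rule N_K_le[OF s1(1)]) (auto simp: N spM mM)
  also have "... = ennreal ((l s1)^2 * m)" using m by (simp add: N spM mM ennreal_mult')
  finally have "(q * m0)^2 * m0 <= (l s1)^2 * m" using m by (subst (asm) ennreal_le_iff) auto
  moreover have "m <= q^2 * m0 ^ 3" using q(2) m0 by (simp add: field_simps)
  then have "m <= (q * m0)^2 * m0" by (simp add: power_mult_distrib power2_eq_square power3_eq_cube mult_ac)
  ultimately have "1 * m <= (l s1)^2 * m" by simp
  then have "1 <= (l s1)^2" using m by (subst (asm) mult_le_cancel_right) auto
  then show ?thesis using power2_le_imp_le[of 1 "l s1"] Lam_l(2)[OF s1(1)] by simp
 qed
 define s2 where "s2 = max s1 (sqrt Vm)"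
 have s2: "s1 <= s2" "s2 > 0" "s2^2 >= Vm"
 proof -
  show "s1 <= s2" "s2 > 0" using s1 by (auto simp: s2_def)
  have "(sqrt Vm)^2 <= s2^2" using Vm by (intro power_mono) (auto simp: s2_def)
  then show "s2^2 >= Vm" using Vm by simp
 qed
 have "1 / s2^2 * Vm <= 1" using s2(2,3) by (simp add: divide_le_eq)
 then have "l s2 <= 1" using l_le[OF s2(2)] by linarith
 then obtain \<sigma> where \<sigma>: "s1 <= \<sigma>" "\<sigma> <= s2" "l \<sigma> = 1"
 proof -
  have "{s1..s2} \<subseteq> {0<..}" using s1(1) by auto
  from IVT2'[of l s2 1 s1, OF _ _ _ continuous_on_subset[OF cont this]] \<open>l s1 >= 1\<close> \<open>l s2 <= 1\<close> s2(1) that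
  show ?thesis by auto
 qed
 have s: "\<sigma> > 0" using \<sigma> s1 by simp
 interpret positive_kernel M "%x y. resolvent_kernel \<sigma> (x - y)" by (rule PKr)
 let ?L = "%C. C * Vm * (4 * exp (1/4)) * resolvent_const \<sigma>"
 have lip: "local.K g x <= local.K g x' + ennreal (?L C * norm (x - x'))"
  if [measurable]: "g \<in> borel_measurable M" and g: "!!x. g x <= ennreal C" and C: "C >= 0" for g C x x'
 proof -
  have f: "g x * ennreal (V x) <= ennreal (C * Vm)" for x
   using mult_mono[OF g[of x] ennreal_leI[OF V(3)[of x]]] C Vm by (simp add: ennreal_mult)
  have Kf: "local.K g x = (LNN y. mixture (rweight \<sigma>) (x - y) * (g y * ennreal (V y)))" for x
   unfolding positive_kernel.K_def[OF PKr] unfolding resolvent_kernel_def by (subst nnM) (auto simp: mult.assoc)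
  have "local.K g x <= local.K g x' + ennreal (C * Vm) * ennreal (4 * exp (1/4) * norm (x - x')) * half_integral (%r. rweight \<sigma> r / r)"
   unfolding Kf by (rule mixture_convolution_Lipschitz) (auto simp: f rweight_nonneg)
  also have "ennreal (C * Vm) * ennreal (4 * exp (1/4) * norm (x - x')) * half_integral (%r. rweight \<sigma> r / r)
   = ennreal (?L C * norm (x - x'))"
   using resolvent_const[OF s] C Vm by (simp add: mult_ac flip: ennreal_mult)
  finally show ?thesis .
 qed
 have fin: "local.K g x <= ennreal (1 / \<sigma>^2 * Vm * C)" if g: "!!x. g x <= ennreal C" and "C >= 0" for g C x
 proof -
  have "local.K g x <= ennreal (1 / \<sigma>^2 * Vm) * ennreal C"
   by (rule K_sup_bound[OF Sr[OF s]]) (auto simp: g spM)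
  also have "... = ennreal (1 / \<sigma>^2 * Vm * C)"
   by (rule ennreal_mult[symmetric]) (use Vm that in auto)
  finally show ?thesis .
 qed
 have real_lip: "\<bar>enn2real (local.K g x) - enn2real (local.K g x')\<bar> <= ?L C * norm (x - x')"
  if g: "g \<in> borel_measurable M" "!!x. g x <= ennreal C" and C: "C >= 0" for g C x x'
 proof -
  have L0: "?L C >= 0" using C Vm resolvent_const[OF s] by simp
  have fg: "local.K g z <= ennreal (1 / \<sigma>^2 * Vm * C)" for z by (rule fin) (use g C in auto)
  have lg: "local.K g z <= local.K g z' + ennreal (?L C * norm (z - z'))" for z z' by (rule lip) (use g C in auto)
  obtain a where a: "local.K g x = ennreal a" "a >= 0" using fg[of x] by (cases "local.K g x") (auto simp: top_unique)
  obtain b where b: "local.K g x' = ennreal b" "b >= 0" using fg[of x'] by (cases "local.K g x'") (auto simp: top_unique)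
  have "a <= b + ?L C * norm (x - x')" using lg[of x x'] a b L0 by (simp flip: ennreal_plus)
  moreover have "b <= a + ?L C * norm (x - x')" using lg[of x' x] a b L0 by (simp add: norm_minus_commute flip: ennreal_plus)
  ultimately show ?thesis using a b by simp
 qed
 obtain \<phi> B where \<phi>: "\<phi> \<in> borel_measurable M" "!!x. 0 <= \<phi> x" "!!x. \<phi> x <= B"
  "\<not> (AE x in M. \<phi> x = 0)" "!!x. local.K (%y. ennreal (\<phi> y)) x = ennreal (\<phi> x)"
 proof (rule fixed_point[of "1 / \<sigma>^2 * Vm" "(resolvent_const \<sigma>)^2 * Vm"])
  show "space M = UNIV" by (rule spM)
  show "emeasure M UNIV < \<infinity>" by (simp add: mM)
  show "integral\<^sup>N M (%y. resolvent_kernel \<sigma> (x - y)) <= ennreal (1 / \<sigma>^2 * Vm)" for x by (rule Sr[OF s])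
  show "0 <= 1 / \<sigma>^2 * Vm" "0 <= (resolvent_const \<sigma>)^2 * Vm" using Vm by auto
  show "(\<integral>\<^sup>+y. (resolvent_kernel \<sigma> (x - y))\<^sup>2 \<partial>M) <= ennreal ((resolvent_const \<sigma>)^2 * Vm)" for x
  proof -
   have "(\<integral>\<^sup>+y. (resolvent_kernel \<sigma> (x - y))\<^sup>2 \<partial>M) <= (LNN y. (resolvent_kernel \<sigma> (x - y))\<^sup>2) * ennreal Vm"
    by (rule nnM_le) measurable
   also have "... <= (ennreal (resolvent_const \<sigma>))^2 * ennreal Vm"
    unfolding resolvent_const(1)[OF s, symmetric] resolvent_kernel_def
    by (intro mult_right_mono mixture_L2) (auto simp: rweight_nonneg)
   finally show ?thesis using resolvent_const(2)[OF s] Vm by (simp add: ennreal_mult ennreal_power)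
  qed
  show "opnorm2 = 1" using Lam_l(1)[OF s] \<sigma>(3) by (simp add: Lam_def)
  fix g :: "nat => real^2 => ennreal" and C :: real
  assume g: "!!n. g n \<in> borel_measurable M" "!!n x. g n x <= ennreal C"
  have g': "g n x <= ennreal (max C 0)" for n x using g(2)[of n x] by (rule order.trans) (simp add: ennreal_leI)
  show "EX s. strict_mono s & (ALL x. EX l. (%n. enn2real (local.K (g (s n)) x)) \<longlonglongrightarrow> l)"
  proof (rule equi_Lipschitz_subsequence[where F="%n x. enn2real (local.K (g n) x)"])
   show "\<bar>enn2real (local.K (g n) x)\<bar> <= 1 / \<sigma>^2 * Vm * max C 0" for n x
   proof -
    have "local.K (g n) x <= ennreal (1 / \<sigma>^2 * Vm * max C 0)" by (rule fin) (auto simp: g')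
    then have "enn2real (local.K (g n) x) <= 1 / \<sigma>^2 * Vm * max C 0" by (rule enn2real_leI[rotated]) (use Vm in simp)
    then show ?thesis by simp
   qed
   show "\<bar>enn2real (local.K (g n) x) - enn2real (local.K (g n) y)\<bar> <= ?L (max C 0) * norm (x - y)" for n x y
    by (rule real_lip) (auto simp: g' g(1))
  qed
 qed (rule that)
 have [measurable]: "\<phi> \<in> borel_measurable borel"
  using \<phi>(1) measurable_cong_sets[OF \<open>sets M = sets borel\<close> refl, of "borel :: real measure"] by simp
 have B: "B >= 0" using \<phi>(2,3)[of 0] by simp
 have eq: "ennreal (\<phi> x) = (LNN y. resolvent_kernel \<sigma> (x - y) * ennreal (V y * \<phi> y))" for x
 proof -
  have "ennreal (\<phi> x) = local.K (%y. ennreal (\<phi> y)) x" by (rule \<phi>(5)[symmetric])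
  also have "... = (\<integral>\<^sup>+y. resolvent_kernel \<sigma> (x - y) * ennreal (\<phi> y) \<partial>M)"
   by (rule positive_kernel.K_def[OF PKr])
  also have "... = (LNN y. resolvent_kernel \<sigma> (x - y) * ennreal (\<phi> y) * ennreal (V y))"
   by (rule nnM) measurable
  also have "... = (LNN y. resolvent_kernel \<sigma> (x - y) * ennreal (V y * \<phi> y))"
   by (intro nn_integral_cong) (simp add: ennreal_mult V0 \<phi>(2) mult_ac)
  finally show ?thesis .
 qed
 show ?thesis
 proof (rule that[OF s \<phi>(2,3) _ _ _ eq])
  show "\<bar>\<phi> x - \<phi> y\<bar> <= ?L B * norm (x - y)" for x y
  proof -
   have "\<bar>enn2real (local.K (%y. ennreal (\<phi> y)) x) - enn2real (local.K (%y. ennreal (\<phi> y)) y)\<bar> <= ?L B * norm (x - y)"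
    by (rule real_lip) (use B \<phi>(3) in \<open>auto simp: ennreal_leI\<close>)
   then show ?thesis unfolding \<phi>(5) using \<phi>(2) by simp
  qed
  show "\<not> (AE x in lborel. \<phi> x = 0)"
  proof
   assume "AE x in lborel. \<phi> x = 0"
   then have "AE x in M. \<phi> x = 0" unfolding M_def by (subst AE_density) auto
   with \<phi>(4) show False by blast
  qed
  show "integrable lborel \<phi>"
  proof (rule integrableI_nonneg)
   have "(LNN x. ennreal (\<phi> x)) = (LNN x. (LNN y. resolvent_kernel \<sigma> (x - y) * ennreal (V y * \<phi> y)))"
    by (simp add: eq)
   also have "... = (LNN y. (LNN x. resolvent_kernel \<sigma> (x - y) * ennreal (V y * \<phi> y)))"
    by (rule lborel_pair.Fubini') measurable
   also have "... = (LNN y. ennreal (1 / \<sigma>^2) * ennreal (V y * \<phi> y))"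
   proof (intro nn_integral_cong)
    fix y
    have "(LNN x. resolvent_kernel \<sigma> (x - y) * ennreal (V y * \<phi> y)) = (LNN x. resolvent_kernel \<sigma> (y - x) * ennreal (V y * \<phi> y))"
     unfolding resolvent_kernel_def using mixture_minus[of "rweight \<sigma>" "_ - y"] by simp
    also have "... = (LNN x. resolvent_kernel \<sigma> (y - x)) * ennreal (V y * \<phi> y)"
     by (rule nn_integral_multc) measurable
    also have "(LNN x. resolvent_kernel \<sigma> (y - x)) = ennreal (1 / \<sigma>^2)"
     unfolding resolvent_kernel_def using half_integral_rweight[OF s]
     by (subst mixture_L1) (auto simp: rweight_nonneg)
    finally show "(LNN x. resolvent_kernel \<sigma> (x - y) * ennreal (V y * \<phi> y)) = ennreal (1 / \<sigma>^2) * ennreal (V y * \<phi> y)" .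
   qed
   also have "... <= (LNN y. ennreal (1 / \<sigma>^2 * B) * ennreal (V y))"
   proof (intro nn_integral_mono)
    fix y
    have "1 / \<sigma>^2 * (V y * \<phi> y) <= 1 / \<sigma>^2 * (V y * B)" by (intro mult_left_mono \<phi> V0) auto
    then show "ennreal (1 / \<sigma>^2) * ennreal (V y * \<phi> y) <= ennreal (1 / \<sigma>^2 * B) * ennreal (V y)"
     using V0 \<phi>(2) B by (simp add: mult_ac ennreal_leI flip: ennreal_mult)
   qed
   also have "... = ennreal (1 / \<sigma>^2 * B) * ennreal m"
    using nn_integral_eq_integral[OF Vint] V0 by (simp add: nn_integral_cmult m_def)
   also have "... < \<infinity>" by (simp add: ennreal_mult_less_top)
   finally show "(LNN x. ennreal (\<phi> x)) < \<infinity>" .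
  qed (use \<phi>(2) in auto)
 qed
qed

section \<open>Approximation by nonnegative test functions\<close>

lemma convolve_L1_bound:
 fixes \<rho> f :: "'a::euclidean_space => real"
 assumes \<rho>: "integrable lborel \<rho>" and f: "integrable lborel f"
 shows "integrable lborel (convolve \<rho> f)" "(LBINT x. \<bar>convolve \<rho> f x\<bar>) <= (LBINT x. \<bar>\<rho> x\<bar>) * (LBINT x. \<bar>f x\<bar>)"
proof -
 have [measurable]: "\<rho> \<in> borel_measurable borel" "f \<in> borel_measurable borel" using \<rho> f by auto
 have tr: "integrable lborel (%x. \<rho> (x - y))" "(LBINT x. \<bar>\<rho> (x - y)\<bar>) = (LBINT x. \<bar>\<rho> x\<bar>)" for y
  using integrable_affine[OF \<rho>, of 1 "- y"] integral_affine[of "%x. \<bar>\<rho> x\<bar>" 1 "- y"] by simp_all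
 have "integrable (lborel \<Otimes>\<^sub>M lborel) (%(y, x). \<rho> (x - y) * f y)"
 proof (rule lborel_pair.Fubini_integrable)
  have "(LBINT x. norm (case (y, x) of (y, x) => \<rho> (x - y) * f y)) = (LBINT x. \<bar>\<rho> x\<bar>) * \<bar>f y\<bar>" for y
   using tr by (simp add: abs_mult)
  then show "integrable lborel (%y. LBINT x. norm (case (y, x) of (y, x) => \<rho> (x - y) * f y))" using f by simp
 qed (use tr in auto)
 from lborel_pair.integrable_product_swap[OF this]
 have I: "integrable (lborel \<Otimes>\<^sub>M lborel) (%(x, y). \<rho> (x - y) * f y)" by (simp add: case_prod_unfold)
 have I': "integrable (lborel \<Otimes>\<^sub>M lborel) (%(x, y). \<bar>\<rho> (x - y) * f y\<bar>)"
  using integrable_abs[OF I] by (simp add: case_prod_unfold)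
 show "integrable lborel (convolve \<rho> f)" unfolding convolve_def[abs_def] using lborel_pair.integrable_fst'[OF I] by simp
 then have "(LBINT x. \<bar>convolve \<rho> f x\<bar>) <= (LBINT x. (LBINT y. \<bar>\<rho> (x - y) * f y\<bar>))"
  using lborel_pair.integrable_fst'[OF I'] unfolding convolve_def[abs_def]
  by (intro integral_mono) (auto simp: case_prod_unfold)
 also have "... = (LBINT y. (LBINT x. \<bar>\<rho> (x - y) * f y\<bar>))"
  using lborel_pair.Fubini_integral[OF I'] by simp
 also have "... = (LBINT x. \<bar>\<rho> x\<bar>) * (LBINT x. \<bar>f x\<bar>)"
  using tr by (simp add: abs_mult)
 finally show "(LBINT x. \<bar>convolve \<rho> f x\<bar>) <= (LBINT x. \<bar>\<rho> x\<bar>) * (LBINT x. \<bar>f x\<bar>)" .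
qed

lemma convolve_sup_bound:
 fixes \<rho> f :: "'a::euclidean_space => real"
 assumes \<rho>: "integrable lborel \<rho>" and f: "f \<in> borel_measurable borel" "!!x. \<bar>f x\<bar> <= C"
 shows "\<bar>convolve \<rho> f x\<bar> <= (LBINT x. \<bar>\<rho> x\<bar>) * C"
proof -
 have [measurable]: "\<rho> \<in> borel_measurable borel" "f \<in> borel_measurable borel" using \<rho> f by auto
 have tr: "integrable lborel (%y. \<rho> (x - y))" "(LBINT y. \<bar>\<rho> (x - y)\<bar>) = (LBINT y. \<bar>\<rho> y\<bar>)"
  using integrable_affine[OF \<rho>, of "-1" x] integral_affine[of "%x. \<bar>\<rho> x\<bar>" "-1" x] by simp_all
 have "\<bar>convolve \<rho> f x\<bar> <= (LBINT y. \<bar>\<rho> (x - y)\<bar> * C)"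
  unfolding convolve_def
 proof (rule abs_integral_le_integral)
  show i: "integrable lborel (%y. \<bar>\<rho> (x - y)\<bar> * C)" using tr by simp
  show le: "\<bar>\<rho> (x - y) * f y\<bar> <= \<bar>\<rho> (x - y)\<bar> * C" for y
   unfolding abs_mult by (intro mult_left_mono f) auto
  show "integrable lborel (%y. \<rho> (x - y) * f y)"
   by (rule integrable_le[OF i]) (use order.trans[OF le abs_ge_self] in auto)
 qed
 then show ?thesis using tr by simp
qed

definition mollifier :: "nat => 'a::euclidean_space => real" where
 "mollifier n x = real (Suc n) ^ DIM('a) / (LBINT y. bump_nd (y::'a)) * bump_nd (0 + real (Suc n) *\<^sub>R x)"

lemma bump_nd_supp_ball: "supp_ball (real DIM('a)) (bump_nd :: 'a::euclidean_space => real)"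
 unfolding supp_ball_def
proof (intro allI impI, rule ccontr)
 fix x :: 'a assume x: "norm x > real DIM('a)" "bump_nd x ~= 0"
 have "norm x <= (\<Sum>b\<in>Basis. \<bar>x \<bullet> b\<bar>)" by (rule norm_le_l1)
 also have "... <= (\<Sum>b\<in>(Basis::'a set). 1)" using bump_nd_support[OF x(2)]
  by (intro sum_mono) (auto simp: mem_box abs_le_iff minus_le_iff)
 finally show False using x by simp
qed

lemma bump_nd_integral: "integrable lborel (bump_nd :: 'a::euclidean_space => real)" "(LBINT y. bump_nd (y::'a)) > 0"
 by (rule continuous_csupp_integrable[OF Ck_continuous[OF Ck_bump_nd[of 0]] bump_nd_supp_ball])
   (rule integral_pos_of_pos_at_0[OF Ck_continuous[OF Ck_bump_nd[of 0]] bump_nd_supp_ball bump_nd_nonneg bump_nd_0_pos])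

lemma mollifier_Ck: "Ck k (mollifier n)"
 unfolding mollifier_def[abs_def] by (intro Ck_cmult Ck_affine Ck_bump_nd)

lemma mollifier_nonneg: "mollifier n x >= 0"
 unfolding mollifier_def using bump_nd_integral(2) by (intro mult_nonneg_nonneg bump_nd_nonneg divide_nonneg_pos) auto

lemma mollifier_supp: "supp_ball (real DIM('a) / real (Suc n)) (mollifier n :: 'a::euclidean_space => real)"
 unfolding supp_ball_def
proof (intro allI impI)
 fix x :: 'a assume "norm x > real DIM('a) / real (Suc n)"
 then have "norm (real (Suc n) *\<^sub>R x) > real DIM('a)" by (simp add: field_simps del: of_nat_Suc)
 from supp_ballD[OF bump_nd_supp_ball this] show "mollifier n x = 0" by (simp add: mollifier_def)
qed

lemma mollifier_integral:
 "integrable lborel (mollifier n :: 'a::euclidean_space => real)" "(LBINT x. mollifier n (x::'a)) = 1"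
proof -
 show "integrable lborel (mollifier n :: 'a => real)"
  by (rule continuous_csupp_integrable[OF Ck_continuous[OF mollifier_Ck[of 0]] mollifier_supp])
 have [measurable]: "(bump_nd :: 'a => real) \<in> borel_measurable borel" using bump_nd_integral(1) by auto
 have "(LBINT y. bump_nd (y::'a)) = \<bar>real (Suc n)\<bar> ^ DIM('a) * (LBINT x. bump_nd ((0::'a) + real (Suc n) *\<^sub>R x))"
  by (rule integral_affine) auto
 moreover have "(LBINT (x::'a). mollifier n x) = real (Suc n) ^ DIM('a) * (LBINT x. bump_nd ((0::'a) + real (Suc n) *\<^sub>R x)) / (LBINT y. bump_nd (y::'a))"
  unfolding mollifier_def by (simp del: of_nat_Suc)
 ultimately show "(LBINT (x::'a). mollifier n x) = 1"
  using bump_nd_integral(2)[where 'a='a] by (metis abs_of_nat divide_self less_irrefl)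
qed

lemma convolve_mollifier_tendsto:
 fixes f :: "'a::euclidean_space => real"
 assumes f: "integrable lborel f" "isCont f x"
 shows "(%n. convolve (mollifier n) f x) \<longlonglongrightarrow> f x"
proof (rule LIMSEQ_I)
 fix e :: real assume e: "e > 0"
 obtain d where d: "d > 0" "!!y. norm (y - x) < d ==> \<bar>f y - f x\<bar> < e / 2"
  using f(2) e unfolding isCont_def LIM_eq by (metis abs_zero diff_self half_gt_zero real_norm_def)
 obtain N where N: "real DIM('a) / d < real N" using reals_Archimedean2 by blast
 show "EX no. ALL n>=no. norm (convolve (mollifier n) f x - f x) < e"
 proof (intro exI allI impI)
  fix n assume "n >= N"
  then have n: "real DIM('a) / real (Suc n) < d"
  proof -
   have "real DIM('a) < d * real N" using N d by (simp add: field_simps)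
   also have "... <= d * real (Suc n)" using \<open>n >= N\<close> d by (intro mult_left_mono) auto
   finally show ?thesis by (simp add: field_simps)
  qed
  have tr: "integrable lborel (%y. mollifier n (x - y))" "(LBINT y. mollifier n (x - y)) = 1"
   using integrable_affine[OF mollifier_integral(1)[of n], of "-1" x] integral_affine[of "mollifier n" "-1" x] mollifier_integral[of n, where 'a='a]
   by (simp_all)
  have i: "integrable lborel (%y. mollifier n (x - y) * f y)"
   by (rule convolve_integrable[OF Ck_continuous[OF mollifier_Ck[of 0]] mollifier_supp f(1)])
  have "convolve (mollifier n) f x - f x = (LBINT y. mollifier n (x - y) * f y - mollifier n (x - y) * f x)"
   unfolding convolve_def using i tr by simp
  also have "\<bar>...\<bar> <= (LBINT y. mollifier n (x - y) * (e / 2))"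
  proof (rule abs_integral_le_integral)
   fix y
   show "\<bar>mollifier n (x - y) * f y - mollifier n (x - y) * f x\<bar> <= mollifier n (x - y) * (e / 2)"
   proof (cases "norm (x - y) < d")
    case True
    then have "mollifier n (x - y) * \<bar>f y - f x\<bar> <= mollifier n (x - y) * (e / 2)"
     using d(2)[of y] by (intro mult_left_mono mollifier_nonneg) (auto simp: norm_minus_commute)
    then show ?thesis using mollifier_nonneg[of n "x - y"] by (simp add: abs_mult flip: right_diff_distrib)
   next
    case False
    then show ?thesis using supp_ballD[OF mollifier_supp, of n "x - y"] n by simp
   qed
  qed (use i tr in auto)
  also have "... = e / 2" using tr by simp
  finally show "norm (convolve (mollifier n) f x - f x) < e" using e by simp
 qed
qed

lemma convolve_diff:
 assumes "integrable lborel (%y. \<rho> (x - y) * f y)" "integrable lborel (%y. \<rho> (x - y) * g y)"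
 shows "convolve \<rho> (%y. f y - g y) x = convolve \<rho> f x - convolve \<rho> g x"
 using assms unfolding convolve_def by (simp add: right_diff_distrib)

text \<open>For a nonnegative continuous function, pointwise convergence and equality of the integrals give \<open>L\<^sup>1\<close> convergence by Scheffe's argument.\<close>
lemma convolve_mollifier_L1_nonneg:
 fixes f :: "'a::euclidean_space => real"
 assumes f: "integrable lborel f" "continuous_on UNIV f" "!!x. f x >= 0"
 shows "(%n. LBINT x. \<bar>convolve (mollifier n) f x - f x\<bar>) \<longlonglongrightarrow> 0"
proof -
 have cv: "integrable lborel (convolve (mollifier n) f)" for n by (rule convolve_L1_bound(1)[OF mollifier_integral(1) f(1)])
 have nn: "convolve (mollifier n) f x >= 0" for n x
  unfolding convolve_def by (intro integral_ge_0 mult_nonneg_nonneg mollifier_nonneg f)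
 define g where "g n x = f x - convolve (mollifier n) f x" for n x
 have lim: "(%n. LBINT x. max (g n x) 0) \<longlonglongrightarrow> (LBINT (x::'a). 0)"
 proof (rule integral_dominated_convergence[OF _ _ f(1)])
  show "AE x in lborel. (%n. max (g n x) 0) \<longlonglongrightarrow> 0"
  proof (rule AE_I2)
   fix x
   have "(%n. max (g n x) 0) \<longlonglongrightarrow> max (f x - f x) 0" unfolding g_def
    by (intro tendsto_intros convolve_mollifier_tendsto f) (use f(2) in \<open>simp add: continuous_on_eq_continuous_at\<close>)
   then show "(%n. max (g n x) 0) \<longlonglongrightarrow> 0" by simp
  qed
  show "AE x in lborel. norm (max (g n x) 0) <= f x" for n using nn f(3) by (intro AE_I2) (auto simp: g_def)
 qed (use f(1) borel_measurable_integrable[OF cv] in \<open>auto simp: g_def\<close>)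
 have "(LBINT x. \<bar>convolve (mollifier n) f x - f x\<bar>) <= 2 * (LBINT x. max (g n x) 0)" for n
 proof -
  have gi: "integrable lborel (g n)" unfolding g_def using cv f by auto
  have "(LBINT x. convolve (mollifier n) f x) <= (LBINT x. \<bar>convolve (mollifier n) f x\<bar>)" using cv by (intro integral_mono) auto
  moreover have "(LBINT x. \<bar>mollifier n (x::'a)\<bar>) = 1"
   using mollifier_integral(2)[of n, where 'a='a] by (simp only: abs_of_nonneg[OF mollifier_nonneg])
  moreover have "(LBINT x. \<bar>f x\<bar>) = (LBINT x. f x)" using f(3) by simp
  moreover have "(LBINT x. convolve (mollifier n) f x) = (LBINT x. f x)"
  proof -
   have [measurable]: "f \<in> borel_measurable borel" "(mollifier n :: 'a => real) \<in> borel_measurable borel" using f mollifier_integral(1)[of n] by auto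
   have tr: "integrable lborel (%x. mollifier n (x - y))" "(LBINT x. mollifier n (x - y)) = 1" for y :: 'a
    using integrable_affine[OF mollifier_integral(1)[of n], of 1 "- y"] integral_affine[of "mollifier n" 1 "- y"] mollifier_integral[of n, where 'a='a]
    by (simp_all)
   have I: "integrable (lborel \<Otimes>\<^sub>M lborel) (%(y, x). mollifier n (x - y) * f y)"
   proof (rule lborel_pair.Fubini_integrable)
    have "(LBINT x. norm (case (y, x) of (y, x) => mollifier n (x - y) * f y)) = f y" for y
     using tr f(3) by (simp add: abs_mult mollifier_nonneg)
    then show "integrable lborel (%y. LBINT x. norm (case (y, x) of (y, x) => mollifier n (x - y) * f y))" using f by simp
   qed (use tr in auto)
   show ?thesis unfolding convolve_def using lborel_pair.Fubini_integral[OF I] tr by simp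
  qed
  ultimately have g0: "(LBINT x. g n x) = 0" unfolding g_def using cv f by simp
  have "(LBINT x. \<bar>convolve (mollifier n) f x - f x\<bar>) = (LBINT x. 2 * max (g n x) 0 - g n x)"
   by (intro integral_eqI) (auto simp: g_def max_def)
  also have "... = 2 * (LBINT x. max (g n x) 0)" using gi g0 by simp
  finally show ?thesis by simp
 qed
 note le = this
 have lim2: "(%n. 2 * (LBINT x. max (g n x) 0)) \<longlonglongrightarrow> 0" using tendsto_mult_right_zero[of _ sequentially 2] lim by simp
 show ?thesis
 proof (rule tendsto_sandwich[OF _ _ tendsto_const lim2])
  show "\<forall>\<^sub>F n in sequentially. 0 <= (LBINT x. \<bar>convolve (mollifier n) f x - f x\<bar>)"
   by (intro always_eventually allI integral_ge_0 abs_ge_zero)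
 qed (intro always_eventually allI le)
qed

lemma convolve_mollifier_L1:
 fixes f g :: "'a::euclidean_space => real"
 assumes f: "integrable lborel f" "continuous_on UNIV f" "!!x. f x >= 0"
  and g: "integrable lborel g" "continuous_on UNIV g" "!!x. g x >= 0"
 shows "(%n. LBINT x. \<bar>convolve (mollifier n) (%x. f x - g x) x - (f x - g x)\<bar>) \<longlonglongrightarrow> 0"
proof -
 have cv: "integrable lborel (convolve (mollifier n) f)" "integrable lborel (convolve (mollifier n) g)" for n
  using convolve_L1_bound(1)[OF mollifier_integral(1)] f g by auto
 have "convolve (mollifier n) (%x. f x - g x) x = convolve (mollifier n) f x - convolve (mollifier n) g x" for n x
  by (rule convolve_diff; rule convolve_integrable[OF Ck_continuous[OF mollifier_Ck[of 0]] mollifier_supp])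
    (use f g in auto)
 then have "(LBINT x. \<bar>convolve (mollifier n) (%x. f x - g x) x - (f x - g x)\<bar>) \<le>
  (LBINT x. \<bar>convolve (mollifier n) f x - f x\<bar> + \<bar>convolve (mollifier n) g x - g x\<bar>)" for n
  using cv f g by (intro integral_mono) auto
 then have le: "(LBINT x. \<bar>convolve (mollifier n) (%x. f x - g x) x - (f x - g x)\<bar>) \<le>
   (LBINT x. \<bar>convolve (mollifier n) f x - f x\<bar>) + (LBINT x. \<bar>convolve (mollifier n) g x - g x\<bar>)" for n
  using cv f g by simp
 have "(%n. (LBINT x. \<bar>convolve (mollifier n) f x - f x\<bar>) + (LBINT x. \<bar>convolve (mollifier n) g x - g x\<bar>)) \<longlonglongrightarrow> 0 + 0"
  by (intro tendsto_add convolve_mollifier_L1_nonneg f g)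
 then have lim: "(%n. (LBINT x. \<bar>convolve (mollifier n) f x - f x\<bar>) + (LBINT x. \<bar>convolve (mollifier n) g x - g x\<bar>)) \<longlonglongrightarrow> 0"
  by (simp only: add_0)
 show ?thesis
 proof (rule tendsto_sandwich[OF _ _ tendsto_const lim])
  show "\<forall>\<^sub>F n in sequentially. 0 <= (LBINT x. \<bar>convolve (mollifier n) (%x. f x - g x) x - (f x - g x)\<bar>)"
   by (intro always_eventually allI integral_ge_0 abs_ge_zero)
 qed (intro always_eventually allI le)
qed

text \<open>Truncate \<open>\<phi>\<close> to a large ball, then mollify. The mollification of \<open>\<phi>\<close> itself has as its Laplacian the
 mollification of \<open>f - g\<close>, which is close to \<open>f - g\<close>. The truncation error, small in \<open>L\<^sup>1\<close>, is convolved with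
 the Laplacian of the mollifier, whose norm is large but known before the radius is chosen. The \<open>L\<^sup>2\<close> bounds
 follow from the uniform bounds.\<close>
lemma test_function_approximation:
 fixes \<phi> h :: "'a::euclidean_space => real"
 assumes \<phi>: "integrable lborel \<phi>" "continuous_on UNIV \<phi>" "!!x. \<phi> x >= 0" "!!x. \<phi> x <= B"
  and f: "integrable lborel f" "continuous_on UNIV f" "!!x. f x >= 0" "!!x. f x <= C"
  and g: "integrable lborel g" "continuous_on UNIV g" "!!x. g x >= 0" "!!x. g x <= C"
  and eq: "!!\<xi>. \<xi> \<in> test_functions UNIV ==> (LBINT x. \<phi> x * laplacian \<xi> x) = (LBINT x. (f x - g x) * \<xi> x)"
  and e: "eps > 0"
 shows "EX \<xi>:test_functions UNIV. (ALL x. 0 <= \<xi> x) & (ALL x. \<xi> x <= B) &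
  (LBINT x. \<bar>\<xi> x - \<phi> x\<bar>) <= eps & (LBINT x. (\<xi> x - \<phi> x)\<^sup>2) <= eps &
  (LBINT x. \<bar>laplacian \<xi> x - (f x - g x)\<bar>) <= eps & (LBINT x. (laplacian \<xi> x - (f x - g x))\<^sup>2) <= eps"
proof -
 let ?s = "%x. f x - g x"
 have B: "B >= 0" and C: "C >= 0" using \<phi>(3,4)[of 0] f(3,4)[of 0] by linarith+
 have [measurable]: "\<phi> \<in> borel_measurable borel" "f \<in> borel_measurable borel" "g \<in> borel_measurable borel"
  using \<phi> f g by auto
 define \<delta> where "\<delta> = eps / (2 + 4 * B + 8 * C)"
 have \<delta>: "\<delta> > 0" using e B C by (simp add: \<delta>_def add_pos_nonneg)
 have \<delta>eps: "\<delta> * (2 + 4 * B + 8 * C) = eps"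
 proof -
  have "2 + 4 * B + 8 * C ~= 0" using B C by linarith
  then show ?thesis by (simp add: \<delta>_def)
 qed
 have ev1: "\<forall>\<^sub>F n in sequentially. (LBINT x. \<bar>convolve (mollifier n) \<phi> x - \<phi> x\<bar>) < \<delta>"
  using order_tendstoD(2)[OF convolve_mollifier_L1_nonneg[OF \<phi>(1-3)] \<delta>] .
 have ev2: "\<forall>\<^sub>F n in sequentially. (LBINT x. \<bar>convolve (mollifier n) ?s x - ?s x\<bar>) < \<delta>"
  using order_tendstoD(2)[OF convolve_mollifier_L1[OF f(1-3) g(1-3)] \<delta>] .
 from eventually_happens'[OF sequentially_bot eventually_conj[OF ev1 ev2]]
 obtain n where n1: "(LBINT x. \<bar>convolve (mollifier n) \<phi> x - \<phi> x\<bar>) < \<delta>"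
  and n2: "(LBINT x. \<bar>convolve (mollifier n) ?s x - ?s x\<bar>) < \<delta>" by blast
 let ?\<rho> = "mollifier n :: 'a => real"
 let ?l = "laplacian ?\<rho>"
 have l_supp: "supp_ball (real DIM('a) / real (Suc n)) ?l"
  by (rule supp_ball_laplacian[OF mollifier_supp])
 have l_int: "integrable lborel ?l"
  by (rule continuous_csupp_integrable[OF laplacian_continuous[OF mollifier_Ck] l_supp])
 define \<Lambda> where "\<Lambda> = (LBINT x. \<bar>?l x\<bar>)"
 have \<Lambda>: "\<Lambda> >= 0" unfolding \<Lambda>_def by (rule integral_ge_0) simp
 define F where "F k x = indicator (cball 0 (real k)) x * \<phi> x" for k :: nat and x
 have [measurable]: "F k \<in> borel_measurable borel" for k
  unfolding F_def[abs_def] by (rule borel_measurable_times[OF borel_measurable_indicator]) (use \<phi>(1) in auto)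
 have Fb: "0 <= F k x" "F k x <= \<phi> x" for k x using \<phi>(3)[of x] by (auto simp: F_def indicator_def)
 have Fi: "integrable lborel (F k)" for k
  by (rule integrable_le[OF \<phi>(1)]) (use Fb \<phi>(3) in auto)
 define G where "G k x = F k x - \<phi> x" for k x
 have Gi: "integrable lborel (G k)" for k unfolding G_def using Fi \<phi>(1) by auto
 have Gb: "\<bar>G k x\<bar> <= B" for k x using Fb[of k x] \<phi>(4)[of x] by (auto simp: G_def)
 have [measurable]: "G k \<in> borel_measurable borel" for k unfolding G_def[abs_def] by measurable
 have "(%k. LBINT x. \<bar>G k x\<bar>) \<longlonglongrightarrow> (LBINT (x::'a). 0)"
 proof (rule integral_dominated_convergence[OF _ _ \<phi>(1)])
  show "AE x in lborel. (%k. \<bar>G k x\<bar>) \<longlonglongrightarrow> 0"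
  proof (rule AE_I2)
   fix x :: 'a
   obtain N where N: "norm x < real N" using reals_Archimedean2 by blast
   have "\<forall>\<^sub>F k in sequentially. \<bar>G k x\<bar> = 0"
    using eventually_ge_at_top[of N] by eventually_elim (use N in \<open>auto simp: G_def F_def\<close>)
   then show "(%k. \<bar>G k x\<bar>) \<longlonglongrightarrow> 0" by (rule tendsto_eventually)
  qed
  show "AE x in lborel. norm \<bar>G k x\<bar> <= \<phi> x" for k using Fb by (intro AE_I2) (auto simp: G_def)
 qed auto
 then have "(%k. LBINT x. \<bar>G k x\<bar>) \<longlonglongrightarrow> 0" by simp
 moreover have "min \<delta> (\<delta> / ((\<Lambda> + 1) * (\<Lambda> * B + 1))) > 0" using \<delta> \<Lambda> B by (simp add: add_nonneg_pos)
 ultimately have "\<forall>\<^sub>F k in sequentially. (LBINT x. \<bar>G k x\<bar>) < min \<delta> (\<delta> / ((\<Lambda> + 1) * (\<Lambda> * B + 1)))"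
  by (rule order_tendstoD(2))
 from eventually_happens'[OF sequentially_bot this]
 obtain k where k: "(LBINT x. \<bar>G k x\<bar>) < \<delta>" "(LBINT x. \<bar>G k x\<bar>) < \<delta> / ((\<Lambda> + 1) * (\<Lambda> * B + 1))" by auto
 define \<tau> where "\<tau> = (LBINT x. \<bar>G k x\<bar>)"
 have \<tau>0: "\<tau> >= 0" unfolding \<tau>_def by (rule integral_ge_0) simp
 have pos: "(\<Lambda> + 1) * (\<Lambda> * B + 1) > 0" using \<Lambda> B by (simp add: add_nonneg_pos)
 have \<tau>: "\<tau> < \<delta>" "(\<Lambda> + 1) * (\<Lambda> * B + 1) * \<tau> < \<delta>"
  using k pos by (auto simp: \<tau>_def pos_less_divide_eq mult.commute)
 define \<xi> where "\<xi> = convolve ?\<rho> (F k)"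
 have ci: "integrable lborel (%y. ?\<rho> (x - y) * u y)" "integrable lborel (%y. ?l (x - y) * u y)" if "integrable lborel u" for u x
  by (rule convolve_integrable[OF Ck_continuous[OF mollifier_Ck[of 0]] mollifier_supp that])
    (rule convolve_integrable[OF laplacian_continuous[OF mollifier_Ck] l_supp that])
 have \<xi>split: "\<xi> x - \<phi> x = convolve ?\<rho> (G k) x + (convolve ?\<rho> \<phi> x - \<phi> x)" for x
  unfolding \<xi>_def G_def convolve_diff[OF ci(1)[OF Fi] ci(1)[OF \<phi>(1)]] by simp
 have lap\<phi>: "convolve ?l \<phi> x = convolve ?\<rho> ?s x" for x
 proof -
  let ?t = "%y. ?\<rho> (x + (- 1) *\<^sub>R y)"
  have t: "?t \<in> test_functions UNIV"
   unfolding test_functions_def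
  proof (intro CollectI conjI exI)
   show "ALL k. Ck k ?t" by (intro allI Ck_affine mollifier_Ck)
   show "compact (cball (0::'a) (real DIM('a) / real (Suc n) + norm x))" by simp
   show "ALL y. y \<notin> cball 0 (real DIM('a) / real (Suc n) + norm x) --> ?t y = 0"
   proof (intro allI impI)
    fix y :: 'a assume "y \<notin> cball 0 (real DIM('a) / real (Suc n) + norm x)"
    then have "norm (x - y) > real DIM('a) / real (Suc n)" using norm_triangle_sub[of y x] by (simp add: norm_minus_commute)
    then show "?t y = 0" using supp_ballD[OF mollifier_supp] by simp
   qed
  qed simp
  show ?thesis using eq[OF t] unfolding laplacian_affine[OF mollifier_Ck] by (simp add: convolve_def mult.commute)
 qed
 have lsplit: "laplacian \<xi> x - ?s x = convolve ?l (G k) x + (convolve ?\<rho> ?s x - ?s x)" for x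
  unfolding \<xi>_def laplacian_convolve[OF mollifier_Ck mollifier_supp Fi] G_def
   convolve_diff[OF ci(2)[OF Fi] ci(2)[OF \<phi>(1)]] lap\<phi> by simp
 have m1: "(LBINT x. \<bar>?\<rho> x\<bar>) = 1"
  using mollifier_integral(2)[of n, where 'a='a] by (simp only: abs_of_nonneg[OF mollifier_nonneg])
 have split_bounds: "(LBINT x. \<bar>a x + b x\<bar>) <= \<alpha> + \<beta> & (LBINT x. (a x + b x)\<^sup>2) <= 2 * A * \<alpha> + 2 * A' * \<beta>"
  if a: "integrable lborel a" "(LBINT x. \<bar>a x\<bar>) <= \<alpha>" "!!x. \<bar>a x\<bar> <= A"
   and b: "integrable lborel b" "(LBINT x. \<bar>b x\<bar>) <= \<beta>" "!!x. \<bar>b x\<bar> <= A'"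
  for a b :: "'a => real" and \<alpha> \<beta> A A'
 proof
  have A0: "A >= 0" "A' >= 0" using a(3)[of 0] b(3)[of 0] by auto
  have "(LBINT x. \<bar>a x + b x\<bar>) <= (LBINT x. \<bar>a x\<bar> + \<bar>b x\<bar>)" using a b by (intro integral_mono) auto
  also have "... <= \<alpha> + \<beta>" using a b by simp
  finally show "(LBINT x. \<bar>a x + b x\<bar>) <= \<alpha> + \<beta>" .
  have [measurable]: "a \<in> borel_measurable borel" "b \<in> borel_measurable borel" using a b by auto
  have le: "(a x + b x)^2 <= 2 * A * \<bar>a x\<bar> + 2 * A' * \<bar>b x\<bar>" for x
  proof -
   have "(a x + b x)^2 <= 2 * (\<bar>a x\<bar> * \<bar>a x\<bar>) + 2 * (\<bar>b x\<bar> * \<bar>b x\<bar>)"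
    using zero_le_power2[of "a x - b x"] by (simp add: power2_eq_square algebra_simps)
   also have "... <= 2 * (A * \<bar>a x\<bar>) + 2 * (A' * \<bar>b x\<bar>)"
    using a(3)[of x] b(3)[of x] by (intro add_mono mult_left_mono mult_right_mono) auto
   finally show ?thesis by simp
  qed
  have i: "integrable lborel (%x. 2 * A * \<bar>a x\<bar> + 2 * A' * \<bar>b x\<bar>)" using a b by auto
  have "(LBINT x. (a x + b x)\<^sup>2) <= (LBINT x. 2 * A * \<bar>a x\<bar> + 2 * A' * \<bar>b x\<bar>)"
  proof (rule integral_mono[OF _ i le])
   show "integrable lborel (%x. (a x + b x)\<^sup>2)"
    by (rule integrable_le[OF i]) (use order.trans[OF le abs_ge_self] in auto)
  qed
  also have "... <= 2 * A * \<alpha> + 2 * A' * \<beta>" using a b A0 by (simp add: add_mono mult_left_mono)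
  finally show "(LBINT x. (a x + b x)\<^sup>2) <= 2 * A * \<alpha> + 2 * A' * \<beta>" .
 qed
 have cvm: "integrable lborel (convolve ?\<rho> u)" if "integrable lborel u" for u by (rule convolve_L1_bound(1)[OF mollifier_integral(1) that])
 have S1: "(LBINT x. \<bar>\<xi> x - \<phi> x\<bar>) <= \<delta> + \<delta> & (LBINT x. (\<xi> x - \<phi> x)\<^sup>2) <= 2 * B * \<delta> + 2 * B * \<delta>"
  unfolding \<xi>split
 proof (rule split_bounds)
  show "integrable lborel (convolve ?\<rho> (G k))" by (rule cvm[OF Gi])
  show "(LBINT x. \<bar>convolve ?\<rho> (G k) x\<bar>) <= \<delta>"
   using convolve_L1_bound(2)[OF mollifier_integral(1)[of n] Gi, of k] m1 k(1) by simp
  show "\<bar>convolve ?\<rho> (G k) x\<bar> <= B" for x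
  proof -
   have "\<bar>convolve ?\<rho> (G k) x\<bar> <= (LBINT x. \<bar>?\<rho> x\<bar>) * B"
    by (rule convolve_sup_bound[OF mollifier_integral(1)]) (auto simp: Gb)
   then show ?thesis using m1 by simp
  qed
  show "integrable lborel (%x. convolve ?\<rho> \<phi> x - \<phi> x)" using cvm[OF \<phi>(1)] \<phi>(1) by auto
  show "(LBINT x. \<bar>convolve ?\<rho> \<phi> x - \<phi> x\<bar>) <= \<delta>" using n1 by simp
  fix x
  have "\<bar>convolve ?\<rho> \<phi> x\<bar> <= B"
   using convolve_sup_bound[OF mollifier_integral(1)[of n], of \<phi> B x] m1 \<phi>(3,4) by simp
  moreover have "convolve ?\<rho> \<phi> x >= 0"
   unfolding convolve_def by (intro integral_ge_0 mult_nonneg_nonneg mollifier_nonneg \<phi>)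
  ultimately show "\<bar>convolve ?\<rho> \<phi> x - \<phi> x\<bar> <= B" using \<phi>(3,4)[of x] by (simp add: abs_le_iff)
 qed
 have S2: "(LBINT x. \<bar>laplacian \<xi> x - ?s x\<bar>) <= \<Lambda> * \<tau> + \<delta> & (LBINT x. (laplacian \<xi> x - ?s x)\<^sup>2) <= 2 * (\<Lambda> * B) * (\<Lambda> * \<tau>) + 2 * (2 * C) * \<delta>"
  unfolding lsplit
 proof (rule split_bounds)
  show "integrable lborel (convolve ?l (G k))" by (rule convolve_L1_bound(1)[OF l_int Gi])
  show "(LBINT x. \<bar>convolve ?l (G k) x\<bar>) <= \<Lambda> * \<tau>"
   using convolve_L1_bound(2)[OF l_int Gi, of k] by (simp add: \<Lambda>_def \<tau>_def)
  show "\<bar>convolve ?l (G k) x\<bar> <= \<Lambda> * B" for x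
   unfolding \<Lambda>_def by (rule convolve_sup_bound[OF l_int]) (auto simp: Gb)
  have si: "integrable lborel ?s" using f g by auto
  show "integrable lborel (%x. convolve ?\<rho> ?s x - ?s x)" using cvm[OF si] si by auto
  show "(LBINT x. \<bar>convolve ?\<rho> ?s x - ?s x\<bar>) <= \<delta>" using n2 by simp
  fix x
  have sb: "\<bar>?s x\<bar> <= C" for x using f(3,4)[of x] g(3,4)[of x] by linarith
  have "\<bar>convolve ?\<rho> ?s x\<bar> <= C"
   using convolve_sup_bound[OF mollifier_integral(1)[of n], of ?s C x] m1 sb by simp
  then show "\<bar>convolve ?\<rho> ?s x - ?s x\<bar> <= 2 * C" using sb[of x] by linarith
 qed
 have "\<Lambda> * \<tau> <= (\<Lambda> + 1) * (\<Lambda> * B + 1) * \<tau>"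
 proof (rule mult_right_mono[OF _ \<tau>0])
  have "0 <= \<Lambda> * (\<Lambda> * B) + \<Lambda> * B" using \<Lambda> B by simp
  then show "\<Lambda> <= (\<Lambda> + 1) * (\<Lambda> * B + 1)" by (simp add: algebra_simps)
 qed
 then have a1: "\<Lambda> * \<tau> <= \<delta>" using \<tau> by linarith
 have "(\<Lambda> * B) * (\<Lambda> * \<tau>) <= (\<Lambda> + 1) * (\<Lambda> * B + 1) * \<tau>"
  unfolding mult.assoc[symmetric]
 proof (rule mult_right_mono[OF _ \<tau>0])
  have "0 <= \<Lambda> * B" using \<Lambda> B by simp
  then show "\<Lambda> * B * \<Lambda> <= (\<Lambda> + 1) * (\<Lambda> * B + 1)" using \<Lambda> by (simp add: algebra_simps)
 qed
 then have a2: "(\<Lambda> * B) * (\<Lambda> * \<tau>) <= \<delta>" using \<tau> by linarith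
 have B\<delta>: "0 <= B * \<delta>" "0 <= C * \<delta>" using B C \<delta> by auto
 have eps: "eps = 2 * \<delta> + 4 * (B * \<delta>) + 8 * (C * \<delta>)" unfolding \<delta>eps[symmetric] by (simp add: algebra_simps)
 show ?thesis
 proof (intro bexI[of _ \<xi>] conjI allI)
  show "0 <= \<xi> x" for x unfolding \<xi>_def convolve_def
   by (intro integral_ge_0 mult_nonneg_nonneg mollifier_nonneg Fb)
  show "\<xi> x <= B" for x
  proof -
   have "\<bar>F k x\<bar> <= B" for x using Fb[of k x] \<phi>(4)[of x] by simp
   then show ?thesis using convolve_sup_bound[OF mollifier_integral(1)[of n], of "F k" B x] m1 by (simp add: \<xi>_def)
  qed
  show "(LBINT x. \<bar>\<xi> x - \<phi> x\<bar>) <= eps" using S1 B\<delta> eps by linarith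
  show "(LBINT x. (\<xi> x - \<phi> x)\<^sup>2) <= eps"
  proof -
   have "(LBINT x. (\<xi> x - \<phi> x)\<^sup>2) <= 2 * B * \<delta> + 2 * B * \<delta>" using S1 by blast
   also have "... = 4 * (B * \<delta>)" by simp
   finally show ?thesis using B\<delta> eps \<delta> by linarith
  qed
  show "(LBINT x. \<bar>laplacian \<xi> x - ?s x\<bar>) <= eps" using S2 a1 B\<delta> eps by linarith
  show "(LBINT x. (laplacian \<xi> x - ?s x)\<^sup>2) <= eps"
  proof -
   have "(LBINT x. (laplacian \<xi> x - ?s x)\<^sup>2) <= 2 * (\<Lambda> * B) * (\<Lambda> * \<tau>) + 2 * (2 * C) * \<delta>" using S2 by blast
   also have "... = 2 * ((\<Lambda> * B) * (\<Lambda> * \<tau>)) + 4 * (C * \<delta>)" by simp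
   finally show ?thesis using a2 B\<delta> eps \<delta> by linarith
  qed
  show "\<xi> \<in> test_functions UNIV"
   unfolding test_functions_def
  proof (intro CollectI conjI exI)
   show "ALL j. Ck j \<xi>" unfolding \<xi>_def by (intro allI Ck_convolve[OF mollifier_Ck mollifier_supp Fi])
   show "compact (cball (0::'a) (real k + real DIM('a) / real (Suc n)))" by simp
   show "ALL x. x \<notin> cball 0 (real k + real DIM('a) / real (Suc n)) --> \<xi> x = 0"
   proof (intro allI impI)
    fix x :: 'a assume x: "x \<notin> cball 0 (real k + real DIM('a) / real (Suc n))"
    have "?\<rho> (x - y) * F k y = 0" for y
    proof (cases "norm y <= real k")
     case True
     then have "norm (x - y) > real DIM('a) / real (Suc n)" using x norm_triangle_sub[of x y] by simp
     from supp_ballD[OF mollifier_supp this] show ?thesis by simp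
    qed (simp add: F_def)
    then have "(%y. ?\<rho> (x - y) * F k y) = (%y. 0)" by blast
    then show "\<xi> x = 0" by (simp add: \<xi>_def convolve_def)
   qed
  qed simp
 qed
qed

section \<open>Growth of supersolutions of second-order differential inequalities\<close>

lemma absolutely_integrable_mult_continuous:
 fixes b p :: "real => real"
 assumes b: "b absolutely_integrable_on {s..t}" and p: "continuous_on {s..t} p"
 shows "(%r. b r * p r) absolutely_integrable_on {s..t}"
proof -
 have "compact (p ` {s..t})" by (intro compact_continuous_image p) auto
 then have "bounded (p ` {s..t})" by (rule compact_imp_bounded)
 moreover have "p \<in> borel_measurable (lebesgue_on {s..t})"
  by (rule continuous_imp_measurable_on_sets_lebesgue[OF p]) auto
 ultimately have "(%r. p r * b r) absolutely_integrable_on {s..t}"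
  by (intro absolutely_integrable_bounded_measurable_product_real b) auto
 then show ?thesis by (simp add: mult.commute)
qed

lemma integral_mono_AE_real:
 fixes f g :: "real => real"
 assumes f: "f absolutely_integrable_on S" and g: "g absolutely_integrable_on S"
  and le: "AE x in lebesgue. x \<in> S --> f x <= g x"
 shows "integral S f <= integral S g"
proof -
 have "(LINT x:S|lebesgue. f x) <= (LINT x:S|lebesgue. g x)"
  unfolding set_lebesgue_integral_def using f g le
  by (intro integral_mono_AE) (auto simp: set_integrable_def indicator_def elim: eventually_mono)
 then show ?thesis using f g by (simp add: set_lebesgue_integral_eq_integral)
qed

lemma abs_integral_le_bound:
 fixes b p :: "real => real"
 assumes b: "b absolutely_integrable_on {s..t}" and p: "continuous_on {s..t} p"
  and M: "!!r. r \<in> {s..t} ==> \<bar>p r\<bar> <= M" and e: "integral {s..t} (%r. \<bar>b r\<bar>) <= e" and M0: "M >= 0"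
 shows "\<bar>integral {s..t} (%r. b r * p r)\<bar> <= e * M"
proof -
 have i: "(%r. b r * p r) absolutely_integrable_on {s..t}" by (rule absolutely_integrable_mult_continuous[OF b p])
 have b': "(%r. \<bar>b r\<bar>) integrable_on {s..t}" using b unfolding absolutely_integrable_on_def by simp
 have "norm (integral {s..t} (%r. b r * p r)) <= integral {s..t} (%r. \<bar>b r\<bar> * M)"
  by (rule Henstock_Kurzweil_Integration.integral_norm_bound_integral)
    (use i integrable_on_mult_left[OF b', of M] M in \<open>auto simp: absolutely_integrable_on_def abs_mult intro!: mult_left_mono\<close>)
 then have "\<bar>integral {s..t} (%r. b r * p r)\<bar> <= integral {s..t} (%r. \<bar>b r\<bar> * M)" by simp
 also have "... = integral {s..t} (%r. \<bar>b r\<bar>) * M" by simp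
 also have "... <= e * M" by (intro mult_right_mono e M0)
 finally show ?thesis .
qed

lemma Ico0_Icc: "t \<in> Ico0 T ==> 0 <= s ==> {s..t} \<subseteq> Ico0 T"
 by (auto simp: Ico0_def) (meson ereal_less_eq(3) le_less_trans)

lemma Ioo0_Icc: "t \<in> Ioo0 T ==> 0 < s ==> {s..t} \<subseteq> Ioo0 T"
 by (auto simp: Ioo0_def) (meson ereal_less_eq(3) le_less_trans)

lemma Ioo0_subset: "Ioo0 T \<subseteq> Ico0 T" by (auto simp: Ioo0_def Ico0_def)

lemma Ioo0_eq: "Ioo0 (ereal t) = {0<..<t}" "Ioo0 \<infinity> = {0<..}" "Ioo0 (- \<infinity>) = {}"
 by (auto simp: Ioo0_def)

lemma Ioo0_open: "open (Ioo0 T)"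
 by (cases T) (auto simp: Ioo0_eq)

text \<open>Integrated form of \<open>p' \<ge> \<kappa> y - \<beta> p\<close> with \<open>p = y'\<close>. The coefficient \<open>\<beta>\<close> is merely locally
 integrable on the open interval and may fail to be integrable near zero, so that there is no
 integrating factor based at time zero.\<close>
locale supersolution =
 fixes T :: ereal and y p \<kappa> \<beta> :: "real => real"
 assumes T: "T > 0"
  and p_cont: "continuous_on (Ico0 T) p"
  and y_der: "!!t. t \<in> Ico0 T ==> (y has_real_derivative p t) (at t within Ico0 T)"
  and y0: "y 0 > 0" and p0: "p 0 > 0"
  and \<kappa>_cont: "continuous_on (Ioo0 T) \<kappa>" and \<kappa>_nonneg: "!!t. t \<in> Ioo0 T ==> \<kappa> t >= 0"
  and \<beta>_int: "!!s t. 0 < s ==> t \<in> Ioo0 T ==> \<beta> absolutely_integrable_on {s..t}"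
  and ineq: "!!s t. 0 < s ==> s <= t ==> t \<in> Ioo0 T ==> p t - p s >= integral {s..t} (%r. \<kappa> r * y r - \<beta> r * p r)"
begin

lemma y_cont: "continuous_on (Ico0 T) y"
 using y_der by (rule DERIV_continuous_on)

lemma y_diff_integral:
 assumes "0 <= s" "s <= t" "t \<in> Ico0 T"
 shows "(p has_integral (y t - y s)) {s..t}"
proof (rule fundamental_theorem_of_calculus[OF assms(2)])
 fix x assume "x \<in> {s..t}"
 then show "(y has_vector_derivative p x) (at x within {s..t})"
  using y_der[of x] Ico0_Icc[OF assms(3,1)] DERIV_subset has_real_derivative_iff_has_vector_derivative by blast
qed

lemma cont_subset:
 assumes "0 < s" "t \<in> Ioo0 T"
 shows "continuous_on {s..t} p" "continuous_on {s..t} y" "continuous_on {s..t} \<kappa>"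
proof -
 have I: "{s..t} \<subseteq> Ioo0 T" by (rule Ioo0_Icc[OF assms(2,1)])
 then have J: "{s..t} \<subseteq> Ico0 T" using Ioo0_subset[of T] by (rule subset_trans)
 show "continuous_on {s..t} p" "continuous_on {s..t} y" "continuous_on {s..t} \<kappa>"
  using continuous_on_subset[OF p_cont J] continuous_on_subset[OF y_cont J] continuous_on_subset[OF \<kappa>_cont I] .
qed

lemma ints:
 assumes "0 < s" "t \<in> Ioo0 T"
 shows "(%r. \<kappa> r * y r) absolutely_integrable_on {s..t}" "(%r. \<beta> r * p r) absolutely_integrable_on {s..t}"
proof -
 have "continuous_on {s..t} (%r. \<kappa> r * y r)" using cont_subset[OF assms] by (intro continuous_intros)
 then show "(%r. \<kappa> r * y r) absolutely_integrable_on {s..t}" by (rule absolutely_integrable_continuous_real)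
 show "(%r. \<beta> r * p r) absolutely_integrable_on {s..t}"
  by (rule absolutely_integrable_mult_continuous[OF \<beta>_int[OF assms] cont_subset(1)[OF assms]])
qed

lemma ineq':
 assumes "0 < s" "s <= t" "t \<in> Ioo0 T"
 shows "p t - p s >= integral {s..t} (%r. \<kappa> r * y r) - integral {s..t} (%r. \<beta> r * p r)"
 using ineq[OF assms] ints[OF assms(1,3)] by (simp add: Henstock_Kurzweil_Integration.integral_diff absolutely_integrable_on_def)

lemma y_mono_if:
 assumes "!!r. r \<in> {s..t} ==> p r >= 0" "0 <= s" "s <= t" "t \<in> Ico0 T"
 shows "y s <= y t"
 using has_integral_nonneg[OF y_diff_integral[OF assms(2-4)] assms(1)] by simp

text \<open>At a first zero \<open>u\<close> of \<open>p\<close>, choose a left neighbourhood on which \<open>\<beta>\<close> has integral at most 1/2. From the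
 point where \<open>p\<close> is maximal there it can drop by at most half of the maximum before \<open>u\<close>, because \<open>\<kappa> y \<ge> 0\<close>.\<close>
lemma p_pos: "t \<in> Ico0 T ==> p t > 0"
proof (rule ccontr)
 assume t: "t \<in> Ico0 T" and np: "\<not> p t > 0"
 define Z where "Z = {x \<in> {0..t}. p x <= 0}"
 have ct: "continuous_on {0..t} p" using continuous_on_subset[OF p_cont Ico0_Icc[OF t]] by simp
 have "closed Z"
  unfolding Z_def using continuous_closed_preimage[OF ct, of "{..0}"] by (simp add: vimage_def Int_def conj_commute)
 moreover have "Z ~= {}" "bdd_below Z" using t np by (auto simp: Z_def Ico0_def)
 ultimately have ZI: "Inf Z \<in> Z" by (rule closed_contains_Inf[rotated 2])
 define u where "u = Inf Z"
 have u: "u \<in> {0..t}" "p u <= 0" using ZI by (auto simp: Z_def u_def)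
 have before: "p x > 0" if "0 <= x" "x < u" for x
 proof (rule ccontr)
  assume "\<not> p x > 0"
  then have "x \<in> Z" using that u by (auto simp: Z_def)
  then have "u <= x" unfolding u_def using \<open>bdd_below Z\<close> by (rule cInf_lower)
  then show False using that by simp
 qed
 have u0: "u > 0" using u p0 by (cases "u = 0") auto
 have uT: "u \<in> Ioo0 T" using u u0 t Ico0_Icc[OF t order_refl] by (auto simp: Ioo0_def Ico0_def subset_iff)
 have uI: "u \<in> Ico0 T" using uT Ioo0_subset by auto
 have pos_y: "y x > 0" if "0 <= x" "x <= u" for x
 proof -
  have "p r >= 0" if "r \<in> {0..x}" "x < u" for r using before[of r] that by auto
  then have lt: "y x > 0" if "0 <= x" "x < u" for x
   using y_mono_if[of 0 x] before that Ico0_Icc[OF uI order_refl] y0 by (force simp: subset_iff less_imp_le)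
  have "y u >= y 0"
  proof (rule ccontr)
   assume "\<not> y u >= y 0"
   have "EX z. z \<in> {0<..<u} & y u - y 0 = (u - 0) * p z"
    using mvt_simple[OF u0, of y "%x h. h * p x"] y_der Ico0_Icc[OF uI order_refl]
    by (metis DERIV_subset has_field_derivative_imp_has_derivative mult.commute atLeastAtMost_iff subsetD diff_zero has_field_derivative_def mult_commute_abs)
   then obtain z where z: "z \<in> {0<..<u}" "y u - y 0 = u * p z" by auto
   then have "u * p z > 0" using before[of z] u0 by (intro mult_pos_pos) auto
   then show False using z(2) \<open>\<not> y u >= y 0\<close> by linarith
  qed
  then show ?thesis using lt[of x] that y0 by (cases "x < u") auto
 qed
 obtain s where s: "0 < s" "s < u" "integral {s..u} (%r. \<bar>\<beta> r\<bar>) <= 1 / 2"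
 proof -
  define s0 where "s0 = u / 2"
  have s0: "0 < s0" "s0 < u" using u0 by (auto simp: s0_def)
  have i: "(%r. \<bar>\<beta> r\<bar>) integrable_on {s0..u}" using \<beta>_int[OF s0(1) uT] unfolding absolutely_integrable_on_def by simp
  have "continuous_on {s0..u} (%x. integral {x..u} (%r. \<bar>\<beta> r\<bar>))"
   by (rule indefinite_integral_continuous_1'[OF i])
  from this[unfolded continuous_on_def, THEN bspec, of u]
  have "((%x. integral {x..u} (%r. \<bar>\<beta> r\<bar>)) \<longlongrightarrow> integral {u..u} (%r. \<bar>\<beta> r\<bar>)) (at u within {s0..u})"
   using s0 by simp
  then have "\<forall>\<^sub>F x in at u within {s0..u}. integral {x..u} (%r. \<bar>\<beta> r\<bar>) < 1 / 2"
   by (rule order_tendstoD(2)) simp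
  then obtain d where d: "d > 0" "!!x. x \<in> {s0..u} ==> x ~= u ==> dist x u < d ==> integral {x..u} (%r. \<bar>\<beta> r\<bar>) < 1 / 2"
   unfolding eventually_at by blast
  define s where "s = max s0 (u - d / 2)"
  have "s \<in> {s0..u}" "s ~= u" "dist s u < d" using s0 d(1) by (auto simp: s_def dist_real_def max_def)
  from d(2)[OF this] show ?thesis using s0 d(1) by (intro that[of s]) (auto simp: s_def)
 qed
 have cs: "continuous_on {s..u} p" by (rule cont_subset(1)[OF s(1) uT])
 obtain x where x: "x \<in> {s..u}" "!!r. r \<in> {s..u} ==> p r <= p x"
  using continuous_attains_sup[OF _ _ cs] s by fastforce
 have px: "p x > 0" using x(2)[of s] before[of s] s by auto
 have nn: "p r >= 0" if "r \<in> {s..u}" "r < u" for r using before[of r] that s by auto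
 have pu: "p u = 0"
 proof -
  have "((%r. p r) \<longlongrightarrow> p u) (at_left u)"
   using cs s(2) by (simp add: continuous_on_Icc_at_leftD)
  moreover have "\<forall>\<^sub>F r in at_left u. p r >= 0"
   using eventually_at_left_real[OF s(2)] by eventually_elim (use nn in auto)
  ultimately have "p u >= 0" by (rule tendsto_lowerbound) simp
  then show ?thesis using u by simp
 qed
 have xs: "0 < x" "x <= u" using x s by auto
 have "p u - p x >= integral {x..u} (%r. \<kappa> r * y r) - integral {x..u} (%r. \<beta> r * p r)"
  by (rule ineq'[OF xs uT])
 moreover have "integral {x..u} (%r. \<kappa> r * y r) >= 0"
  using ints(1)[OF xs(1) uT] \<kappa>_nonneg pos_y Ioo0_Icc[OF uT xs(1)] xs
  by (intro integral_nonneg) (auto simp: absolutely_integrable_on_def subset_iff less_imp_le intro!: mult_nonneg_nonneg)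
 moreover have "\<bar>integral {x..u} (%r. \<beta> r * p r)\<bar> <= 1 / 2 * p x"
 proof (rule abs_integral_le_bound)
  show "\<beta> absolutely_integrable_on {x..u}" by (rule \<beta>_int[OF xs(1) uT])
  show "continuous_on {x..u} p" by (rule cont_subset(1)[OF xs(1) uT])
  show "\<bar>p r\<bar> <= p x" if "r \<in> {x..u}" for r
   using x(2)[of r] nn[of r] pu that x(1) px by (cases "r < u") auto
  have i: "(%r. \<bar>\<beta> r\<bar>) integrable_on {s..u}" using \<beta>_int[OF s(1) uT] unfolding absolutely_integrable_on_def by simp
  have "integral {x..u} (%r. \<bar>\<beta> r\<bar>) <= integral {s..u} (%r. \<bar>\<beta> r\<bar>)"
   using x(1) i by (intro integral_subset_le integrable_on_subinterval[OF i]) auto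
  then show "integral {x..u} (%r. \<bar>\<beta> r\<bar>) <= 1 / 2" using s(3) by simp
 qed (use px in simp)
 ultimately show False using pu px by (simp add: abs_le_iff)
qed

lemma y_mono: "0 <= s ==> s <= t ==> t \<in> Ico0 T ==> y s <= y t"
 using y_mono_if p_pos Ico0_Icc by (meson less_imp_le subsetD)

lemma y_ge: "t \<in> Ico0 T ==> y 0 <= y t"
 using y_mono[of 0 t] by (auto simp: Ico0_def)

lemma y_pos: "t \<in> Ico0 T ==> y t > 0" using y_ge y0 by fastforce

lemma ln_y_integral:
 assumes "0 < s" "s <= t" "t \<in> Ioo0 T"
 shows "((%r. p r / y r) has_integral (ln (y t) - ln (y s))) {s..t}"
proof (rule fundamental_theorem_of_calculus[OF assms(2)])
 fix x assume x: "x \<in> {s..t}"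
 have I: "{s..t} \<subseteq> Ico0 T" using Ioo0_Icc[OF assms(3,1)] Ioo0_subset by (rule subset_trans)
 have "(y has_real_derivative p x) (at x within {s..t})"
  by (rule DERIV_subset[OF y_der I]) (use x I in auto)
 moreover have "y x > 0" using y_pos x I by auto
 ultimately have "((%x. ln (y x)) has_real_derivative p x / y x) (at x within {s..t})"
  by (auto intro!: derivative_eq_intros simp: field_simps)
 then show "((%x. ln (y x)) has_vector_derivative p x / y x) (at x within {s..t})"
  by (simp add: has_real_derivative_iff_has_vector_derivative)
qed

text \<open>Here \<open>m\<close> is the positive root of \<open>m\<^sup>2 + 2 B m = \<kappa>\<close>, the growth rate for constant coefficients. The defect
 \<open>z = p - m y\<close> satisfies \<open>z' \<ge> - (B + m) z\<close> because \<open>m\<close> decreases. Once \<open>z \<ge> 0\<close>, this persists and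
 \<open>y' \<ge> m y\<close>. If \<open>z\<close> stays negative, it increases, the integral of \<open>m |z|\<close> is finite, and \<open>y\<close> loses
 only a bounded factor against \<open>exp (\<integral> m)\<close>.\<close>
lemma riccati_growth:
 fixes m m' :: "real => real"
 assumes m_der: "!!t. t \<in> Ioo0 T ==> (m has_real_derivative m' t) (at t)"
  and m'_le: "!!t. t \<in> Ioo0 T ==> m' t <= 0" and m_nonneg: "!!t. t \<in> Ioo0 T ==> m t >= 0"
  and B: "B >= 0" and \<kappa>m: "!!t. t \<in> Ioo0 T ==> \<kappa> t = (m t)^2 + 2 * B * m t"
  and \<beta>B: "AE t in lebesgue. t \<in> Ioo0 T --> \<bar>\<beta> t\<bar> <= B"
 shows "EX t0:Ioo0 T. EX D. ALL t:Ioo0 T. t0 <= t --> ln (y t) - ln (y t0) >= integral {t0..t} m - D"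
proof -
 define z where "z t = p t - m t * y t" for t
 have m_cont: "continuous_on (Ioo0 T) m"
  using m_der by (metis DERIV_isCont continuous_at_imp_continuous_on)
 have mc: "continuous_on {s..t} m" if "0 < s" "t \<in> Ioo0 T" for s t
  using continuous_on_subset[OF m_cont Ioo0_Icc[OF that(2,1)]] .
 have zc: "continuous_on {s..t} z" if "0 < s" "t \<in> Ioo0 T" for s t
  unfolding z_def using cont_subset[OF that] mc[OF that] by (intro continuous_intros)
 have pI: "p r > 0" "y r > 0" if "r \<in> Ioo0 T" for r using p_pos y_pos that Ioo0_subset by auto
 have z_ineq: "z t - z s >= integral {s..t} (%r. - (B + m r) * z r)" if st: "0 < s" "s <= t" "t \<in> Ioo0 T" for s t
 proof -
  note I = Ioo0_Icc[OF st(3,1)]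
  note c = cont_subset[OF st(1,3)] mc[OF st(1,3)]
  have fm: "((%r. m' r * y r + m r * p r) has_integral (m t * y t - m s * y s)) {s..t}"
  proof (rule fundamental_theorem_of_calculus[OF st(2)])
   fix x assume x: "x \<in> {s..t}"
   have "(y has_real_derivative p x) (at x within {s..t})"
    by (rule DERIV_subset[OF y_der]) (use x I Ioo0_subset[of T] in auto)
   moreover have "(m has_real_derivative m' x) (at x within {s..t})"
    by (rule DERIV_subset[OF m_der]) (use x I in auto)
   ultimately have "((%r. m r * y r) has_real_derivative m' x * y x + m x * p x) (at x within {s..t})"
    by (auto intro!: derivative_eq_intros)
   then show "((%r. m r * y r) has_vector_derivative m' x * y x + m x * p x) (at x within {s..t})"
    by (simp add: has_real_derivative_iff_has_vector_derivative)
  qed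
  have mp: "(%r. m r * p r) integrable_on {s..t}" by (intro integrable_continuous_real continuous_intros c)
  have le1: "m t * y t - m s * y s <= integral {s..t} (%r. m r * p r)"
  proof (rule has_integral_le[OF fm integrable_integral[OF mp]])
   fix r assume "r \<in> {s..t}"
   then have "r \<in> Ioo0 T" using I by auto
   then have "m' r * y r <= 0" using m'_le[of r] pI(2)[of r] by (simp add: mult_nonpos_nonneg)
   then show "m' r * y r + m r * p r <= m r * p r" by simp
  qed
  have Bp: "(%r. B * p r) absolutely_integrable_on {s..t}"
   by (intro absolutely_integrable_continuous_real continuous_intros c)
  have "integral {s..t} (%r. \<beta> r * p r) <= integral {s..t} (%r. B * p r)"
  proof (rule integral_mono_AE_real[OF ints(2)[OF st(1,3)] Bp])
   show "AE x in lebesgue. x \<in> {s..t} --> \<beta> x * p x <= B * p x"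
    using \<beta>B
   proof eventually_elim
    fix x assume x: "x \<in> Ioo0 T --> \<bar>\<beta> x\<bar> <= B"
    show "x \<in> {s..t} --> \<beta> x * p x <= B * p x"
    proof
     assume "x \<in> {s..t}"
     then have xI: "x \<in> Ioo0 T" using I by auto
     then have "\<beta> x <= B" using x by auto
     then show "\<beta> x * p x <= B * p x" using pI(1)[OF xI] by (intro mult_right_mono) auto
    qed
   qed
  qed
  then have "p t - p s >= integral {s..t} (%r. \<kappa> r * y r) - integral {s..t} (%r. B * p r)"
   using ineq'[OF st] by linarith
  then have "z t - z s >= integral {s..t} (%r. \<kappa> r * y r) - integral {s..t} (%r. B * p r) - integral {s..t} (%r. m r * p r)"
   using le1 unfolding z_def by linarith
  also have "integral {s..t} (%r. \<kappa> r * y r) - integral {s..t} (%r. B * p r) - integral {s..t} (%r. m r * p r)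
   = integral {s..t} (%r. \<kappa> r * y r - B * p r - m r * p r)"
   using c by (subst Henstock_Kurzweil_Integration.integral_diff; (subst Henstock_Kurzweil_Integration.integral_diff)?)
     (auto intro!: integrable_continuous_real continuous_intros)
  finally have "integral {s..t} (%r. \<kappa> r * y r - B * p r - m r * p r) <= z t - z s" .
  moreover have "integral {s..t} (%r. - (B + m r) * z r) <= integral {s..t} (%r. \<kappa> r * y r - B * p r - m r * p r)"
  proof (rule integral_le)
   show "(%r. - (B + m r) * z r) integrable_on {s..t}"
    by (intro integrable_continuous_real continuous_intros c zc st)
   show "(%r. \<kappa> r * y r - B * p r - m r * p r) integrable_on {s..t}"
    by (intro integrable_continuous_real continuous_intros c)
   fix r assume "r \<in> {s..t}"
   then have r: "r \<in> Ioo0 T" using I by auto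
   have "0 <= B * m r * y r" using B m_nonneg[OF r] pI(2)[OF r] by simp
   then show "- (B + m r) * z r <= \<kappa> r * y r - B * p r - m r * p r"
    unfolding z_def \<kappa>m[OF r] by (simp add: power2_eq_square algebra_simps)
  qed
  ultimately show ?thesis by linarith
 qed
 have ln_ge: "ln (y t) - ln (y s) >= integral {s..t} f" if st: "0 < s" "s <= t" "t \<in> Ioo0 T"
  and f: "continuous_on {s..t} f" "!!r. r \<in> {s..t} ==> f r <= p r / y r" for s t and f :: "real => real"
  using has_integral_le[OF integrable_integral[OF integrable_continuous_real[OF f(1)]] ln_y_integral[OF st]] f(2) by simp
 show ?thesis
 proof (cases "EX t1:Ioo0 T. z t1 >= 0")
  case True
  then obtain t1 where t1: "t1 \<in> Ioo0 T" "z t1 >= 0" by blast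
  then have t10: "t1 > 0" by (simp add: Ioo0_def)
  have z_nn: "z t >= 0" if t: "t \<in> Ioo0 T" "t1 <= t" for t
  proof (rule ccontr)
   assume neg: "\<not> z t >= 0"
   define A where "A = {x \<in> {t1..t}. z x >= 0}"
   have "closed A" unfolding A_def using continuous_closed_preimage[OF zc[OF t10 t(1)], of "{0..}"]
    by (simp add: vimage_def Int_def conj_commute)
   moreover have "A ~= {}" "bdd_above A" using t1 t by (auto simp: A_def)
   ultimately have SA: "Sup A \<in> A" by (rule closed_contains_Sup[rotated 2])
   define s where "s = Sup A"
   have s: "t1 <= s" "s <= t" "z s >= 0" using SA by (auto simp: A_def s_def)
   have st: "s < t" using s neg by (cases "s = t") auto
   have neg_after: "z x < 0" if "s < x" "x <= t" for x
   proof (rule ccontr)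
    assume "\<not> z x < 0"
    then have "x \<in> A" using that s by (auto simp: A_def)
    then have "x <= s" unfolding s_def using \<open>bdd_above A\<close> by (rule cSup_upper)
    then show False using that by simp
   qed
   have "z x <= z t" if x: "s < x" "x <= t" for x
   proof -
    have x0: "0 < x" using x s t10 by linarith
    have "integral {x..t} (%r. - (B + m r) * z r) >= 0"
    proof (rule integral_nonneg)
     show "(%r. - (B + m r) * z r) integrable_on {x..t}"
      by (intro integrable_continuous_real continuous_intros zc mc x0 t)
     fix r assume r: "r \<in> {x..t}"
     then have "r \<in> Ioo0 T" using Ioo0_Icc[OF t(1) x0] by auto
     then show "0 <= - (B + m r) * z r" using neg_after[of r] r x m_nonneg[of r] B
      by (intro mult_nonpos_nonpos) auto
    qed
    then show ?thesis using z_ineq[OF x0 x(2) t(1)] by linarith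
   qed
   then have "\<forall>\<^sub>F x in at_right s. z x <= z t"
    using eventually_at_right_real[OF st] by (rule eventually_mono[rotated]) auto
   moreover have "(z \<longlongrightarrow> z s) (at_right s)"
    using zc[of s t] s t10 t(1) st by (intro continuous_on_Icc_at_rightD) auto
   ultimately have "z s <= z t" using tendsto_upperbound by fastforce
   then show False using s neg by linarith
  qed
  show ?thesis
  proof (intro bexI[OF _ t1(1)] exI[of _ 0] ballI impI)
   fix t assume t: "t \<in> Ioo0 T" "t1 <= t"
   have "ln (y t) - ln (y t1) >= integral {t1..t} m"
   proof (rule ln_ge[OF t10 t(2,1) mc[OF t10 t(1)]])
    fix r assume r: "r \<in> {t1..t}"
    then have rI: "r \<in> Ioo0 T" using Ioo0_Icc[OF t(1) t10] by auto
    then show "m r <= p r / y r" using z_nn[OF rI] r pI(2)[OF rI] by (simp add: z_def pos_le_divide_eq)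
   qed
   then show "ln (y t) - ln (y t1) >= integral {t1..t} m - 0" by simp
  qed
 next
  case False
  then have zneg: "z t < 0" if "t \<in> Ioo0 T" for t using that by force
  obtain t0 where t0: "t0 \<in> Ioo0 T"
  proof (cases T)
   case (real r)
   then show ?thesis using T by (intro that[of "r / 2"]) (auto simp: Ioo0_eq zero_ereal_def)
  next
   case PInf
   then show ?thesis by (intro that[of 1]) (auto simp: Ioo0_eq)
  qed (use T in auto)
  then have t00: "t0 > 0" by (simp add: Ioo0_def)
  define p1 where "p1 = p t0"
  have p1: "p1 > 0" using pI[OF t0] by (simp add: p1_def)
  show ?thesis
  proof (intro bexI[OF _ t0] exI[of _ "- z t0 / p1"] ballI impI)
   fix t assume t: "t \<in> Ioo0 T" "t0 <= t"
   note I = Ioo0_Icc[OF t(1) t00]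
   have zint: "integral {t0..t} (%r. - m r * z r) <= - z t0"
   proof -
    have "integral {t0..t} (%r. - m r * z r) <= integral {t0..t} (%r. - (B + m r) * z r)"
    proof (rule integral_le)
     show "(%r. - m r * z r) integrable_on {t0..t}" "(%r. - (B + m r) * z r) integrable_on {t0..t}"
      by (intro integrable_continuous_real continuous_intros zc mc t00 t)+
     fix r assume "r \<in> {t0..t}"
     then have "B * z r <= 0" using zneg[of r] B I by (intro mult_nonneg_nonpos) (auto intro: less_imp_le)
     then show "- m r * z r <= - (B + m r) * z r" by (simp add: algebra_simps)
    qed
    then show ?thesis using z_ineq[OF t00 t(2,1)] zneg[OF t(1)] by linarith
   qed
   have p_ge: "p r >= p1" if r: "r \<in> {t0..t}" for r
   proof -
    have rI: "r \<in> Ioo0 T" using r I by auto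
    have zr: "z r - z t0 >= integral {t0..r} (%x. - (B + m x) * z x)" by (rule z_ineq) (use r t00 rI in auto)
    note I' = Ioo0_Icc[OF rI t00]
    have c: "continuous_on {t0..r} p" "continuous_on {t0..r} y" "continuous_on {t0..r} \<kappa>" "continuous_on {t0..r} m" "continuous_on {t0..r} z"
     using cont_subset[OF t00 rI] mc[OF t00 rI] zc[OF t00 rI] by auto
    have Bp: "(%r. B * p r) absolutely_integrable_on {t0..r}"
     by (intro absolutely_integrable_continuous_real continuous_intros c)
    have "integral {t0..r} (%r. \<beta> r * p r) <= integral {t0..r} (%r. B * p r)"
    proof (rule integral_mono_AE_real[OF ints(2)[OF t00 rI] Bp])
     show "AE x in lebesgue. x \<in> {t0..r} --> \<beta> x * p x <= B * p x"
      using \<beta>B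
     proof eventually_elim
      fix x assume x: "x \<in> Ioo0 T --> \<bar>\<beta> x\<bar> <= B"
      show "x \<in> {t0..r} --> \<beta> x * p x <= B * p x"
      proof
       assume "x \<in> {t0..r}"
       then have xI: "x \<in> Ioo0 T" using I' by auto
       then have "\<beta> x <= B" using x by auto
       then show "\<beta> x * p x <= B * p x" using pI(1)[OF xI] by (intro mult_right_mono) auto
      qed
     qed
    qed
    moreover have "integral {t0..r} (%r. B * p r) <= integral {t0..r} (%r. \<kappa> r * y r)"
    proof (rule integral_le)
     show "(%r. B * p r) integrable_on {t0..r}" "(%r. \<kappa> r * y r) integrable_on {t0..r}"
      by (intro integrable_continuous_real continuous_intros c)+
     fix x assume "x \<in> {t0..r}"
     then have x: "x \<in> Ioo0 T" using I' by auto
     have "p x <= m x * y x" using zneg[OF x] by (simp add: z_def)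
     then have "B * p x <= B * (m x * y x)" using B by (intro mult_left_mono) auto
     also have "... <= \<kappa> x * y x"
      unfolding \<kappa>m[OF x] using m_nonneg[OF x] pI(2)[OF x] B by (simp add: algebra_simps)
     finally show "B * p x <= \<kappa> x * y x" .
    qed
    ultimately show ?thesis using ineq'[of t0 r] r rI t00 by (simp add: p1_def)
   qed
   have c: "continuous_on {t0..t} m" "continuous_on {t0..t} z" by (rule mc zc, rule t00, rule t)+
   have "ln (y t) - ln (y t0) >= integral {t0..t} (%r. m r - (- m r * z r) / p1)"
   proof (rule ln_ge[OF t00 t(2,1)])
    show "continuous_on {t0..t} (%r. m r - (- m r * z r) / p1)" using p1 by (intro continuous_intros c) auto
    fix r assume r: "r \<in> {t0..t}"
    then have rI: "r \<in> Ioo0 T" using I by auto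
    have "p1 <= m r * y r" using p_ge[OF r] zneg[OF rI] by (simp add: z_def)
    then have "1 / y r <= m r / p1" using p1 pI(2)[OF rI] by (simp add: field_simps)
    then have "(- z r) * (1 / y r) <= (- z r) * (m r / p1)" using zneg[OF rI] by (intro mult_left_mono) auto
    moreover have "p r / y r = m r - (- z r) * (1 / y r)" using pI(2)[OF rI] by (simp add: z_def field_simps)
    ultimately show "m r - (- m r * z r) / p1 <= p r / y r" by (simp add: mult.commute)
   qed
   also have "integral {t0..t} (%r. m r - (- m r * z r) / p1) = integral {t0..t} m - integral {t0..t} (%r. - m r * z r) / p1"
    using c p1 by (subst Henstock_Kurzweil_Integration.integral_diff) (auto intro!: integrable_continuous_real continuous_intros)
   finally show "ln (y t) - ln (y t0) >= integral {t0..t} m - - z t0 / p1"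
    using divide_right_mono[OF zint, of p1] p1 by simp
  qed
 qed
qed

text \<open>Beyond a time after which \<open>\<integral> |\<beta>| \<le> 1/2\<close>, the damping can destroy at most half of the maximum of \<open>p\<close> on any
 interval. In one unit of time \<open>p\<close> reaches a multiple of \<open>\<kappa>0 y\<close>, in the next one \<open>y\<close> grows
 by a fixed factor, and this is iterated.\<close>
lemma exponential_growth:
 assumes TI: "T = \<infinity>" and \<beta>: "\<beta> absolutely_integrable_on {0<..}"
  and \<kappa>0: "\<kappa>0 > 0" and \<kappa>: "AE t in lebesgue. 0 < t --> \<kappa> t >= \<kappa>0"
 shows "EX T0>0. EX C>0. EX \<mu>>0. ALL t>T0. y t >= C * exp (\<mu> * t)"
proof -
 have inI: "t \<in> Ioo0 T" if "t > 0" for t using that TI by (simp add: Ioo0_eq)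
 have inJ: "t \<in> Ico0 T" if "t >= 0" for t using that TI by (simp add: Ico0_def)
 have \<beta>': "integrable lebesgue (%x. indicator {0<..} x * \<bar>\<beta> x\<bar>)"
  using set_integrable_abs[OF \<beta>] by (simp add: set_integrable_def)
 have "(%n. LINT x|lebesgue. indicator {real n..} x * (indicator {0<..} x * \<bar>\<beta> x\<bar>)) \<longlonglongrightarrow> (LINT x|(lebesgue :: real measure). 0)"
 proof (rule integral_dominated_convergence[OF _ _ \<beta>'])
  show "AE x in lebesgue. (%n. indicator {real n..} x * (indicator {0<..} x * \<bar>\<beta> x\<bar>)) \<longlonglongrightarrow> 0"
  proof (rule AE_I2)
   fix x :: real
   obtain N where N: "x < real N" using reals_Archimedean2 by blast
   have "\<forall>\<^sub>F n in sequentially. indicator {real n..} x * (indicator {0<..} x * \<bar>\<beta> x\<bar>) = 0"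
    using eventually_ge_at_top[of N] by eventually_elim (use N in auto)
   then show "(%n. indicator {real n..} x * (indicator {0<..} x * \<bar>\<beta> x\<bar>)) \<longlonglongrightarrow> 0" by (rule tendsto_eventually)
  qed
  show "(%x. indicator {real n..} x * (indicator {0<..} x * \<bar>\<beta> x\<bar>)) \<in> borel_measurable lebesgue" for n
   by (rule borel_measurable_times[OF borel_measurable_indicator borel_measurable_integrable[OF \<beta>']]) auto
  show "AE x in lebesgue. norm (indicator {real n..} x * (indicator {0<..} x * \<bar>\<beta> x\<bar>)) <= indicator {0<..} x * \<bar>\<beta> x\<bar>" for n
   by (intro AE_I2) (auto simp: indicator_def)
 qed simp
 then have "\<forall>\<^sub>F n in sequentially. (LINT x|lebesgue. indicator {real n..} x * (indicator {0<..} x * \<bar>\<beta> x\<bar>)) < 1 / 2"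
  by (rule order_tendstoD(2)) simp
 then obtain n where n: "(LINT x|lebesgue. indicator {real n..} x * (indicator {0<..} x * \<bar>\<beta> x\<bar>)) < 1 / 2"
  by (auto simp: eventually_sequentially)
 define T1 where "T1 = real n + 1"
 have T1: "T1 > 0" by (simp add: T1_def)
 have tail: "integral {s..t} (%r. \<bar>\<beta> r\<bar>) <= 1 / 2" if st: "T1 <= s" for s t
 proof -
  have sub: "{s..t} \<subseteq> {0<..}" using st T1 by auto
  have "(%r. \<bar>\<beta> r\<bar>) absolutely_integrable_on {s..t}"
   using set_integrable_subset[OF set_integrable_abs[OF \<beta>] _ sub] by simp
  then have "integral {s..t} (%r. \<bar>\<beta> r\<bar>) = (LINT x|lebesgue. indicator {s..t} x * \<bar>\<beta> x\<bar>)"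
   by (subst set_lebesgue_integral_eq_integral(2)[symmetric]) (auto simp: set_lebesgue_integral_def)
  also have "... <= (LINT x|lebesgue. indicator {real n..} x * (indicator {0<..} x * \<bar>\<beta> x\<bar>))"
  proof (rule integral_mono)
   show "integrable lebesgue (%x. indicator {s..t} x * \<bar>\<beta> x\<bar>)"
    using \<open>(%r. \<bar>\<beta> r\<bar>) absolutely_integrable_on {s..t}\<close> by (simp add: set_integrable_def)
   show "integrable lebesgue (%x. indicator {real n..} x * (indicator {0<..} x * \<bar>\<beta> x\<bar>))"
    using integrable_real_mult_indicator[OF _ \<beta>', of "{real n..}"] by (simp add: mult.commute)
   show "indicator {s..t} x * \<bar>\<beta> x\<bar> <= indicator {real n..} x * (indicator {0<..} x * \<bar>\<beta> x\<bar>)" for x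
    using st T1 by (auto simp: indicator_def T1_def)
  qed
  finally show ?thesis using n by simp
 qed
 have p_drop: "p t >= p u - 1 / 2 * M" if u: "T1 <= u" "u <= t" and M: "!!r. r \<in> {u..t} ==> p r <= M" for u t M
 proof -
  have u0: "0 < u" "0 < t" using u T1 by linarith+
  have "\<bar>integral {u..t} (%r. \<beta> r * p r)\<bar> <= 1 / 2 * M"
  proof (rule abs_integral_le_bound[OF \<beta>_int[OF u0(1) inI[OF u0(2)]] cont_subset(1)[OF u0(1) inI[OF u0(2)]] _ tail[OF u(1)]])
   show "\<bar>p r\<bar> <= M" if "r \<in> {u..t}" for r using M[OF that] p_pos[OF inJ, of r] that u0 by auto
   show "0 <= M" using M[of u] p_pos[OF inJ, of u] u u0 by auto
  qed
  moreover have "integral {u..t} (%r. \<kappa> r * y r) >= 0"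
  proof (rule integral_nonneg)
   show "(%r. \<kappa> r * y r) integrable_on {u..t}"
    using ints(1)[OF u0(1) inI[OF u0(2)]] by (simp add: absolutely_integrable_on_def)
   fix r assume "r \<in> {u..t}"
   then have "r > 0" using u0 by auto
   then show "0 <= \<kappa> r * y r" using \<kappa>_nonneg[OF inI, of r] y_pos[OF inJ, of r] by simp
  qed
  ultimately show ?thesis using ineq'[OF u0(1) u(2) inI[OF u0(2)]] by linarith
 qed
 have step: "y (s + 2) >= (1 + \<kappa>0 / 3) * y s" if s: "T1 <= s" for s
 proof -
  have s0: "0 < s" using s T1 by linarith
  have pc: "continuous_on {a..b} p" if "0 < a" for a b
  proof (cases "a <= b")
   case True then show ?thesis using cont_subset(1)[OF that inI] that by simp
  qed simp
  obtain u where u: "u \<in> {s..s+1}" "!!r. r \<in> {s..s+1} ==> p r <= p u"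
   using continuous_attains_sup[OF _ _ pc[OF s0], of "s + 1"] by fastforce
  have M1: "p u >= 2 / 3 * \<kappa>0 * y s"
  proof -
   have "\<bar>integral {s..s+1} (%r. \<beta> r * p r)\<bar> <= 1 / 2 * p u"
   proof (rule abs_integral_le_bound[OF \<beta>_int[OF s0 inI] pc[OF s0] _ tail[OF s]])
    show "\<bar>p r\<bar> <= p u" if "r \<in> {s..s+1}" for r using u(2)[OF that] p_pos[OF inJ, of r] that s0 by auto
    show "0 <= p u" using p_pos[OF inJ, of u] u s0 by auto
   qed (use s0 in simp)
   moreover have "integral {s..s+1} (%r. \<kappa>0 * y s) <= integral {s..s+1} (%r. \<kappa> r * y r)"
   proof (rule integral_mono_AE_real)
    show "(%r. \<kappa>0 * y s) absolutely_integrable_on {s..s+1}"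
     by (intro absolutely_integrable_continuous_real continuous_intros)
    show "(%r. \<kappa> r * y r) absolutely_integrable_on {s..s+1}" by (rule ints(1)[OF s0 inI]) (use s0 in simp)
    show "AE x in lebesgue. x \<in> {s..s+1} --> \<kappa>0 * y s <= \<kappa> x * y x"
     using \<kappa>
    proof eventually_elim
     fix x assume x: "0 < x --> \<kappa>0 <= \<kappa> x"
     show "x \<in> {s..s+1} --> \<kappa>0 * y s <= \<kappa> x * y x"
     proof
      assume xs: "x \<in> {s..s+1}"
      then have x0: "0 < x" using s0 by auto
      show "\<kappa>0 * y s <= \<kappa> x * y x"
       using x x0 xs s0 y_mono[of s x] inJ[of x] y_pos[OF inJ, of s] \<kappa>0 by (intro mult_mono) auto
     qed
    qed
   qed
   moreover have "p (s + 1) <= p u" using u(2)[of "s + 1"] by simp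
   moreover have "p s > 0" by (rule p_pos[OF inJ]) (use s0 in simp)
   moreover have "s + 1 \<in> Ioo0 T" by (rule inI) (use s0 in simp)
   ultimately show ?thesis using ineq'[of s "s + 1"] s0 by simp
  qed
  have late: "p t >= 1 / 3 * \<kappa>0 * y s" if t: "t \<in> {s+1..s+2}" for t
  proof -
   have ut: "u <= t" "T1 <= u" "0 < u" using u t s s0 by auto
   obtain w where w: "w \<in> {u..t}" "!!r. r \<in> {u..t} ==> p r <= p w"
    using continuous_attains_sup[OF _ _ pc[OF ut(3)], of t] ut by fastforce
   have "p t >= p w - 1 / 2 * p w"
    by (rule p_drop) (use w ut in auto)
   moreover have "p w >= p u" using w(2)[of u] ut by simp
   ultimately show ?thesis using M1 by linarith
  qed
  have "y (s + 2) - y (s + 1) >= 1 / 3 * \<kappa>0 * y s"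
  proof -
   have "integral {s+1..s+2} (%_. 1 / 3 * \<kappa>0 * y s) <= y (s + 2) - y (s + 1)"
    by (rule has_integral_le[OF integrable_integral y_diff_integral]) (use late s0 inJ in auto)
   then show ?thesis by simp
  qed
  moreover have "y (s + 1) >= y s" by (rule y_mono) (use s0 inJ in auto)
  ultimately show ?thesis by (simp add: algebra_simps)
 qed
 define q where "q = 1 + \<kappa>0 / 3"
 have q: "q > 1" using \<kappa>0 by (simp add: q_def)
 have iter: "y (T1 + 2 * real k) >= q ^ k * y T1" for k
 proof (induction k)
  case (Suc k)
  have "q ^ Suc k * y T1 = q * (q ^ k * y T1)" by simp
  also have "... <= q * y (T1 + 2 * real k)" using Suc q by (intro mult_left_mono) auto
  also have "... <= y (T1 + 2 * real k + 2)" unfolding q_def by (rule step) simp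
  finally show ?case by (simp add: algebra_simps)
 qed simp
 have yT1: "y T1 > 0" by (rule y_pos[OF inJ]) (use T1 in simp)
 define \<mu> where "\<mu> = ln q / 2"
 have \<mu>: "\<mu> > 0" using q by (simp add: \<mu>_def)
 have "ALL t>T1. y t >= y T1 * exp (- \<mu> * (T1 + 2)) * exp (\<mu> * t)"
 proof (intro allI impI)
  fix t assume t: "t > T1"
  define k where "k = nat \<lfloor>(t - T1) / 2\<rfloor>"
  have k: "real k <= (t - T1) / 2" "(t - T1) / 2 < real k + 1"
  proof -
   have "real k = of_int \<lfloor>(t - T1) / 2\<rfloor>" using t by (simp add: k_def)
   then show "real k <= (t - T1) / 2" "(t - T1) / 2 < real k + 1" using floor_correct[of "(t - T1) / 2"] by linarith+
  qed
  have "y T1 * exp (- \<mu> * (T1 + 2)) * exp (\<mu> * t) = exp (\<mu> * (t - T1 - 2)) * y T1"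
   by (simp add: algebra_simps flip: exp_add)
  also have "... <= exp (\<mu> * (2 * real k)) * y T1"
   using k \<mu> yT1 by (intro mult_right_mono) auto
  also have "exp (\<mu> * (2 * real k)) = q ^ k"
   using q by (simp add: \<mu>_def exp_of_nat_mult[symmetric] mult.commute flip: powr_realpow) (simp add: powr_def mult.commute)
  also have "q ^ k * y T1 <= y (T1 + 2 * real k)" by (rule iter)
  also have "... <= y t" using k T1 inJ by (intro y_mono) auto
  finally show "y t >= y T1 * exp (- \<mu> * (T1 + 2)) * exp (\<mu> * t)" .
 qed
 moreover have "y T1 * exp (- \<mu> * (T1 + 2)) > 0" using yT1 by simp
 ultimately show ?thesis using T1 \<mu> by blast
qed

end

section \<open>From distributional to integrated inequalities\<close>

lemma mollifier_minus: "mollifier n (- x) = mollifier n x"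
proof -
 have "bump (- a) = bump a" for a by (simp add: bump_def mult.commute)
 then show ?thesis by (simp add: mollifier_def bump_nd_def)
qed

lemma has_real_derivative_Ck:
 fixes f :: "real => real"
 assumes "Ck (Suc k) f" shows "(f has_real_derivative deriv f x) (at x)"
 using Ck_differentiable[OF assms] DERIV_deriv_iff_real_differentiable by blast

lemma Ck_deriv_real: "Ck (Suc k) f ==> Ck k (deriv f)" for f :: "real => real"
proof -
 assume f: "Ck (Suc k) f"
 have "deriv f = partial 1 f" using partial_real[OF Ck_differentiable[OF f]] by auto
 then show ?thesis using f by simp
qed

text \<open>The derivative of a mollified \<open>w 1\<^sub>[\<^sub>s\<^sub>,\<^sub>t\<^sub>]\<close> consists of approximate point masses at the end points and the mollified derivative.\<close>
lemma deriv_mollified_cutoff: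
 fixes w w' :: "real => real"
 assumes st: "s < t" and w: "!!x. x \<in> {s..t} ==> (w has_real_derivative w' x) (at x)" "!!x. x \<in> {s..t} ==> isCont w' x"
 shows "deriv (convolve (mollifier n) (%x. indicator {s..t} x * w x)) \<tau> =
  mollifier n (\<tau> - s) * w s - mollifier n (\<tau> - t) * w t + convolve (mollifier n) (%x. indicator {s..t} x * w' x) \<tau>"
proof -
 let ?\<rho> = "mollifier n :: real => real"
 have D: "(?\<rho> has_real_derivative deriv ?\<rho> x) (at x)" for x by (rule has_real_derivative_Ck[OF mollifier_Ck])
 have Dc: "continuous_on UNIV (deriv ?\<rho>)" using Ck_continuous[OF Ck_deriv_real[OF mollifier_Ck[of "Suc 0"]]] .
 have \<rho>c: "continuous_on UNIV ?\<rho>" by (rule Ck_continuous[OF mollifier_Ck[of 0]])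
 have wc: "continuous_on {s..t} w" using w(1) DERIV_isCont continuous_at_imp_continuous_on by blast
 have wc': "continuous_on {s..t} w'" using w(2) continuous_at_imp_continuous_on by blast
 have ui: "integrable lborel (%x. indicator {s..t} x * w x)"
  using borel_integrable_compact[OF _ wc] by simp
 have "deriv (convolve ?\<rho> (%x. indicator {s..t} x * w x)) \<tau> = partial 1 (convolve ?\<rho> (%x. indicator {s..t} x * w x)) \<tau>"
  by (rule partial_real[symmetric], rule Ck_differentiable, rule Ck_convolve[OF mollifier_Ck mollifier_supp ui])
 also have "... = convolve (partial 1 ?\<rho>) (%x. indicator {s..t} x * w x) \<tau>"
  by (subst partial_convolve[OF mollifier_Ck mollifier_supp ui]) auto
 also have "partial 1 ?\<rho> = deriv ?\<rho>" using partial_real[OF Ck_differentiable[OF mollifier_Ck]] by auto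
 finally have 1: "deriv (convolve ?\<rho> (%x. indicator {s..t} x * w x)) \<tau> = (LBINT y. deriv ?\<rho> (\<tau> - y) * (indicator {s..t} y * w y))"
  unfolding convolve_def[of "deriv ?\<rho>"] .
 have "(LBINT y. (deriv ?\<rho> (\<tau> - y) * w y - ?\<rho> (\<tau> - y) * w' y) * indicator {s..t} y) = - ?\<rho> (\<tau> - t) * w t - - ?\<rho> (\<tau> - s) * w s"
 proof (rule integral_FTC_Icc_real)
  fix y assume y: "s <= y" "y <= t"
  have "((%y. ?\<rho> (\<tau> - y)) has_real_derivative deriv ?\<rho> (\<tau> - y) * (- 1)) (at y)"
   by (rule DERIV_chain2[OF D]) (auto intro!: derivative_eq_intros)
  from DERIV_mult[OF DERIV_minus[OF this] w(1)[of y]] y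
  show "((%y. - ?\<rho> (\<tau> - y) * w y) has_real_derivative deriv ?\<rho> (\<tau> - y) * w y - ?\<rho> (\<tau> - y) * w' y) (at y)"
   by (simp add: algebra_simps)
  have "isCont (%y. deriv ?\<rho> (\<tau> - y)) y"
   using continuous_on_compose2[OF Dc, of UNIV "%y. \<tau> - y"] by (simp add: continuous_on_eq_continuous_at continuous_on_diff)
  moreover have "isCont (%y. ?\<rho> (\<tau> - y)) y"
   using continuous_on_compose2[OF \<rho>c, of UNIV "%y. \<tau> - y"] by (simp add: continuous_on_eq_continuous_at continuous_on_diff)
  ultimately show "isCont (%y. deriv ?\<rho> (\<tau> - y) * w y - ?\<rho> (\<tau> - y) * w' y) y"
   using DERIV_isCont[OF w(1)[of y]] w(2)[of y] y by (intro continuous_intros) auto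
 qed (use st in simp)
 moreover have "(LBINT y. (deriv ?\<rho> (\<tau> - y) * w y - ?\<rho> (\<tau> - y) * w' y) * indicator {s..t} y)
  = (LBINT y. deriv ?\<rho> (\<tau> - y) * (indicator {s..t} y * w y)) - (LBINT y. ?\<rho> (\<tau> - y) * (indicator {s..t} y * w' y))"
 proof -
  have "integrable lborel (%y. indicator {s..t} y *\<^sub>R (deriv ?\<rho> (\<tau> - y) * w y))"
   by (rule borel_integrable_compact) (auto intro!: continuous_intros wc continuous_on_compose2[OF Dc])
  moreover have "integrable lborel (%y. indicator {s..t} y *\<^sub>R (?\<rho> (\<tau> - y) * w' y))"
   by (rule borel_integrable_compact) (auto intro!: continuous_intros wc' continuous_on_compose2[OF \<rho>c])
  ultimately show ?thesis
   by (subst integral_minus[symmetric]) (auto simp: algebra_simps intro!: integral_eqI)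
 qed
 ultimately show ?thesis unfolding 1 convolve_def by simp
qed

text \<open>Test with mollifications of \<open>w\<close> cut off to \<open>[s,t]\<close>: the end point masses recover the boundary values of the continuous function \<open>F\<close>. The weight \<open>w\<close> serves to divide the equation by its leading coefficient.\<close>
lemma weak_to_integral:
 fixes F g w w' :: "real => real"
 assumes F: "continuous_on (Ioo0 T) F"
  and g: "!!s t. 0 < s ==> t \<in> Ioo0 T ==> g absolutely_integrable_on {s..t}"
  and w: "!!t. t \<in> Ioo0 T ==> (w has_real_derivative w' t) (at t)" "continuous_on (Ioo0 T) w'" "!!t. t \<in> Ioo0 T ==> w t >= 0"
  and weak: "!!\<eta>. \<eta> \<in> test_functions (Ioo0 T) ==> (!!x. \<eta> x >= 0) ==> 0 <= (LINT t:Ioo0 T|lebesgue. - F t * deriv \<eta> t - g t * \<eta> t)"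
  and st: "0 < s" "s < t" "t \<in> Ioo0 T"
 shows "integral {s..t} (%r. g r * w r + F r * w' r) <= w t * F t - w s * F s"
proof -
 obtain e0 where e0: "e0 > 0" "cball t e0 \<subseteq> Ioo0 T" using Ioo0_open st(3) open_contains_cball by blast
 define e where "e = min e0 (s / 2)"
 have e: "e > 0" "e <= s / 2" "e <= e0" using e0 st by (auto simp: e_def)
 have te: "t + e \<in> Ioo0 T" using e0 e by (auto simp: subset_iff dist_real_def)
 let ?J = "{s - e..t + e}"
 have J: "?J \<subseteq> Ioo0 T" by (rule Ioo0_Icc[OF te]) (use e st in simp)
 have sJ: "{s..t} \<subseteq> ?J" using e by auto
 have IsCw': "isCont w' x" if "x \<in> Ioo0 T" for x using w(2) Ioo0_open that continuous_on_eq_continuous_at by blast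
 have IsCF: "isCont F x" if "x \<in> Ioo0 T" for x using F Ioo0_open that continuous_on_eq_continuous_at by blast
 have wc: "continuous_on {s..t} w" using w(1) J sJ DERIV_isCont continuous_at_imp_continuous_on by (metis subsetD)
 have wc': "continuous_on {s..t} w'" using continuous_on_subset[OF w(2)] J sJ by blast
 have Fc: "continuous_on ?J F" by (rule continuous_on_subset[OF F J])
 define u where "u x = indicator {s..t} x * w x" for x
 define u' where "u' x = indicator {s..t} x * w' x" for x
 define Ft where "Ft x = indicator ?J x * F x" for x
 have ui: "integrable lborel u" and ui': "integrable lborel u'" and Fi: "integrable lborel Ft"
  using borel_integrable_compact[OF _ wc] borel_integrable_compact[OF _ wc'] borel_integrable_compact[OF _ Fc]
  by (simp_all add: u_def[abs_def] u'_def[abs_def] Ft_def[abs_def])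
 have [measurable]: "u \<in> borel_measurable borel" "u' \<in> borel_measurable borel" "Ft \<in> borel_measurable borel" using ui ui' Fi by auto
 have bnd: "EX C>=0. ALL x:A. \<bar>f x\<bar> <= C" if "continuous_on A f" "compact A" for f :: "real => real" and A
  using compact_imp_bounded[OF compact_continuous_image[OF that]] bounded_pos[of "f ` A"] by (auto intro: less_imp_le)
 obtain W where W: "W >= 0" "!!x. x \<in> {s..t} ==> \<bar>w x\<bar> <= W" using bnd[OF wc] by auto
 obtain W' where W': "W' >= 0" "!!x. x \<in> {s..t} ==> \<bar>w' x\<bar> <= W'" using bnd[OF wc'] by auto
 obtain M where M: "M >= 0" "!!x. x \<in> ?J ==> \<bar>F x\<bar> <= M" using bnd[OF Fc] by auto
 have ub: "\<bar>u x\<bar> <= W" "\<bar>u' x\<bar> <= W'" "\<bar>Ft x\<bar> <= M" for x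
  using W W' M by (auto simp: u_def u'_def Ft_def indicator_def)
 have stI: "{s..t} \<subseteq> Ioo0 T" using sJ J by (rule subset_trans)
 have u0: "u x >= 0" for x using w(3)[of x] subsetD[OF stI, of x] by (auto simp: u_def indicator_def)
 define \<eta> where "\<eta> n = convolve (mollifier n) u" for n :: nat
 define \<gamma> where "\<gamma> n = convolve (mollifier n) u'" for n :: nat
 have m1: "(LBINT x. \<bar>mollifier n (x::real)\<bar>) = 1" for n
  using mollifier_integral(2)[of n, where 'a=real] by (simp only: abs_of_nonneg[OF mollifier_nonneg])
 have \<eta>b: "\<bar>\<eta> n x\<bar> <= W" for n x
  using convolve_sup_bound[OF mollifier_integral(1)[of n], of u W x] ub(1) m1[of n] by (simp add: \<eta>_def)
 have \<gamma>b: "\<bar>\<gamma> n x\<bar> <= W'" for n x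
  using convolve_sup_bound[OF mollifier_integral(1)[of n], of u' W' x] ub(2) m1[of n] by (simp add: \<gamma>_def)
 have \<eta>Ck: "Ck k (\<eta> n)" for k n unfolding \<eta>_def by (rule Ck_convolve[OF mollifier_Ck mollifier_supp ui])
 have \<eta>0: "\<eta> n x >= 0" for n x unfolding \<eta>_def convolve_def
  by (intro integral_ge_0 mult_nonneg_nonneg mollifier_nonneg u0)
 have deta: "deriv (\<eta> n) \<tau> = mollifier n (\<tau> - s) * w s - mollifier n (\<tau> - t) * w t + \<gamma> n \<tau>" for n \<tau>
  unfolding \<eta>_def \<gamma>_def u_def[abs_def] u'_def[abs_def]
  by (rule deriv_mollified_cutoff[OF st(2)]) (use w(1) IsCw' subsetD[OF stI] in auto)
 define gt where "gt x = indicator ?J x * g x" for x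
 have gti: "integrable lebesgue gt"
  using g[of "s - e", OF _ te] e st by (simp add: set_integrable_def gt_def[abs_def])
 have out: "\<eta> n x = 0" "deriv (\<eta> n) x = 0" if n: "1 / real (Suc n) < e" and x: "x \<notin> ?J" for n x
 proof -
  have z: "\<eta> n x = 0" if "x \<notin> ?J" for x
  proof -
   have "mollifier n (x - y) * u y = 0" for y
   proof (cases "y \<in> {s..t}")
    case True
    then have "norm (x - y) > real DIM(real) / real (Suc n)" using that n by auto
    from supp_ballD[OF mollifier_supp this] show ?thesis by simp
   qed (simp add: u_def)
   then have "(%y. mollifier n (x - y) * u y) = (%y. 0)" by blast
   then show ?thesis by (simp add: \<eta>_def convolve_def)
  qed
  show "\<eta> n x = 0" by (rule z[OF x])
  have "open (- ?J)" by auto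
  moreover have "((%x. 0) has_real_derivative 0) (at x)" by simp
  ultimately have "(\<eta> n has_real_derivative 0) (at x)"
   using has_field_derivative_transform_within_open[of "%x. 0" 0 x "- ?J" "\<eta> n"] x z by auto
  then show "deriv (\<eta> n) x = 0" by (rule DERIV_imp_deriv)
 qed
 have tf: "\<eta> n \<in> test_functions (Ioo0 T)" if n: "1 / real (Suc n) < e" for n
  unfolding test_functions_def using \<eta>Ck out(1)[OF n] J by (auto intro!: exI[of _ ?J])
 have ic: "integrable lborel (%\<tau>. mollifier n (\<tau> - a) * Ft \<tau>)" "(LBINT \<tau>. mollifier n (\<tau> - a) * Ft \<tau>) = convolve (mollifier n) Ft a" for n a
 proof -
  have eq: "mollifier n (\<tau> - a) = mollifier n (a - \<tau>)" for \<tau> using mollifier_minus[of n "a - \<tau>"] by simp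
  show "integrable lborel (%\<tau>. mollifier n (\<tau> - a) * Ft \<tau>)"
   unfolding eq by (rule convolve_integrable[OF Ck_continuous[OF mollifier_Ck[of 0]] mollifier_supp Fi])
  show "(LBINT \<tau>. mollifier n (\<tau> - a) * Ft \<tau>) = convolve (mollifier n) Ft a" unfolding convolve_def eq ..
 qed
 have \<gamma>m[measurable]: "\<gamma> n \<in> borel_measurable borel" for n
  unfolding \<gamma>_def using borel_measurable_integrable[OF convolve_L1_bound(1)[OF mollifier_integral(1) ui']] by simp
 have \<eta>m: "\<eta> n \<in> borel_measurable lebesgue" for n
  using borel_measurable_continuous_onI[OF Ck_continuous[OF \<eta>Ck[of 0]]] measurable_completion[of "\<eta> n" lborel] by simp
 have iF\<gamma>: "integrable lborel (%\<tau>. Ft \<tau> * \<gamma> n \<tau>)" for n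
  by (rule integrable_le[OF integrable_mult_right[OF integrable_abs[OF Fi], of W']])
    (use \<gamma>b W' in \<open>auto simp: abs_mult mult.commute[of W'] intro!: mult_left_mono\<close>)
 have ig\<eta>: "integrable lebesgue (%\<tau>. gt \<tau> * \<eta> n \<tau>)" for n
 proof (rule integrable_le[OF integrable_mult_right[OF integrable_abs[OF gti], of W]])
  show "(%\<tau>. gt \<tau> * \<eta> n \<tau>) \<in> borel_measurable lebesgue" using gti \<eta>m by (intro borel_measurable_times) auto
  show "AE \<tau> in lebesgue. norm (gt \<tau> * \<eta> n \<tau>) <= norm (W * \<bar>gt \<tau>\<bar>)"
   using \<eta>b[of n] W(1) by (intro AE_I2) (auto simp: abs_mult mult.commute[of W] intro!: mult_left_mono)
 qed
 have val: "0 <= w t * convolve (mollifier n) Ft t - w s * convolve (mollifier n) Ft s - (LBINT \<tau>. Ft \<tau> * \<gamma> n \<tau>) - (LINT \<tau>|lebesgue. gt \<tau> * \<eta> n \<tau>)"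
  if n: "1 / real (Suc n) < e" for n
 proof -
  let ?h = "%\<tau>. w t * (mollifier n (\<tau> - t) * Ft \<tau>) - w s * (mollifier n (\<tau> - s) * Ft \<tau>) - Ft \<tau> * \<gamma> n \<tau>"
  have hi: "integrable lborel ?h" using ic iF\<gamma> by auto
  then have hi': "integrable lebesgue ?h" using integrable_completion[of ?h lborel] by auto
  have "0 <= (LINT \<tau>:Ioo0 T|lebesgue. - F \<tau> * deriv (\<eta> n) \<tau> - g \<tau> * \<eta> n \<tau>)"
   by (rule weak[OF tf[OF n] \<eta>0])
  also have "... = (LINT \<tau>|lebesgue. ?h \<tau> - gt \<tau> * \<eta> n \<tau>)"
   unfolding set_lebesgue_integral_def
  proof (rule integral_eqI[OF refl])
   fix \<tau>
   show "indicator (Ioo0 T) \<tau> *\<^sub>R (- F \<tau> * deriv (\<eta> n) \<tau> - g \<tau> * \<eta> n \<tau>) = ?h \<tau> - gt \<tau> * \<eta> n \<tau>"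
   proof (cases "\<tau> \<in> ?J")
    case True
    then have "\<tau> \<in> Ioo0 T" using J by (rule subsetD[rotated])
    with True show ?thesis unfolding deta by (simp add: Ft_def gt_def algebra_simps)
   next
    case False
    then show ?thesis using out[OF n False] by (simp add: Ft_def gt_def)
   qed
  qed
  also have "... = (LINT \<tau>|lebesgue. ?h \<tau>) - (LINT \<tau>|lebesgue. gt \<tau> * \<eta> n \<tau>)"
   using hi' ig\<eta> by simp
  also have "(LINT \<tau>|lebesgue. ?h \<tau>) = (LBINT \<tau>. ?h \<tau>)" by (rule integral_completion) (use hi in auto)
  also have "... = w t * convolve (mollifier n) Ft t - w s * convolve (mollifier n) Ft s - (LBINT \<tau>. Ft \<tau> * \<gamma> n \<tau>)"
   using ic iF\<gamma> by simp
  finally show ?thesis .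
 qed
 have Ft_cont: "isCont Ft a" if "a \<in> {s..t}" for a
 proof -
  have "isCont F a" using IsCF subsetD[OF stI that] by auto
  moreover have "\<forall>\<^sub>F x in nhds a. Ft x = F x"
   using eventually_nhds_in_open[of "{s - e<..<t + e}" a] that e by (auto simp: Ft_def elim!: eventually_mono)
  ultimately show ?thesis by (simp add: isCont_cong)
 qed
 have Ft_val: "Ft a = F a" if "a \<in> {s..t}" for a using that sJ by (auto simp: Ft_def)
 have cutoff_cont: "isCont (%x. indicator {s..t} x * f x) x" if "x ~= s" "x ~= t" "!!x. x \<in> {s..t} ==> isCont f x" for f :: "real => real" and x
 proof (cases "x \<in> {s..t}")
  case True
  then have "\<forall>\<^sub>F y in nhds x. indicator {s..t} y * f y = f y"
   using eventually_nhds_in_open[of "{s<..<t}" x] that by (auto elim!: eventually_mono)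
  from isCont_cong[OF this] show ?thesis using that(3)[OF True] by simp
 next
  case False
  then have "\<forall>\<^sub>F y in nhds x. y \<in> - {s..t}"
   by (intro eventually_nhds_in_open) (auto intro: open_Compl)
  then have "\<forall>\<^sub>F y in nhds x. indicator {s..t} y * f y = 0"
   by eventually_elim auto
  from isCont_cong[OF this] show ?thesis by simp
 qed
 have null: "AE x in lborel. x ~= s & x ~= t" using AE_lborel_singleton[of s] AE_lborel_singleton[of t] by eventually_elim auto
 have L1: "(%n. convolve (mollifier n) Ft t) \<longlonglongrightarrow> F t" "(%n. convolve (mollifier n) Ft s) \<longlonglongrightarrow> F s"
  using convolve_mollifier_tendsto[OF Fi Ft_cont, of t] convolve_mollifier_tendsto[OF Fi Ft_cont, of s] st by (auto simp: Ft_val)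
 have L2: "(%n. LBINT \<tau>. Ft \<tau> * \<gamma> n \<tau>) \<longlonglongrightarrow> (LBINT \<tau>. Ft \<tau> * u' \<tau>)"
 proof (rule integral_dominated_convergence[where w="%\<tau>. \<bar>Ft \<tau>\<bar> * W'"])
  show "AE \<tau> in lborel. (%n. Ft \<tau> * \<gamma> n \<tau>) \<longlonglongrightarrow> Ft \<tau> * u' \<tau>"
   using null
  proof eventually_elim
   fix x assume "x ~= s & x ~= t"
   then have "isCont u' x" unfolding u'_def[abs_def] by (intro cutoff_cont) (use IsCw' subsetD[OF stI] in auto)
   then show "(%n. Ft x * \<gamma> n x) \<longlonglongrightarrow> Ft x * u' x"
    unfolding \<gamma>_def by (intro tendsto_intros convolve_mollifier_tendsto ui')
  qed
 qed (use Fi \<gamma>b in \<open>auto simp: abs_mult intro!: mult_left_mono\<close>)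
 have L3: "(%n. LINT \<tau>|lebesgue. gt \<tau> * \<eta> n \<tau>) \<longlonglongrightarrow> (LINT \<tau>|lebesgue. gt \<tau> * u \<tau>)"
 proof (rule integral_dominated_convergence[where w="%\<tau>. \<bar>gt \<tau>\<bar> * W"])
  show "(%\<tau>. gt \<tau> * u \<tau>) \<in> borel_measurable lebesgue"
   by (rule borel_measurable_times[OF borel_measurable_integrable[OF gti]], rule measurable_completion) simp
  show "(%\<tau>. gt \<tau> * \<eta> n \<tau>) \<in> borel_measurable lebesgue" for n using ig\<eta>[of n] by auto
  show "AE \<tau> in lebesgue. (%n. gt \<tau> * \<eta> n \<tau>) \<longlonglongrightarrow> gt \<tau> * u \<tau>"
   using AE_completion[OF null]
  proof eventually_elim
   fix x assume "x ~= s & x ~= t"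
   then have "isCont u x" unfolding u_def[abs_def] by (intro cutoff_cont) (use w(1) DERIV_isCont subsetD[OF stI] in blast)+
   then show "(%n. gt x * \<eta> n x) \<longlonglongrightarrow> gt x * u x"
    unfolding \<eta>_def by (intro tendsto_intros convolve_mollifier_tendsto ui)
  qed
  show "AE \<tau> in lebesgue. norm (gt \<tau> * \<eta> n \<tau>) <= \<bar>gt \<tau>\<bar> * W" for n
   using \<eta>b[of n] by (intro AE_I2) (auto simp: abs_mult intro!: mult_left_mono)
 qed (use gti in auto)
 have "(%n. w t * convolve (mollifier n) Ft t - w s * convolve (mollifier n) Ft s - (LBINT \<tau>. Ft \<tau> * \<gamma> n \<tau>) - (LINT \<tau>|lebesgue. gt \<tau> * \<eta> n \<tau>))
  \<longlonglongrightarrow> w t * F t - w s * F s - (LBINT \<tau>. Ft \<tau> * u' \<tau>) - (LINT \<tau>|lebesgue. gt \<tau> * u \<tau>)"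
  by (intro tendsto_intros L1 L2 L3)
 moreover have "\<forall>\<^sub>F n in sequentially. 0 <= w t * convolve (mollifier n) Ft t - w s * convolve (mollifier n) Ft s - (LBINT \<tau>. Ft \<tau> * \<gamma> n \<tau>) - (LINT \<tau>|lebesgue. gt \<tau> * \<eta> n \<tau>)"
 proof -
  have "\<forall>\<^sub>F n in sequentially. 1 / real (Suc n) < e" using order_tendstoD(2)[OF LIMSEQ_Suc[OF lim_1_over_n] e(1)] by simp
  then show ?thesis by eventually_elim (rule val)
 qed
 ultimately have main: "0 <= w t * F t - w s * F s - (LBINT \<tau>. Ft \<tau> * u' \<tau>) - (LINT \<tau>|lebesgue. gt \<tau> * u \<tau>)"
  using tendsto_lowerbound[OF _ _ sequentially_bot] by blast
 have c: "continuous_on {s..t} (%r. F r * w' r)" by (intro continuous_intros continuous_on_subset[OF Fc sJ] wc')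
 then have a1: "(%r. F r * w' r) absolutely_integrable_on {s..t}" by (rule absolutely_integrable_continuous_real)
 have a2: "(%r. g r * w r) absolutely_integrable_on {s..t}" by (rule absolutely_integrable_mult_continuous[OF g[OF st(1,3)] wc])
 have "(LBINT \<tau>. Ft \<tau> * u' \<tau>) = (LINT \<tau>|lebesgue. Ft \<tau> * u' \<tau>)" by (rule integral_completion[symmetric]) measurable
 also have "... = (LINT r:{s..t}|lebesgue. F r * w' r)"
  unfolding set_lebesgue_integral_def using sJ by (intro integral_eqI) (auto simp: Ft_def u'_def indicator_def)
 also have "... = integral {s..t} (%r. F r * w' r)" by (rule set_lebesgue_integral_eq_integral(2)[OF a1])
 finally have e1: "(LBINT \<tau>. Ft \<tau> * u' \<tau>) = integral {s..t} (%r. F r * w' r)" .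
 have "(LINT \<tau>|lebesgue. gt \<tau> * u \<tau>) = (LINT r:{s..t}|lebesgue. g r * w r)"
  unfolding set_lebesgue_integral_def using sJ by (intro integral_eqI) (auto simp: gt_def u_def indicator_def)
 also have "... = integral {s..t} (%r. g r * w r)" by (rule set_lebesgue_integral_eq_integral(2)[OF a2])
 finally have e2: "(LINT \<tau>|lebesgue. gt \<tau> * u \<tau>) = integral {s..t} (%r. g r * w r)" .
 have "integral {s..t} (%r. g r * w r + F r * w' r) = integral {s..t} (%r. g r * w r) + integral {s..t} (%r. F r * w' r)"
  using a1 a2 by (intro Henstock_Kurzweil_Integration.integral_add) (auto simp: absolutely_integrable_on_def)
 then show ?thesis using main e1 e2 by linarith
qed

section \<open>Testing the perturbation equation with products\<close>

lemma integrable_lebesgue_sections: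
 fixes f :: "'a::euclidean_space \<times> 'b::euclidean_space => real"
 assumes f: "integrable lebesgue f"
 shows "AE t in lebesgue. integrable lebesgue (%x. f (t, x))"
  and "integrable lebesgue (%t. LINT x|lebesgue. f (t, x))"
proof -
 obtain g where g: "g \<in> borel_measurable lborel" "AE p in lborel. f p = g p"
  using completion_ex_borel_measurable_real[of f lborel] f by auto
 have "integrable lebesgue g"
  using f by (rule integrable_cong_AE_imp) (use AE_completion[OF g(2)] measurable_completion[OF g(1)] in auto)
 then have "integrable lborel g" using integrable_completion[OF g(1)] by simp
 then have gi: "integrable (lborel \<Otimes>\<^sub>M lborel) g" by (simp add: lborel_prod)
 have "AE p in lborel \<Otimes>\<^sub>M lborel. f p = g p" unfolding lborel_prod by (rule g(2))
 then have 1: "AE t in lborel. AE x in lborel. f (t, x) = g (t, x)" by (rule lborel_pair.AE_pair)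
 have 2: "AE t in lborel. integrable lborel (%x. g (t, x))" by (rule lborel_pair.AE_integrable_fst'[OF gi])
 have sec: "integrable lebesgue (%x. f (t, x)) & (LINT x|lebesgue. f (t, x)) = (LBINT x. g (t, x))"
  if a: "AE x in lborel. f (t, x) = g (t, x)" and i: "integrable lborel (%x. g (t, x))" for t
 proof -
  have gm: "(%x. g (t, x)) \<in> borel_measurable lborel" using i by auto
  have gi': "integrable lebesgue (%x. g (t, x))" using i integrable_completion[OF gm] by simp
  have a': "AE x in lebesgue. g (t, x) = f (t, x)" using AE_completion[OF a] by eventually_elim simp
  have fm: "(%x. f (t, x)) \<in> borel_measurable lebesgue"
   by (rule borel_measurable_AE[OF _ a']) (use gi' in auto)
  have "integrable lebesgue (%x. f (t, x))" by (rule integrable_cong_AE_imp[OF gi' fm a'])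
  moreover have "(LINT x|lebesgue. f (t, x)) = (LINT x|lebesgue. g (t, x))"
   using a' fm gi' by (intro integral_cong_AE) (auto elim: eventually_mono)
  ultimately show ?thesis using integral_completion[OF gm] by simp
 qed
 have 3: "AE t in lborel. integrable lebesgue (%x. f (t, x)) & (LINT x|lebesgue. f (t, x)) = (LBINT x. g (t, x))"
  using 1 2 by eventually_elim (rule sec)
 show "AE t in lebesgue. integrable lebesgue (%x. f (t, x))"
  using AE_completion[OF 3] by eventually_elim simp
 have i: "integrable lborel (%t. LBINT x. g (t, x))" by (rule lborel_pair.integrable_fst'[OF gi])
 then have i': "integrable lebesgue (%t. LBINT x. g (t, x))" using integrable_completion by auto
 have a: "AE t in lebesgue. (LBINT x. g (t, x)) = (LINT x|lebesgue. f (t, x))"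
  using AE_completion[OF 3] by eventually_elim simp
 show "integrable lebesgue (%t. LINT x|lebesgue. f (t, x))"
  by (rule integrable_cong_AE_imp[OF i' _ a]) (rule borel_measurable_AE[OF _ a], use i' in auto)
qed

lemma product_test_function:
 assumes \<eta>: "\<eta> \<in> test_functions I" and \<xi>: "\<xi> \<in> test_functions UNIV"
 shows "(%p. \<eta> (fst p) * \<xi> (snd p)) \<in> test_functions (I \<times> UNIV)"
proof -
 obtain K1 where K1: "compact K1" "K1 \<subseteq> I" "!!x. x \<notin> K1 ==> \<eta> x = 0" using \<eta> by (auto simp: test_functions_def)
 obtain K2 where K2: "compact K2" "!!x. x \<notin> K2 ==> \<xi> x = 0" using \<xi> by (auto simp: test_functions_def)
 have "Ck k (%p. \<eta> (fst p) * \<xi> (snd p))" for k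
 proof (rule Ck_mult)
  show "Ck k (%p. \<eta> (fst p))" using Ck_compose_affine[OF bounded_linear_fst, of k \<eta> 0] \<eta> by (simp add: test_functions_def)
  show "Ck k (%p. \<xi> (snd p))" using Ck_compose_affine[OF bounded_linear_snd, of k \<xi> 0] \<xi> by (simp add: test_functions_def)
 qed
 moreover have "EX K. compact K & K \<subseteq> I \<times> UNIV & (ALL p. p \<notin> K --> \<eta> (fst p) * \<xi> (snd p) = 0)"
  using K1 K2 by (intro exI[of _ "K1 \<times> K2"]) (auto simp: compact_Times mem_Times_iff)
 ultimately show ?thesis by (simp add: test_functions_def)
qed

lemma test_functions_supp_ball:
 assumes "\<xi> \<in> test_functions S"
 obtains R where "supp_ball R \<xi>"
proof -
 obtain K where K: "compact K" "!!x. x \<notin> K ==> \<xi> x = 0" using assms by (auto simp: test_functions_def)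
 then obtain R where "!!x. x \<in> K ==> norm x <= R" using compact_imp_bounded bounded_iff by metis
 then have "supp_ball R \<xi>" unfolding supp_ball_def using K(2) by force
 then show ?thesis by (rule that)
qed

text \<open>For nonnegative product test functions the convexity inequality \<open>e\<^sup>u - e\<^sup>v \<ge> e\<^sup>v (u - v)\<close> turns the nonlinear equation into a linear differential inequality in time for the spatial averages.\<close>
lemma perturbation_weak_inequality:
 fixes v \<xi> :: "real^2 => real" and \<eta> :: "real => real"
 assumes pe: "perturbation_eq T a b v u wt"
  and vc: "continuous_on UNIV v"
  and \<eta>: "\<eta> \<in> test_functions (Ioo0 T)" "!!t. \<eta> t >= 0"
  and \<xi>: "\<xi> \<in> test_functions UNIV" "!!x. \<xi> x >= 0"
  and int: "!!t. t \<in> Ioo0 T ==> integrable lebesgue (%x. \<xi> x * wt t x)"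
   "!!t. t \<in> Ioo0 T ==> integrable lebesgue (%x. laplacian \<xi> x * (u t x - v x))"
   "!!t. t \<in> Ioo0 T ==> integrable lebesgue (%x. exp (v x) * \<xi> x * (u t x - v x))"
  and Vi: "set_integrable lebesgue (Ioo0 T) (%t. \<eta> t * (LINT x|lebesgue. exp (v x) * \<xi> x * (u t x - v x)))"
 shows "(LINT t:Ioo0 T|lebesgue. \<eta> t * (LINT x|lebesgue. exp (v x) * \<xi> x * (u t x - v x))) \<le>
  (LINT t:Ioo0 T|lebesgue. - (LINT x|lebesgue. \<xi> x * wt t x) * (deriv a t * \<eta> t + a t * deriv \<eta> t)
   + b t * (LINT x|lebesgue. \<xi> x * wt t x) * \<eta> t - \<eta> t * (LINT x|lebesgue. laplacian \<xi> x * (u t x - v x)))"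
proof -
 let ?\<psi> = "%p. \<eta> (fst p) * \<xi> (snd p)"
 have \<eta>Ck: "Ck k \<eta>" and \<xi>Ck: "Ck k \<xi>" for k using \<eta> \<xi> by (auto simp: test_functions_def)
 obtain K1 where K1: "compact K1" "K1 \<subseteq> Ioo0 T" "!!t. t \<notin> K1 ==> \<eta> t = 0" using \<eta> by (auto simp: test_functions_def)
 obtain K2 where K2: "compact K2" "!!x. x \<notin> K2 ==> \<xi> x = 0" using \<xi> by (auto simp: test_functions_def)
 have eq: "(LINT t:Ioo0 T|lebesgue. LINT x|lebesgue.
      - wt t x * (deriv a t * ?\<psi> (t, x) + a t * deriv (%s. ?\<psi> (s, x)) t)
      + b t * wt t x * ?\<psi> (t, x)
      - (u t x - v x) * laplacian (%y. ?\<psi> (t, y)) x) =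
    (LINT t:Ioo0 T|lebesgue. LINT x|lebesgue. (exp (u t x) - exp (v x)) * ?\<psi> (t, x))"
  by (rule bspec[OF conjunct2[OF pe[unfolded perturbation_eq_def]] product_test_function[OF \<eta>(1) \<xi>(1)]])
 have lhs: "(LINT x|lebesgue. - wt t x * (deriv a t * ?\<psi> (t, x) + a t * deriv (%s. ?\<psi> (s, x)) t)
      + b t * wt t x * ?\<psi> (t, x) - (u t x - v x) * laplacian (%y. ?\<psi> (t, y)) x) =
   - (LINT x|lebesgue. \<xi> x * wt t x) * (deriv a t * \<eta> t + a t * deriv \<eta> t)
   + b t * (LINT x|lebesgue. \<xi> x * wt t x) * \<eta> t - \<eta> t * (LINT x|lebesgue. laplacian \<xi> x * (u t x - v x))"
  if t: "t \<in> Ioo0 T" for t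
 proof -
  let ?c = "- (deriv a t * \<eta> t + a t * deriv \<eta> t) + b t * \<eta> t"
  have d: "deriv (%s. \<eta> s * \<xi> x) t = deriv \<eta> t * \<xi> x" for x
  proof -
   have "(\<eta> has_real_derivative deriv \<eta> t) (at t)"
    using Ck_differentiable[OF \<eta>Ck] DERIV_deriv_iff_real_differentiable by blast
   then have "((%s. \<eta> s * \<xi> x) has_real_derivative deriv \<eta> t * \<xi> x) (at t)" by (rule DERIV_cmult_right)
   then show ?thesis by (rule DERIV_imp_deriv)
  qed
  have "(LINT x|lebesgue. - wt t x * (deriv a t * ?\<psi> (t, x) + a t * deriv (%s. ?\<psi> (s, x)) t)
      + b t * wt t x * ?\<psi> (t, x) - (u t x - v x) * laplacian (%y. ?\<psi> (t, y)) x)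
   = (LINT x|lebesgue. ?c * (\<xi> x * wt t x) - \<eta> t * (laplacian \<xi> x * (u t x - v x)))"
   by (intro integral_eqI) (simp_all add: d laplacian_cmult[OF \<xi>Ck] algebra_simps)
  also have "... = ?c * (LINT x|lebesgue. \<xi> x * wt t x) - \<eta> t * (LINT x|lebesgue. laplacian \<xi> x * (u t x - v x))"
   using int(1,2)[OF t] by simp
  finally show ?thesis by (simp add: algebra_simps)
 qed
 have "(LINT t:Ioo0 T|lebesgue. - (LINT x|lebesgue. \<xi> x * wt t x) * (deriv a t * \<eta> t + a t * deriv \<eta> t)
   + b t * (LINT x|lebesgue. \<xi> x * wt t x) * \<eta> t - \<eta> t * (LINT x|lebesgue. laplacian \<xi> x * (u t x - v x)))
   = (LINT t:Ioo0 T|lebesgue. LINT x|lebesgue. (exp (u t x) - exp (v x)) * ?\<psi> (t, x))"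
  unfolding eq[symmetric] unfolding set_lebesgue_integral_def
 proof (rule integral_eqI[OF refl])
  fix t
  show "indicator (Ioo0 T) t *\<^sub>R (- (LINT x|lebesgue. \<xi> x * wt t x) * (deriv a t * \<eta> t + a t * deriv \<eta> t)
   + b t * (LINT x|lebesgue. \<xi> x * wt t x) * \<eta> t - \<eta> t * (LINT x|lebesgue. laplacian \<xi> x * (u t x - v x))) =
   indicator (Ioo0 T) t *\<^sub>R (LINT x|lebesgue. - wt t x * (deriv a t * ?\<psi> (t, x) + a t * deriv (%s. ?\<psi> (s, x)) t)
      + b t * wt t x * ?\<psi> (t, x) - (u t x - v x) * laplacian (%y. ?\<psi> (t, y)) x)"
  proof (cases "t \<in> Ioo0 T")
   case True
   show ?thesis unfolding lhs[OF True] ..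
  qed simp
 qed
 also have "... = (LINT t|lebesgue. LINT x|lebesgue. (exp (u t x) - exp (v x)) * ?\<psi> (t, x))"
  unfolding set_lebesgue_integral_def
 proof (rule integral_eqI[OF refl])
  fix t
  show "indicator (Ioo0 T) t *\<^sub>R (LINT x|lebesgue. (exp (u t x) - exp (v x)) * ?\<psi> (t, x)) =
   (LINT x|lebesgue. (exp (u t x) - exp (v x)) * ?\<psi> (t, x))"
  proof (cases "t \<in> Ioo0 T")
   case False
   then have "\<eta> t = 0" using K1 by auto
   then show ?thesis by simp
  qed simp
 qed
 finally have L: "(LINT t:Ioo0 T|lebesgue. - (LINT x|lebesgue. \<xi> x * wt t x) * (deriv a t * \<eta> t + a t * deriv \<eta> t)
   + b t * (LINT x|lebesgue. \<xi> x * wt t x) * \<eta> t - \<eta> t * (LINT x|lebesgue. laplacian \<xi> x * (u t x - v x)))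
   = (LINT t|lebesgue. LINT x|lebesgue. (exp (u t x) - exp (v x)) * ?\<psi> (t, x))" .
 define G where "G = (%(t, x). (exp (u t x) - exp (v x)) * (\<eta> t * \<xi> x))"
 have Gi: "integrable lebesgue G"
 proof -
  have KK: "compact (K1 \<times> K2)" by (intro compact_Times K1 K2)
  have "(%(t, x). exp (u t x)) absolutely_integrable_on (K1 \<times> K2)"
   using pe KK K1(2) unfolding perturbation_eq_def L1_loc_def by auto
  moreover have "(%(t, x). exp (v x)) absolutely_integrable_on (K1 \<times> K2)"
  proof -
   have "continuous_on (K1 \<times> K2) (%p. exp (v (snd p)))"
    by (intro continuous_intros continuous_on_compose2[OF vc]) auto
   from borel_integrable_compact[OF KK this] have "set_integrable lborel (K1 \<times> K2) (%p. exp (v (snd p)))"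
    by (simp add: set_integrable_def)
   then show ?thesis using KK borel_compact[OF KK]
    by (simp add: set_integrable_def case_prod_unfold integrable_completion borel_measurable_integrable)
  qed
  ultimately have i: "integrable lebesgue (%p. indicator (K1 \<times> K2) p * (exp (u (fst p) (snd p)) - exp (v (snd p))))"
   using set_integral_diff(1)[of lebesgue "K1 \<times> K2" "%(t, x). exp (u t x)" "%(t, x). exp (v x)"]
   by (simp add: set_integrable_def case_prod_unfold)
  have pc: "continuous_on UNIV ?\<psi>"
   by (intro continuous_intros continuous_on_compose2[OF Ck_continuous[OF \<eta>Ck[of 0]]] continuous_on_compose2[OF Ck_continuous[OF \<xi>Ck[of 0]]]) auto
  obtain R where R: "supp_ball R ?\<psi>" using test_functions_supp_ball[OF product_test_function[OF \<eta>(1) \<xi>(1)]] .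
  obtain C where C: "C > 0" "!!p. \<bar>?\<psi> p\<bar> <= C" by (rule continuous_csupp_bounded[OF pc R]) (rule that)
  have pm: "?\<psi> \<in> borel_measurable lebesgue"
   by (rule measurable_completion) (use borel_measurable_continuous_onI[OF pc] in simp)
  have "integrable lebesgue (%p. (indicator (K1 \<times> K2) p * (exp (u (fst p) (snd p)) - exp (v (snd p)))) * ?\<psi> p)"
  proof (rule integrable_le[OF integrable_mult_right[OF i, of C]])
   show "(%p. (indicator (K1 \<times> K2) p * (exp (u (fst p) (snd p)) - exp (v (snd p)))) * ?\<psi> p) \<in> borel_measurable lebesgue"
    by (intro borel_measurable_times borel_measurable_integrable[OF i] pm)
   show "AE p in lebesgue. norm ((indicator (K1 \<times> K2) p * (exp (u (fst p) (snd p)) - exp (v (snd p)))) * ?\<psi> p)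
    <= norm (C * (indicator (K1 \<times> K2) p * (exp (u (fst p) (snd p)) - exp (v (snd p)))))"
   proof (rule AE_I2)
    fix p
    let ?q = "indicator (K1 \<times> K2) p * (exp (u (fst p) (snd p)) - exp (v (snd p)))"
    have "\<bar>?q\<bar> * \<bar>?\<psi> p\<bar> <= \<bar>?q\<bar> * C" by (intro mult_left_mono C) auto
    then show "norm (?q * ?\<psi> p) <= norm (C * ?q)" using C(1) by (simp add: abs_mult mult.commute)
   qed
  qed
  also have "(%p. (indicator (K1 \<times> K2) p * (exp (u (fst p) (snd p)) - exp (v (snd p)))) * ?\<psi> p) = G"
   unfolding G_def using K1(3) K2(2) by (force simp: fun_eq_iff indicator_def)
  finally show ?thesis .
 qed
 note sec = integrable_lebesgue_sections[OF Gi]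
 show ?thesis
  unfolding L
  unfolding set_lebesgue_integral_def
 proof (rule integral_mono_AE)
  show "integrable lebesgue (%t. indicator (Ioo0 T) t *\<^sub>R (\<eta> t * (LINT x|lebesgue. exp (v x) * \<xi> x * (u t x - v x))))"
   using Vi by (simp add: set_integrable_def)
  show "integrable lebesgue (%t. LINT x|lebesgue. (exp (u t x) - exp (v x)) * ?\<psi> (t, x))"
   using sec(2) by (simp add: G_def)
  show "AE t in lebesgue. indicator (Ioo0 T) t *\<^sub>R (\<eta> t * (LINT x|lebesgue. exp (v x) * \<xi> x * (u t x - v x)))
    <= (LINT x|lebesgue. (exp (u t x) - exp (v x)) * ?\<psi> (t, x))"
   using sec(1)
  proof eventually_elim
   fix t assume i: "integrable lebesgue (%x. G (t, x))"
   show "indicator (Ioo0 T) t *\<^sub>R (\<eta> t * (LINT x|lebesgue. exp (v x) * \<xi> x * (u t x - v x)))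
    <= (LINT x|lebesgue. (exp (u t x) - exp (v x)) * ?\<psi> (t, x))"
   proof (cases "t \<in> K1")
    case True
    then have t: "t \<in> Ioo0 T" using K1 by auto
    have "(LINT x|lebesgue. \<eta> t * (exp (v x) * \<xi> x * (u t x - v x))) <= (LINT x|lebesgue. G (t, x))"
    proof (rule integral_mono)
     show "integrable lebesgue (%x. \<eta> t * (exp (v x) * \<xi> x * (u t x - v x)))" using int(3)[OF t] by simp
     show "integrable lebesgue (%x. G (t, x))" by fact
     fix x
     have "1 + (u t x - v x) <= exp (u t x - v x)" by (rule exp_ge_add_one_self)
     then have "exp (v x) * (1 + (u t x - v x)) <= exp (v x) * exp (u t x - v x)" by (intro mult_left_mono) auto
     also have "... = exp (u t x)" by (simp flip: exp_add)
     finally have "exp (v x) * (u t x - v x) <= exp (u t x) - exp (v x)" by (simp add: algebra_simps)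
     then have "exp (v x) * (u t x - v x) * (\<eta> t * \<xi> x) <= (exp (u t x) - exp (v x)) * (\<eta> t * \<xi> x)"
      using \<eta>(2) \<xi>(2) by (intro mult_right_mono) auto
     then show "\<eta> t * (exp (v x) * \<xi> x * (u t x - v x)) <= G (t, x)" by (simp add: G_def mult_ac)
    qed
    then show ?thesis using t by (simp add: G_def)
   qed (use K1(3) in simp)
  qed
 qed
qed

section \<open>Pairing with square-integrable functions\<close>

lemma L2_norm_nonneg: "L2_norm M f >= 0"
 unfolding L2_norm_def by (intro real_sqrt_ge_zero integral_ge_0) simp

lemma L2_norm_sq: "(L2_norm M f)^2 = (LINT x|M. (f x)\<^sup>2)"
 unfolding L2_norm_def by (intro real_sqrt_pow2 integral_ge_0) simp

lemma L2_add: "f \<in> L2 M ==> g \<in> L2 M ==> (%x. f x + g x) \<in> L2 M"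
proof -
 assume f: "f \<in> L2 M" and g: "g \<in> L2 M"
 then have [measurable]: "f \<in> borel_measurable M" "g \<in> borel_measurable M" by (auto simp: L2_def)
 have i: "integrable M (%x. 2 * (f x)^2 + 2 * (g x)^2)" using f g by (auto simp: L2_def)
 have le: "(f x + g x)^2 <= 2 * (f x)^2 + 2 * (g x)^2" for x
  using zero_le_power2[of "f x - g x"] by (simp add: power2_eq_square algebra_simps)
 have "integrable M (%x. (f x + g x)\<^sup>2)"
  by (rule integrable_le[OF i]) (use order.trans[OF le abs_ge_self] in auto)
 then show ?thesis by (simp add: L2_def)
qed

lemma L2_cmult: "f \<in> L2 M ==> (%x. c * f x) \<in> L2 M"
 by (auto simp: L2_def power_mult_distrib)

lemma L2_diff: "f \<in> L2 M ==> g \<in> L2 M ==> (%x. f x - g x) \<in> L2 M"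
 using L2_add[OF _ L2_cmult[of g M "-1"], of f] by simp

lemma L2_norm_cmult: "L2_norm M (%x. c * f x) = \<bar>c\<bar> * L2_norm M f"
 by (simp add: L2_norm_def power_mult_distrib real_sqrt_mult)

lemma L2_Cauchy_Schwarz:
 assumes f: "f \<in> L2 M" and g: "g \<in> L2 M"
 shows "integrable M (%x. f x * g x)" "\<bar>LINT x|M. f x * g x\<bar> <= L2_norm M f * L2_norm M g"
proof -
 have [measurable]: "f \<in> borel_measurable M" "g \<in> borel_measurable M" using f g by (auto simp: L2_def)
 have fi: "integrable M (%x. (f x)\<^sup>2)" and gi: "integrable M (%x. (g x)\<^sup>2)" using f g by (auto simp: L2_def)
 have le: "\<bar>f x * g x\<bar> <= (f x)^2 + (g x)^2" for x
 proof -
  have "0 <= (\<bar>f x\<bar> - \<bar>g x\<bar>)^2" "0 <= \<bar>f x\<bar> * \<bar>g x\<bar>" by auto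
  moreover have "(\<bar>f x\<bar> - \<bar>g x\<bar>)^2 = (f x)^2 + (g x)^2 - 2 * (\<bar>f x\<bar> * \<bar>g x\<bar>)"
   by (simp add: power2_diff)
  ultimately show ?thesis unfolding abs_mult by linarith
 qed
 show fg: "integrable M (%x. f x * g x)"
  by (rule integrable_le[OF Bochner_Integration.integrable_add[OF fi gi]])
    (use order.trans[OF le abs_ge_self] in auto)
 have "(\<integral>\<^sup>+x. ennreal \<bar>f x\<bar> * ennreal \<bar>g x\<bar> \<partial>M)^2 <= (\<integral>\<^sup>+x. (ennreal \<bar>f x\<bar>)\<^sup>2 \<partial>M) * (\<integral>\<^sup>+x. (ennreal \<bar>g x\<bar>)\<^sup>2 \<partial>M)"
  by (rule Cauchy_Schwarz_nn_integral) measurable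
 also have "(\<integral>\<^sup>+x. (ennreal \<bar>f x\<bar>)\<^sup>2 \<partial>M) = ennreal ((L2_norm M f)^2)"
  unfolding L2_norm_sq using nn_integral_eq_integral[OF fi] by (simp add: ennreal_power)
 also have "(\<integral>\<^sup>+x. (ennreal \<bar>g x\<bar>)\<^sup>2 \<partial>M) = ennreal ((L2_norm M g)^2)"
  unfolding L2_norm_sq using nn_integral_eq_integral[OF gi] by (simp add: ennreal_power)
 also have "(\<integral>\<^sup>+x. ennreal \<bar>f x\<bar> * ennreal \<bar>g x\<bar> \<partial>M) = ennreal (LINT x|M. \<bar>f x * g x\<bar>)"
  using nn_integral_eq_integral[OF integrable_abs[OF fg]] by (simp add: abs_mult ennreal_mult)
 finally have "(LINT x|M. \<bar>f x * g x\<bar>)^2 <= (L2_norm M f * L2_norm M g)^2"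
  by (simp add: ennreal_power integral_ge_0 power_mult_distrib flip: ennreal_mult)
 then have "(LINT x|M. \<bar>f x * g x\<bar>) <= L2_norm M f * L2_norm M g"
  by (rule power2_le_imp_le) (intro mult_nonneg_nonneg L2_norm_nonneg)
 moreover have "\<bar>LINT x|M. f x * g x\<bar> <= (LINT x|M. \<bar>f x * g x\<bar>)" by (rule integral_abs_bound)
 ultimately show "\<bar>LINT x|M. f x * g x\<bar> <= L2_norm M f * L2_norm M g" by linarith
qed

lemma L2_norm_triangle:
 assumes f: "f \<in> L2 M" and g: "g \<in> L2 M"
 shows "L2_norm M (%x. f x + g x) <= L2_norm M f + L2_norm M g"
proof (rule power2_le_imp_le)
 have "(L2_norm M (%x. f x + g x))^2 = (LINT x|M. ((f x)^2 + (g x)^2) + 2 * (f x * g x))"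
  unfolding L2_norm_sq by (intro integral_eqI) (auto simp: power2_eq_square algebra_simps)
 also have "... = ((L2_norm M f)^2 + (L2_norm M g)^2) + 2 * (LINT x|M. f x * g x)"
  using f g L2_Cauchy_Schwarz(1)[OF f g] by (simp add: L2_norm_sq L2_def)
 also have "... <= (L2_norm M f + L2_norm M g)^2"
  using L2_Cauchy_Schwarz(2)[OF f g] by (simp add: power2_eq_square algebra_simps abs_le_iff)
 finally show "(L2_norm M (%x. f x + g x))^2 <= (L2_norm M f + L2_norm M g)^2" .
qed (intro add_nonneg_nonneg L2_norm_nonneg)

text \<open>Any functional bounded by one of the seminorms turns a continuously differentiable curve into a continuously differentiable function; this is used both for \<open>L\<^sup>2\<close> and for \<open>L\<^sup>1\<close> on balls.\<close>
lemma C1_curve_functional: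
 assumes C: "C1_curve X P I w w'" and p: "p \<in> P"
  and X: "!!f g h (c::real). f \<in> X ==> g \<in> X ==> h \<in> X ==> (%x. (f x - g x) / c - h x) \<in> X" "!!f g. f \<in> X ==> g \<in> X ==> (%x. f x - g x) \<in> X"
  and k: "!!f. f \<in> X ==> integrable M (%x. k x * f x)" "!!f. f \<in> X ==> \<bar>LINT x|M. k x * f x\<bar> <= c * p f"
 shows "!!t. t \<in> I ==> ((%t. LINT x|M. k x * w t x) has_real_derivative (LINT x|M. k x * w' t x)) (at t within I)"
  and "continuous_on I (%t. LINT x|M. k x * w' t x)"
proof -
 have wX: "w t \<in> X" "w' t \<in> X" if "t \<in> I" for t using C that by (auto simp: C1_curve_def)
 have l1: "((%t. p (%x. (w t x - w s x) / (t - s) - w' s x)) \<longlongrightarrow> 0) (at s within I)"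
  and l2: "((%t. p (%x. w' t x - w' s x)) \<longlongrightarrow> 0) (at s within I)" if "s \<in> I" for s
  using C p that by (auto simp: C1_curve_def)
 show "((%t. LINT x|M. k x * w t x) has_real_derivative (LINT x|M. k x * w' s x)) (at s within I)" if s: "s \<in> I" for s
  unfolding has_field_derivative_iff
 proof (subst LIM_zero_iff[symmetric], rule Lim_null_comparison)
  show "((%t. c * p (%x. (w t x - w s x) / (t - s) - w' s x)) \<longlongrightarrow> 0) (at s within I)"
   using tendsto_mult_right_zero[OF l1[OF s]] .
  show "\<forall>\<^sub>F t in at s within I. norm (((LINT x|M. k x * w t x) - (LINT x|M. k x * w s x)) / (t - s) - (LINT x|M. k x * w' s x))
   <= c * p (%x. (w t x - w s x) / (t - s) - w' s x)"
   unfolding eventually_at_filter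
  proof (intro always_eventually allI impI)
   fix t assume "t \<in> I"
   note t = wX[OF this] wX[OF s]
   have "((LINT x|M. k x * w t x) - (LINT x|M. k x * w s x)) / (t - s) - (LINT x|M. k x * w' s x)
    = (LINT x|M. (k x * w t x - k x * w s x) / (t - s) - k x * w' s x)"
    using k(1) t by simp
   also have "... = (LINT x|M. k x * ((w t x - w s x) / (t - s) - w' s x))"
    by (intro integral_eqI) (auto simp: algebra_simps diff_divide_distrib)
   finally show "norm (((LINT x|M. k x * w t x) - (LINT x|M. k x * w s x)) / (t - s) - (LINT x|M. k x * w' s x))
    <= c * p (%x. (w t x - w s x) / (t - s) - w' s x)"
    using k(2)[OF X(1)[OF t(1,3,4), of "t - s"]] by simp
  qed
 qed
 show "continuous_on I (%t. LINT x|M. k x * w' t x)"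
  unfolding continuous_on_def
 proof
  fix s assume s: "s \<in> I"
  show "((%t. LINT x|M. k x * w' t x) \<longlongrightarrow> (LINT x|M. k x * w' s x)) (at s within I)"
  proof (subst LIM_zero_iff[symmetric], rule Lim_null_comparison)
   show "((%t. c * p (%x. w' t x - w' s x)) \<longlongrightarrow> 0) (at s within I)"
    using tendsto_mult_right_zero[OF l2[OF s]] .
   show "\<forall>\<^sub>F t in at s within I. norm ((LINT x|M. k x * w' t x) - (LINT x|M. k x * w' s x)) <= c * p (%x. w' t x - w' s x)"
    unfolding eventually_at_filter
   proof (intro always_eventually allI impI)
    fix t assume "t \<in> I"
    note t = wX[OF this] wX[OF s]
    have "(LINT x|M. k x * w' t x) - (LINT x|M. k x * w' s x) = (LINT x|M. k x * (w' t x - w' s x))"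
     using k(1) t by (simp add: right_diff_distrib)
    then show "norm ((LINT x|M. k x * w' t x) - (LINT x|M. k x * w' s x)) <= c * p (%x. w' t x - w' s x)"
     using k(2)[OF X(2)[OF t(2,4)]] by simp
   qed
  qed
 qed
qed

lemma locally_bounded_imp_bounded:
 fixes f :: "real => real"
 assumes loc: "!!s. s \<in> {c..d} ==> EX e>0. EX C. ALL t:{c..d}. \<bar>t - s\<bar> < e --> f t <= C"
 shows "EX C. ALL t:{c..d}. f t <= C"
proof (cases "c <= d")
 case True
 have "EX C. ALL t:{c..d} \<inter> {c..d}. f t <= C"
 proof (rule Bolzano[where P="%a b. EX C. ALL t:{a..b} \<inter> {c..d}. f t <= C", OF True])
  fix a b e assume "EX C. ALL t:{a..b} \<inter> {c..d}. f t <= C" "EX C. ALL t:{b..e} \<inter> {c..d}. f t <= C"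
  then obtain C1 C2 where C: "ALL t:{a..b} \<inter> {c..d}. f t <= C1" "ALL t:{b..e} \<inter> {c..d}. f t <= C2" by blast
  have "ALL t:{a..e} \<inter> {c..d}. f t <= max C1 C2"
  proof
   fix t assume "t \<in> {a..e} \<inter> {c..d}"
   then show "f t <= max C1 C2" using C by (cases "t <= b") (auto simp: le_max_iff_disj)
  qed
  then show "EX C. ALL t:{a..e} \<inter> {c..d}. f t <= C" by blast
 next
  fix x assume "c <= x" "x <= d"
  then obtain e C where e: "e > 0" "ALL t:{c..d}. \<bar>t - x\<bar> < e --> f t <= C" using loc[of x] by auto
  have "ALL t:{a..b} \<inter> {c..d}. f t <= C" if "a <= x" "x <= b" "b - a < e" for a b
   using e(2) that by auto
  then show "EX e>0. ALL a b. a <= x & x <= b & b - a < e --> (EX C. ALL t:{a..b} \<inter> {c..d}. f t <= C)"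
   using e(1) by blast
 qed
 then show ?thesis by simp
qed simp

lemma L2_curve_bounded:
 assumes C: "C1_curve (L2 M) {L2_norm M} I w w'" and sub: "{c..d} \<subseteq> I"
 shows "EX K. ALL t:{c..d}. L2_norm M (w t) <= K" "EX K. ALL t:{c..d}. L2_norm M (w' t) <= K"
proof -
 have wX: "w t \<in> L2 M" "w' t \<in> L2 M" if "t \<in> I" for t using C that by (auto simp: C1_curve_def)
 have l1: "((%t. L2_norm M (%x. (w t x - w s x) / (t - s) - w' s x)) \<longlongrightarrow> 0) (at s within I)"
  and l2: "((%t. L2_norm M (%x. w' t x - w' s x)) \<longlongrightarrow> 0) (at s within I)" if "s \<in> I" for s
  using C that by (auto simp: C1_curve_def)
 show "EX K. ALL t:{c..d}. L2_norm M (w' t) <= K"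
 proof (rule locally_bounded_imp_bounded)
  fix s assume "s \<in> {c..d}"
  then have s: "s \<in> I" using sub by auto
  have "\<forall>\<^sub>F t in at s within I. L2_norm M (%x. w' t x - w' s x) < 1" using order_tendstoD(2)[OF l2[OF s]] by simp
  then obtain e where e: "e > 0" "!!t. t \<in> I ==> t ~= s ==> dist t s < e ==> L2_norm M (%x. w' t x - w' s x) < 1"
   unfolding eventually_at by blast
  have "L2_norm M (w' t) <= L2_norm M (w' s) + 1" if t: "t \<in> {c..d}" "\<bar>t - s\<bar> < e" for t
  proof (cases "t = s")
   case False
   have tI: "t \<in> I" using t sub by auto
   have "L2_norm M (%x. w' s x + (w' t x - w' s x)) <= L2_norm M (w' s) + L2_norm M (%x. w' t x - w' s x)"
    by (rule L2_norm_triangle[OF wX(2)[OF s] L2_diff[OF wX(2)[OF tI] wX(2)[OF s]]])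
   then show ?thesis using e(2)[OF tI False] t by (simp add: dist_real_def)
  qed simp
  then show "EX e>0. EX K. ALL t:{c..d}. \<bar>t - s\<bar> < e --> L2_norm M (w' t) <= K" using e(1) by blast
 qed
 show "EX K. ALL t:{c..d}. L2_norm M (w t) <= K"
 proof (rule locally_bounded_imp_bounded)
  fix s assume "s \<in> {c..d}"
  then have s: "s \<in> I" using sub by auto
  have "\<forall>\<^sub>F t in at s within I. L2_norm M (%x. (w t x - w s x) / (t - s) - w' s x) < 1" using order_tendstoD(2)[OF l1[OF s]] by simp
  then obtain e where e: "e > 0" "!!t. t \<in> I ==> t ~= s ==> dist t s < e ==> L2_norm M (%x. (w t x - w s x) / (t - s) - w' s x) < 1"
   unfolding eventually_at by blast
  have "L2_norm M (w t) <= L2_norm M (w s) + (1 + L2_norm M (w' s))" if t: "t \<in> {c..d}" "\<bar>t - s\<bar> < min e 1" for t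
  proof (cases "t = s")
   case False
   have tI: "t \<in> I" using t sub by auto
   let ?q = "%x. (w t x - w s x) / (t - s) - w' s x"
   have q: "?q \<in> L2 M"
    using L2_diff[OF L2_cmult[OF L2_diff[OF wX(1)[OF tI] wX(1)[OF s]], of "1 / (t - s)"] wX(2)[OF s]] by simp
   have qs: "(%x. ?q x + w' s x) \<in> L2 M" by (rule L2_add[OF q wX(2)[OF s]])
   have "w t = (%x. w s x + (t - s) * (?q x + w' s x))" using False by auto
   then have "L2_norm M (w t) = L2_norm M (%x. w s x + (t - s) * (?q x + w' s x))" by simp
   also have "... <= L2_norm M (w s) + L2_norm M (%x. (t - s) * (?q x + w' s x))"
    by (rule L2_norm_triangle[OF wX(1)[OF s] L2_cmult[OF qs]])
   also have "... = L2_norm M (w s) + \<bar>t - s\<bar> * L2_norm M (%x. ?q x + w' s x)"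
    by (subst L2_norm_cmult) simp
   also have "... <= L2_norm M (w s) + 1 * (L2_norm M ?q + L2_norm M (w' s))"
    using t by (intro add_left_mono mult_mono L2_norm_triangle[OF q wX(2)[OF s]] L2_norm_nonneg) auto
   also have "... <= L2_norm M (w s) + (1 + L2_norm M (w' s))"
    using e(2)[OF tI False] t by (simp add: dist_real_def)
   finally show ?thesis .
  qed (simp add: L2_norm_nonneg)
  moreover have "min e 1 > 0" using e by simp
  ultimately show "EX e>0. EX K. ALL t:{c..d}. \<bar>t - s\<bar> < e --> L2_norm M (w t) <= K" by blast
 qed
qed

section \<open>The ground state as a weight\<close>

lemma continuous_integral_lebesgue:
 fixes f :: "'a::euclidean_space => real"
 assumes "continuous_on UNIV f"
 shows "(LINT x|lebesgue. f x) = (LBINT x. f x)" "integrable lebesgue f \<longleftrightarrow> integrable lborel f" "f \<in> borel_measurable lebesgue"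
proof -
 have m: "f \<in> borel_measurable lborel" using borel_measurable_continuous_onI[OF assms] by simp
 show "(LINT x|lebesgue. f x) = (LBINT x. f x)" by (rule integral_completion[OF m])
 show "integrable lebesgue f \<longleftrightarrow> integrable lborel f" by (rule integrable_completion[OF m])
 show "f \<in> borel_measurable lebesgue" by (rule measurable_completion[OF m])
qed

lemma continuous_bounded_L2:
 fixes f :: "'a::euclidean_space => real"
 assumes c: "continuous_on UNIV f" and i: "integrable lborel f" and b: "!!x. \<bar>f x\<bar> <= C"
 shows "f \<in> L2 lebesgue"
proof -
 have [measurable]: "f \<in> borel_measurable borel" by (rule borel_measurable_continuous_onI[OF c])
 have "integrable lborel (%x. (f x)\<^sup>2)"
 proof (rule integrable_le[OF integrable_mult_right[OF integrable_abs[OF i], of C]])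
  show "AE x in lborel. norm ((f x)^2) <= norm (C * \<bar>f x\<bar>)"
  proof (rule AE_I2)
   fix x
   have "\<bar>f x\<bar> * \<bar>f x\<bar> <= C * \<bar>f x\<bar>" by (intro mult_right_mono b) auto
   also have "C * \<bar>f x\<bar> <= \<bar>C\<bar> * \<bar>f x\<bar>" by (intro mult_right_mono) auto
   finally show "norm ((f x)^2) <= norm (C * \<bar>f x\<bar>)" by (simp add: power2_eq_square abs_mult)
  qed
 qed measurable
 then have "integrable lebesgue (%x. (f x)\<^sup>2)"
  using continuous_integral_lebesgue(2)[of "%x. (f x)\<^sup>2"] c by (simp add: continuous_on_power)
 then show ?thesis using continuous_integral_lebesgue(3)[OF c] by (simp add: L2_def)
qed

lemma continuous_csupp_L2:
 fixes f :: "'a::euclidean_space => real"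
 assumes c: "continuous_on UNIV f" and R: "supp_ball R f"
 shows "f \<in> L2 lebesgue"
proof -
 obtain C where C: "C > 0" "!!x. \<bar>f x\<bar> <= C" by (rule continuous_csupp_bounded[OF c R]) (rule that)
 show ?thesis by (rule continuous_bounded_L2[OF c continuous_csupp_integrable[OF c R] C(2)])
qed

lemma deriv_eq_0_outside:
 fixes f :: "real => real"
 assumes K: "closed K" and f: "!!x. x \<notin> K ==> f x = 0" and x: "x \<notin> K"
 shows "deriv f x = 0"
proof -
 have "((%x. 0) has_real_derivative 0) (at x)" by simp
 then have "(f has_real_derivative 0) (at x)"
  using has_field_derivative_transform_within_open[of "%x. 0" 0 x "- K" f] K f x by auto
 then show ?thesis by (rule DERIV_imp_deriv)
qed

lemma set_integral_restrict:
 fixes f :: "real => real"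
 assumes "J \<subseteq> A" "!!x. x \<in> A ==> x \<notin> J ==> f x = 0"
 shows "(LINT x:A|lebesgue. f x) = (LINT x:J|lebesgue. f x)"
  and "set_integrable lebesgue A f \<longleftrightarrow> set_integrable lebesgue J f"
proof -
 have eq: "(%x. indicator A x *\<^sub>R f x) = (%x. indicator J x *\<^sub>R f x)"
  using assms by (auto simp: indicator_def fun_eq_iff)
 show "(LINT x:A|lebesgue. f x) = (LINT x:J|lebesgue. f x)"
  "set_integrable lebesgue A f \<longleftrightarrow> set_integrable lebesgue J f"
  unfolding set_lebesgue_integral_def set_integrable_def eq by (rule refl)+
qed

lemma compact_in_Ioo0:
 assumes T: "T > 0" and K: "compact K" "K \<subseteq> Ioo0 T"
 obtains c d where "0 < c" "d \<in> Ioo0 T" "K \<subseteq> {c..d}"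
proof (cases "K = {}")
 case True
 obtain t where "t \<in> Ioo0 T"
 proof (cases T)
  case (real r)
  then show ?thesis using T by (intro that[of "r / 2"]) (auto simp: Ioo0_eq zero_ereal_def)
 next
  case PInf
  then show ?thesis by (intro that[of 1]) (auto simp: Ioo0_eq)
 qed (use T in auto)
 then show ?thesis using True by (intro that[of t t]) (auto simp: Ioo0_def)
next
 case False
 obtain c where "c \<in> K" "!!x. x \<in> K ==> c <= x" using compact_attains_inf[OF K(1) False] by blast
 moreover obtain d where "d \<in> K" "!!x. x \<in> K ==> x <= d" using compact_attains_sup[OF K(1) False] by blast
 ultimately show ?thesis using K(2) by (intro that[of c d]) (auto simp: Ioo0_def)
qed

text \<open>The eigenfunction together with its quantitative properties, as a weak solution of \<open>\<sigma>\<^sup>2 \<phi> - \<Delta>\<phi> = e\<^sup>v \<phi>\<close>.\<close>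
locale ground_state =
 fixes v \<phi> :: "real^2 => real" and \<sigma> B Vm :: real
 assumes v_cont: "continuous_on UNIV v" and V_le: "!!x. exp (v x) <= Vm" and \<sigma>: "\<sigma> > 0"
  and \<phi>_cont: "continuous_on UNIV \<phi>" and \<phi>_nonneg: "!!x. \<phi> x >= 0" and \<phi>_le: "!!x. \<phi> x <= B"
  and \<phi>_int: "integrable lborel \<phi>" and \<phi>_nonzero: "\<not> (AE x in lborel. \<phi> x = 0)"
  and weak: "!!\<xi>. \<xi> \<in> test_functions UNIV ==>
   (LBINT x. \<phi> x * (\<sigma>^2 * \<xi> x - laplacian \<xi> x)) = (LBINT x. exp (v x) * \<phi> x * \<xi> x)"
begin

text \<open>The distributional Laplacian of \<open>\<phi>\<close>.\<close>
definition src :: "real^2 => real" where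
 "src x = \<sigma>^2 * \<phi> x - exp (v x) * \<phi> x"

lemma B: "B >= 0" using \<phi>_nonneg[of 0] \<phi>_le[of 0] by linarith

lemma Vm: "Vm > 0" using V_le[of 0] exp_gt_zero[of "v 0"] by linarith

lemma V_cont: "continuous_on UNIV (%x. exp (v x))" by (intro continuous_intros v_cont)

lemma V\<phi>_cont: "continuous_on UNIV (%x. exp (v x) * \<phi> x)" by (intro continuous_intros v_cont \<phi>_cont)

lemma V\<phi>_bounds: "0 <= exp (v x) * \<phi> x" "exp (v x) * \<phi> x <= Vm * B"
 by (intro mult_nonneg_nonneg \<phi>_nonneg exp_ge_zero) (intro mult_mono V_le \<phi>_le \<phi>_nonneg, use Vm in simp)

lemma V\<phi>_int: "integrable lborel (%x. exp (v x) * \<phi> x)"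
proof (rule integrable_le[OF integrable_mult_right[OF \<phi>_int, of Vm]])
 show "(%x. exp (v x) * \<phi> x) \<in> borel_measurable lborel" using borel_measurable_continuous_onI[OF V\<phi>_cont] by simp
 show "AE x in lborel. norm (exp (v x) * \<phi> x) <= norm (Vm * \<phi> x)"
  using V_le \<phi>_nonneg Vm by (intro AE_I2) (auto simp: abs_mult intro!: mult_right_mono)
qed

lemma test_continuous:
 assumes "\<xi> \<in> test_functions UNIV"
 shows "continuous_on UNIV \<xi>" "continuous_on UNIV (laplacian \<xi>)" "EX R. supp_ball R \<xi> & supp_ball R (laplacian \<xi>)"
proof -
 have C: "Ck k \<xi>" for k using assms by (simp add: test_functions_def)
 show "continuous_on UNIV \<xi>" by (rule Ck_continuous[OF C[of 0]])
 show "continuous_on UNIV (laplacian \<xi>)" by (rule laplacian_continuous[OF C])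
 obtain R where "supp_ball R \<xi>" using test_functions_supp_ball[OF assms] .
 then show "EX R. supp_ball R \<xi> & supp_ball R (laplacian \<xi>)" using supp_ball_laplacian by blast
qed

lemma weak': "\<xi> \<in> test_functions UNIV ==> (LBINT x. \<phi> x * laplacian \<xi> x) = (LBINT x. (\<sigma>^2 * \<phi> x - exp (v x) * \<phi> x) * \<xi> x)"
proof -
 assume \<xi>: "\<xi> \<in> test_functions UNIV"
 note c = test_continuous[OF \<xi>]
 obtain R where R: "supp_ball R \<xi>" "supp_ball R (laplacian \<xi>)" using c(3) by blast
 have i: "integrable lborel (%x. f x * g x)" if "continuous_on UNIV f" "continuous_on UNIV g" "supp_ball R g" for f g :: "real^2 => real"
  by (rule continuous_csupp_integrable[of _ R]) (use that in \<open>auto simp: supp_ball_def intro!: continuous_intros\<close>)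
 have "(LBINT x. \<phi> x * (\<sigma>^2 * \<xi> x - laplacian \<xi> x)) = \<sigma>^2 * (LBINT x. \<phi> x * \<xi> x) - (LBINT x. \<phi> x * laplacian \<xi> x)"
  using i[OF \<phi>_cont c(1) R(1)] i[OF \<phi>_cont c(2) R(2)] by (simp add: right_diff_distrib mult.left_commute[of _ "\<sigma>^2"])
 moreover have "(LBINT x. (\<sigma>^2 * \<phi> x - exp (v x) * \<phi> x) * \<xi> x) = \<sigma>^2 * (LBINT x. \<phi> x * \<xi> x) - (LBINT x. exp (v x) * \<phi> x * \<xi> x)"
  using i[OF \<phi>_cont c(1) R(1)] i[OF V\<phi>_cont c(1) R(1)] by (simp add: left_diff_distrib mult.assoc)
 ultimately show ?thesis using weak[OF \<xi>] by simp
qed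

lemma src_cont: "continuous_on UNIV src"
 unfolding src_def[abs_def] by (intro continuous_intros \<phi>_cont V\<phi>_cont)

lemma src_int: "integrable lborel src"
 unfolding src_def[abs_def] using \<phi>_int V\<phi>_int by auto

lemma L2_facts: "\<phi> \<in> L2 lebesgue" "(%x. exp (v x) * \<phi> x) \<in> L2 lebesgue" "src \<in> L2 lebesgue"
proof -
 show 1: "\<phi> \<in> L2 lebesgue" by (rule continuous_bounded_L2[OF \<phi>_cont \<phi>_int, of B]) (use \<phi>_nonneg \<phi>_le in auto)
 show 2: "(%x. exp (v x) * \<phi> x) \<in> L2 lebesgue"
  by (rule continuous_bounded_L2[OF V\<phi>_cont V\<phi>_int, of "Vm * B"]) (use V\<phi>_bounds in auto)
 show "src \<in> L2 lebesgue" unfolding src_def[abs_def] by (rule L2_diff[OF L2_cmult[OF 1] 2])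
qed

lemma approximation:
 obtains \<xi> :: "nat => real^2 => real" where "!!n. \<xi> n \<in> test_functions UNIV" "!!n x. 0 <= \<xi> n x"
  "(%n. LINT x|lebesgue. \<bar>\<xi> n x - \<phi> x\<bar>) \<longlonglongrightarrow> 0" "(%n. L2_norm lebesgue (%x. \<xi> n x - \<phi> x)) \<longlonglongrightarrow> 0"
  "(%n. LINT x|lebesgue. \<bar>laplacian (\<xi> n) x - src x\<bar>) \<longlonglongrightarrow> 0" "(%n. L2_norm lebesgue (%x. laplacian (\<xi> n) x - src x)) \<longlonglongrightarrow> 0"
proof -
 have "EX \<xi>:test_functions UNIV. (ALL x. 0 <= \<xi> x) & (ALL x. \<xi> x <= B) &
  (LBINT x. \<bar>\<xi> x - \<phi> x\<bar>) <= 1 / real (Suc n) & (LBINT x. (\<xi> x - \<phi> x)\<^sup>2) <= 1 / real (Suc n) &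
  (LBINT x. \<bar>laplacian \<xi> x - (\<sigma>^2 * \<phi> x - exp (v x) * \<phi> x)\<bar>) <= 1 / real (Suc n) &
  (LBINT x. (laplacian \<xi> x - (\<sigma>^2 * \<phi> x - exp (v x) * \<phi> x))\<^sup>2) <= 1 / real (Suc n)" for n
 proof (rule test_function_approximation[OF \<phi>_int \<phi>_cont \<phi>_nonneg \<phi>_le, where C="\<sigma>^2 * B + Vm * B"])
  show "integrable lborel (%x. \<sigma>\<^sup>2 * \<phi> x)" "continuous_on UNIV (%x. \<sigma>\<^sup>2 * \<phi> x)" "!!x. 0 <= \<sigma>^2 * \<phi> x"
   using \<phi>_int \<phi>_nonneg by (auto intro!: continuous_intros \<phi>_cont)
  show "\<sigma>^2 * \<phi> x <= \<sigma>^2 * B + Vm * B" for x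
  proof -
   have "\<sigma>^2 * \<phi> x <= \<sigma>^2 * B" by (intro mult_left_mono \<phi>_le) auto
   then show ?thesis using Vm B by (simp add: add_increasing2)
  qed
  show "exp (v x) * \<phi> x <= \<sigma>^2 * B + Vm * B" for x using V\<phi>_bounds(2)[of x] B by (simp add: add_increasing)
 qed (use V\<phi>_int V\<phi>_cont V\<phi>_bounds weak' in auto)
 then have "ALL n. EX \<xi>. \<xi> \<in> test_functions UNIV & (ALL x. 0 <= \<xi> x) &
  (LBINT x. \<bar>\<xi> x - \<phi> x\<bar>) <= 1 / real (Suc n) & (LBINT x. (\<xi> x - \<phi> x)\<^sup>2) <= 1 / real (Suc n) &
  (LBINT x. \<bar>laplacian \<xi> x - src x\<bar>) <= 1 / real (Suc n) & (LBINT x. (laplacian \<xi> x - src x)\<^sup>2) <= 1 / real (Suc n)"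
  unfolding src_def Bex_def by blast
 from choice[OF this] obtain \<xi> where \<xi>: "!!n. \<xi> n \<in> test_functions UNIV" "!!n x. 0 <= \<xi> n x"
  and e: "!!n. (LBINT x. \<bar>\<xi> n x - \<phi> x\<bar>) <= 1 / real (Suc n)" "!!n. (LBINT x. (\<xi> n x - \<phi> x)\<^sup>2) <= 1 / real (Suc n)"
   "!!n. (LBINT x. \<bar>laplacian (\<xi> n) x - src x\<bar>) <= 1 / real (Suc n)" "!!n. (LBINT x. (laplacian (\<xi> n) x - src x)\<^sup>2) <= 1 / real (Suc n)"
  by blast
 have l0: "(%n. 1 / real (Suc n)) \<longlonglongrightarrow> 0" by (rule LIMSEQ_Suc[OF lim_1_over_n])
 have squeeze: "X \<longlonglongrightarrow> 0" if "!!n. 0 <= X n" "!!n. X n <= 1 / real (Suc n)" for X :: "nat => real"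
 proof (rule tendsto_sandwich[OF _ _ tendsto_const l0])
  show "\<forall>\<^sub>F n in sequentially. 0 <= X n" using that(1) by simp
  show "\<forall>\<^sub>F n in sequentially. X n <= 1 / real (Suc n)" using that(2) by simp
 qed
 note c = test_continuous[OF \<xi>(1)]
 show ?thesis
 proof (rule that[OF \<xi>])
  have eq1: "(LINT x|lebesgue. \<bar>\<xi> n x - \<phi> x\<bar>) = (LBINT x. \<bar>\<xi> n x - \<phi> x\<bar>)" "(LINT x|lebesgue. (\<xi> n x - \<phi> x)\<^sup>2) = (LBINT x. (\<xi> n x - \<phi> x)\<^sup>2)" for n
   by (rule continuous_integral_lebesgue(1), intro continuous_intros c(1) \<phi>_cont)+
  have eq2: "(LINT x|lebesgue. \<bar>laplacian (\<xi> n) x - src x\<bar>) = (LBINT x. \<bar>laplacian (\<xi> n) x - src x\<bar>)"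
   "(LINT x|lebesgue. (laplacian (\<xi> n) x - src x)\<^sup>2) = (LBINT x. (laplacian (\<xi> n) x - src x)\<^sup>2)" for n
   by (rule continuous_integral_lebesgue(1), intro continuous_intros c(2) src_cont)+
  show "(%n. LINT x|lebesgue. \<bar>\<xi> n x - \<phi> x\<bar>) \<longlonglongrightarrow> 0" unfolding eq1
   by (rule squeeze[OF _ e(1)]) (intro integral_ge_0 abs_ge_zero)
  show "(%n. LINT x|lebesgue. \<bar>laplacian (\<xi> n) x - src x\<bar>) \<longlonglongrightarrow> 0" unfolding eq2
   by (rule squeeze[OF _ e(3)]) (intro integral_ge_0 abs_ge_zero)
  have "(%n. sqrt (LBINT x. (\<xi> n x - \<phi> x)\<^sup>2)) \<longlonglongrightarrow> sqrt 0"
   by (intro tendsto_real_sqrt squeeze[OF _ e(2)] integral_ge_0 zero_le_power2)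
  then show "(%n. L2_norm lebesgue (%x. \<xi> n x - \<phi> x)) \<longlonglongrightarrow> 0" unfolding L2_norm_def eq1 by simp
  have "(%n. sqrt (LBINT x. (laplacian (\<xi> n) x - src x)\<^sup>2)) \<longlonglongrightarrow> sqrt 0"
   by (intro tendsto_real_sqrt squeeze[OF _ e(4)] integral_ge_0 zero_le_power2)
  then show "(%n. L2_norm lebesgue (%x. laplacian (\<xi> n) x - src x)) \<longlonglongrightarrow> 0" unfolding L2_norm_def eq2 by simp
 qed
qed

end

section \<open>The projected second-order equation\<close>

lemma set_lebesgue_integral_limit_nonneg:
 fixes h :: "nat => real => real"
 assumes h: "!!n. set_integrable M J (h n)" "!!n. 0 <= (LINT t:J|M. h n t)" and g: "set_integrable M J g"
  and G: "set_integrable M J G" and le: "!!n t. t \<in> J ==> \<bar>h n t - g t\<bar> <= \<delta> n * G t" and \<delta>: "\<delta> \<longlonglongrightarrow> 0"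
 shows "0 <= (LINT t:J|M. g t)"
proof (rule LIMSEQ_le_const)
 show "(%n. (LINT t:J|M. g t) + \<delta> n * (LINT t:J|M. G t)) \<longlonglongrightarrow> (LINT t:J|M. g t)"
  using tendsto_add[OF tendsto_const tendsto_mult_left_zero[OF \<delta>, of "LINT t:J|M. G t"], of "LINT t:J|M. g t"] by simp
 show "EX N. ALL n>=N. 0 <= (LINT t:J|M. g t) + \<delta> n * (LINT t:J|M. G t)"
 proof (intro exI allI impI)
  fix n :: nat
  have "(LINT t:J|M. h n t) <= (LINT t:J|M. g t + \<delta> n * G t)"
  proof (rule set_integral_mono[OF h(1)])
   show "set_integrable M J (%t. g t + \<delta> n * G t)" using g G by (intro set_integral_add(1) set_integrable_mult_right) auto
   show "h n t <= g t + \<delta> n * G t" if "t \<in> J" for t using le[OF that, of n] by linarith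
  qed
  also have "... = (LINT t:J|M. g t) + \<delta> n * (LINT t:J|M. G t)"
   using g G by (subst set_integral_add(2)) auto
  finally show "0 <= (LINT t:J|M. g t) + \<delta> n * (LINT t:J|M. G t)" using h(2)[of n] by linarith
 qed
qed

lemma L1_loc_Icc: "b \<in> L1_loc {0<..} ==> 0 < (s::real) ==> b absolutely_integrable_on {s..t}"
proof -
 assume b: "b \<in> L1_loc {0<..}" and s: "0 < s"
 have "compact {s..t}" "{s..t} \<subseteq> {0<..}" using s by auto
 then show "b absolutely_integrable_on {s..t}" using b unfolding L1_loc_def by blast
qed

lemma C1_differentiable_deriv:
 fixes a :: "real => real"
 assumes "a C1_differentiable_on S"
 shows "!!t. t \<in> S ==> (a has_real_derivative deriv a t) (at t)" "continuous_on S (deriv a)"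
proof -
 obtain D where D: "!!t. t \<in> S ==> (a has_real_derivative D t) (at t)" "continuous_on S D"
  using assms unfolding C1_differentiable_on_def has_real_derivative_iff_has_vector_derivative by blast
 have eq: "deriv a t = D t" if "t \<in> S" for t using DERIV_imp_deriv[OF D(1)[OF that]] .
 show "(a has_real_derivative deriv a t) (at t)" if "t \<in> S" for t using D(1)[OF that] eq[OF that] by simp
 show "continuous_on S (deriv a)" using D(2) eq by (simp cong: continuous_on_cong)
qed

lemma L2_curve_functional:
 assumes C: "C1_curve (L2 M) {L2_norm M} I w w'" and k: "k \<in> L2 M"
 shows "!!t. t \<in> I ==> ((%t. LINT x|M. k x * w t x) has_real_derivative (LINT x|M. k x * w' t x)) (at t within I)"
  and "continuous_on I (%t. LINT x|M. k x * w' t x)"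
  and "continuous_on I (%t. LINT x|M. k x * w t x)"
proof -
 have X: "(%x. (f x - g x) / c - h x) \<in> L2 M" if "f \<in> L2 M" "g \<in> L2 M" "h \<in> L2 M" for f g h and c :: real
  using L2_diff[OF L2_cmult[OF L2_diff[OF that(1,2)], of "1 / c"] that(3)] by simp
 note F = C1_curve_functional[where p = "L2_norm M" and c = "L2_norm M k" and k = k, OF C singletonI X L2_diff
   L2_Cauchy_Schwarz(1)[OF k] L2_Cauchy_Schwarz(2)[OF k]]
 show d: "((%t. LINT x|M. k x * w t x) has_real_derivative (LINT x|M. k x * w' t x)) (at t within I)" if "t \<in> I" for t
  by (rule F(1)) (use that in auto)
 show "continuous_on I (%t. LINT x|M. k x * w' t x)" by (rule F(2)) auto
 show "continuous_on I (%t. LINT x|M. k x * w t x)" by (rule DERIV_continuous_on[OF d])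
qed

lemma test_function_real:
 assumes \<eta>: "\<eta> \<in> test_functions (Ioo0 T)" and T: "T > 0"
 obtains c d where "0 < c" "d \<in> Ioo0 T" "{c..d} \<subseteq> Ioo0 T" "!!t. t \<notin> {c..d} ==> \<eta> t = 0" "!!t. t \<notin> {c..d} ==> deriv \<eta> t = 0"
  "continuous_on UNIV \<eta>" "continuous_on UNIV (deriv \<eta>)"
proof -
 have C: "Ck k \<eta>" for k using \<eta> by (simp add: test_functions_def)
 obtain K where K: "compact K" "K \<subseteq> Ioo0 T" "!!t. t \<notin> K ==> \<eta> t = 0" using \<eta> by (auto simp: test_functions_def)
 obtain c d where cd: "0 < c" "d \<in> Ioo0 T" "K \<subseteq> {c..d}" by (rule compact_in_Ioo0[OF T K(1,2)])
 have z: "\<eta> t = 0" if "t \<notin> {c..d}" for t using K(3) cd(3) that by blast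
 show ?thesis
 proof (rule that[OF cd(1,2) Ioo0_Icc[OF cd(2,1)] z])
  show "deriv \<eta> t = 0" if "t \<notin> {c..d}" for t
   by (rule deriv_eq_0_outside[OF _ _ that]) (use z in auto)
  show "continuous_on UNIV \<eta>" by (rule Ck_continuous[OF C[of 0]])
  show "continuous_on UNIV (deriv \<eta>)" by (rule Ck_continuous[OF Ck_deriv_real[OF C[of "Suc 0"]]])
 qed auto
qed

context ground_state
begin

text \<open>The eigenfunction is not an admissible test function. It is approached by test functions \<open>\<xi>\<^sub>n\<close> for which
 \<open>\<Delta>\<xi>\<^sub>n + e\<^sup>v \<xi>\<^sub>n\<close> tends to \<open>\<sigma>\<^sup>2 \<phi>\<close> in \<open>L\<^sup>2\<close>, and the error is uniform on the support of the
 function of time.\<close>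
lemma second_order_weak:
 assumes T: "T > 0" and a: "a C1_differentiable_on Ioo0 T" and b: "b \<in> L1_loc {0<..}"
  and C: "C1_curve (L2 lebesgue) {L2_norm lebesgue} (Ico0 T) (%t x. u t x - v x) wt"
  and pe: "perturbation_eq T a b v u wt"
  and \<eta>: "\<eta> \<in> test_functions (Ioo0 T)" "!!t. \<eta> t >= 0"
 defines "y \<equiv> %t. LINT x|lebesgue. \<phi> x * (u t x - v x)" and "p \<equiv> %t. LINT x|lebesgue. \<phi> x * wt t x"
 shows "0 <= (LINT t:Ioo0 T|lebesgue. - (a t * p t) * deriv \<eta> t - (deriv a t * p t - b t * p t + \<sigma>^2 * y t) * \<eta> t)"
proof -
 obtain c d where cd: "0 < c" "d \<in> Ioo0 T" "{c..d} \<subseteq> Ioo0 T" and z: "!!t. t \<notin> {c..d} ==> \<eta> t = 0" "!!t. t \<notin> {c..d} ==> deriv \<eta> t = 0"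
  and \<eta>c: "continuous_on UNIV \<eta>" "continuous_on UNIV (deriv \<eta>)"
  by (rule test_function_real[OF \<eta>(1) T]) (rule that)
 let ?J = "{c..d}"
 have J0: "?J \<subseteq> Ico0 T" using cd(3) Ioo0_subset by blast
 have wL: "(%x. u t x - v x) \<in> L2 lebesgue" "wt t \<in> L2 lebesgue" if "t \<in> Ico0 T" for t
  using C that by (auto simp: C1_curve_def)
 obtain K1 where K1: "!!t. t \<in> ?J ==> L2_norm lebesgue (%x. u t x - v x) <= K1" using L2_curve_bounded(1)[OF C J0] by blast
 obtain K2 where K2: "!!t. t \<in> ?J ==> L2_norm lebesgue (wt t) <= K2" using L2_curve_bounded(2)[OF C J0] by blast
 obtain \<xi> where \<xi>: "!!n. \<xi> n \<in> test_functions UNIV" "!!n x. 0 <= \<xi> n x"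
  and l: "(%n. LINT x|lebesgue. \<bar>\<xi> n x - \<phi> x\<bar>) \<longlonglongrightarrow> 0" "(%n. L2_norm lebesgue (%x. \<xi> n x - \<phi> x)) \<longlonglongrightarrow> 0"
   "(%n. LINT x|lebesgue. \<bar>laplacian (\<xi> n) x - src x\<bar>) \<longlonglongrightarrow> 0" "(%n. L2_norm lebesgue (%x. laplacian (\<xi> n) x - src x)) \<longlonglongrightarrow> 0"
  by (rule approximation) (rule that)
 define d1 where "d1 n = L2_norm lebesgue (%x. \<xi> n x - \<phi> x)" for n
 define d2 where "d2 n = L2_norm lebesgue (%x. (laplacian (\<xi> n) x + exp (v x) * \<xi> n x) - \<sigma>\<^sup>2 * \<phi> x)" for n
 have L2: "\<xi> n \<in> L2 lebesgue" "laplacian (\<xi> n) \<in> L2 lebesgue" "(%x. exp (v x) * \<xi> n x) \<in> L2 lebesgue" for n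
 proof -
  note t = test_continuous[OF \<xi>(1)]
  obtain R where R: "supp_ball R (\<xi> n)" "supp_ball R (laplacian (\<xi> n))" using t(3) by blast
  show "\<xi> n \<in> L2 lebesgue" "laplacian (\<xi> n) \<in> L2 lebesgue" using continuous_csupp_L2 t(1,2) R by blast+
  show "(%x. exp (v x) * \<xi> n x) \<in> L2 lebesgue"
   by (rule continuous_csupp_L2[of _ R]) (use R in \<open>auto simp: supp_ball_def intro!: continuous_intros V_cont t(1)\<close>)
 qed
 have L2s: "(%x. laplacian (\<xi> n) x + exp (v x) * \<xi> n x) \<in> L2 lebesgue" for n by (rule L2_add[OF L2(2,3)])
 have L2\<phi>: "(%x. \<sigma>\<^sup>2 * \<phi> x) \<in> L2 lebesgue" by (rule L2_cmult[OF L2_facts(1)])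
 have d2_le: "d2 n <= L2_norm lebesgue (%x. laplacian (\<xi> n) x - src x) + Vm * d1 n" for n
 proof -
  have V2: "(%x. exp (v x) * (\<xi> n x - \<phi> x)) \<in> L2 lebesgue"
   using L2_diff[OF L2(3)[of n] L2_facts(2)] by (simp add: right_diff_distrib)
  have "d2 n = L2_norm lebesgue (%x. (laplacian (\<xi> n) x - src x) + exp (v x) * (\<xi> n x - \<phi> x))"
   unfolding d2_def src_def by (simp add: algebra_simps)
  also have "... <= L2_norm lebesgue (%x. laplacian (\<xi> n) x - src x) + L2_norm lebesgue (%x. exp (v x) * (\<xi> n x - \<phi> x))"
   by (rule L2_norm_triangle[OF L2_diff[OF L2(2) L2_facts(3)] V2])
  also have "L2_norm lebesgue (%x. exp (v x) * (\<xi> n x - \<phi> x)) <= L2_norm lebesgue (%x. Vm * (\<xi> n x - \<phi> x))"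
   unfolding L2_norm_def
  proof (intro real_sqrt_le_mono integral_mono)
   show "integrable lebesgue (%x. (exp (v x) * (\<xi> n x - \<phi> x))\<^sup>2)" using V2 by (simp add: L2_def)
   show "integrable lebesgue (%x. (Vm * (\<xi> n x - \<phi> x))\<^sup>2)"
    using L2_cmult[OF L2_diff[OF L2(1)[of n] L2_facts(1)], of Vm] by (simp add: L2_def)
   show "(exp (v x) * (\<xi> n x - \<phi> x))^2 <= (Vm * (\<xi> n x - \<phi> x))^2" for x
    unfolding power_mult_distrib by (intro mult_right_mono power_mono V_le) auto
  qed
  finally show ?thesis using Vm unfolding L2_norm_cmult d1_def by simp
 qed
 define \<delta> where "\<delta> n = d1 n + d2 n" for n
 have d0: "0 <= d1 n" "0 <= d2 n" for n unfolding d1_def d2_def by (rule L2_norm_nonneg)+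
 have d1_lim: "d1 \<longlonglongrightarrow> 0" using l(2) unfolding d1_def .
 have "d2 \<longlonglongrightarrow> 0"
 proof (rule tendsto_sandwich[OF _ _ tendsto_const])
  show "\<forall>\<^sub>F n in sequentially. 0 <= d2 n" using d0 by simp
  show "\<forall>\<^sub>F n in sequentially. d2 n <= L2_norm lebesgue (%x. laplacian (\<xi> n) x - src x) + Vm * d1 n" using d2_le by simp
  show "(%n. L2_norm lebesgue (%x. laplacian (\<xi> n) x - src x) + Vm * d1 n) \<longlonglongrightarrow> 0"
   using tendsto_add[OF l(4) tendsto_mult_right_zero[OF d1_lim, of Vm]] by simp
 qed
 then have \<delta>: "\<delta> \<longlonglongrightarrow> 0" using tendsto_add[OF d1_lim, of d2 0] unfolding \<delta>_def by simp
 define A where "A t = deriv a t * \<eta> t + a t * deriv \<eta> t" for t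
 define I where "I P S t = - P t * A t + b t * P t * \<eta> t - \<eta> t * S t" for P S :: "real => real" and t
 have ac: "continuous_on ?J a" "continuous_on ?J (deriv a)"
  using C1_differentiable_imp_continuous_on[OF a] C1_differentiable_deriv(2)[OF a] cd(3) continuous_on_subset by blast+
 have \<eta>J: "continuous_on ?J \<eta>" "continuous_on ?J (deriv \<eta>)" using \<eta>c continuous_on_subset by blast+
 have Ac: "continuous_on ?J A" unfolding A_def by (intro continuous_intros ac \<eta>J)
 have bJ: "b absolutely_integrable_on ?J" by (rule L1_loc_Icc[OF b cd(1)])
 have ci: "set_integrable lebesgue ?J f" if "continuous_on ?J f" for f :: "real => real"
  using absolutely_integrable_continuous_real[OF that] .
 have Ii: "set_integrable lebesgue ?J (I P S)" if "continuous_on ?J P" "continuous_on ?J S" for P S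
 proof -
  have "set_integrable lebesgue ?J (%t. (- P t * A t - \<eta> t * S t) + b t * (P t * \<eta> t))"
   by (intro set_integral_add(1) ci absolutely_integrable_mult_continuous bJ continuous_intros that \<eta>J Ac)
  then show ?thesis unfolding I_def by (simp add: algebra_simps)
 qed
 define P where "P n t = (LINT x|lebesgue. \<xi> n x * wt t x)" for n t
 define S where "S n t = (LINT x|lebesgue. (laplacian (\<xi> n) x + exp (v x) * \<xi> n x) * (u t x - v x))" for n t
 have Pc: "continuous_on ?J (P n)" for n
  unfolding P_def[abs_def] by (rule continuous_on_subset[OF L2_curve_functional(2)[OF C L2(1)] J0])
 have Sc: "continuous_on ?J (S n)" for n
  unfolding S_def[abs_def] by (rule continuous_on_subset[OF L2_curve_functional(3)[OF C L2s] J0])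
 have pc: "continuous_on ?J p"
  unfolding p_def by (rule continuous_on_subset[OF L2_curve_functional(2)[OF C L2_facts(1)] J0])
 have yc: "continuous_on ?J y"
  unfolding y_def by (rule continuous_on_subset[OF L2_curve_functional(3)[OF C L2_facts(1)] J0])
 have Vc: "continuous_on ?J (%t. LINT x|lebesgue. exp (v x) * \<xi> n x * (u t x - v x))" for n
  by (rule continuous_on_subset[OF L2_curve_functional(3)[OF C L2(3)] J0])
 have Lc: "continuous_on ?J (%t. LINT x|lebesgue. laplacian (\<xi> n) x * (u t x - v x))" for n
  by (rule continuous_on_subset[OF L2_curve_functional(3)[OF C L2(2)] J0])
 have pos: "0 <= (LINT t:?J|lebesgue. I (P n) (S n) t)" for n
 proof -
  let ?V = "%t. LINT x|lebesgue. exp (v x) * \<xi> n x * (u t x - v x)"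
  let ?L = "%t. LINT x|lebesgue. laplacian (\<xi> n) x * (u t x - v x)"
  let ?R = "I (P n) ?L"
  have Vi: "set_integrable lebesgue ?J (%t. \<eta> t * ?V t)" by (intro ci continuous_intros \<eta>J Vc)
  have "(LINT t:Ioo0 T|lebesgue. \<eta> t * ?V t) <= (LINT t:Ioo0 T|lebesgue. - P n t * (deriv a t * \<eta> t + a t * deriv \<eta> t)
   + b t * P n t * \<eta> t - \<eta> t * ?L t)"
   unfolding P_def
  proof (rule perturbation_weak_inequality[OF pe v_cont \<eta> \<xi>(1,2)])
   fix t assume "t \<in> Ioo0 T"
   then have t: "t \<in> Ico0 T" using Ioo0_subset by blast
   show "integrable lebesgue (%x. \<xi> n x * wt t x)" by (rule L2_Cauchy_Schwarz(1)[OF L2(1) wL(2)[OF t]])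
   show "integrable lebesgue (%x. laplacian (\<xi> n) x * (u t x - v x))" by (rule L2_Cauchy_Schwarz(1)[OF L2(2) wL(1)[OF t]])
   show "integrable lebesgue (%x. exp (v x) * \<xi> n x * (u t x - v x))" by (rule L2_Cauchy_Schwarz(1)[OF L2(3) wL(1)[OF t]])
  next
   show "set_integrable lebesgue (Ioo0 T) (%t. \<eta> t * ?V t)"
    by (subst set_integral_restrict(2)[OF cd(3)]) (use z Vi in auto)
  qed
  also have "... = (LINT t:Ioo0 T|lebesgue. ?R t)" by (simp add: I_def A_def)
  also have "... = (LINT t:?J|lebesgue. ?R t)" by (rule set_integral_restrict(1)[OF cd(3)]) (simp add: I_def A_def z)
  also have "(LINT t:Ioo0 T|lebesgue. \<eta> t * ?V t) = (LINT t:?J|lebesgue. \<eta> t * ?V t)"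
   by (rule set_integral_restrict(1)[OF cd(3)]) (simp add: z)
  finally have "0 <= (LINT t:?J|lebesgue. ?R t - \<eta> t * ?V t)"
   by (subst set_integral_diff(2)[OF Ii[OF Pc Lc] Vi]) simp
  also have "... = (LINT t:?J|lebesgue. I (P n) (S n) t)"
  proof (rule set_lebesgue_integral_cong)
   show "ALL t. t \<in> ?J --> ?R t - \<eta> t * ?V t = I (P n) (S n) t"
   proof (intro allI impI)
    fix t assume "t \<in> ?J"
    then have t: "t \<in> Ico0 T" using J0 by blast
    have "S n t = ?L t + ?V t" unfolding S_def distrib_right
     by (rule integral_plus[OF L2_Cauchy_Schwarz(1)[OF L2(2) wL(1)[OF t]] L2_Cauchy_Schwarz(1)[OF L2(3) wL(1)[OF t]]])
    then show "?R t - \<eta> t * ?V t = I (P n) (S n) t" unfolding I_def by (simp add: algebra_simps)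
   qed
  qed simp
  finally show ?thesis .
 qed
 have "0 <= (LINT t:?J|lebesgue. I p (%t. \<sigma>\<^sup>2 * y t) t)"
 proof (rule set_lebesgue_integral_limit_nonneg[OF Ii[OF Pc Sc] pos Ii _ _ \<delta>])
  show "set_integrable lebesgue ?J (%t. \<bar>K2\<bar> * \<bar>A t\<bar> + \<bar>K2\<bar> * \<bar>b t * \<eta> t\<bar> + \<bar>K1\<bar> * \<bar>\<eta> t\<bar>)"
   by (intro set_integral_add(1) set_integrable_mult_right set_integrable_abs ci absolutely_integrable_mult_continuous bJ \<eta>J Ac)
  fix n t assume tJ: "t \<in> ?J"
  then have t: "t \<in> Ico0 T" using J0 by blast
  have "P n t - p t = (LINT x|lebesgue. (\<xi> n x - \<phi> x) * wt t x)" unfolding P_def p_def left_diff_distrib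
   by (rule integral_minus[OF L2_Cauchy_Schwarz(1)[OF L2(1) wL(2)[OF t]] L2_Cauchy_Schwarz(1)[OF L2_facts(1) wL(2)[OF t]], symmetric])
  then have "\<bar>P n t - p t\<bar> <= d1 n * L2_norm lebesgue (wt t)"
   unfolding d1_def using L2_Cauchy_Schwarz(2)[OF L2_diff[OF L2(1)[of n] L2_facts(1)] wL(2)[OF t]] by simp
  also have "... <= \<delta> n * \<bar>K2\<bar>" using d0[of n] K2[OF tJ] by (intro mult_mono L2_norm_nonneg) (auto simp: \<delta>_def)
  finally have 1: "\<bar>P n t - p t\<bar> <= \<delta> n * \<bar>K2\<bar>" .
  have "S n t - \<sigma>\<^sup>2 * y t = (LINT x|lebesgue. (laplacian (\<xi> n) x + exp (v x) * \<xi> n x) * (u t x - v x)) - (LINT x|lebesgue. (\<sigma>^2 * \<phi> x) * (u t x - v x))"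
   unfolding S_def y_def by (simp add: mult.assoc)
  also have "... = (LINT x|lebesgue. ((laplacian (\<xi> n) x + exp (v x) * \<xi> n x) - \<sigma>\<^sup>2 * \<phi> x) * (u t x - v x))"
   unfolding left_diff_distrib[of "laplacian (\<xi> n) _ + exp (v _) * \<xi> n _"]
   by (rule integral_minus[OF L2_Cauchy_Schwarz(1)[OF L2s wL(1)[OF t]] L2_Cauchy_Schwarz(1)[OF L2\<phi> wL(1)[OF t]], symmetric])
  finally have "\<bar>S n t - \<sigma>\<^sup>2 * y t\<bar> <= d2 n * L2_norm lebesgue (%x. u t x - v x)"
   unfolding d2_def using L2_Cauchy_Schwarz(2)[OF L2_diff[OF L2s[of n] L2\<phi>] wL(1)[OF t]] by simp
  also have "... <= \<delta> n * \<bar>K1\<bar>" using d0[of n] K1[OF tJ] by (intro mult_mono L2_norm_nonneg) (auto simp: \<delta>_def)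
  finally have 2: "\<bar>S n t - \<sigma>\<^sup>2 * y t\<bar> <= \<delta> n * \<bar>K1\<bar>" .
  have "I (P n) (S n) t - I p (%t. \<sigma>\<^sup>2 * y t) t = - (P n t - p t) * A t + (P n t - p t) * (b t * \<eta> t) - (S n t - \<sigma>\<^sup>2 * y t) * \<eta> t"
   unfolding I_def by (simp add: algebra_simps)
  then have "\<bar>I (P n) (S n) t - I p (%t. \<sigma>\<^sup>2 * y t) t\<bar> <= \<bar>P n t - p t\<bar> * \<bar>A t\<bar> + \<bar>P n t - p t\<bar> * \<bar>b t * \<eta> t\<bar> + \<bar>S n t - \<sigma>\<^sup>2 * y t\<bar> * \<bar>\<eta> t\<bar>"
   unfolding abs_mult[of "P n t - p t", symmetric] abs_mult[of "S n t - _", symmetric] by (simp only: mult_minus_left)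
  also have "... <= (\<delta> n * \<bar>K2\<bar>) * \<bar>A t\<bar> + (\<delta> n * \<bar>K2\<bar>) * \<bar>b t * \<eta> t\<bar> + (\<delta> n * \<bar>K1\<bar>) * \<bar>\<eta> t\<bar>"
   by (intro add_mono mult_right_mono 1 2 abs_ge_zero)
  finally show "\<bar>I (P n) (S n) t - I p (%t. \<sigma>\<^sup>2 * y t) t\<bar> <= \<delta> n * (\<bar>K2\<bar> * \<bar>A t\<bar> + \<bar>K2\<bar> * \<bar>b t * \<eta> t\<bar> + \<bar>K1\<bar> * \<bar>\<eta> t\<bar>)"
   by (simp add: algebra_simps)
 qed (intro continuous_intros pc yc)+
 also have "... = (LINT t:Ioo0 T|lebesgue. I p (%t. \<sigma>\<^sup>2 * y t) t)"
  by (rule set_integral_restrict(1)[OF cd(3), symmetric]) (simp add: I_def A_def z)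
 also have "... = (LINT t:Ioo0 T|lebesgue. - (a t * p t) * deriv \<eta> t - (deriv a t * p t - b t * p t + \<sigma>^2 * y t) * \<eta> t)"
  by (rule arg_cong[where f = "set_lebesgue_integral lebesgue (Ioo0 T)"]) (simp add: fun_eq_iff I_def A_def algebra_simps)
 finally show ?thesis .
qed

text \<open>The inequality \<open>(a p)' \<ge> a' p - b p + \<sigma>\<^sup>2 y\<close> is divided by \<open>a\<close> through the weight \<open>1/a\<close>.\<close>
lemma second_order_supersolution:
 assumes T: "T > 0" and a: "a C1_differentiable_on Ioo0 T" "a0 > 0" "!!t. t >= 0 ==> a t >= a0" and b: "b \<in> L1_loc {0<..}"
  and C: "C1_curve (L2 lebesgue) {L2_norm lebesgue} (Ico0 T) (%t x. u t x - v x) wt"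
  and pe: "perturbation_eq T a b v u wt"
 defines "y \<equiv> %t. LINT x|lebesgue. \<phi> x * (u t x - v x)" and "p \<equiv> %t. LINT x|lebesgue. \<phi> x * wt t x"
 assumes y0: "y 0 > 0" and p0: "p 0 > 0"
 shows "supersolution T y p (%t. \<sigma>\<^sup>2 / a t) (%t. b t / a t)"
proof -
 note da = C1_differentiable_deriv[OF a(1)]
 have ac: "continuous_on (Ioo0 T) a" by (rule C1_differentiable_imp_continuous_on[OF a(1)])
 have apos: "a t > 0" if "t \<in> Ioo0 T" for t using a(3)[of t] a(2) that by (simp add: Ioo0_def)
 have bJ: "b absolutely_integrable_on {s..t}" if "0 < s" for s t by (rule L1_loc_Icc[OF b that])
 have pc: "continuous_on (Ico0 T) p" unfolding p_def by (rule L2_curve_functional(2)[OF C L2_facts(1)])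
 have yc: "continuous_on (Ico0 T) y" unfolding y_def by (rule L2_curve_functional(3)[OF C L2_facts(1)])
 have pyI: "continuous_on (Ioo0 T) p" "continuous_on (Ioo0 T) y" using pc yc Ioo0_subset continuous_on_subset by blast+
 let ?g = "%t. deriv a t * p t - b t * p t + \<sigma>^2 * y t"
 have cJ: "continuous_on {s..t} f" if "continuous_on (Ioo0 T) f" "0 < s" "t \<in> Ioo0 T" for f :: "real => real" and s t
  by (rule continuous_on_subset[OF that(1) Ioo0_Icc[OF that(3,2)]])
 show ?thesis
 proof (unfold_locales, goal_cases)
  case (3 t) then show ?case unfolding y_def p_def by (rule L2_curve_functional(1)[OF C L2_facts(1)])
 next
  case 6 show ?case by (intro continuous_intros ac) (use apos in force)
 next
  case (7 t) then show ?case using apos[of t] by simp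
 next
  case (8 s t)
  have "(%r. b r * (1 / a r)) absolutely_integrable_on {s..t}"
   by (intro absolutely_integrable_mult_continuous bJ 8 cJ[OF _ 8] continuous_intros ac) (use apos in force)
  then show ?case by simp
 next
  case (9 s t)
  show ?case
  proof (cases "s = t")
   case False
   have "integral {s..t} (%r. ?g r * (1 / a r) + a r * p r * (- deriv a r / (a r)^2)) <= 1 / a t * (a t * p t) - 1 / a s * (a s * p s)"
   proof (rule weak_to_integral[where T = T and F = "%t. a t * p t"])
    show "continuous_on (Ioo0 T) (%t. a t * p t)" by (intro continuous_intros ac pyI)
    show "?g absolutely_integrable_on {s..t}" if st: "0 < s" "t \<in> Ioo0 T" for s t
    proof -
     have 1: "(%t. deriv a t * p t + \<sigma>^2 * y t) absolutely_integrable_on {s..t}"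
      by (intro absolutely_integrable_continuous_real cJ[OF _ st] continuous_intros da pyI)
     have 2: "(%r. b r * p r) absolutely_integrable_on {s..t}"
      by (rule absolutely_integrable_mult_continuous[OF bJ[OF st(1)] cJ[OF pyI(1) st]])
     show ?thesis using set_integral_diff(1)[OF 1 2] by (simp add: algebra_simps)
    qed
    show "((%t. 1 / a t) has_real_derivative - deriv a t / (a t)^2) (at t)" if "t \<in> Ioo0 T" for t
     using da(1)[OF that] apos[OF that] by (auto intro!: derivative_eq_intros simp: power2_eq_square)
    show "continuous_on (Ioo0 T) (%t. - deriv a t / (a t)^2)" by (intro continuous_intros da ac) (use apos in force)
    show "0 <= 1 / a t" if "t \<in> Ioo0 T" for t using apos[OF that] by simp
    show "0 <= (LINT t:Ioo0 T|lebesgue. - (a t * p t) * deriv \<eta> t - ?g t * \<eta> t)" if "\<eta> \<in> test_functions (Ioo0 T)" "!!x. \<eta> x >= 0" for \<eta>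
     unfolding p_def y_def by (rule second_order_weak[OF T a(1) b C pe that])
   qed (use 9 False in auto)
   moreover have "integral {s..t} (%r. ?g r * (1 / a r) + a r * p r * (- deriv a r / (a r)^2)) = integral {s..t} (%r. \<sigma>\<^sup>2 / a r * y r - b r / a r * p r)"
   proof (rule Henstock_Kurzweil_Integration.integral_cong)
    fix r assume "r \<in> {s..t}"
    then have "a r > 0" using Ioo0_Icc[OF 9(3,1)] apos by blast
    then show "?g r * (1 / a r) + a r * p r * (- deriv a r / (a r)^2) = \<sigma>^2 / a r * y r - b r / a r * p r"
     by (simp add: field_simps power2_eq_square)
   qed
   moreover have "a t > 0" "a s > 0" using apos[OF 9(3)] apos[of s] Ioo0_Icc[OF 9(3,1)] 9(2) by auto
   ultimately show ?thesis by simp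
  qed simp
 qed (use T pc y0 p0 in auto)
qed

end

section \<open>Growth rates for the second-order equation\<close>

lemma Linf_norm_nonneg: "f \<in> Linf M ==> 0 <= Linf_norm M f"
proof -
 assume f: "f \<in> Linf M"
 then have [measurable]: "f \<in> borel_measurable M" by (simp add: Linf_def)
 show "0 <= Linf_norm M f"
 proof (cases "emeasure M (space M) = 0")
  case True
  then have "esssup M (%x. ereal \<bar>f x\<bar>) = - \<infinity>" by (intro esssup_zero_space) auto
  then show ?thesis by (simp add: Linf_norm_def)
 next
  case False
  have "esssup M (%x. 0 :: ereal) <= esssup M (%x. ereal \<bar>f x\<bar>)" by (intro esssup_mono) auto
  then have "0 <= esssup M (%x. ereal \<bar>f x\<bar>)" using esssup_const[OF False, of "0 :: ereal"] by simp
  then show ?thesis unfolding Linf_norm_def by (rule real_of_ereal_pos)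
 qed
qed

lemma AE_le_Linf_norm: "f \<in> Linf M ==> AE x in M. \<bar>f x\<bar> <= Linf_norm M f"
proof -
 assume f: "f \<in> Linf M"
 have ae: "AE x in M. ereal \<bar>f x\<bar> <= esssup M (%x. ereal \<bar>f x\<bar>)" by (rule esssup_AE)
 show ?thesis
 proof (cases "esssup M (%x. ereal \<bar>f x\<bar>)")
  case (real r)
  then show ?thesis using ae by (simp add: Linf_norm_def)
 next
  case PInf
  then show ?thesis using f by (simp add: Linf_def)
 next
  case MInf
  then show ?thesis using ae by (auto elim: eventually_mono)
 qed
qed

lemma Ioo0_measurable: "Ioo0 T \<in> sets lebesgue"
 using Ioo0_open[of T] by (simp add: borel_open)

lemma AE_lebesgue_on_Ioo0: "(AE t in lebesgue_on (Ioo0 T). P t) ==> AE t in lebesgue. t \<in> Ioo0 T --> P t"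
 using Ioo0_measurable[of T] by (simp add: AE_restrict_space_iff)

lemma Ico0_Ioo: "t \<in> Ico0 T ==> 0 <= s ==> {s<..<t} \<subseteq> Ioo0 T"
proof
 fix x assume "t \<in> Ico0 T" "0 <= s" "x \<in> {s<..<t}"
 then show "x \<in> Ioo0 T" using less_trans[of "ereal x" "ereal t" T] by (auto simp: Ico0_def Ioo0_def)
qed

lemma bounded_continuous_integrable:
 fixes f :: "real => real"
 assumes c: "continuous_on (Ioo0 T) f" and b: "!!t. t \<in> Ioo0 T ==> \<bar>f t\<bar> <= M" and t: "t \<in> Ico0 T" and s: "0 <= s"
 shows "f integrable_on {s..t}"
proof -
 have sub: "{s<..<t} \<subseteq> Ioo0 T" by (rule Ico0_Ioo[OF t s])
 have "f absolutely_integrable_on {s<..<t}"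
 proof (rule measurable_bounded_by_integrable_imp_absolutely_integrable)
  show "f \<in> borel_measurable (lebesgue_on {s<..<t})"
   by (intro continuous_imp_measurable_on_sets_lebesgue continuous_on_subset[OF c sub]) auto
  show "(%_. M) integrable_on {s<..<t}" by (simp add: integrable_on_open_interval_real integrable_const_ivl)
  show "norm (f x) <= M" if "x \<in> {s<..<t}" for x using b[of x] sub that by auto
 qed auto
 then show ?thesis using absolutely_integrable_on_Icc_iff_Ioo[where f = f and a = s and b = t] by (simp add: absolutely_integrable_on_def)
qed

text \<open>The lower bound for \<open>\<mu>\<close> comes from rationalising the root: \<open>m = (\<sigma>\<^sup>2/a) / (B + sqrt (\<sigma>\<^sup>2/a + B\<^sup>2))\<close>, with the denominator bounded because \<open>a \<ge> a0\<close>.\<close>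
lemma riccati_rate:
 assumes T: "T > 0" and a: "continuous_on (Ioo0 T) a" "a0 > 0" "ALL t>=0. a t >= a0" and B: "B >= 0" and \<sigma>: "\<sigma> > 0"
 defines "m \<equiv> %s. - B + sqrt (\<sigma>^2 / a s + B^2)"
 defines "\<mu> \<equiv> %t. integral {0..t} m"
 shows "!!t. t \<in> Ioo0 T ==> m t > 0"
  and "!!s t. 0 <= s ==> s <= t ==> t \<in> Ico0 T ==> \<mu> t = \<mu> s + integral {s..t} m"
  and "strict_mono_on (Ico0 T) \<mu>" and "!!t. t \<in> Ioo0 T ==> \<mu> t > 0"
  and "EX C>0. ALL t:Ioo0 T. \<mu> t > C * integral {0..t} (%s. 1 / a s)"
proof -
 have apos: "a t > 0" if "t >= 0" for t using a(2,3) that by (auto intro: less_le_trans)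
 have I: "t >= 0" if "t \<in> Ioo0 T" for t using that by (simp add: Ioo0_def)
 show mpos: "m t > 0" if "t \<in> Ioo0 T" for t
 proof -
  have "sqrt (B^2) < sqrt (\<sigma>^2 / a t + B^2)" using apos[OF I[OF that]] \<sigma> by (intro real_sqrt_less_mono) simp
  then show ?thesis using B by (simp add: m_def)
 qed
 define N where "N = sqrt (\<sigma>^2 / a0 + B^2)"
 have sq_le: "sqrt (\<sigma>^2 / a t + B^2) <= N" if "t >= 0" for t
  unfolding N_def using a(2) a(3)[rule_format, OF that] by (intro real_sqrt_le_mono add_right_mono divide_left_mono) auto
 have N: "N > 0" unfolding N_def using \<sigma> a(2) by (simp add: add_pos_nonneg)
 have mc: "continuous_on (Ioo0 T) m" unfolding m_def by (intro continuous_intros a(1)) (use apos I in force)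
 have mb: "\<bar>m t\<bar> <= N" if "t \<in> Ioo0 T" for t
  using mpos[OF that] sq_le[OF I[OF that]] B by (simp add: m_def)
 have mi: "m integrable_on {s..t}" if "0 <= s" "t \<in> Ico0 T" for s t
  by (rule bounded_continuous_integrable[OF mc mb that(2,1)])
 show split: "\<mu> t = \<mu> s + integral {s..t} m" if "0 <= s" "s <= t" "t \<in> Ico0 T" for s t
  unfolding \<mu>_def using Henstock_Kurzweil_Integration.integral_combine[OF that(1,2) mi] that by simp
 have pos: "integral {s..t} m > 0" if st: "0 <= s" "s < t" "t \<in> Ico0 T" for s t
 proof -
  define r where "r = (s + t) / 2"
  have r: "s < r" "r < t" "0 < r" using st by (auto simp: r_def)
  have tI: "t \<in> Ioo0 T" using st by (simp add: Ico0_def Ioo0_def)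
  have rI: "{r..t} \<subseteq> Ioo0 T" by (rule Ioo0_Icc[OF tI r(3)])
  have rT: "r \<in> Ico0 T" using Ico0_Icc[OF st(3), of r] r by auto
  have rest: "{s<..<r} \<subseteq> Ioo0 T" by (rule Ico0_Ioo[OF rT st(1)])
  have "integral {s..t} m = integral {s..r} m + integral {r..t} m"
   using Henstock_Kurzweil_Integration.integral_combine[of s r t m] mi[OF st(1,3)] r by simp
  moreover have "0 < integral {r..t} m"
  proof -
   have "integral {r..t} (%_. 0) < integral {r..t} m"
    by (rule integral_less_real) (use r continuous_on_subset[OF mc rI] in \<open>auto intro!: mpos subsetD[OF rI]\<close>)
   then show ?thesis by simp
  qed
  moreover have "0 <= integral {s<..<r} m"
   using mi[OF st(1) rT] rest mpos by (intro Henstock_Kurzweil_Integration.integral_nonneg) (auto simp: integrable_on_open_interval_real intro!: less_imp_le)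
  ultimately show ?thesis by (simp add: integral_open_interval_real)
 qed
 show "strict_mono_on (Ico0 T) \<mu>"
 proof (rule strict_mono_onI)
  fix s t assume "s \<in> Ico0 T" "t \<in> Ico0 T" "s < t"
  then show "\<mu> s < \<mu> t" using split[of s t] pos[of s t] by (auto simp: Ico0_def)
 qed
 show \<mu>pos: "\<mu> t > 0" if "t \<in> Ioo0 T" for t
  unfolding \<mu>_def using pos[of 0 t] that Ioo0_subset by (auto simp: Ioo0_def Ico0_def)
 define c where "c = \<sigma>^2 / (B + N)"
 have c: "c > 0" using \<sigma> B N by (simp add: c_def)
 have mge: "c * (1 / a t) <= m t" if "t \<in> Ioo0 T" for t
 proof -
  have ap: "a t > 0" using apos I that by blast
  define q where "q = sqrt (\<sigma>^2 / a t + B^2)"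
  have "(q - B) * (q + B) = \<sigma>^2 / a t" using ap by (simp add: q_def algebra_simps power2_eq_square[symmetric])
  moreover have "m t * (q + B) <= m t * (N + B)"
   using mpos[OF that] sq_le[OF I[OF that]] by (intro mult_left_mono) (auto simp: q_def)
  ultimately have "\<sigma>^2 / a t <= m t * (N + B)" by (simp add: m_def q_def)
  then have "\<sigma>^2 / a t / (N + B) <= m t" using N B by (subst pos_divide_le_eq) auto
  then show ?thesis by (simp add: c_def field_simps)
 qed
 have "\<mu> t > c / 2 * integral {0..t} (%s. 1 / a s)" if t: "t \<in> Ioo0 T" for t
 proof -
  have tJ: "t \<in> Ico0 T" using t Ioo0_subset by blast
  have ai: "(%s. 1 / a s) integrable_on {0..t}"
  proof (rule bounded_continuous_integrable[OF _ _ tJ])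
   show "continuous_on (Ioo0 T) (%s. 1 / a s)" by (intro continuous_intros a(1)) (use apos I in force)
   show "\<bar>1 / a t\<bar> <= 1 / a0" if "t \<in> Ioo0 T" for t using a(2) a(3)[rule_format, OF I[OF that]] by (simp add: frac_le)
  qed simp
  have I0: "{0<..<t} \<subseteq> Ioo0 T" by (rule Ico0_Ioo[OF tJ]) simp
  have mi0: "m integrable_on {0<..<t}" using mi[of 0 t] tJ by (simp add: integrable_on_open_interval_real)
  have ai0: "(%s. 1 / a s) integrable_on {0<..<t}" using ai by (simp add: integrable_on_open_interval_real)
  have "integral {0<..<t} (%s. c * (1 / a s)) <= integral {0<..<t} m"
   by (rule integral_le[OF integrable_on_mult_right[OF ai0] mi0]) (use mge I0 in auto)
  then have "c * integral {0..t} (%s. 1 / a s) <= \<mu> t"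
   unfolding integral_mult_right by (simp add: \<mu>_def integral_open_interval_real)
  then show ?thesis using \<mu>pos[OF t] by linarith
 qed
 then show "EX C>0. ALL t:Ioo0 T. \<mu> t > C * integral {0..t} (%s. 1 / a s)" using c by (intro exI[of _ "c / 2"]) auto
qed

text \<open>On a bounded time interval any exponential is bounded, so a positive lower bound for \<open>y\<close> already gives the claim.\<close>
lemma finite_time_growth:
 assumes T: "T > 0" "T ~= \<infinity>" and y: "!!t. t \<in> Ioo0 T ==> c <= y t" and c: "c > 0"
 shows "EX T0>0. EX C>0. EX \<mu>>0. ereal T0 < T & (ALL t:Ioo0 T. t > T0 --> y t >= C * exp (\<mu> * t))"
proof -
 obtain R where R: "T = ereal R" "R > 0" using T by (cases T) auto
 show ?thesis
 proof (intro exI conjI ballI impI)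
  show "R / 2 > 0" "c * exp (- R) > 0" "(1::real) > 0" "ereal (R / 2) < T" using R c by auto
  fix t assume t: "t \<in> Ioo0 T" "R / 2 < t"
  then have "exp (- R) * exp (1 * t) <= 1" using R by (simp add: Ioo0_eq exp_add[symmetric])
  then have "c * (exp (- R) * exp (1 * t)) <= c * 1" using c by (intro mult_left_mono) auto
  then show "y t >= c * exp (- R) * exp (1 * t)" using y[OF t(1)] by (simp add: mult.assoc)
 qed
qed

lemma second_order_riccati_growth:
 assumes a: "a C1_differentiable_on Ioo0 T" "a0 > 0" "!!t. t >= 0 ==> a t >= a0" "!!t. t \<in> Ioo0 T ==> deriv a t > 0" and \<sigma>: "\<sigma> > 0"
  and b: "b \<in> Linf (lebesgue_on (Ioo0 T))"
  and sup: "supersolution T y p (%t. \<sigma>\<^sup>2 / a t) (%t. b t / a t)"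
 defines "B \<equiv> Linf_norm (lebesgue_on (Ioo0 T)) b / a0"
 shows "EX C>0. ALL t:Ioo0 T. y t >= C * exp (integral {0..t} (%s. - B + sqrt (\<sigma>^2 / a s + B^2)))"
proof -
 interpret supersolution T y p "%t. \<sigma>\<^sup>2 / a t" "%t. b t / a t" by (rule sup)
 have B: "B >= 0" unfolding B_def using Linf_norm_nonneg[OF b] a(2) by simp
 have apos: "a t > 0" if "t \<in> Ioo0 T" for t using a(3)[of t] a(2) that by (simp add: Ioo0_def)
 define m where "m = (%s. - B + sqrt (\<sigma>^2 / a s + B^2))"
 define \<mu> where "\<mu> = (%t. integral {0..t} m)"
 have a3: "ALL t>=0. a t >= a0" using a(3) by blast
 note rate = riccati_rate[OF T C1_differentiable_imp_continuous_on[OF a(1)] a(2) a3 B \<sigma>, folded m_def, folded \<mu>_def]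
 have q: "\<sigma>^2 / a t + B^2 > 0" if "t \<in> Ioo0 T" for t using apos[OF that] \<sigma> by (simp add: add_pos_nonneg)
 have "EX t0:Ioo0 T. EX D. ALL t:Ioo0 T. t0 <= t --> ln (y t) - ln (y t0) >= integral {t0..t} m - D"
 proof (rule riccati_growth[OF _ _ _ B])
  fix t assume t: "t \<in> Ioo0 T"
  show "(m has_real_derivative (- \<sigma>\<^sup>2 * deriv a t / (a t)^2) / (2 * sqrt (\<sigma>^2 / a t + B^2))) (at t)"
   unfolding m_def using C1_differentiable_deriv(1)[OF a(1) t] apos[OF t] q[OF t]
   by (auto intro!: derivative_eq_intros simp: power2_eq_square field_simps)
  show "(- \<sigma>\<^sup>2 * deriv a t / (a t)^2) / (2 * sqrt (\<sigma>^2 / a t + B^2)) <= 0"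
   using a(4)[OF t] q[OF t] by (intro divide_nonpos_nonneg) auto
  show "0 <= m t" unfolding m_def by (rule less_imp_le[OF rate(1)[OF t]])
  show "\<sigma>^2 / a t = (m t)^2 + 2 * B * m t"
   using q[OF t] by (simp add: m_def power2_eq_square algebra_simps)
 next
  show "AE t in lebesgue. t \<in> Ioo0 T --> \<bar>b t / a t\<bar> <= B"
   using AE_lebesgue_on_Ioo0[OF AE_le_Linf_norm[OF b]]
  proof (rule AE_mp, intro AE_I2 impI)
   fix t assume le: "t \<in> Ioo0 T --> \<bar>b t\<bar> <= Linf_norm (lebesgue_on (Ioo0 T)) b" and t: "t \<in> Ioo0 T"
   have "a0 <= a t" using a(3)[of t] t by (simp add: Ioo0_def)
   then have "\<bar>b t\<bar> / a t <= Linf_norm (lebesgue_on (Ioo0 T)) b / a0" using le t a(2) by (intro frac_le) auto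
   then show "\<bar>b t / a t\<bar> <= B" using apos[OF t] by (simp add: B_def)
  qed
 qed
 then obtain t0 D where t0: "t0 \<in> Ioo0 T" and g: "!!t. t \<in> Ioo0 T ==> t0 <= t ==> ln (y t) - ln (y t0) >= integral {t0..t} m - D" by blast
 have J: "t \<in> Ico0 T" "t >= 0" if "t \<in> Ioo0 T" for t using that Ioo0_subset by (auto simp: Ioo0_def)
 let ?C = "min (y t0 * exp (- D - \<mu> t0)) (y 0 * exp (- \<mu> t0))"
 have "y t >= ?C * exp (\<mu> t)" if t: "t \<in> Ioo0 T" for t
 proof (cases "t0 <= t")
  case True
  have "ln (y t) >= ln (y t0) + (\<mu> t - \<mu> t0 - D)" using g[OF t True] rate(2)[OF J(2)[OF t0] True J(1)[OF t]] unfolding \<mu>_def by linarith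
  then have "exp (ln (y t)) >= exp (ln (y t0) + (\<mu> t - \<mu> t0 - D))" by simp
  then have "y t >= y t0 * exp (\<mu> t - \<mu> t0 - D)" using y_pos J[OF t] J[OF t0] by (simp add: exp_add)
  also have "\<mu> t - \<mu> t0 - D = (- D - \<mu> t0) + \<mu> t" by simp
  finally have "y t0 * exp (- D - \<mu> t0) * exp (\<mu> t) <= y t" unfolding exp_add by (simp add: mult.assoc)
  moreover have "?C * exp (\<mu> t) <= y t0 * exp (- D - \<mu> t0) * exp (\<mu> t)" by (intro mult_right_mono) auto
  ultimately show ?thesis by linarith
 next
  case False
  have "\<mu> t <= \<mu> t0" using strict_mono_onD[OF rate(3) J(1)[OF t] J(1)[OF t0]] False by simp
  then have "exp (- \<mu> t0) * exp (\<mu> t) <= 1" by (simp add: exp_add[symmetric])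
  then have "y 0 * (exp (- \<mu> t0) * exp (\<mu> t)) <= y 0 * 1" using y0 by (intro mult_left_mono) auto
  moreover have "?C * exp (\<mu> t) <= y 0 * exp (- \<mu> t0) * exp (\<mu> t)" by (intro mult_right_mono) auto
  ultimately show ?thesis using y_ge[OF J(1)[OF t]] unfolding mult.assoc mult_1_right by linarith
 qed
 moreover have "?C > 0" using y_pos J[OF t0] y0 by simp
 ultimately show ?thesis unfolding \<mu>_def m_def by blast
qed

lemma second_order_exponential_growth:
 assumes a: "a C1_differentiable_on Ioo0 T" "a0 > 0" "!!t. t >= 0 ==> a t >= a0" and \<sigma>: "\<sigma> > 0"
  and b: "b absolutely_integrable_on {0<..}" and aL: "a \<in> Linf (lebesgue_on {0<..})"
  and sup: "supersolution T y p (%t. \<sigma>\<^sup>2 / a t) (%t. b t / a t)"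
 shows "EX T0>0. EX C>0. EX \<mu>>0. ereal T0 < T & (ALL t:Ioo0 T. t > T0 --> y t >= C * exp (\<mu> * t))"
proof -
 interpret supersolution T y p "%t. \<sigma>\<^sup>2 / a t" "%t. b t / a t" by (rule sup)
 show ?thesis
 proof (cases "T = \<infinity>")
  case False
  then show ?thesis using y_ge y0 Ioo0_subset by (intro finite_time_growth[OF T False, of "y 0"]) auto
 next
  case True
  have apos: "a t > 0" if "t > 0" for t using a(3)[of t] a(2) that by simp
  have ac: "continuous_on {0<..} a" using C1_differentiable_imp_continuous_on[OF a(1)] True by (simp add: Ioo0_eq)
  define A where "A = Linf_norm (lebesgue_on {0<..}) a"
  have A: "AE t in lebesgue. 0 < t --> \<bar>a t\<bar> <= A"
   unfolding A_def by (rule AE_lebesgue_on_Ioo0[of _ \<infinity>, unfolded Ioo0_eq greaterThan_iff, OF AE_le_Linf_norm[OF aL]])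
  have A0: "A + 1 > 0" using Linf_norm_nonneg[OF aL] by (simp add: A_def)
  have "EX T0>0. EX C>0. EX \<mu>>0. ALL t>T0. y t >= C * exp (\<mu> * t)"
  proof (rule exponential_growth[OF True])
   have "(%t. (1 / a t) * b t) absolutely_integrable_on {0<..}"
   proof (rule absolutely_integrable_bounded_measurable_product_real[OF _ _ _ b])
    show "(%t. 1 / a t) \<in> borel_measurable (lebesgue_on {0<..})"
     by (intro continuous_imp_measurable_on_sets_lebesgue continuous_intros ac) (use apos in force)+
    have "1 / a t \<in> {0..1 / a0}" if "t > 0" for t using apos[OF that] a(3)[of t] a(2) that by (simp add: frac_le)
    then show "bounded ((%t. 1 / a t) ` {0<..})" by (intro bounded_subset[OF bounded_closed_interval[of 0 "1 / a0"]]) auto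
   qed auto
   then show "(%t. b t / a t) absolutely_integrable_on {0<..}" by simp
   show "\<sigma>^2 / (A + 1) > 0" using \<sigma> A0 by simp
   show "AE t in lebesgue. 0 < t --> \<sigma>\<^sup>2 / a t >= \<sigma>^2 / (A + 1)"
    using A
   proof (rule AE_mp, intro AE_I2 impI)
    fix t assume "0 < t --> \<bar>a t\<bar> <= A" "0 < t"
    then show "\<sigma>^2 / a t >= \<sigma>^2 / (A + 1)" using apos[of t] by (intro divide_left_mono) auto
   qed
  qed
  then show ?thesis using True by auto
 qed
qed

context ground_state
begin

text \<open>Cauchy-Schwarz against \<open>\<phi>\<close> transfers every lower bound for the projection \<open>y\<close> to the norm of the perturbation.\<close>
lemma second_order_conclusions:
 assumes T: "T > 0" and a: "a C1_differentiable_on Ioo0 T" "a0 > 0" "!!t. t >= 0 ==> a t >= a0" and b: "b \<in> L1_loc {0<..}"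
  and pos: "(LINT x|lebesgue. \<phi> x * u1 x) > 0" "(LINT x|lebesgue. \<phi> x * u0 x) > 0"
  and u: "second_order_solution T a b v u0 u1 u" "u0 \<in> L2 lebesgue" "u1 \<in> L2 lebesgue"
 obtains y p N where "supersolution T y p (%t. \<sigma>\<^sup>2 / a t) (%t. b t / a t)" "y 0 = (LINT x|lebesgue. \<phi> x * u0 x)"
  "N > 0" "!!t. t \<in> Ioo0 T ==> y t / N <= L2_norm lebesgue (%x. u t x - v x)"
proof -
 obtain wt where C: "C1_curve (L2 lebesgue) {L2_norm lebesgue} (Ico0 T) (%t x. u t x - v x) wt"
  and pe: "perturbation_eq T a b v u wt" and i: "AE x in lebesgue. u 0 x = v x + u0 x" "AE x in lebesgue. wt 0 x = u1 x"
  using u(1) unfolding second_order_solution_def by blast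
 define y where "y = (%t. LINT x|lebesgue. \<phi> x * (u t x - v x))"
 define p where "p = (%t. LINT x|lebesgue. \<phi> x * wt t x)"
 have wL: "(%x. u t x - v x) \<in> L2 lebesgue" "wt t \<in> L2 lebesgue" if "t \<in> Ico0 T" for t
  using C that by (auto simp: C1_curve_def)
 have 0: "0 \<in> Ico0 T" using T by (simp add: Ico0_def zero_ereal_def)
 have meas: "f \<in> borel_measurable lebesgue" if "f \<in> L2 lebesgue" for f :: "real^2 => real" using that by (simp add: L2_def)
 have y0: "y 0 = (LINT x|lebesgue. \<phi> x * u0 x)" unfolding y_def
  by (rule integral_cong_AE) (use i(1) in \<open>auto intro!: borel_measurable_times[OF meas meas] wL 0 L2_facts u\<close>)
 have p0: "p 0 = (LINT x|lebesgue. \<phi> x * u1 x)" unfolding p_def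
  by (rule integral_cong_AE) (use i(2) in \<open>auto intro!: borel_measurable_times[OF meas meas] wL 0 L2_facts u\<close>)
 have yle: "y t <= L2_norm lebesgue \<phi> * L2_norm lebesgue (%x. u t x - v x)" if "t \<in> Ico0 T" for t
  using L2_Cauchy_Schwarz(2)[OF L2_facts(1) wL(1)[OF that]] unfolding y_def by linarith
 have N: "L2_norm lebesgue \<phi> > 0"
  using yle[OF 0] pos(2) y0 L2_norm_nonneg[of lebesgue \<phi>] by (cases "L2_norm lebesgue \<phi> = 0") auto
 show ?thesis
 proof (rule that[where y = y and p = p and N = "L2_norm lebesgue \<phi>"])
  show "y 0 = (LINT x|lebesgue. \<phi> x * u0 x)" "L2_norm lebesgue \<phi> > 0" by (rule y0 N)+
  show "supersolution T y p (%t. \<sigma>\<^sup>2 / a t) (%t. b t / a t)" unfolding y_def p_def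
   by (rule second_order_supersolution[OF T a b C pe]) (use pos y0 p0 in \<open>simp_all add: y_def p_def\<close>)
  show "y t / L2_norm lebesgue \<phi> <= L2_norm lebesgue (%x. u t x - v x)" if "t \<in> Ioo0 T" for t
   using yle[of t] that Ioo0_subset N by (subst pos_divide_le_eq) (auto simp: mult.commute)
 qed
qed

end

section \<open>The first-order equation\<close>

text \<open>The projections \<open>Y n\<close> on test functions are differentiable, their limit \<open>y\<close> need not be. Where \<open>y\<close> is
 positive, the forcing \<open>k n\<close> is eventually positive, so the derivatives are bounded below and the limit increases. A
 first zero of \<open>y\<close> is therefore impossible.\<close>
lemma approximate_growth:
 fixes y :: "real => real" and Y P k :: "nat => real => real"
 assumes T: "T > 0" and der: "!!n t. t \<in> Ioo0 T ==> (Y n has_real_derivative P n t) (at t)"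
  and at0: "!!n. (Y n \<longlongrightarrow> Y n 0) (at_right 0)"
  and unif: "!!\<tau>. \<tau> \<in> Ico0 T ==> EX W. ALL n. ALL t:{0..\<tau>}. \<bar>Y n t - y t\<bar> <= W * \<delta> n & \<bar>k n t - \<gamma> * y t\<bar> <= W * \<delta> n"
  and \<delta>: "\<delta> \<longlonglongrightarrow> 0" and \<gamma>: "\<gamma> > 0" and \<theta>: "\<theta> >= 0"
  and key: "!!n t. t \<in> Ioo0 T ==> k n t > 0 ==> P n t >= \<theta> * k n t" and y0: "y 0 > 0"
 shows "!!s t. 0 < s ==> s <= t ==> t \<in> Ioo0 T ==> y t >= y s + (t - s) * (\<theta> * (\<gamma> * y s))"
  and "!!t. t \<in> Ioo0 T ==> y t >= y 0"
proof -
 have yc: "continuous_on {0..t} y" if t: "t \<in> Ioo0 T" for t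
 proof -
  obtain W where W: "!!n x. x \<in> {0..t} ==> \<bar>Y n x - y x\<bar> <= W * \<delta> n"
   using unif[of t] t Ioo0_subset by blast
  have "uniform_limit {0..t} Y y sequentially"
  proof (rule uniform_limitI)
   fix e :: real assume "e > 0"
   have "(%n. W * \<delta> n) \<longlonglongrightarrow> 0" by (rule tendsto_mult_right_zero[OF \<delta>])
   then have "\<forall>\<^sub>F n in sequentially. W * \<delta> n < e" using \<open>e > 0\<close> by (rule order_tendstoD)
   then show "\<forall>\<^sub>F n in sequentially. ALL x:{0..t}. dist (Y n x) (y x) < e"
    by eventually_elim (use W in \<open>fastforce simp: dist_real_def intro: le_less_trans\<close>)
  qed
  moreover have "continuous_on {0..t} (Y n)" for n
   unfolding continuous_on_def
  proof
   fix x assume x: "x \<in> {0..t}"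
   show "(Y n \<longlongrightarrow> Y n x) (at x within {0..t})"
   proof (cases "x = 0")
    case True
    have "at 0 within {0..t} <= at_right 0"
     unfolding at_within_def by (intro inf_mono order_refl) auto
    then show ?thesis using at0[of n] True filterlim_mono[OF _ order_refl] by blast
   next
    case False
    then have "x \<in> Ioo0 T" using Ioo0_Icc[OF t, of x] x by auto
    then have "isCont (Y n) x" using der DERIV_isCont by blast
    then show ?thesis using isCont_def tendsto_within_subset by blast
   qed
  qed
  ultimately show ?thesis by (intro uniform_limit_theorem[OF always_eventually]) auto
 qed
 have step: "y t - y s >= (t - s) * (\<theta> * (\<gamma> * e))"
  if st: "0 < s" "s <= t" "t \<in> Ioo0 T" and e: "e > 0" "!!r. r \<in> {s..t} ==> e <= y r" for s t e
 proof (cases "s = t")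
  case False
  have tJ: "t \<in> Ico0 T" using st(3) Ioo0_subset by blast
  obtain W where W: "!!n x. x \<in> {0..t} ==> \<bar>Y n x - y x\<bar> <= W * \<delta> n & \<bar>k n x - \<gamma> * y x\<bar> <= W * \<delta> n"
   using unif[OF tJ] by blast
  have W0: "(%n. W * \<delta> n) \<longlonglongrightarrow> 0" by (rule tendsto_mult_right_zero[OF \<delta>])
  have lim: "(%n. Y n x) \<longlonglongrightarrow> y x" if "x \<in> {0..t}" for x
  proof (subst LIM_zero_iff[symmetric], rule Lim_null_comparison[OF _ W0])
   show "\<forall>\<^sub>F n in sequentially. norm (Y n x - y x) <= W * \<delta> n" using W[OF that] by simp
  qed
  have "\<forall>\<^sub>F n in sequentially. W * \<delta> n < \<gamma> * e" using order_tendstoD(2)[OF W0, of "\<gamma> * e"] \<gamma> e by simp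
  then have "\<forall>\<^sub>F n in sequentially. (t - s) * (\<theta> * (\<gamma> * e - W * \<delta> n)) <= Y n t - Y n s"
  proof eventually_elim
   case (elim n)
   obtain z where z: "s < z" "z < t" "Y n t - Y n s = (t - s) * P n z"
    using MVT2[of s t "Y n" "P n"] der Ioo0_Icc[OF st(3,1)] st(2) False by (auto simp: subset_iff)
   have zI: "z \<in> Ioo0 T" using Ioo0_Icc[OF st(3,1)] z by auto
   have "\<gamma> * e <= \<gamma> * y z" using e(2)[of z] z \<gamma> by (intro mult_left_mono) auto
   then have kz: "\<gamma> * e - W * \<delta> n <= k n z" using W[of z n] z st by auto
   then have "\<theta> * (\<gamma> * e - W * \<delta> n) <= \<theta> * k n z" using \<theta> by (intro mult_left_mono) auto
   also have "... <= P n z" using key[OF zI, of n] kz elim by linarith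
   finally show ?case unfolding z(3) using st(2) by (intro mult_left_mono) auto
  qed
  moreover have "(%n. (t - s) * (\<theta> * (\<gamma> * e - W * \<delta> n))) \<longlonglongrightarrow> (t - s) * (\<theta> * (\<gamma> * e - 0))"
   by (intro tendsto_intros W0)
  moreover have "(%n. Y n t - Y n s) \<longlonglongrightarrow> y t - y s" by (intro tendsto_diff lim) (use st in auto)
  ultimately have "(t - s) * (\<theta> * (\<gamma> * e - 0)) <= y t - y s"
   by (intro tendsto_le[OF sequentially_bot])
  then show ?thesis by simp
 qed simp
 have mono: "y s <= y t" if st: "0 < s" "s <= t" "t \<in> Ioo0 T" and pos: "!!r. r \<in> {s..t} ==> 0 < y r" for s t
 proof -
  have "continuous_on {s..t} y" using yc[OF st(3)] continuous_on_subset st by (metis atLeastatMost_subset_iff less_imp_le order_refl)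
  then obtain z where "z \<in> {s..t}" "!!r. r \<in> {s..t} ==> y z <= y r"
   using continuous_attains_inf[of "{s..t}" y] st by auto
  then have "y t - y s >= (t - s) * (\<theta> * (\<gamma> * y z))" using step[OF st, of "y z"] pos by blast
  moreover have "(t - s) * (\<theta> * (\<gamma> * y z)) >= 0" using st(2) \<theta> \<gamma> pos[OF \<open>z \<in> _\<close>] by (intro mult_nonneg_nonneg) auto
  ultimately show ?thesis by linarith
 qed
 have pos: "y t > 0" if t: "t \<in> Ioo0 T" for t
 proof (rule ccontr)
  assume np: "\<not> y t > 0"
  define Z where "Z = {x \<in> {0..t}. y x <= 0}"
  have "closed Z"
   unfolding Z_def using continuous_closed_preimage[OF yc[OF t], of "{..0}"] by (simp add: vimage_def Int_def conj_commute)
  moreover have "Z ~= {}" "bdd_below Z" using t np by (auto simp: Z_def Ioo0_def)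
  ultimately have ZI: "Inf Z \<in> Z" by (rule closed_contains_Inf[rotated 2])
  define z where "z = Inf Z"
  have z: "z \<in> {0..t}" "y z <= 0" using ZI by (auto simp: Z_def z_def)
  have before: "y x > 0" if "0 <= x" "x < z" for x
  proof (rule ccontr)
   assume "\<not> y x > 0"
   then have "x \<in> Z" using that z by (auto simp: Z_def)
   then have "z <= x" unfolding z_def by (intro cInf_lower \<open>bdd_below Z\<close>)
   then show False using that by simp
  qed
  have z0: "z > 0" using z y0 by (cases "z = 0") auto
  have "continuous_on {z / 2..z} y" by (rule continuous_on_subset[OF yc[OF t]]) (use z z0 in auto)
  then obtain q where q: "z / 2 <= q" "q <= z" "y q = y (z / 2) / 2"
   using IVT2'[of y z "y (z / 2) / 2" "z / 2"] before[of "z / 2"] z z0 by auto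
  have "q < z" using q z before[of "z / 2"] z0 by (cases "q = z") auto
  then have "y (z / 2) <= y q" using before z0 q Ioo0_Icc[OF t, of q] z by (intro mono) auto
  then show False using q(3) before[of "z / 2"] z0 by simp
 qed
 have pos': "0 < y r" if "0 < s" "t \<in> Ioo0 T" "r \<in> {s..t}" for r s t using pos Ioo0_Icc[OF that(2,1)] that(3) by blast
 show "y t >= y s + (t - s) * (\<theta> * (\<gamma> * y s))" if st: "0 < s" "s <= t" "t \<in> Ioo0 T" for s t
 proof -
  have "y s <= y r" if r: "r \<in> {s..t}" for r
  proof (rule mono[OF st(1)])
   show "r \<in> Ioo0 T" using Ioo0_Icc[OF st(3,1)] r by blast
   then show "!!x. x \<in> {s..r} ==> 0 < y x" using pos' st(1) by blast
  qed (use r in auto)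
  then have "y t - y s >= (t - s) * (\<theta> * (\<gamma> * y s))" using step[OF st] pos' st by auto
  then show ?thesis by linarith
 qed
 show "y t >= y 0" if t: "t \<in> Ioo0 T" for t
 proof (rule tendsto_upperbound)
  have t0: "0 < t" using t by (simp add: Ioo0_def)
  have "(y \<longlongrightarrow> y 0) (at 0 within {0..t})" using yc[OF t] t0 by (auto simp: continuous_on_def)
  then show "(y \<longlongrightarrow> y 0) (at_right 0)" using at_within_Icc_at_right[OF t0] by simp
  show "\<forall>\<^sub>F s in at_right 0. y s <= y t"
   using eventually_at_right_less[of 0] eventually_at_right_real[OF t0]
  proof eventually_elim
   case (elim s)
   then show ?case using pos'[of s t] t by (intro mono) auto
  qed
 qed simp
qed

lemma iterated_growth:
 fixes y :: "real => real"
 assumes y: "!!s t. 0 < s ==> s <= t ==> y t >= y s + (t - s) * (c * y s)" and pos: "!!t. t > 0 ==> y t > 0" and c: "c > 0"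
 shows "EX T0>0. EX C>0. EX \<mu>>0. ALL t>T0. y t >= C * exp (\<mu> * t)"
proof -
 have mono: "y s <= y t" if "0 < s" "s <= t" for s t
 proof -
  have "0 <= (t - s) * (c * y s)" using that pos[OF that(1)] c by simp
  then show ?thesis using y[OF that] by linarith
 qed
 have n: "y (1 + real n) >= y 1 * (1 + c) ^ n" for n
 proof (induction n)
  case (Suc n)
  have "y 1 * (1 + c) ^ Suc n <= (1 + c) * y (1 + real n)" using Suc c by (simp add: mult.left_commute mult_left_mono)
  also have "... <= y (1 + real (Suc n))" using y[of "1 + real n" "1 + real (Suc n)"] by (simp add: algebra_simps)
  finally show ?case .
 qed simp
 have "y t >= (y 1 / (1 + c)^2) * exp (ln (1 + c) * t)" if t: "t > 1" for t
 proof -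
  define n where "n = nat \<lfloor>t - 1\<rfloor>"
  have n1: "1 + real n <= t" "t <= real n + 2" using t by (simp_all add: n_def) linarith+
  have "exp (ln (1 + c) * t) <= exp (ln (1 + c) * real (n + 2))" using n1 c by (simp add: mult_left_mono)
  also have "... = exp (ln (1 + c)) ^ (n + 2)" by (rule exp_of_nat2_mult)
  also have "exp (ln (1 + c)) = 1 + c" using c by simp
  finally have "exp (ln (1 + c) * t) / (1 + c)^2 <= (1 + c) ^ n" unfolding power_add
   by (subst pos_divide_le_eq) (use c in simp_all)
  then have "y 1 * (exp (ln (1 + c) * t) / (1 + c)^2) <= y 1 * (1 + c) ^ n" using pos[of 1] by (intro mult_left_mono) auto
  also have "... <= y (1 + real n)" by (rule n)
  also have "... <= y t" by (rule mono) (use n1 in auto)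
  finally show ?thesis by simp
 qed
 moreover have "y 1 / (1 + c)^2 > 0" "ln (1 + c) > 0" using pos[of 1] c by (auto simp: add_pos_pos)
 ultimately show ?thesis using zero_less_one by blast
qed

text \<open>If \<open>P r < \<theta> k r\<close>, then near \<open>r\<close> even \<open>P \<le> l \<theta> k\<close> for some \<open>l < 1\<close>, hence \<open>b P \<le> l k\<close>, and integrating
 contradicts \<open>le\<close>. The case \<open>\<theta> = 0\<close> yields monotonicity for unbounded \<open>b\<close>.\<close>
lemma weighted_derivative_lower_bound:
 fixes k P b :: "real => real"
 assumes c: "continuous_on (Ioo0 T) k" "continuous_on (Ioo0 T) P" and b: "b \<in> L1_loc {0<..}" "!!t. t > 0 ==> b t > 0"
  and le: "!!s t. 0 < s ==> s < t ==> t \<in> Ioo0 T ==> integral {s..t} k <= integral {s..t} (%r. b r * P r)"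
  and \<theta>: "\<theta> >= 0" "AE t in lebesgue. t \<in> Ioo0 T --> \<theta> * b t <= 1"
  and r: "r \<in> Ioo0 T" "k r > 0"
 shows "P r >= \<theta> * k r"
proof (rule ccontr)
 assume "\<not> ?thesis"
 then have P: "P r < \<theta> * k r" by simp
 have \<theta>k: "\<theta> * k r >= 0" using \<theta> r by simp
 obtain l where l: "0 < l" "l < 1" "P r < l * (\<theta> * k r)"
 proof (cases "\<theta> * k r = 0")
  case True
  have "P r < 1 / 2 * (\<theta> * k r)" using P unfolding True by simp
  then show ?thesis by (intro that[of "1 / 2"]) simp_all
 next
  case False
  then have q: "\<theta> * k r > 0" using \<theta>k by linarith
  then have "P r / (\<theta> * k r) < 1" using P by simp
  then obtain l where "max 0 (P r / (\<theta> * k r)) < l" "l < 1" using dense[of "max 0 (P r / (\<theta> * k r))" 1] by auto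
  then show ?thesis using q by (intro that[of l]) (auto simp: pos_divide_less_eq)
 qed
 have ct: "isCont k r" "isCont P r" using c r Ioo0_open continuous_on_eq_continuous_at by blast+
 have "\<forall>\<^sub>F x in nhds r. k x > 0" using order_tendstoD(1)[OF ct(1)[unfolded isCont_def tendsto_at_iff_tendsto_nhds] r(2)] .
 moreover have "((%x. l * (\<theta> * k x) - P x) \<longlongrightarrow> l * (\<theta> * k r) - P r) (nhds r)"
  using ct unfolding isCont_def tendsto_at_iff_tendsto_nhds by (intro tendsto_intros)
 then have "\<forall>\<^sub>F x in nhds r. l * (\<theta> * k x) - P x > 0" by (rule order_tendstoD(1)) (use l in simp)
 moreover have "\<forall>\<^sub>F x in nhds r. x \<in> Ioo0 T" using r Ioo0_open by (intro eventually_nhds_in_open)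
 ultimately have "\<forall>\<^sub>F x in nhds r. k x > 0 & P x < l * (\<theta> * k x) & x \<in> Ioo0 T" by eventually_elim auto
 then obtain d where d: "d > 0" "!!x. dist x r < d ==> k x > 0 & P x < l * (\<theta> * k x) & x \<in> Ioo0 T"
  unfolding eventually_nhds_metric by blast
 define t where "t = r + d / 2"
 have J: "k x > 0 & P x < l * (\<theta> * k x) & x \<in> Ioo0 T" if "x \<in> {r..t}" for x
  using d that by (auto simp: t_def dist_real_def)
 have rt: "0 < r" "r < t" using r d by (auto simp: t_def Ioo0_def)
 have tI: "t \<in> Ioo0 T" using J[of t] rt by auto
 have kc: "continuous_on {r..t} k" "continuous_on {r..t} P" using c Ioo0_Icc[OF tI rt(1)] continuous_on_subset by blast+
 have ki: "k absolutely_integrable_on {r..t}" by (rule absolutely_integrable_continuous_real[OF kc(1)])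
 have "integral {r..t} (%x. b x * P x) <= integral {r..t} (%x. l * k x)"
 proof (rule integral_mono_AE_real)
  show "(%x. b x * P x) absolutely_integrable_on {r..t}"
   by (rule absolutely_integrable_mult_continuous[OF L1_loc_Icc[OF b(1) rt(1)] kc(2)])
  show "(%x. l * k x) absolutely_integrable_on {r..t}" using ki by (rule set_integrable_mult_right)
  show "AE x in lebesgue. x \<in> {r..t} --> b x * P x <= l * k x"
   using \<theta>(2)
  proof (rule AE_mp, intro AE_I2 impI)
   fix x assume le: "x \<in> Ioo0 T --> \<theta> * b x <= 1" and x: "x \<in> {r..t}"
   note x' = J[OF x]
   have "b x * P x <= b x * (l * (\<theta> * k x))" using x' b(2)[of x] rt x by (intro mult_left_mono) auto
   also have "... = l * ((\<theta> * b x) * k x)" by simp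
   also have "... <= l * (1 * k x)" using le x' l by (intro mult_left_mono mult_right_mono) auto
   finally show "b x * P x <= l * k x" by simp
  qed
 qed
 also have "... = l * integral {r..t} k" by simp
 also have "... < 1 * integral {r..t} k"
 proof (rule mult_strict_right_mono[OF l(2)])
  have "integral {r..t} (%_. 0) < integral {r..t} k"
   by (rule integral_less_real) (use rt kc J in auto)
  then show "0 < integral {r..t} k" by simp
 qed
 finally show False using le[OF rt tI] by simp
qed

lemma Linf_integrable_mult:
 assumes f: "f \<in> Linf M" and k: "integrable M k"
 shows "integrable M (%x. k x * f x)" "\<bar>LINT x|M. k x * f x\<bar> <= (LINT x|M. \<bar>k x\<bar>) * Linf_norm M f"
proof -
 let ?N = "Linf_norm M f"
 have [measurable]: "f \<in> borel_measurable M" using f by (simp add: Linf_def)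
 have i: "integrable M (%x. \<bar>k x\<bar> * ?N)" using k by simp
 have ae: "AE x in M. \<bar>k x * f x\<bar> <= \<bar>k x\<bar> * ?N"
  using AE_le_Linf_norm[OF f]
 proof eventually_elim
  case (elim x)
  then show ?case unfolding abs_mult by (intro mult_left_mono) auto
 qed
 show kf: "integrable M (%x. k x * f x)"
 proof (rule integrable_le[OF i])
  show "AE x in M. norm (k x * f x) <= norm (\<bar>k x\<bar> * ?N)"
   using ae by eventually_elim (use order.trans[OF _ abs_ge_self] in auto)
 qed (use k in measurable)
 have "\<bar>LINT x|M. k x * f x\<bar> <= (LINT x|M. \<bar>k x * f x\<bar>)" by (rule integral_abs_bound)
 also have "... <= (LINT x|M. \<bar>k x\<bar> * ?N)" by (rule integral_mono_AE[OF integrable_abs[OF kf] i ae])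
 finally show "\<bar>LINT x|M. k x * f x\<bar> <= (LINT x|M. \<bar>k x\<bar>) * ?N" by simp
qed

lemma Linf_subset_L1_loc: "f \<in> Linf lebesgue ==> f \<in> L1_loc UNIV"
 unfolding L1_loc_def
proof (intro CollectI allI impI, elim conjE)
 fix K :: "'a set" assume f: "f \<in> Linf lebesgue" and K: "compact K"
 have "integrable lebesgue (indicator K :: 'a => real)"
  using lmeasurable_compact[OF K] by (intro integrable_real_indicator) (auto simp: fmeasurable_def)
 from Linf_integrable_mult(1)[OF f this] show "f absolutely_integrable_on K" by (simp add: set_integrable_def)
qed

lemma csupp_L1_loc_pairing:
 fixes k f :: "'a::euclidean_space => real"
 assumes k: "continuous_on UNIV k" "supp_ball R k" "!!x. \<bar>k x\<bar> <= C" and f: "f \<in> L1_loc UNIV"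
 shows "integrable lebesgue (%x. k x * f x)" "\<bar>LINT x|lebesgue. k x * f x\<bar> <= C * (LINT x:cball 0 R|lebesgue. \<bar>f x\<bar>)"
proof -
 have "f absolutely_integrable_on cball 0 R" using f by (auto simp: L1_loc_def)
 then have fi: "integrable lebesgue (%x. indicator (cball 0 R) x * f x)" by (simp add: set_integrable_def)
 have [measurable]: "k \<in> borel_measurable lebesgue" by (rule continuous_integral_lebesgue(3)[OF k(1)])
 have eq: "k x * f x = k x * (indicator (cball 0 R) x * f x)" for x
  using supp_ballD[OF k(2), of x] by (auto simp: indicator_def)
 have C: "C >= 0" using k(3)[of 0] by linarith
 have bd: "\<bar>k x * f x\<bar> <= C * \<bar>indicator (cball 0 R) x * f x\<bar>" for x
  unfolding eq[of x] abs_mult[of "k x"] by (intro mult_right_mono k(3)) auto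
 have i: "integrable lebesgue (%x. C * \<bar>indicator (cball 0 R) x * f x\<bar>)" using fi by simp
 have m: "(%x. k x * f x) \<in> borel_measurable lebesgue" unfolding eq using fi by measurable
 show kf: "integrable lebesgue (%x. k x * f x)"
  by (rule integrable_le[OF i m]) (use order.trans[OF bd abs_ge_self] in auto)
 have "\<bar>LINT x|lebesgue. k x * f x\<bar> <= (LINT x|lebesgue. \<bar>k x * f x\<bar>)" by (rule integral_abs_bound)
 also have "... <= (LINT x|lebesgue. C * \<bar>indicator (cball 0 R) x * f x\<bar>)"
  by (rule integral_mono[OF integrable_abs[OF kf] i bd])
 also have "... = C * (LINT x:cball 0 R|lebesgue. \<bar>f x\<bar>)"
  by (simp add: set_lebesgue_integral_def abs_mult)
 finally show "\<bar>LINT x|lebesgue. k x * f x\<bar> <= C * (LINT x:cball 0 R|lebesgue. \<bar>f x\<bar>)" .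
qed

lemma L1_loc_diff: "f \<in> L1_loc S ==> g \<in> L1_loc S ==> (%x. f x - g x) \<in> L1_loc S"
 unfolding L1_loc_def by (auto intro!: set_integral_diff(1))

lemma L1_loc_divide: "f \<in> L1_loc S ==> (%x. f x / c) \<in> L1_loc S"
 unfolding L1_loc_def by (auto intro!: set_integrable_divide)

lemma L1_loc_curve_functional:
 fixes k :: "'a::euclidean_space => real"
 assumes C: "C1_curve (L1_loc UNIV) L1_loc_seminorms I w w'" and k: "continuous_on UNIV k" "supp_ball R k"
 shows "!!t. t \<in> I ==> ((%t. LINT x|lebesgue. k x * w t x) has_real_derivative (LINT x|lebesgue. k x * w' t x)) (at t within I)"
  and "continuous_on I (%t. LINT x|lebesgue. k x * w' t x)"
  and "continuous_on I (%t. LINT x|lebesgue. k x * w t x)"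
proof -
 obtain B where B: "B > 0" "!!x. \<bar>k x\<bar> <= B" by (rule continuous_csupp_bounded[OF k]) (rule that)
 let ?p = "%f :: 'a => real. LINT x:cball 0 R|lebesgue. \<bar>f x\<bar>"
 have p: "?p \<in> L1_loc_seminorms" unfolding L1_loc_seminorms_def by (intro CollectI exI[of _ "cball 0 R"] conjI refl compact_cball)
 have X: "(%x. (f x - g x) / c - h x) \<in> L1_loc UNIV" if "f \<in> L1_loc UNIV" "g \<in> L1_loc UNIV" "h \<in> L1_loc UNIV"
  for f g h :: "'a => real" and c :: real by (rule L1_loc_diff[OF L1_loc_divide[OF L1_loc_diff[OF that(1,2)]] that(3)])
 note F = C1_curve_functional[where p = ?p and c = B and k = k and M = lebesgue, OF C p X L1_loc_diff
   csupp_L1_loc_pairing(1)[OF k B(2)] csupp_L1_loc_pairing(2)[OF k B(2)]]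
 show d: "((%t. LINT x|lebesgue. k x * w t x) has_real_derivative (LINT x|lebesgue. k x * w' t x)) (at t within I)" if "t \<in> I" for t
  by (rule F(1)) (use that in auto)
 show "continuous_on I (%t. LINT x|lebesgue. k x * w' t x)" by (rule F(2)) auto
 show "continuous_on I (%t. LINT x|lebesgue. k x * w t x)" by (rule DERIV_continuous_on[OF d])
qed

context ground_state
begin

text \<open>The equation \<open>b y' \<ge> \<sigma>\<^sup>2 y\<close> cannot be divided by \<open>b\<close> in the sense of distributions, so it is used in
 integrated form for each approximating test function, and pointwise information on the derivative is
 recovered from the continuity in time. Convergence in \<open>L\<^sup>1\<close> of the test functions suffices since the perturbation is bounded.\<close>
lemma first_order_growth:
 assumes T: "T > 0" and b: "b \<in> L1_loc {0<..}" "!!t. t > 0 ==> b t > 0" and u0: "u0 \<in> Linf lebesgue"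
  and pos: "(LINT x|lebesgue. \<phi> x * u0 x) > 0" and u: "first_order_solution T b v u0 u"
  and \<theta>: "\<theta> >= 0" "AE t in lebesgue. t \<in> Ioo0 T --> \<theta> * b t <= 1"
 obtains y N where "y 0 = (LINT x|lebesgue. \<phi> x * u0 x)" "N > 0"
  "!!t. t \<in> Ioo0 T ==> y t / N <= Linf_norm lebesgue (%x. u t x - v x)"
  "!!s t. 0 < s ==> s <= t ==> t \<in> Ioo0 T ==> y t >= y s + (t - s) * (\<theta> * (\<sigma>^2 * y s))"
  "!!t. t \<in> Ioo0 T ==> y t >= y 0"
proof -
 obtain wt where C: "C1_curve (L1_loc UNIV) L1_loc_seminorms (Ioo0 T) (%t x. u t x - v x) wt"
  and pe: "perturbation_eq T (%_. 0) b v u wt" using u unfolding first_order_solution_def by blast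
 have wL: "(%x. u t x - v x) \<in> Linf lebesgue" if "t \<in> Ico0 T" for t using u that by (simp add: first_order_solution_def)
 have wt: "(%x. u t x - v x) \<in> L1_loc UNIV" "wt t \<in> L1_loc UNIV" if "t \<in> Ioo0 T" for t
  using C that by (auto simp: C1_curve_def)
 have bdd: "EX M. ALL t:{0..\<tau>}. Linf_norm lebesgue (%x. u t x - v x) <= M" if "\<tau> \<in> Ico0 T" for \<tau>
  using u that by (simp add: first_order_solution_def)
 have at0: "((%t. p (%x. u t x - u 0 x)) \<longlongrightarrow> 0) (at_right 0)" if "p \<in> L1_loc_seminorms" for p
  using u that by (simp add: first_order_solution_def)
 have i0: "AE x in lebesgue. u 0 x = v x + u0 x" using u by (simp add: first_order_solution_def)
 have 0: "0 \<in> Ico0 T" using T by (simp add: Ico0_def zero_ereal_def)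
 have \<phi>L: "integrable lebesgue \<phi>" using continuous_integral_lebesgue(2)[OF \<phi>_cont] \<phi>_int by simp
 define y where "y t = (LINT x|lebesgue. \<phi> x * (u t x - v x))" for t
 have meas: "f \<in> borel_measurable lebesgue" if "f \<in> Linf lebesgue" for f :: "real^2 => real" using that by (simp add: Linf_def)
 have y0: "y 0 = (LINT x|lebesgue. \<phi> x * u0 x)" unfolding y_def
  by (rule integral_cong_AE) (use i0 in \<open>auto intro!: borel_measurable_times[OF continuous_integral_lebesgue(3)[OF \<phi>_cont] meas] wL 0 u0\<close>)
 define N where "N = (LINT x|lebesgue. \<bar>\<phi> x\<bar>)"
 have yN: "y t <= N * Linf_norm lebesgue (%x. u t x - v x)" if "t \<in> Ico0 T" for t
  using Linf_integrable_mult(2)[OF wL[OF that] \<phi>L] unfolding y_def N_def by linarith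
 have N0: "N >= 0" unfolding N_def by (intro integral_ge_0) simp
 have N: "N > 0" using N0 yN[OF 0] pos y0 by (cases "N = 0") auto
 obtain \<xi> where \<xi>: "!!n. \<xi> n \<in> test_functions UNIV" "!!n x. 0 <= \<xi> n x"
  and l: "(%n. LINT x|lebesgue. \<bar>\<xi> n x - \<phi> x\<bar>) \<longlonglongrightarrow> 0" "(%n. L2_norm lebesgue (%x. \<xi> n x - \<phi> x)) \<longlonglongrightarrow> 0"
   "(%n. LINT x|lebesgue. \<bar>laplacian (\<xi> n) x - src x\<bar>) \<longlonglongrightarrow> 0" "(%n. L2_norm lebesgue (%x. laplacian (\<xi> n) x - src x)) \<longlonglongrightarrow> 0"
  by (rule approximation) (rule that)
 note tc = test_continuous[OF \<xi>(1)]
 obtain R where R: "!!n. supp_ball (R n) (\<xi> n)" "!!n. supp_ball (R n) (laplacian (\<xi> n))" using tc(3) by metis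
 define q where "q n x = laplacian (\<xi> n) x + exp (v x) * \<xi> n x" for n x
 have Vc: "continuous_on UNIV (%x. exp (v x) * \<xi> n x)" "supp_ball (R n) (%x. exp (v x) * \<xi> n x)" for n
  using R(1)[of n] by (auto simp: supp_ball_def intro!: continuous_intros V_cont tc(1))
 have qc: "continuous_on UNIV (q n)" "supp_ball (R n) (q n)" for n
  using R[of n] by (auto simp: q_def supp_ball_def intro!: continuous_intros V_cont tc(1,2))
 have il: "integrable lebesgue k" if "continuous_on UNIV k" "supp_ball r k" for k :: "real^2 => real" and r
  using continuous_integral_lebesgue(2)[OF that(1)] continuous_csupp_integrable[OF that] by simp
 have d\<xi>: "integrable lebesgue (%x. \<xi> n x - \<phi> x)" for n using il[OF tc(1) R(1)] \<phi>L by simp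
 have srcL: "integrable lebesgue src" using continuous_integral_lebesgue(2)[OF src_cont] src_int by simp
 have dl: "integrable lebesgue (%x. laplacian (\<xi> n) x - src x)" for n using il[OF tc(2) R(2)] srcL by simp
 have dq: "integrable lebesgue (%x. q n x - \<sigma>\<^sup>2 * \<phi> x)" for n using il[OF qc] \<phi>L by simp
 define \<delta> where "\<delta> n = (1 + Vm) * (LINT x|lebesgue. \<bar>\<xi> n x - \<phi> x\<bar>) + (LINT x|lebesgue. \<bar>laplacian (\<xi> n) x - src x\<bar>)" for n
 have \<delta>0: "\<delta> \<longlonglongrightarrow> 0"
  using tendsto_add[OF tendsto_mult_right_zero[OF l(1), of "1 + Vm"] l(3)] unfolding \<delta>_def by simp
 have n1: "0 <= (LINT x|lebesgue. \<bar>\<xi> n x - \<phi> x\<bar>)" "0 <= (LINT x|lebesgue. \<bar>laplacian (\<xi> n) x - src x\<bar>)" for n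
  by (intro integral_ge_0 abs_ge_zero)+
 have \<delta>1: "(LINT x|lebesgue. \<bar>\<xi> n x - \<phi> x\<bar>) <= \<delta> n" for n
 proof -
  have "0 <= Vm * (LINT x|lebesgue. \<bar>\<xi> n x - \<phi> x\<bar>)" using Vm n1(1) by (intro mult_nonneg_nonneg) auto
  then show ?thesis using n1(2)[of n] by (simp add: \<delta>_def distrib_right)
 qed
 have \<delta>2: "(LINT x|lebesgue. \<bar>q n x - \<sigma>\<^sup>2 * \<phi> x\<bar>) <= \<delta> n" for n
 proof -
  have le: "\<bar>q n x - \<sigma>\<^sup>2 * \<phi> x\<bar> <= \<bar>laplacian (\<xi> n) x - src x\<bar> + Vm * \<bar>\<xi> n x - \<phi> x\<bar>" for x
  proof -
   have "q n x - \<sigma>\<^sup>2 * \<phi> x = (laplacian (\<xi> n) x - src x) + exp (v x) * (\<xi> n x - \<phi> x)"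
    by (simp add: q_def src_def algebra_simps)
   moreover have "\<bar>exp (v x) * (\<xi> n x - \<phi> x)\<bar> <= Vm * \<bar>\<xi> n x - \<phi> x\<bar>"
    unfolding abs_mult by (intro mult_right_mono) (use V_le in auto)
   ultimately show ?thesis by linarith
  qed
  have "(LINT x|lebesgue. \<bar>q n x - \<sigma>\<^sup>2 * \<phi> x\<bar>) <= (LINT x|lebesgue. \<bar>laplacian (\<xi> n) x - src x\<bar> + Vm * \<bar>\<xi> n x - \<phi> x\<bar>)"
   by (rule integral_mono[OF integrable_abs[OF dq] _ le])
    (intro Bochner_Integration.integrable_add integrable_abs integrable_mult_right dl d\<xi>)
  also have "... = (LINT x|lebesgue. \<bar>laplacian (\<xi> n) x - src x\<bar>) + Vm * (LINT x|lebesgue. \<bar>\<xi> n x - \<phi> x\<bar>)"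
   using dl d\<xi> by (subst integral_plus) auto
  also have "... <= \<delta> n" using n1(1)[of n] by (simp add: \<delta>_def distrib_right)
  finally show ?thesis .
 qed
 define Y where "Y n t = (LINT x|lebesgue. \<xi> n x * (u t x - v x))" for n t
 define P where "P n t = (LINT x|lebesgue. \<xi> n x * wt t x)" for n t
 define k where "k n t = (LINT x|lebesgue. q n x * (u t x - v x))" for n t
 note Fx = L1_loc_curve_functional[OF C tc(1) R(1)]
 have Pc: "continuous_on (Ioo0 T) (P n)" for n unfolding P_def[abs_def] by (rule Fx(2))
 have kc: "continuous_on (Ioo0 T) (k n)" for n unfolding k_def[abs_def] by (rule L1_loc_curve_functional(3)[OF C qc])
 have loc: "integrable lebesgue (%x. g x * f x)" if gf: "continuous_on UNIV g" "supp_ball r g" "f \<in> L1_loc UNIV" for f g :: "real^2 => real" and r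
 proof -
  obtain B where B: "B > 0" "!!x. \<bar>g x\<bar> <= B" by (rule continuous_csupp_bounded[OF gf(1,2)]) (rule that)
  show ?thesis by (rule csupp_L1_loc_pairing(1)[OF gf(1,2) B(2) gf(3)])
 qed
 have integrated: "integral {s..t} (k n) <= integral {s..t} (%r. b r * P n r)" if st: "0 < s" "s < t" "t \<in> Ioo0 T" for n s t
 proof -
  have bJ: "(%r. b r * P n r) absolutely_integrable_on {s..t}" if "0 < s" "t \<in> Ioo0 T" for s t
   by (rule absolutely_integrable_mult_continuous[OF L1_loc_Icc[OF b(1) that(1)] continuous_on_subset[OF Pc Ioo0_Icc[OF that(2,1)]]])
  have kJ: "k n absolutely_integrable_on {s..t}" if "0 < s" "t \<in> Ioo0 T" for s t
   by (rule absolutely_integrable_continuous_real[OF continuous_on_subset[OF kc Ioo0_Icc[OF that(2,1)]]])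
  have "integral {s..t} (%r. (k n r - b r * P n r) * 1 + 0 * 0) <= 1 * 0 - 1 * 0"
  proof (rule weak_to_integral[where T = T and F = "%_. 0" and w = "%_. 1" and w' = "%_. 0"])
   show "(%r. k n r - b r * P n r) absolutely_integrable_on {s..t}" if "0 < s" "t \<in> Ioo0 T" for s t
    by (intro set_integral_diff(1) kJ bJ that)
   fix \<eta> assume \<eta>: "\<eta> \<in> test_functions (Ioo0 T)" "!!x. \<eta> x >= 0"
   obtain c d where cd: "0 < c" "d \<in> Ioo0 T" "{c..d} \<subseteq> Ioo0 T" and z: "!!t. t \<notin> {c..d} ==> \<eta> t = 0" "!!t. t \<notin> {c..d} ==> deriv \<eta> t = 0"
    and \<eta>c: "continuous_on UNIV \<eta>" "continuous_on UNIV (deriv \<eta>)"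
    by (rule test_function_real[OF \<eta>(1) T]) (rule that)
   let ?J = "{c..d}"
   have \<eta>J: "continuous_on ?J \<eta>" using \<eta>c continuous_on_subset by blast
   let ?V = "%t. LINT x|lebesgue. exp (v x) * \<xi> n x * (u t x - v x)"
   let ?L = "%t. LINT x|lebesgue. laplacian (\<xi> n) x * (u t x - v x)"
   have cV: "continuous_on ?J ?V" by (rule continuous_on_subset[OF L1_loc_curve_functional(3)[OF C Vc] cd(3)])
   have cL: "continuous_on ?J ?L" by (rule continuous_on_subset[OF L1_loc_curve_functional(3)[OF C tc(2) R(2)] cd(3)])
   have Vi: "set_integrable lebesgue ?J (%t. \<eta> t * ?V t)"
    by (intro absolutely_integrable_continuous_real continuous_intros \<eta>J cV)
   have Ri: "set_integrable lebesgue ?J (%t. b t * P n t * \<eta> t - \<eta> t * ?L t)"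
    by (intro set_integral_diff(1) absolutely_integrable_mult_continuous[OF bJ[OF cd(1,2)] \<eta>J]
      absolutely_integrable_continuous_real continuous_intros \<eta>J cL)
   have "(LINT t:Ioo0 T|lebesgue. \<eta> t * ?V t) <= (LINT t:Ioo0 T|lebesgue. - P n t * (deriv (%_. 0) t * \<eta> t + 0 * deriv \<eta> t)
    + b t * P n t * \<eta> t - \<eta> t * ?L t)"
    unfolding P_def
   proof (rule perturbation_weak_inequality[OF pe v_cont \<eta> \<xi>(1,2)])
    fix t assume t: "t \<in> Ioo0 T"
    show "integrable lebesgue (%x. \<xi> n x * wt t x)" by (rule loc[OF tc(1) R(1) wt(2)[OF t]])
    show "integrable lebesgue (%x. laplacian (\<xi> n) x * (u t x - v x))" by (rule loc[OF tc(2) R(2) wt(1)[OF t]])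
    show "integrable lebesgue (%x. exp (v x) * \<xi> n x * (u t x - v x))" by (rule loc[OF Vc wt(1)[OF t]])
   next
    show "set_integrable lebesgue (Ioo0 T) (%t. \<eta> t * ?V t)"
     by (subst set_integral_restrict(2)[OF cd(3)]) (use z Vi in auto)
   qed
   also have "... = (LINT t:Ioo0 T|lebesgue. b t * P n t * \<eta> t - \<eta> t * ?L t)" by simp
   also have "... = (LINT t:?J|lebesgue. b t * P n t * \<eta> t - \<eta> t * ?L t)"
    by (rule set_integral_restrict(1)[OF cd(3)]) (simp add: z)
   also have "(LINT t:Ioo0 T|lebesgue. \<eta> t * ?V t) = (LINT t:?J|lebesgue. \<eta> t * ?V t)"
    by (rule set_integral_restrict(1)[OF cd(3)]) (simp add: z)
   finally have "0 <= (LINT t:?J|lebesgue. (b t * P n t * \<eta> t - \<eta> t * ?L t) - \<eta> t * ?V t)"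
    by (subst set_integral_diff(2)[OF Ri Vi]) simp
   also have "... = (LINT t:?J|lebesgue. - 0 * deriv \<eta> t - (k n t - b t * P n t) * \<eta> t)"
   proof (rule set_lebesgue_integral_cong)
    show "ALL t. t \<in> ?J --> (b t * P n t * \<eta> t - \<eta> t * ?L t) - \<eta> t * ?V t = - 0 * deriv \<eta> t - (k n t - b t * P n t) * \<eta> t"
    proof (intro allI impI)
     fix t assume "t \<in> ?J"
     then have t: "t \<in> Ioo0 T" using cd(3) by blast
     have "k n t = ?L t + ?V t" unfolding k_def q_def distrib_right
      by (rule integral_plus[OF loc[OF tc(2) R(2) wt(1)[OF t]] loc[OF Vc wt(1)[OF t]]])
     then show "(b t * P n t * \<eta> t - \<eta> t * ?L t) - \<eta> t * ?V t = - 0 * deriv \<eta> t - (k n t - b t * P n t) * \<eta> t"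
      by (simp add: algebra_simps)
    qed
   qed simp
   also have "... = (LINT t:Ioo0 T|lebesgue. - 0 * deriv \<eta> t - (k n t - b t * P n t) * \<eta> t)"
    by (rule set_integral_restrict(1)[OF cd(3), symmetric]) (simp add: z)
   finally show "0 <= (LINT t:Ioo0 T|lebesgue. - 0 * deriv \<eta> t - (k n t - b t * P n t) * \<eta> t)" .
  qed (use st in auto)
  moreover have "integral {s..t} (%r. k n r - b r * P n r) = integral {s..t} (k n) - integral {s..t} (%r. b r * P n r)"
   using kJ[OF st(1,3)] bJ[OF st(1,3)] by (intro Henstock_Kurzweil_Integration.integral_diff) (auto simp: absolutely_integrable_on_def)
  ultimately show ?thesis by simp
 qed
 have "(ALL s t. 0 < s --> s <= t --> t \<in> Ioo0 T --> y t >= y s + (t - s) * (\<theta> * (\<sigma>^2 * y s))) & (ALL t:Ioo0 T. y t >= y 0)"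
 proof -
  have der: "(Y n has_real_derivative P n t) (at t)" if "t \<in> Ioo0 T" for n t
   using Fx(1)[OF that, of n] at_within_open[OF that Ioo0_open] unfolding Y_def[abs_def] P_def by simp
  have Y0: "(Y n \<longlongrightarrow> Y n 0) (at_right 0)" for n
  proof -
   obtain B where B: "B > 0" "!!x. \<bar>\<xi> n x\<bar> <= B" by (rule continuous_csupp_bounded[OF tc(1) R(1)]) (rule that)
   have ps: "(%f. LINT x:cball 0 (R n)|lebesgue. \<bar>f x\<bar>) \<in> L1_loc_seminorms"
    unfolding L1_loc_seminorms_def by (intro CollectI exI[of _ "cball 0 (R n)"] conjI refl compact_cball)
   have lim: "((%t. B * (LINT x:cball 0 (R n)|lebesgue. \<bar>u t x - u 0 x\<bar>)) \<longlongrightarrow> 0) (at_right 0)"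
    by (rule tendsto_mult_right_zero[OF at0[OF ps]])
   obtain t1 where t1: "t1 \<in> Ioo0 T" "t1 > 0" using compact_in_Ioo0[OF T compact_empty] by (auto simp: Ioo0_def)
   have "\<forall>\<^sub>F t in at_right 0. norm (Y n t - Y n 0) <= B * (LINT x:cball 0 (R n)|lebesgue. \<bar>u t x - u 0 x\<bar>)"
    using eventually_at_right_real[OF t1(2)]
   proof eventually_elim
    case (elim t)
    have t: "t \<in> Ioo0 T" using Ioo0_Icc[OF t1(1), of t] elim by auto
    note w0 = Linf_subset_L1_loc[OF wL[OF 0]]
    have "Y n t - Y n 0 = (LINT x|lebesgue. \<xi> n x * ((u t x - v x) - (u 0 x - v x)))"
     unfolding Y_def right_diff_distrib[of "\<xi> n _" "u t _ - v _"]
     by (rule integral_minus[OF loc[OF tc(1) R(1) wt(1)[OF t]] loc[OF tc(1) R(1) w0], symmetric])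
    then show ?case using csupp_L1_loc_pairing(2)[OF tc(1) R(1) B(2) L1_loc_diff[OF wt(1)[OF t] w0]] by simp
   qed
   then have "((%t. Y n t - Y n 0) \<longlongrightarrow> 0) (at_right 0)" by (rule Lim_null_comparison[OF _ lim])
   then show ?thesis by (simp add: LIM_zero_iff)
  qed
  have unif: "EX W. ALL n. ALL t:{0..\<tau>}. \<bar>Y n t - y t\<bar> <= W * \<delta> n & \<bar>k n t - \<sigma>\<^sup>2 * y t\<bar> <= W * \<delta> n" if \<tau>: "\<tau> \<in> Ico0 T" for \<tau>
  proof -
   obtain W where W: "!!t. t \<in> {0..\<tau>} ==> Linf_norm lebesgue (%x. u t x - v x) <= W" using bdd[OF \<tau>] by blast
   have "\<bar>Y n t - y t\<bar> <= W * \<delta> n & \<bar>k n t - \<sigma>\<^sup>2 * y t\<bar> <= W * \<delta> n" if t: "t \<in> {0..\<tau>}" for n t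
   proof -
    have w: "(%x. u t x - v x) \<in> Linf lebesgue" using wL Ico0_Icc[OF \<tau>, of 0] t by auto
    have bd: "\<bar>LINT x|lebesgue. g x * (u t x - v x)\<bar> <= W * \<delta> n" if g: "integrable lebesgue g" "(LINT x|lebesgue. \<bar>g x\<bar>) <= \<delta> n" for g
    proof -
     have "0 <= (LINT x|lebesgue. \<bar>g x\<bar>)" by (intro integral_ge_0 abs_ge_zero)
     then have "0 <= \<delta> n" using g(2) by (rule order.trans)
     then have "(LINT x|lebesgue. \<bar>g x\<bar>) * Linf_norm lebesgue (%x. u t x - v x) <= \<delta> n * W"
      using g(2) W[OF t] Linf_norm_nonneg[OF w] by (intro mult_mono) auto
     then show ?thesis using Linf_integrable_mult(2)[OF w g(1)] by (simp add: mult.commute)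
    qed
    have "Y n t - y t = (LINT x|lebesgue. (\<xi> n x - \<phi> x) * (u t x - v x))" unfolding Y_def y_def left_diff_distrib
     by (rule integral_minus[OF Linf_integrable_mult(1)[OF w il[OF tc(1) R(1)]] Linf_integrable_mult(1)[OF w \<phi>L], symmetric])
    moreover have "k n t - \<sigma>\<^sup>2 * y t = (LINT x|lebesgue. q n x * (u t x - v x)) - (LINT x|lebesgue. (\<sigma>^2 * \<phi> x) * (u t x - v x))"
     unfolding k_def y_def by (simp add: mult.assoc)
    then have "k n t - \<sigma>\<^sup>2 * y t = (LINT x|lebesgue. (q n x - \<sigma>\<^sup>2 * \<phi> x) * (u t x - v x))" unfolding left_diff_distrib[of "q n _"]
     using integral_minus[OF Linf_integrable_mult(1)[OF w il[OF qc]] Linf_integrable_mult(1)[OF w integrable_mult_right[OF \<phi>L]], of n "\<sigma>^2"] by simp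
    ultimately show ?thesis using bd[OF d\<xi> \<delta>1] bd[OF dq \<delta>2] by simp
   qed
   then show ?thesis by blast
  qed
  have key: "P n t >= \<theta> * k n t" if "t \<in> Ioo0 T" "k n t > 0" for n t
   by (rule weighted_derivative_lower_bound[OF kc Pc b integrated \<theta> that])
  have \<gamma>: "\<sigma>^2 > 0" using \<sigma> by simp
  have yp: "y 0 > 0" using pos y0 by simp
  note G = approximate_growth[where Y = Y and P = P and k = k and y = y, OF T der Y0 unif \<delta>0 \<gamma> \<theta>(1) key yp]
  show ?thesis by (intro conjI allI impI ballI; rule G; assumption)
 qed
 then show ?thesis using yN Ioo0_subset N
  by (intro that[of y N]) (auto simp: y0 pos_divide_le_eq mult.commute[of N])
qed

end

section \<open>Nonlinear instability\<close>

text \<open>The potential \<open>e\<^sup>v\<close> is bounded and integrable, so the planar Birman-Schwinger argument applies to it.\<close>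
lemma ground_state_of_liouville:
 fixes v :: "real^2 => real"
 assumes v: "Ck 2 v" "!!x. - laplacian v x = exp (v x)" "integrable lborel (%x. exp (v x))"
 obtains \<sigma> \<phi> B Vm where "ground_state v \<phi> \<sigma> B Vm"
proof -
 obtain Vm where Vm: "Vm > 0" "!!x. exp (v x) <= Vm" by (rule liouville_exp_bounded[OF v]) (rule that)
 have vc: "continuous_on UNIV v" by (rule Ck_continuous[OF v(1)])
 have Vc: "continuous_on UNIV (%x. exp (v x))" by (intro continuous_intros vc)
 obtain \<sigma> \<phi> B L where \<sigma>: "\<sigma> > 0" and \<phi>: "!!x. 0 <= \<phi> x" "!!x. \<phi> x <= B" "!!x y. \<bar>\<phi> x - \<phi> y\<bar> <= L * norm (x - y)"
   "\<not> (AE x in lborel. \<phi> x = 0)" "integrable lborel \<phi>"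
   "!!x. ennreal (\<phi> x) = (LNN y. resolvent_kernel \<sigma> (x - y) * ennreal (exp (v y) * \<phi> y))"
  by (rule ground_state_exists[OF Vc _ Vm(2) v(3)]) (rule exp_gt_zero, rule that)
 have \<phi>c: "continuous_on UNIV \<phi>"
 proof (rule lipschitz_on_continuous_on[of "\<bar>L\<bar>"], rule lipschitz_onI)
  show "dist (\<phi> x) (\<phi> y) <= \<bar>L\<bar> * dist x y" for x y
   using \<phi>(3)[of x y] mult_right_mono[OF abs_ge_self norm_ge_zero, of L "x - y"] by (simp add: dist_norm)
 qed simp
 have V\<phi>c: "continuous_on UNIV (%x. exp (v x) * \<phi> x)" by (intro continuous_intros vc \<phi>c)
 have V\<phi>i: "integrable lborel (%x. exp (v x) * \<phi> x)"
 proof (rule integrable_le[OF integrable_mult_right[OF \<phi>(5), of Vm]])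
  show "(%x. exp (v x) * \<phi> x) \<in> borel_measurable lborel" using borel_measurable_continuous_onI[OF V\<phi>c] by simp
  show "AE x in lborel. norm (exp (v x) * \<phi> x) <= norm (Vm * \<phi> x)"
   using Vm \<phi>(1) by (intro AE_I2) (auto simp: abs_mult intro!: mult_right_mono)
 qed
 have "ground_state v \<phi> \<sigma> B Vm"
 proof (unfold_locales, goal_cases)
  case (9 \<xi>)
  obtain R where R: "supp_ball R \<xi>" using test_functions_supp_ball[OF 9] .
  have C: "Ck 2 \<xi>" using 9 by (simp add: test_functions_def)
  show ?case
   by (rule resolvent_identity[OF \<sigma> C R V\<phi>i _ \<phi>(5,1,6)]) (use \<phi>(1) in simp)
 qed (use vc Vm \<sigma> \<phi> \<phi>c in auto)
 then show ?thesis by (rule that)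
qed

lemma (in ground_state) eigenfunction: "L2_eigenfunction (%x. exp (v x)) (- \<sigma>\<^sup>2) \<phi>"
 unfolding L2_eigenfunction_def
proof (intro conjI ballI)
 show "\<phi> \<in> L2 lebesgue" by (rule L2_facts(1))
 show "\<not> (AE x in lebesgue. \<phi> x = 0)" using \<phi>_nonzero by (simp add: AE_completion_iff)
 fix \<xi> :: "real^2 => real" assume \<xi>: "\<xi> \<in> test_functions UNIV"
 note c = test_continuous[OF \<xi>]
 obtain R where R: "supp_ball R \<xi>" "supp_ball R (laplacian \<xi>)" using c(3) by blast
 have cc: "continuous_on UNIV (%x. \<phi> x * (- laplacian \<xi> x - exp (v x) * \<xi> x))" "continuous_on UNIV (%x. \<phi> x * \<xi> x)"
  by (intro continuous_intros \<phi>_cont c(1,2) V_cont)+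
 have i: "integrable lborel (%x. f x * g x)" if "continuous_on UNIV f" "continuous_on UNIV g" "supp_ball R g" for f g :: "real^2 => real"
  by (rule continuous_csupp_integrable[of _ R]) (use that in \<open>auto simp: supp_ball_def intro!: continuous_intros\<close>)
 note i1 = i[OF \<phi>_cont c(1) R(1)] and i2 = i[OF V\<phi>_cont c(1) R(1)] and i3 = i[OF \<phi>_cont c(2) R(2)]
 have "(LBINT x. \<phi> x * (\<sigma>^2 * \<xi> x - laplacian \<xi> x)) = (LBINT x. \<sigma>\<^sup>2 * (\<phi> x * \<xi> x) - \<phi> x * laplacian \<xi> x)"
  by (simp add: algebra_simps)
 then have w: "\<sigma>^2 * (LBINT x. \<phi> x * \<xi> x) - (LBINT x. \<phi> x * laplacian \<xi> x) = (LBINT x. exp (v x) * \<phi> x * \<xi> x)"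
  using weak[OF \<xi>] i1 i3 by simp
 have "(LBINT x. \<phi> x * (- laplacian \<xi> x - exp (v x) * \<xi> x)) = (LBINT x. - (\<phi> x * laplacian \<xi> x) - exp (v x) * \<phi> x * \<xi> x)"
  by (simp add: algebra_simps)
 also have "... = - (LBINT x. \<phi> x * laplacian \<xi> x) - (LBINT x. exp (v x) * \<phi> x * \<xi> x)" using i2 i3 by simp
 also have "... = - \<sigma>\<^sup>2 * (LBINT x. \<phi> x * \<xi> x)" using w by simp
 finally show "(LINT x|lebesgue. \<phi> x * (- laplacian \<xi> x - exp (v x) * \<xi> x)) = - \<sigma>\<^sup>2 * (LINT x|lebesgue. \<phi> x * \<xi> x)"
  unfolding continuous_integral_lebesgue(1)[OF cc(1)] continuous_integral_lebesgue(1)[OF cc(2)] .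
qed

lemma strict_lower_bound_of_pairing:
 fixes n y :: "real => real"
 assumes "N > 0" "c > 0" "!!t. t \<in> I ==> y t / N <= n t" "!!t. t \<in> I ==> c <= y t"
 shows "EX C0>0. ALL t:I. n t > C0 * c & C0 * c > 0"
proof (intro exI[of _ "1 / (2 * N)"] conjI ballI)
 fix t assume t: "t \<in> I"
 have "c / (2 * N) < c / N" using assms(1,2) by (simp add: field_simps)
 also have "... <= y t / N" using assms(1) assms(4)[OF t] by (intro divide_right_mono) auto
 also have "... <= n t" by (rule assms(3)[OF t])
 finally show "n t > 1 / (2 * N) * c" by simp
qed (use assms in auto)

lemma exponential_bound_of_pairing:
 fixes n y :: "real => real"
 assumes "N > 0" "!!t. t \<in> I ==> y t / N <= n t" "EX C>0. ALL t:I. y t >= C * g t"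
 shows "EX C>0. ALL t:I. n t >= C * g t"
proof -
 obtain C where C: "C > 0" "!!t. t \<in> I ==> y t >= C * g t" using assms(3) by blast
 have "n t >= C / N * g t" if "t \<in> I" for t
  using divide_right_mono[OF C(2)[OF that], of N] assms(1) assms(2)[OF that] by simp
 then show ?thesis using C(1) assms(1) by (intro exI[of _ "C / N"]) auto
qed

lemma exponential_bound_of_pairing':
 fixes n y :: "real => real"
 assumes N: "N > 0" and n: "!!t. t \<in> Ioo0 T ==> y t / N <= n t"
  and y: "EX T0>0. EX C>0. EX \<mu>>0. ereal T0 < T & (ALL t:Ioo0 T. t > T0 --> y t >= C * exp (\<mu> * t))"
 shows "EX T0>0. EX C>0. EX \<mu>>0. ereal T0 < T & (ALL t:Ioo0 T. t > T0 --> n t >= C * exp (\<mu> * t))"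
proof -
 obtain T0 C \<mu> where *: "T0 > 0" "C > 0" "\<mu> > 0" "ereal T0 < T" "ALL t:Ioo0 T. t > T0 --> y t >= C * exp (\<mu> * t)" using y by blast
 have "EX C>0. ALL t:{t \<in> Ioo0 T. t > T0}. n t >= C * exp (\<mu> * t)"
  by (rule exponential_bound_of_pairing[OF N, of _ y]) (use n * in auto)
 then obtain C' where "C' > 0" "ALL t:Ioo0 T. t > T0 --> n t >= C' * exp (\<mu> * t)" by auto
 then show ?thesis using *(1,3,4) by blast
qed

context ground_state
begin

lemma second_order_instability:
 assumes T: "T > 0" and b: "b \<in> L1_loc {0<..}" and a: "a C1_differentiable_on Ioo0 T" "a0 > 0" "ALL t>=0. a t >= a0"
  and u: "u0 \<in> L2 lebesgue" "u1 \<in> L2 lebesgue"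
  and pos: "(LINT x|lebesgue. \<phi> x * u1 x) > 0" "(LINT x|lebesgue. \<phi> x * u0 x) > 0" and sol: "second_order_solution T a b v u0 u1 u"
 defines "B' \<equiv> Linf_norm (lebesgue_on (Ioo0 T)) b / a0"
 defines "\<mu> \<equiv> %t. integral {0..t} (%s. - B' + sqrt (\<sigma>^2 / a s + B'^2))"
 shows "EX C0>0. ALL t:Ioo0 T. L2_norm lebesgue (%x. u t x - v x) > C0 * (LINT x|lebesgue. \<phi> x * u0 x) &
      C0 * (LINT x|lebesgue. \<phi> x * u0 x) > 0"
  and "b \<in> Linf (lebesgue_on (Ioo0 T)) ==> ALL t:Ioo0 T. deriv a t > 0 ==>
   (EX C1>0. ALL t:Ioo0 T. L2_norm lebesgue (%x. u t x - v x) >= C1 * exp (\<mu> t)) &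
   strict_mono_on (Ico0 T) \<mu> & (ALL t:Ioo0 T. \<mu> t > 0) &
   (EX C>0. ALL t:Ioo0 T. \<mu> t > C * integral {0..t} (%s. 1 / a s))"
  and "b absolutely_integrable_on {0<..} ==> a \<in> Linf (lebesgue_on {0<..}) ==>
   EX T0>0. EX C2>0. EX \<mu>>0. ereal T0 < T & (ALL t:Ioo0 T. t > T0 --> L2_norm lebesgue (%x. u t x - v x) >= C2 * exp (\<mu> * t))"
proof -
 have a3: "a t >= a0" if "t >= 0" for t using a(3) that by blast
 obtain y p N where sup: "supersolution T y p (%t. \<sigma>\<^sup>2 / a t) (%t. b t / a t)" and y0: "y 0 = (LINT x|lebesgue. \<phi> x * u0 x)"
  and N: "N > 0" "!!t. t \<in> Ioo0 T ==> y t / N <= L2_norm lebesgue (%x. u t x - v x)"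
  by (rule second_order_conclusions[OF T a(1,2) a3 b pos sol u]) (assumption, rule that)
 show "EX C0>0. ALL t:Ioo0 T. L2_norm lebesgue (%x. u t x - v x) > C0 * (LINT x|lebesgue. \<phi> x * u0 x) &
      C0 * (LINT x|lebesgue. \<phi> x * u0 x) > 0"
  by (rule strict_lower_bound_of_pairing[OF N(1) pos(2) N(2)]) (use supersolution.y_ge[OF sup] y0 Ioo0_subset in auto)
 show "(EX C1>0. ALL t:Ioo0 T. L2_norm lebesgue (%x. u t x - v x) >= C1 * exp (\<mu> t)) &
   strict_mono_on (Ico0 T) \<mu> & (ALL t:Ioo0 T. \<mu> t > 0) &
   (EX C>0. ALL t:Ioo0 T. \<mu> t > C * integral {0..t} (%s. 1 / a s))"
  if bL: "b \<in> Linf (lebesgue_on (Ioo0 T))" and a': "ALL t:Ioo0 T. deriv a t > 0"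
 proof -
  have B: "B' >= 0" unfolding B'_def using Linf_norm_nonneg[OF bL] a(2) by simp
  note rate = riccati_rate[OF T C1_differentiable_imp_continuous_on[OF a(1)] a(2,3) B \<sigma>, folded \<mu>_def]
  have "EX C>0. ALL t:Ioo0 T. y t >= C * exp (\<mu> t)"
   unfolding \<mu>_def B'_def by (rule second_order_riccati_growth[OF a(1,2) a3 _ \<sigma> bL sup]) (use a' in auto)
  from exponential_bound_of_pairing[where y = y and g = "%t. exp (\<mu> t)" and n = "%t. L2_norm lebesgue (%x. u t x - v x)", OF N(1) N(2) this]
  have "EX C1>0. ALL t:Ioo0 T. L2_norm lebesgue (%x. u t x - v x) >= C1 * exp (\<mu> t)" by blast
  then show ?thesis using rate(3,4,5) unfolding \<mu>_def by blast
 qed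
 show "EX T0>0. EX C2>0. EX \<mu>>0. ereal T0 < T & (ALL t:Ioo0 T. t > T0 --> L2_norm lebesgue (%x. u t x - v x) >= C2 * exp (\<mu> * t))"
  if "b absolutely_integrable_on {0<..}" "a \<in> Linf (lebesgue_on {0<..})"
  by (rule exponential_bound_of_pairing'[where y = y and n = "%t. L2_norm lebesgue (%x. u t x - v x)", OF N(1) _ second_order_exponential_growth[OF a(1,2) a3 \<sigma> that sup]]) (rule N(2))
qed

lemma first_order_instability:
 assumes T: "T > 0" and b: "b \<in> L1_loc {0<..}" "ALL t>=0. b t > 0" and u0: "u0 \<in> Linf lebesgue"
  and pos: "(LINT x|lebesgue. \<phi> x * u0 x) > 0" and sol: "first_order_solution T b v u0 u"
 shows "EX C0>0. ALL t:Ioo0 T. Linf_norm lebesgue (%x. u t x - v x) > C0 * (LINT x|lebesgue. \<phi> x * u0 x) &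
      C0 * (LINT x|lebesgue. \<phi> x * u0 x) > 0"
  and "b \<in> Linf (lebesgue_on (Ioo0 T)) ==> EX T0>0. EX C1>0. EX \<mu>>0. ereal T0 < T &
   (ALL t:Ioo0 T. t > T0 --> Linf_norm lebesgue (%x. u t x - v x) >= C1 * exp (\<mu> * t))"
proof -
 let ?n = "%t. Linf_norm lebesgue (%x. u t x - v x)"
 have bp: "b t > 0" if "t > 0" for t using b(2) that by simp
 have G: "EX y N. y 0 = (LINT x|lebesgue. \<phi> x * u0 x) & N > 0 & (ALL t:Ioo0 T. y t / N <= ?n t) &
  (ALL s t. 0 < s --> s <= t --> t \<in> Ioo0 T --> y t >= y s + (t - s) * (\<theta> * (\<sigma>^2 * y s))) & (ALL t:Ioo0 T. y t >= y 0)"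
  if \<theta>: "\<theta> >= 0" "AE t in lebesgue. t \<in> Ioo0 T --> \<theta> * b t <= 1" for \<theta>
  by (rule first_order_growth[OF T b(1) bp u0 pos sol \<theta>]) (assumption, blast)
 obtain y N where y: "y 0 = (LINT x|lebesgue. \<phi> x * u0 x)" "N > 0" "!!t. t \<in> Ioo0 T ==> y t / N <= ?n t" "!!t. t \<in> Ioo0 T ==> y t >= y 0"
  using G[of 0] by auto
 show "EX C0>0. ALL t:Ioo0 T. ?n t > C0 * (LINT x|lebesgue. \<phi> x * u0 x) & C0 * (LINT x|lebesgue. \<phi> x * u0 x) > 0"
  by (rule strict_lower_bound_of_pairing[OF y(2) pos y(3)]) (use y(1,4) in auto)
 assume bL: "b \<in> Linf (lebesgue_on (Ioo0 T))"
 define \<theta> where "\<theta> = 1 / (Linf_norm (lebesgue_on (Ioo0 T)) b + 1)"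
 have L: "Linf_norm (lebesgue_on (Ioo0 T)) b + 1 > 0" using Linf_norm_nonneg[OF bL] by simp
 then have \<theta>: "\<theta> > 0" by (simp add: \<theta>_def)
 have "AE t in lebesgue. t \<in> Ioo0 T --> \<theta> * b t <= 1"
  using AE_lebesgue_on_Ioo0[OF AE_le_Linf_norm[OF bL]]
 proof (rule AE_mp, intro AE_I2 impI)
  fix t assume "t \<in> Ioo0 T --> \<bar>b t\<bar> <= Linf_norm (lebesgue_on (Ioo0 T)) b" "t \<in> Ioo0 T"
  then have "b t <= Linf_norm (lebesgue_on (Ioo0 T)) b + 1" by auto
  then show "\<theta> * b t <= 1" using L by (simp add: \<theta>_def pos_divide_le_eq)
 qed
 then obtain y N where y: "y 0 = (LINT x|lebesgue. \<phi> x * u0 x)" "N > 0" "!!t. t \<in> Ioo0 T ==> y t / N <= ?n t"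
  "!!s t. 0 < s ==> s <= t ==> t \<in> Ioo0 T ==> y t >= y s + (t - s) * (\<theta> * (\<sigma>^2 * y s))" "!!t. t \<in> Ioo0 T ==> y t >= y 0"
  using G[of \<theta>] \<theta> by auto
 have "EX T0>0. EX C>0. EX \<mu>>0. ereal T0 < T & (ALL t:Ioo0 T. t > T0 --> y t >= C * exp (\<mu> * t))"
 proof (cases "T = \<infinity>")
  case False
  then show ?thesis using y(1,5) pos by (intro finite_time_growth[OF T False, of "y 0"]) auto
 next
  case True
  have "EX T0>0. EX C>0. EX \<mu>>0. ALL t>T0. y t >= C * exp (\<mu> * t)"
  proof (rule iterated_growth)
   show "\<theta> * \<sigma>^2 > 0" using \<theta> \<sigma> by simp
   show "y t >= y s + (t - s) * (\<theta> * \<sigma>^2 * y s)" if "0 < s" "s <= t" for s t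
    using y(4)[OF that] that True by (simp add: Ioo0_eq mult.assoc)
   show "y t > 0" if "t > 0" for t
    using y(5)[of t] y(1) pos that True by (simp add: Ioo0_eq)
  qed
  then show ?thesis using True by auto
 qed
 note growth = this
 show "EX T0>0. EX C1>0. EX \<mu>>0. ereal T0 < T & (ALL t:Ioo0 T. t > T0 --> ?n t >= C1 * exp (\<mu> * t))"
  by (rule exponential_bound_of_pairing'[where y = y and n = ?n, OF y(2) _ growth]) (rule y(3))
qed

end

theorem theorem4p3:
  fixes v :: "real^2 \<Rightarrow> real"
  assumes "Ck 2 v"
    and "\<forall>x. - laplacian v x = exp (v x)"
    and "integrable lebesgue (\<lambda>x. exp (v x))"
  shows "\<exists>\<sigma>>0. \<exists>\<phi>1 :: real^2 \<Rightarrow> real.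
    (\<forall>x. \<phi>1 x \<ge> 0) \<and> L2_eigenfunction (\<lambda>x. exp (v x)) (- \<sigma>\<^sup>2) \<phi>1 \<and> integrable lebesgue \<phi>1 \<and>
    (\<forall>T::ereal. 0 < T \<longrightarrow>
      (\<forall>(a :: real \<Rightarrow> real) (b :: real \<Rightarrow> real) a0 u0 u1 u.
        b \<in> L1_loc {0<..} \<and> a C1_differentiable_on Ioo0 T \<and>
        a0 > 0 \<and> (\<forall>t\<ge>0. a t \<ge> a0) \<and>
        u0 \<in> H1 \<and> u1 \<in> L2 lebesgue \<and>
        (LINT x|lebesgue. \<phi>1 x * u1 x) > 0 \<and> (LINT x|lebesgue. \<phi>1 x * u0 x) > 0 \<and>
        second_order_solution T a b v u0 u1 u \<longrightarrow>
        (\<exists>C0>0. \<forall>t\<in>Ioo0 T.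
           L2_norm lebesgue (\<lambda>x. u t x - v x) > C0 * (LINT x|lebesgue. \<phi>1 x * u0 x) \<and>
           C0 * (LINT x|lebesgue. \<phi>1 x * u0 x) > 0) \<and>
        (let B = Linf_norm (lebesgue_on (Ioo0 T)) b / a0;
             \<mu> = (\<lambda>t. integral {0..t} (\<lambda>s. - B + sqrt (\<sigma>\<^sup>2 / a s + B\<^sup>2)))
         in b \<in> Linf (lebesgue_on (Ioo0 T)) \<and> (\<forall>t\<in>Ioo0 T. deriv a t > 0) \<and>
            (LINT x|lebesgue. \<phi>1 x * u1 x)
              \<ge> (- B + sqrt (\<sigma>\<^sup>2 / a 0 + B\<^sup>2)) * (LINT x|lebesgue. \<phi>1 x * u0 x) \<longrightarrow>
            (\<exists>C1>0. \<forall>t\<in>Ioo0 T. L2_norm lebesgue (\<lambda>x. u t x - v x) \<ge> C1 * exp (\<mu> t)) \<and>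
            strict_mono_on (Ico0 T) \<mu> \<and> (\<forall>t\<in>Ioo0 T. \<mu> t > 0) \<and>
            (\<exists>C>0. \<forall>t\<in>Ioo0 T. \<mu> t > C * integral {0..t} (\<lambda>s. 1 / a s))) \<and>
        (b absolutely_integrable_on {0<..} \<and> a \<in> Linf (lebesgue_on {0<..}) \<longrightarrow>
           (\<exists>T0>0. \<exists>C2>0. \<exists>\<mu>>0. ereal T0 < T \<and>
              (\<forall>t\<in>Ioo0 T. t > T0 \<longrightarrow>
                 L2_norm lebesgue (\<lambda>x. u t x - v x) \<ge> C2 * exp (\<mu> * t))))) \<and>
      (\<forall>(b :: real \<Rightarrow> real) u0 u.
        b \<in> L1_loc {0<..} \<and> (\<forall>t\<ge>0. b t > 0) \<and>
        u0 \<in> Linf lebesgue \<and> (LINT x|lebesgue. \<phi>1 x * u0 x) > 0 \<and>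
        first_order_solution T b v u0 u \<longrightarrow>
        (\<exists>C0>0. \<forall>t\<in>Ioo0 T.
           Linf_norm lebesgue (\<lambda>x. u t x - v x) > C0 * (LINT x|lebesgue. \<phi>1 x * u0 x) \<and>
           C0 * (LINT x|lebesgue. \<phi>1 x * u0 x) > 0) \<and>
        (b \<in> Linf (lebesgue_on (Ioo0 T)) \<longrightarrow>
           (\<exists>T0>0. \<exists>C1>0. \<exists>\<mu>>0. ereal T0 < T \<and>
              (\<forall>t\<in>Ioo0 T. t > T0 \<longrightarrow>
                 Linf_norm lebesgue (\<lambda>x. u t x - v x) \<ge> C1 * exp (\<mu> * t))))))"
proof -
 have V: "integrable lborel (%x. exp (v x))"
  using continuous_integral_lebesgue(2)[of "%x. exp (v x)"] assms(3) Ck_continuous[OF assms(1)] by (simp add: continuous_on_exp)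
 obtain \<sigma> \<phi> B Vm where gs: "ground_state v \<phi> \<sigma> B Vm"
  by (rule ground_state_of_liouville[OF assms(1) _ V]) (use assms(2) in auto)
 interpret ground_state v \<phi> \<sigma> B Vm by (rule gs)
 have \<phi>L: "integrable lebesgue \<phi>" using continuous_integral_lebesgue(2)[OF \<phi>_cont] \<phi>_int by simp
 have H1: "u0 \<in> L2 lebesgue" if "u0 \<in> H1" for u0 :: "real^2 => real" using that by (simp add: H1_def)
 show ?thesis
 proof (rule exI[of _ \<sigma>], rule conjI[OF \<sigma>], rule exI[of _ \<phi>], intro conjI allI impI, goal_cases)
  case 1 show ?case by (rule \<phi>_nonneg)
 next
  case 2 show ?case by (rule eigenfunction)
 next
  case 3 show ?case by (rule \<phi>L)
 next
  case (4 T a b a0 u0 u1 u)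
  then show ?case by (intro second_order_instability(1)[where a = a and b = b]) (auto intro: H1)
 next
  case (5 T a b a0 u0 u1 u)
  then show ?case unfolding Let_def
   by (elim conjE, intro impI, elim conjE)
     (rule second_order_instability(2)[where a = a and b = b]; (assumption | rule H1)+)
 next
  case (6 T a b a0 u0 u1 u)
  then show ?case by (elim conjE) (rule second_order_instability(3)[where a = a and b = b]; (assumption | rule H1)+)
 next
  case (7 T b u0 u)
  then show ?case by (elim conjE) (rule first_order_instability(1)[where b = b]; assumption)
 next
  case (8 T b u0 u)
  then show ?case by (elim conjE) (rule first_order_instability(2)[where b = b]; assumption)
 qed
qed

end
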